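(* Let $E=\mathbb{C}^2$, $F=\mathbb{C}^6$. The group $G_0=SL(E)\times SL(F)\times\mathbb{C}^*$ ($\mathbb{C}^*$ acting by scaling) has exactly fifteen orbits $O_0,\dots,O_{14}$ on $E\otimes\bigwedge^2F$, with the following representatives and dimensions: $O_0$: $0$, dimension $0$; $O_1$: $[1;12]$, dimension $10$; $O_2$: $[1;12]+[1;34]$, dimension $15$; $O_3$: $[1;12]+[2;13]$, dimension $15$; $O_4$: $[1;12]+[1;34]+[1;56]$, dimension $16$; $O_5$: $[1;12]+[1;34]+[2;13]$, dimension $19$; $O_6$: $[1;12]+[2;34]$, dimension $20$; $O_7$: $[1;12]+[2;34]+[1;35]$, dimension $23$; $O_8$: $[1;12]+[2;34]+[1;35]+[2;15]$, dimension $25$; $O_9$: $[1;12]+[2;34]+[1;35]+[1;46]$, dimension $24$; $O_{10}$: $[1;12]+[2;34]+[1;45]+[2;16]$, dimension $26$; $O_{11}$: $[1;12]+[2;34]+[1;45]+[2;16]+[1;36]$, dimension $28$; $O_{12}$: $[1;12]+[2;34]+[1;56]$, dimension $25$; $O_{13}$: $[1;12]+[2;34]+[1;56]+[2;15]$, dimension $29$; $O_{14}$: a generic element of the span of $[1;12],[2;12],[1;34],[2;34],[1;56],[2;56]$, dimension $30$. The inclusion order on the orbit closures is the partial order generated by the covering relations (where $i<j$ means $\overline{O_i}\subset\overline{O_j}$): $0<1$, $1<2$, $1<3$, $2<4$, $2<5$, $3<5$, $4<9$, $5<6$, $6<7$, $7<8$, $7<9$, $8<10$, $9<12$, $9<11$,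 $10<11$, $11<13$, $12<13$, $13<14$.
   Context: Everything is over $\mathbb{C}$. $E\otimes\bigwedge^2F$ is the degree-one part of the grading of the simple Lie algebra of type $E_7$ determined by the simple root $\alpha_3$ (Bourbaki numbering). Let $e_1,e_2$ and $f_1,\dots,f_6$ be bases of $E$ and $F$; $[a;ij]$ denotes $e_a\otimes(f_i\wedge f_j)$. *)

theory Defs
  imports "HOL-Analysis.Analysis"
begin

section \<open>The representation\<close>

text \<open>
  Index types: \<^typ>\<open>2\<close> and \<^typ>\<open>6\<close> have the elements \<open>1, 2\<close> and \<open>1, \<dots>, 6\<close>
  (with \<open>2 = 0\<close> and \<open>6 = 0\<close>, respectively).
\<close>

type_synonym spaceE = "complex ^ 2"
type_synonym spaceF = "complex ^ 6"
type_synonym tensors = "complex ^ (2 \<times> 6 \<times> 6)"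

text \<open>\<open>\<And>\<^sup>2 F\<close> is realised by the skew-symmetric elements of \<open>F \<otimes> F\<close>.\<close>

definition wedge :: "spaceF \<Rightarrow> spaceF \<Rightarrow> complex ^ (6 \<times> 6)"
  where "wedge u v = vec_lambda (\<lambda>(i, j). u $ i * v $ j - u $ j * v $ i)"

definition tensor :: "spaceE \<Rightarrow> complex ^ (6 \<times> 6) \<Rightarrow> tensors"
  where "tensor a w = vec_lambda (\<lambda>(k, p). a $ k * w $ p)"

definition E_Wedge2_F :: "tensors set"
  where "E_Wedge2_F = {t. \<forall>k i j. t $ (k, j, i) = - t $ (k, i, j)}"

definition G0 :: "((complex ^ 2 ^ 2) \<times> (complex ^ 6 ^ 6) \<times> complex) set"
  where "G0 = {(A, B, c). det A = 1 \<and> det B = 1 \<and> c \<noteq> 0}"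

fun act :: "(complex ^ 2 ^ 2) \<times> (complex ^ 6 ^ 6) \<times> complex \<Rightarrow> tensors \<Rightarrow> tensors"
  where "act (A, B, c) t =
    c *s vec_lambda (\<lambda>(k, i, j). \<Sum>k'\<in>UNIV. \<Sum>i'\<in>UNIV. \<Sum>j'\<in>UNIV.
           A $ k $ k' * B $ i $ i' * B $ j $ j' * t $ (k', i', j'))"

lemma act_tensor_wedge:
  "act (A, B, c) (tensor a (wedge u v)) = c *s tensor (A *v a) (wedge (B *v u) (B *v v))"
proof -
  have "(\<Sum>k'\<in>UNIV. \<Sum>i'\<in>UNIV. \<Sum>j'\<in>UNIV.
           A $ k $ k' * B $ i $ i' * B $ j $ j' * (a $ k' * (u $ i' * v $ j' - u $ j' * v $ i')))
      = (A *v a) $ k * ((B *v u) $ i * (B *v v) $ j - (B *v u) $ j * (B *v v) $ i)" for k i j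
  proof -
    have "(A *v a) $ k * ((B *v u) $ i * (B *v v) $ j - (B *v u) $ j * (B *v v) $ i)
        = (\<Sum>k'\<in>UNIV. A $ k $ k' * a $ k') *
          ((\<Sum>i'\<in>UNIV. \<Sum>j'\<in>UNIV. (B $ i $ i' * u $ i') * (B $ j $ j' * v $ j')) -
           (\<Sum>i'\<in>UNIV. \<Sum>j'\<in>UNIV. (B $ i $ i' * v $ i') * (B $ j $ j' * u $ j')))"
      by (subst mult.commute[of "(B *v u) $ j" "(B *v v) $ i"])
        (simp only: matrix_vector_mult_def sum_product vec_lambda_beta)
    also have "\<dots> = (\<Sum>k'\<in>UNIV. \<Sum>i'\<in>UNIV. \<Sum>j'\<in>UNIV.
           A $ k $ k' * B $ i $ i' * B $ j $ j' * (a $ k' * (u $ i' * v $ j' - u $ j' * v $ i')))"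
      unfolding sum_subtractf[symmetric] unfolding sum_distrib_right unfolding sum_distrib_left
      by (intro sum.cong refl) (simp add: algebra_simps)
    finally show ?thesis by simp
  qed
  then show ?thesis
    by (auto simp: vec_eq_iff tensor_def wedge_def)
qed

lemma E_Wedge2_F_eq_span:
  "E_Wedge2_F = vec.span {tensor a (wedge u v) | a u v. True}"
proof
  show "E_Wedge2_F \<subseteq> vec.span {tensor a (wedge u v) | a u v. True}"
  proof
    fix t assume t: "t \<in> E_Wedge2_F"
    have "t = (\<Sum>k\<in>UNIV. \<Sum>i\<in>UNIV. \<Sum>j\<in>UNIV.
            (t $ (k, i, j) / 2) *s tensor (axis k 1) (wedge (axis i 1) (axis j 1)))"
      (is "_ = ?s")
    proof -
      have "?s $ (k, i, j) = t $ (k, i, j)" for k i j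
      proof -
        have j: "(\<Sum>j'\<in>UNIV. t $ (k', i', j') / 2 * tensor (axis k' 1) (wedge (axis i' 1) (axis j' 1)) $ (k, i, j))
            = (if k' = k then (if i' = i then t $ (k', i', j) / 2 else 0)
                 - (if i' = j then t $ (k', i', i) / 2 else 0) else 0)" for k' i'
        proof -
          have "t $ (k', i', j') / 2 * tensor (axis k' 1) (wedge (axis i' 1) (axis j' 1)) $ (k, i, j)
            = (if j' = j then if k' = k \<and> i' = i then t $ (k', i', j') / 2 else 0 else 0)
              - (if j' = i then if k' = k \<and> i' = j then t $ (k', i', j') / 2 else 0 else 0)" for j'
            by (simp add: tensor_def wedge_def axis_def)
          then show ?thesis by (simp only: sum_subtractf) simp
        qed
        have i: "(\<Sum>i'\<in>UNIV. if k' = k then (if i' = i then t $ (k', i', j) / 2 else 0)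
                 - (if i' = j then t $ (k', i', i) / 2 else 0) else 0)
            = (if k' = k then t $ (k', i, j) / 2 - t $ (k', j, i) / 2 else 0)" for k'
          by (simp add: sum_subtractf)
        have "?s $ (k, i, j) = t $ (k, i, j) / 2 - t $ (k, j, i) / 2"
          by (simp only: sum_component vector_smult_component j i) simp
        also have "\<dots> = t $ (k, i, j)"
        proof -
          have "t $ (k, j, i) = - t $ (k, i, j)"
            using t unfolding E_Wedge2_F_def mem_Collect_eq by (elim allE)
          then show ?thesis by simp
        qed
        finally show ?thesis .
      qed
      then show ?thesis by (simp only: vec_eq_iff split_paired_all) simp
    qed
    also have "\<dots> \<in> vec.span {tensor a (wedge u v) | a u v. True}"
      by (intro vec.span_sum vec.span_scale vec.span_base) blast
    finally show "t \<in> \<dots>" .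
  qed
next
  have mem: "t \<in> E_Wedge2_F \<longleftrightarrow> (\<forall>k i j. t $ (k, j, i) + t $ (k, i, j) = 0)" for t
    unfolding E_Wedge2_F_def mem_Collect_eq eq_neg_iff_add_eq_0 ..
  have "vec.subspace E_Wedge2_F"
  proof (rule vec.subspaceI)
    show "0 \<in> E_Wedge2_F"
      unfolding mem by simp
  next
    fix x y assume x: "x \<in> E_Wedge2_F" and y: "y \<in> E_Wedge2_F"
    have "(x + y) $ (k, j, i) + (x + y) $ (k, i, j) = 0" for k i j
    proof -
      have "(x + y) $ (k, j, i) + (x + y) $ (k, i, j)
          = (x $ (k, j, i) + x $ (k, i, j)) + (y $ (k, j, i) + y $ (k, i, j))"
        by simp
      also have "\<dots> = 0"
        by (simp only: x[unfolded mem, rule_format] y[unfolded mem, rule_format] add_0_right)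
      finally show ?thesis .
    qed
    then show "x + y \<in> E_Wedge2_F"
      unfolding mem by (intro allI)
  next
    fix c x assume x: "x \<in> E_Wedge2_F"
    show "c *s x \<in> E_Wedge2_F"
      unfolding mem vector_smult_component distrib_left[symmetric]
      by (simp only: x[unfolded mem, rule_format] mult_zero_right simp_thms)
  qed
  moreover have "{tensor a (wedge u v) | a u v. True} \<subseteq> E_Wedge2_F"
    unfolding subset_iff mem by (clarsimp simp: tensor_def wedge_def algebra_simps)
  ultimately show "vec.span {tensor a (wedge u v) | a u v. True} \<subseteq> E_Wedge2_F"
    by (intro vec.span_minimal)
qed

definition orbit :: "tensors \<Rightarrow> tensors set"
  where "orbit t = (\<lambda>g. act g t) ` G0"

definition orbits :: "tensors set set"
  where "orbits = orbit ` E_Wedge2_F"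


section \<open>Zariski topology and dimension\<close>

text \<open>The complex algebra of functions generated by a set of functions.\<close>

inductive_set generated_algebra :: "('a \<Rightarrow> complex) set \<Rightarrow> ('a \<Rightarrow> complex) set"
  for X :: "('a \<Rightarrow> complex) set" where
  const: "(\<lambda>_. c) \<in> generated_algebra X"
| gen: "g \<in> X \<Longrightarrow> g \<in> generated_algebra X"
| add: "g \<in> generated_algebra X \<Longrightarrow> h \<in> generated_algebra X
    \<Longrightarrow> (\<lambda>x. g x + h x) \<in> generated_algebra X"
| mult: "g \<in> generated_algebra X \<Longrightarrow> h \<in> generated_algebra X
    \<Longrightarrow> (\<lambda>x. g x * h x) \<in> generated_algebra X"

definition poly_funs :: "(complex ^ 'n \<Rightarrow> complex) set"
  where "poly_funs = generated_algebra (range (\<lambda>i v. v $ i))"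

definition zariski_closed :: "(complex ^ 'n) set \<Rightarrow> bool"
  where "zariski_closed Z \<longleftrightarrow> (\<exists>P \<subseteq> poly_funs. Z = {x. \<forall>p\<in>P. p x = 0})"

definition zariski_closure :: "(complex ^ 'n) set \<Rightarrow> (complex ^ 'n) set"
  where "zariski_closure S = zariski_closed hull S"

definition zariski_open_in :: "(complex ^ 'n) set \<Rightarrow> (complex ^ 'n) set \<Rightarrow> bool"
  where "zariski_open_in W U \<longleftrightarrow> (\<exists>Z. zariski_closed Z \<and> U = W - Z)"

text \<open>
  Polynomials in \<open>d\<close> variables are identified with the functions they induce on sequences
  (only the first \<open>d\<close> entries matter); this is harmless over an infinite field.
\<close>

definition alg_independent_on ::
    "(complex ^ 'n) set \<Rightarrow> nat \<Rightarrow> (nat \<Rightarrow> complex ^ 'n \<Rightarrow> complex) \<Rightarrow> bool"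
  where "alg_independent_on S d g \<longleftrightarrow>
    (\<forall>P \<in> generated_algebra ((\<lambda>i v. v i) ` {..<d}).
       (\<forall>x\<in>S. P (\<lambda>i. g i x) = 0) \<longrightarrow> P = (\<lambda>_. 0))"

text \<open>
  The dimension of \<open>S\<close> is the transcendence degree over the complex numbers of the coordinate
  ring of its Zariski closure, that is, of the ring of restrictions to \<open>S\<close> of polynomial functions:
  the largest number of such functions without a polynomial relation on \<open>S\<close>.
\<close>

definition alg_dim :: "(complex ^ 'n) set \<Rightarrow> enat"
  where "alg_dim S =
    (SUP d \<in> {d. \<exists>g. (\<forall>i<d. g i \<in> poly_funs) \<and> alg_independent_on S d g}. enat d)"


section \<open>Representatives, dimensions and covering relations\<close>

definition is_basis :: "('i \<Rightarrow> complex ^ 'n) \<Rightarrow> bool"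
  where "is_basis b \<longleftrightarrow> inj b \<and> vec.independent (range b) \<and> vec.span (range b) = UNIV"

definition bracket :: "(2 \<Rightarrow> spaceE) \<Rightarrow> (6 \<Rightarrow> spaceF) \<Rightarrow> 2 \<Rightarrow> 6 \<Rightarrow> 6 \<Rightarrow> tensors"
  where "bracket e f a i j = tensor (e a) (wedge (f i) (f j))"

definition generic_space :: "(2 \<Rightarrow> spaceE) \<Rightarrow> (6 \<Rightarrow> spaceF) \<Rightarrow> tensors set"
  where "generic_space e f = (let b = bracket e f in
    vec.span {b 1 1 2, b 2 1 2, b 1 3 4, b 2 3 4, b 1 5 6, b 2 5 6})"

text \<open>The argument \<open>x\<close> is the representative of the last orbit.\<close>

definition representatives :: "(2 \<Rightarrow> spaceE) \<Rightarrow> (6 \<Rightarrow> spaceF) \<Rightarrow> tensors \<Rightarrow> tensors list"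
  where "representatives e f x = (let b = bracket e f in
   [0,
    b 1 1 2,
    b 1 1 2 + b 1 3 4,
    b 1 1 2 + b 2 1 3,
    b 1 1 2 + b 1 3 4 + b 1 5 6,
    b 1 1 2 + b 1 3 4 + b 2 1 3,
    b 1 1 2 + b 2 3 4,
    b 1 1 2 + b 2 3 4 + b 1 3 5,
    b 1 1 2 + b 2 3 4 + b 1 3 5 + b 2 1 5,
    b 1 1 2 + b 2 3 4 + b 1 3 5 + b 1 4 6,
    b 1 1 2 + b 2 3 4 + b 1 4 5 + b 2 1 6,
    b 1 1 2 + b 2 3 4 + b 1 4 5 + b 2 1 6 + b 1 3 6,
    b 1 1 2 + b 2 3 4 + b 1 5 6,
    b 1 1 2 + b 2 3 4 + b 1 5 6 + b 2 1 5,
    x])"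

definition orbit_dims :: "nat list"
  where "orbit_dims = [0, 10, 15, 15, 16, 19, 20, 23, 25, 24, 26, 28, 25, 29, 30]"

definition coverings :: "(nat \<times> nat) set"
  where "coverings =
   {(0, 1), (1, 2), (1, 3), (2, 4), (2, 5), (3, 5), (4, 9), (5, 6), (6, 7), (7, 8), (7, 9),
    (8, 10), (9, 12), (9, 11), (10, 11), (11, 13), (12, 13), (13, 14)}"

end

theory Submission imports Defs "HOL-Computational_Algebra.Fundamental_Theorem_Algebra"
begin

text \<open>
  An element of \<open>E \<otimes> \<And>\<^sup>2 F\<close> is a pencil of alternating forms in six variables. Scalars can be absorbed into the matrices,
  so the orbits are those of \<open>GL(E) \<times> GL(F)\<close> (\<open>orbit_gl\<close>), and to determine the orbit of an element means to find
  frames in which its coordinates are those of a representative (\<open>normal_form\<close>). The generic representative may be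
  replaced by a fixed one, since three pairwise independent vectors in the plane \<open>E\<close> can be rescaled to \<open>e1, e2, e1 + e2\<close>
  (\<open>generic_orbit\<close>).

  Exhaustion (\<open>classification\<close>) is linear algebra. If a nonzero member of the pencil has rank at most two, a Darboux frame
  of another member on its four-dimensional kernel, followed by a normal form of the pairing with a complementary plane,
  leads to one of ten representatives (\<open>classify_rank_2\<close>). Otherwise some member is degenerate, because the determinant of
  the pencil has a zero, and it has rank four. The second form restricted to its kernel plane is nonzero
  (\<open>classify_kernel_nondegenerate\<close>) or zero, and in the latter case the pairing of the plane with a complement has rank one
  or two (\<open>classify_kernel_isotropic\<close>); rank zero is impossible.

  The dimension of an orbit, as a transcendence degree, equals the dimension of its tangent space (\<open>alg_dim_orbit\<close>). The
  upper bound follows from the Jacobian criterion in characteristic zero (\<open>jacobian_criterion\<close>), the lower bound from the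
  fact that coordinates onto which the tangent space projects satisfy no polynomial relation on the orbit
  (\<open>vanishing_on_orbit\<close>). The tangent spaces at the representatives are computed explicitly.

  For the closure order, each of the eighteen coverings is realised by a line through the smaller representative whose other
  points lie in the larger orbit (\<open>degeneration\<close>). Conversely, ten unrelated pairs are extremal, in the sense that every
  unrelated pair reduces to one of them (\<open>related_or_obstructed\<close>). Five of them contradict the monotonicity of the
  dimension. The other five are excluded by polynomials that vanish on one orbit but not on the other: a Pfaffian of a
  member, a minor of the pencil, the rank of \<open>x \<and> x\<close>, the cubic form \<open>x \<and> x \<and> x\<close>, and its Hessian. Distinctness of the
  orbits is a consequence, since the order of the closures is antisymmetric.
\<close>

section \<open>Polynomial functions\<close>

lemma pf_const [intro]: "(\<lambda>_. c) \<in> poly_funs"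
  unfolding poly_funs_def by (rule generated_algebra.const)

lemma pf_coord [intro]: "(\<lambda>x. x $ i) \<in> poly_funs"
  unfolding poly_funs_def by (rule generated_algebra.gen) auto

lemma pf_add [intro]: "f \<in> poly_funs \<Longrightarrow> g \<in> poly_funs \<Longrightarrow> (\<lambda>x. f x + g x) \<in> poly_funs"
  unfolding poly_funs_def by (rule generated_algebra.add)

lemma pf_mult [intro]: "f \<in> poly_funs \<Longrightarrow> g \<in> poly_funs \<Longrightarrow> (\<lambda>x. f x * g x) \<in> poly_funs"
  unfolding poly_funs_def by (rule generated_algebra.mult)

lemma pf_minus [intro]: "f \<in> poly_funs \<Longrightarrow> (\<lambda>x. - f x) \<in> poly_funs"
  using pf_mult[OF pf_const[of "-1"], of f] by simp

lemma pf_diff [intro]: "f \<in> poly_funs \<Longrightarrow> g \<in> poly_funs \<Longrightarrow> (\<lambda>x. f x - g x) \<in> poly_funs"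
  using pf_add[of f "\<lambda>x. - g x"] by auto

lemma pf_sum: "(\<And>i. i \<in> I \<Longrightarrow> f i \<in> poly_funs) \<Longrightarrow> (\<lambda>x. \<Sum>i\<in>I. f i x) \<in> poly_funs"
  by (induction I rule: infinite_finite_induct) auto

lemma pf_prod: "(\<And>i. i \<in> I \<Longrightarrow> f i \<in> poly_funs) \<Longrightarrow> (\<lambda>x. \<Prod>i\<in>I. f i x) \<in> poly_funs"
  by (induction I rule: infinite_finite_induct) auto

lemma pf_power: "f \<in> poly_funs \<Longrightarrow> (\<lambda>x. f x ^ n) \<in> poly_funs"
  by (induction n) auto

lemma poly_funs_induct [consumes 1, case_names const coord add mult]:
  assumes "f \<in> poly_funs" "\<And>c. P (\<lambda>_. c)" "\<And>i. P (\<lambda>x. x $ i)"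
    "\<And>f g. f \<in> poly_funs \<Longrightarrow> g \<in> poly_funs \<Longrightarrow> P f \<Longrightarrow> P g \<Longrightarrow> P (\<lambda>x. f x + g x)"
    "\<And>f g. f \<in> poly_funs \<Longrightarrow> g \<in> poly_funs \<Longrightarrow> P f \<Longrightarrow> P g \<Longrightarrow> P (\<lambda>x. f x * g x)"
  shows "P f"
  using assms(1) unfolding poly_funs_def
  by (induction rule: generated_algebra.induct) (use assms(2-) in \<open>auto simp: poly_funs_def\<close>)

lemma pf_compose:
  assumes "f \<in> poly_funs" "\<And>i. (\<lambda>x. \<pi> x $ i) \<in> poly_funs"
  shows "(\<lambda>x. f (\<pi> x)) \<in> poly_funs"
  using assms(1) by (induction rule: poly_funs_induct) (use assms(2) in auto)

lemma pf_generated: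
  assumes "P \<in> generated_algebra X" "\<And>q. q \<in> X \<Longrightarrow> (\<lambda>x. q (h x)) \<in> poly_funs"
  shows "(\<lambda>x. P (h x)) \<in> poly_funs"
  using assms(1) by (induction rule: generated_algebra.induct) (use assms(2) in auto)

text \<open>
  Restriction to lines reduces zeros of polynomial functions in several variables to zeros of polynomials
  in one variable.
\<close>

lemma pf_along_line:
  assumes "f \<in> poly_funs"
  shows "\<exists>p. \<forall>s. f (x + s *s v) = poly p s"
  using assms
proof (induction rule: poly_funs_induct)
  case (const c)
  show ?case by (rule exI[of _ "[:c:]"]) simp
next
  case (coord i)
  show ?case by (rule exI[of _ "[:x $ i, v $ i:]"]) (simp add: algebra_simps)
next
  case (add f g)
  then obtain p q where "\<forall>s. f (x + s *s v) = poly p s" "\<forall>s. g (x + s *s v) = poly q s"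
    by blast
  then show ?case by (intro exI[of _ "p + q"]) simp
next
  case (mult f g)
  then obtain p q where "\<forall>s. f (x + s *s v) = poly p s" "\<forall>s. g (x + s *s v) = poly q s"
    by blast
  then show ?case by (intro exI[of _ "p * q"]) simp
qed

lemma poly_eq_0_if_small:
  fixes p :: "complex poly"
  assumes "r > 0" "\<And>s. norm s < r \<Longrightarrow> s \<noteq> 0 \<Longrightarrow> poly p s = 0"
  shows "p = 0"
proof (rule ccontr)
  assume "p \<noteq> 0"
  then have "finite {s. poly p s = 0}" by (rule poly_roots_finite)
  moreover have "complex_of_real ` {0<..<r} \<subseteq> {s. poly p s = 0}"
    using assms(2) by (auto simp: norm_of_real)
  ultimately have "finite (complex_of_real ` {0<..<r})" by (rule finite_subset[rotated])
  then have "finite {0<..<r}" by (rule finite_imageD) (auto simp: inj_on_def)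
  then show False using assms(1) by (simp add: infinite_Ioo)
qed

text \<open>
  The polynomial functions form an integral domain: on the line through \<open>x\<close> and \<open>y\<close> both
  functions are nonzero polynomials in one variable.
\<close>

lemma pf_mult_nonzero:
  assumes "f \<in> poly_funs" "g \<in> poly_funs" "f x \<noteq> 0" "g y \<noteq> 0"
  shows "\<exists>z. f z \<noteq> 0 \<and> g z \<noteq> 0"
proof -
  obtain p q where pq: "\<forall>s. f (x + s *s (y - x)) = poly p s" "\<forall>s. g (x + s *s (y - x)) = poly q s"
    using pf_along_line assms by metis
  have "poly p 0 \<noteq> 0" "poly q 1 \<noteq> 0"
    using pq(1)[rule_format, of 0, symmetric] pq(2)[rule_format, of 1, symmetric] assms by simp_all
  then have "p * q \<noteq> 0" by auto
  then have "\<exists>s. poly (p * q) s \<noteq> 0" using poly_all_0_iff_0 by blast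
  then show ?thesis using pq by (metis mult_eq_0_iff poly_mult)
qed

lemma pf_finite_nonzero:
  assumes "finite F" "\<And>f. f \<in> F \<Longrightarrow> f \<in> poly_funs \<and> (\<exists>x. f x \<noteq> 0)"
  shows "\<exists>z. \<forall>f\<in>F. f z \<noteq> 0"
proof -
  have "(\<lambda>x. \<Prod>f\<in>F. f x) \<in> poly_funs \<and> (\<exists>z. (\<Prod>f\<in>F. f z) \<noteq> 0)"
    using assms
  proof (induction F rule: finite_induct)
    case (insert f F)
    then obtain x y where "(\<lambda>x. \<Prod>f\<in>F. f x) \<in> poly_funs" "f \<in> poly_funs" "f x \<noteq> 0" "(\<Prod>f\<in>F. f y) \<noteq> 0"
      by blast
    from pf_mult_nonzero[OF this(2,1,3,4)] show ?case
      using insert by (auto intro!: pf_mult pf_prod simp del: prod_zero_iff)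
  qed auto
  then show ?thesis using assms(1) by auto
qed

section \<open>Directional derivatives\<close>

text \<open>
  Polynomial functions are differentiated along lines, so that all derivatives are derivatives in one complex
  variable.
\<close>

definition dirderiv :: "complex ^ 'n \<Rightarrow> (complex ^ 'n \<Rightarrow> complex) \<Rightarrow> complex ^ 'n \<Rightarrow> complex"
  where "dirderiv v f x = deriv (\<lambda>s. f (x + s *s v)) 0"

lemma has_dirderiv:
  assumes "f \<in> poly_funs"
  shows "((\<lambda>s. f (x + s *s v)) has_field_derivative dirderiv v f x) (at 0)"
proof -
  obtain p where "\<forall>s. f (x + s *s v) = poly p s" using pf_along_line[OF assms] by blast
  then have "(\<lambda>s. f (x + s *s v)) = poly p" by auto
  then show ?thesis unfolding dirderiv_def
    by (simp add: DERIV_deriv_iff_field_differentiable poly_DERIV field_differentiable_def) (metis poly_DERIV)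
qed

lemma dirderivI:
  "((\<lambda>s. f (x + s *s v)) has_field_derivative d) (at 0) \<Longrightarrow> dirderiv v f x = d"
  unfolding dirderiv_def by (rule DERIV_imp_deriv)

lemma dirderiv_const [simp]: "dirderiv v (\<lambda>_. c) x = 0"
  by (rule dirderivI) simp

lemma dirderiv_coord [simp]: "dirderiv v (\<lambda>x. x $ i) x = v $ i"
  by (rule dirderivI) (auto intro!: derivative_eq_intros)

lemma dirderiv_add:
  assumes "f \<in> poly_funs" "g \<in> poly_funs"
  shows "dirderiv v (\<lambda>x. f x + g x) x = dirderiv v f x + dirderiv v g x"
  by (rule dirderivI) (intro DERIV_add has_dirderiv assms)

lemma dirderiv_mult:
  assumes "f \<in> poly_funs" "g \<in> poly_funs"
  shows "dirderiv v (\<lambda>x. f x * g x) x = dirderiv v f x * g x + dirderiv v g x * f x"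
  using DERIV_mult[OF has_dirderiv[OF assms(1)] has_dirderiv[OF assms(2)], of x v x v]
  by (intro dirderivI) simp

lemma dirderiv_sum:
  assumes "\<And>i. i \<in> I \<Longrightarrow> f i \<in> poly_funs"
  shows "dirderiv v (\<lambda>x. \<Sum>i\<in>I. f i x) x = (\<Sum>i\<in>I. dirderiv v (f i) x)"
  using assms by (induction I rule: infinite_finite_induct) (auto simp: dirderiv_add pf_sum)

lemma dirderiv_power:
  assumes "f \<in> poly_funs"
  shows "dirderiv v (\<lambda>x. f x ^ n) x = of_nat n * f x ^ (n - 1) * dirderiv v f x"
  by (rule dirderivI) (use DERIV_power[OF has_dirderiv[OF assms], of x v n] in \<open>simp add: mult_ac\<close>)

lemma dirderiv_axis_sum:
  assumes "f \<in> poly_funs"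
  shows "dirderiv v f x = (\<Sum>i\<in>UNIV. v $ i * dirderiv (axis i 1) f x)"
  using assms
proof (induction rule: poly_funs_induct)
  case (coord i)
  show ?case by (simp add: axis_def if_distrib cong: if_cong)
next
  case (add f g)
  then show ?case by (simp add: dirderiv_add sum.distrib distrib_left)
next
  case (mult f g)
  have "dirderiv v (\<lambda>x. f x * g x) x = dirderiv v f x * g x + dirderiv v g x * f x"
    by (rule dirderiv_mult[OF mult.hyps])
  also have "\<dots> = (\<Sum>i\<in>UNIV. v $ i * (dirderiv (axis i 1) f x * g x + dirderiv (axis i 1) g x * f x))"
    by (subst mult.IH(1), subst mult.IH(2)) (simp add: sum_distrib_left sum_distrib_right sum.distrib distrib_left mult_ac)
  also have "\<dots> = (\<Sum>i\<in>UNIV. v $ i * dirderiv (axis i 1) (\<lambda>x. f x * g x) x)"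
    by (simp add: dirderiv_mult[OF mult.hyps])
  finally show ?case .
qed simp

lemma dirderiv_compose:
  assumes "f \<in> poly_funs" "\<And>i. (\<lambda>x. \<pi> x $ i) \<in> poly_funs"
  shows "dirderiv v (\<lambda>x. f (\<pi> x)) x = dirderiv (\<chi> i. dirderiv v (\<lambda>x. \<pi> x $ i) x) f (\<pi> x)"
  using assms(1)
proof (induction rule: poly_funs_induct)
  case (add f g)
  then show ?case using pf_compose[OF _ assms(2)] by (simp add: dirderiv_add)
next
  case (mult f g)
  then show ?case using pf_compose[OF _ assms(2)] by (simp add: dirderiv_mult)
qed simp_all

lemma pf_continuous:
  assumes "f \<in> poly_funs"
  shows "continuous_on UNIV f"
  using assms by (induction rule: poly_funs_induct) (auto intro!: continuous_intros)

text \<open>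
  The identity theorem, again by restriction to lines.
\<close>

lemma pf_zero_if_open:
  assumes "f \<in> poly_funs" "open U" "x \<in> U" "\<And>y. y \<in> U \<Longrightarrow> f y = 0"
  shows "f z = 0"
proof -
  obtain p where p: "\<forall>s. f (x + s *s (z - x)) = poly p s" using pf_along_line[OF assms(1)] by blast
  have "continuous_on UNIV (\<lambda>s. x + s *s (z - x))"
    by (subst continuous_on_componentwise) (auto simp: Basis_vec_def inner_axis intro!: continuous_intros)
  then have "open ((\<lambda>s. x + s *s (z - x)) -` U)"
    using assms(2) by (simp add: continuous_on_open_vimage)
  moreover have "0 \<in> (\<lambda>s. x + s *s (z - x)) -` U" using assms(3) by simp
  ultimately obtain r where "r > 0" "ball 0 r \<subseteq> (\<lambda>s. x + s *s (z - x)) -` U"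
    using openE by blast
  then have "p = 0" using p assms(4)
    by (intro poly_eq_0_if_small[of r])
      (auto simp: subset_iff dist_norm simp flip: p[rule_format] simp del: vector_ssub_ldistrib)
  then show ?thesis using p[rule_format, of 1] by simp
qed

section \<open>Underdetermined linear systems\<close>

text \<open>
  Gaussian elimination over an arbitrary index type: the relation for \<open>l0\<close> is used to remove one index \<open>i0\<close>.
  This is the only source of dependence relations below: it is applied to gradients, to tangent vectors and to
  coefficients of monomials.
\<close>

lemma underdetermined:
  fixes M :: "'i \<Rightarrow> 'l \<Rightarrow> complex"
  assumes "finite L" "finite I" "card L < card I"
  shows "\<exists>c. (\<exists>i\<in>I. c i \<noteq> 0) \<and> (\<forall>l\<in>L. (\<Sum>i\<in>I. c i * M i l) = 0)"
  using assms
proof (induction L arbitrary: I M rule: finite_induct)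
  case empty
  then obtain i where "i \<in> I" by fastforce
  then show ?case by (intro exI[of _ "\<lambda>_. 1"]) auto
next
  case (insert l0 L)
  show ?case
  proof (cases "\<forall>i\<in>I. M i l0 = 0")
    case True
    obtain c where "\<exists>i\<in>I. c i \<noteq> 0" "\<forall>l\<in>L. (\<Sum>i\<in>I. c i * M i l) = 0"
      using insert.IH[of I M] insert.prems insert.hyps by auto
    then show ?thesis using True by (intro exI[of _ c]) auto
  next
    case False
    then obtain i0 where i0: "i0 \<in> I" "M i0 l0 \<noteq> 0" by blast
    define J where "J = I - {i0}"
    have I: "I = insert i0 J" "i0 \<notin> J" "finite J" using i0 insert.prems by (auto simp: J_def)
    define N where "N i l = M i l - M i l0 / M i0 l0 * M i0 l" for i l
    have "card L < card J" using insert.prems insert.hyps I by simp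
    then obtain c where c: "\<exists>i\<in>J. c i \<noteq> 0" "\<forall>l\<in>L. (\<Sum>i\<in>J. c i * N i l) = 0"
      using insert.IH[of J N] I by auto
    define c' where "c' = c(i0 := - (\<Sum>i\<in>J. c i * M i l0) / M i0 l0)"
    have c'J: "(\<Sum>i\<in>J. c' i * M i l) = (\<Sum>i\<in>J. c i * M i l)" for l
      by (rule sum.cong) (use I in \<open>auto simp: c'_def\<close>)
    have "(\<Sum>i\<in>I. c' i * M i l) = (\<Sum>i\<in>J. c i * N i l)" for l
    proof -
      have "(\<Sum>i\<in>J. c i * N i l) = (\<Sum>i\<in>J. c i * M i l) - (\<Sum>i\<in>J. c i * M i l0) / M i0 l0 * M i0 l"
        by (simp add: N_def right_diff_distrib sum_subtractf sum_distrib_right sum_divide_distrib mult.assoc)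
      then show ?thesis unfolding I(1) using I by (simp add: c'J) (simp add: c'_def)
    qed
    moreover have "(\<Sum>i\<in>J. c i * N i l0) = 0" using i0 by (simp add: N_def)
    ultimately have "\<forall>l\<in>insert l0 L. (\<Sum>i\<in>I. c' i * M i l) = 0" using c by simp
    moreover have "\<exists>i\<in>I. c' i \<noteq> 0" using c I by (auto simp: c'_def)
    ultimately show ?thesis by blast
  qed
qed

section \<open>Degree\<close>

text \<open>
  An upper bound for the degree; it suffices for counting monomials and for inductions in which a derivative
  lowers the degree.
\<close>

inductive deg_le :: "nat \<Rightarrow> (complex ^ 'n \<Rightarrow> complex) \<Rightarrow> bool" where
  deg_const: "deg_le k (\<lambda>_. c)"
| deg_coord: "deg_le (Suc k) (\<lambda>x. x $ i)"
| deg_add: "deg_le k f \<Longrightarrow> deg_le k g \<Longrightarrow> deg_le k (\<lambda>x. f x + g x)"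
| deg_mult: "deg_le k f \<Longrightarrow> deg_le l g \<Longrightarrow> deg_le (k + l) (\<lambda>x. f x * g x)"

lemma deg_le_Suc: "deg_le k f \<Longrightarrow> deg_le (Suc k) f"
proof (induction rule: deg_le.induct)
  case (deg_mult k f l g)
  from deg_le.deg_mult[OF deg_mult.IH(1) deg_mult.hyps(2)] show ?case by simp
qed (auto intro: deg_le.intros)

lemma deg_le_mono: "deg_le k f \<Longrightarrow> k \<le> l \<Longrightarrow> deg_le l f"
  by (induction l) (auto simp: le_Suc_eq intro: deg_le_Suc)

lemma deg_le_poly: "deg_le k f \<Longrightarrow> f \<in> poly_funs"
  by (induction rule: deg_le.induct) auto

lemma poly_deg_le: "f \<in> poly_funs \<Longrightarrow> \<exists>k. deg_le k f"
proof (induction rule: poly_funs_induct)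
  case (add f g)
  then obtain k l where "deg_le k f" "deg_le l g" by blast
  then have "deg_le (max k l) f" "deg_le (max k l) g" by (auto intro: deg_le_mono)
  then show ?case by (blast intro: deg_add)
qed (auto intro: deg_le.intros)

lemma deg_le_dirderiv:
  assumes "deg_le k f"
  shows "deg_le (k - 1) (dirderiv v f) \<and> (k = 0 \<longrightarrow> (\<forall>x. dirderiv v f x = 0))"
  using assms
proof (induction rule: deg_le.induct)
  case (deg_const k c)
  then show ?case by (simp add: deg_le.deg_const[of _ 0])
next
  case (deg_coord k i)
  then show ?case by (simp add: deg_le.deg_const)
next
  case (deg_add k f g)
  have "dirderiv v (\<lambda>x. f x + g x) = (\<lambda>x. dirderiv v f x + dirderiv v g x)"
    using deg_add.hyps by (auto simp: dirderiv_add deg_le_poly)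
  then show ?case using deg_add.IH by (auto intro: deg_le.deg_add)
next
  case (deg_mult k f l g)
  have eq: "dirderiv v (\<lambda>x. f x * g x) = (\<lambda>x. dirderiv v f x * g x + dirderiv v g x * f x)"
    using deg_mult.hyps by (auto simp: dirderiv_mult deg_le_poly)
  have "deg_le (k + l - 1) (\<lambda>x. dirderiv v f x * g x)"
  proof (cases k)
    case 0
    then show ?thesis using deg_mult.IH(1) by (simp add: deg_le.deg_const)
  next
    case (Suc k')
    then show ?thesis using deg_le.deg_mult[of k' "dirderiv v f" l g] deg_mult by simp
  qed
  moreover have "deg_le (k + l - 1) (\<lambda>x. dirderiv v g x * f x)"
  proof (cases l)
    case 0
    then show ?thesis using deg_mult.IH(2) by (simp add: deg_le.deg_const)
  next
    case (Suc l')
    then show ?thesis using deg_le.deg_mult[of l' "dirderiv v g" k f] deg_mult by (simp add: add.commute)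
  qed
  ultimately show ?case unfolding eq using deg_mult.IH by (auto intro: deg_le.deg_add)
qed

lemma pf_dirderiv: "f \<in> poly_funs \<Longrightarrow> dirderiv v f \<in> poly_funs"
  using poly_deg_le deg_le_dirderiv deg_le_poly by metis

lemma pf_constant:
  assumes "f \<in> poly_funs" "\<And>i x. dirderiv (axis i 1) f x = 0"
  shows "f x = f y"
proof -
  obtain p where p: "\<forall>s. f (y + s *s (x - y)) = poly p s" using pf_along_line[OF assms(1)] by blast
  have d0: "dirderiv v f z = 0" for v z
    by (subst dirderiv_axis_sum[OF assms(1)]) (simp add: assms(2))
  have "poly (pderiv p) s = 0" for s
  proof -
    have "((\<lambda>r. f ((y + s *s (x - y)) + r *s (x - y))) has_field_derivative 0) (at 0)"
      using has_dirderiv[OF assms(1)] d0 by metis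
    moreover have "f ((y + s *s (x - y)) + r *s (x - y)) = poly p (s + r)" for r :: complex
      
      using p[rule_format, of "s + r"] by (simp only: vector_sadd_rdistrib add.assoc)
    ultimately have "((\<lambda>r. poly p (s + r)) has_field_derivative 0) (at 0)" by simp
    moreover have "((\<lambda>r. poly p (s + r)) has_field_derivative poly (pderiv p) s) (at 0)"
      using DERIV_chain2[of "poly p" _ "\<lambda>r. s + r" 0 1 UNIV] poly_DERIV[of p s]
      by (auto intro!: derivative_eq_intros poly_DERIV DERIV_chain2)
    ultimately show ?thesis using DERIV_unique by blast
  qed
  then have "pderiv p = 0" using poly_all_0_iff_0 by blast
  then obtain h where "p = [:h:]" using pderiv_iszero by blast
  then have "poly p 1 = poly p 0" by simp
  then show ?thesis using p[rule_format, of 1] p[rule_format, of 0] by simp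
qed

text \<open>
  Each exponent is bounded by the degree. The cube of exponents is larger than the simplex but easier to count.
\<close>

lemma deg_le_monomials:
  fixes f :: "complex ^ 'n \<Rightarrow> complex"
  assumes "deg_le k f"
  shows "\<exists>c. \<forall>x. f x = (\<Sum>e | \<forall>i. e i \<le> k. c e * (\<Prod>i\<in>UNIV. (x $ i) ^ e i))"
  using assms
proof (induction rule: deg_le.induct)
  have fin: "finite {e::'n \<Rightarrow> nat. \<forall>i. e i \<le> k}" for k
    using finite_PiE[of "UNIV :: 'n set" "\<lambda>_. {..k}"] by (simp add: PiE_def Pi_def)
  { case (deg_const k c)
    then show ?case
      by (intro exI[of _ "\<lambda>e. if e = (\<lambda>_. 0) then c else 0"])
         (simp add: if_distrib[of "\<lambda>a. a * _"] sum.delta fin cong: if_cong)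
  next
    case (deg_coord k i)
    show ?case
    proof (rule exI[of _ "\<lambda>e. if e = (\<lambda>j. if j = i then 1 else 0) then 1 else 0"], rule allI)
      fix x :: "complex ^ 'n"
      have "(\<Prod>j\<in>UNIV. (x $ j) ^ (if j = i then 1 else 0)) = (\<Prod>j\<in>UNIV. if j = i then x $ j else 1)"
        by (rule prod.cong) auto
      then show "x $ i = (\<Sum>e | \<forall>i. e i \<le> Suc k.
          (if e = (\<lambda>j. if j = i then 1 else 0) then 1 else 0) * (\<Prod>i\<in>UNIV. (x $ i) ^ e i))"
        by (simp add: if_distrib[of "\<lambda>a. a * _"] sum.delta fin cong: if_cong)
    qed
  next
    case (deg_add k f g)
    then obtain c d where "\<forall>x. f x = (\<Sum>e | \<forall>i. e i \<le> k. c e * (\<Prod>i\<in>UNIV. (x $ i) ^ e i))"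
      "\<forall>x. g x = (\<Sum>e | \<forall>i. e i \<le> k. d e * (\<Prod>i\<in>UNIV. (x $ i) ^ e i))" by blast
    then show ?case by (intro exI[of _ "\<lambda>e. c e + d e"]) (simp add: distrib_right sum.distrib)
  next
    case (deg_mult k f l g)
    let ?E = "\<lambda>k. {e::'n \<Rightarrow> nat. \<forall>i. e i \<le> k}"
    let ?m = "\<lambda>x e. \<Prod>i\<in>UNIV. (x $ i) ^ e i"
    obtain c d where c: "\<forall>x. f x = (\<Sum>e\<in>?E k. c e * ?m x e)"
      and d: "\<forall>x. g x = (\<Sum>e\<in>?E l. d e * ?m x e)" using deg_mult by blast
    show ?case
    proof (rule exI[of _ "\<lambda>s. \<Sum>p\<in>{p \<in> ?E k \<times> ?E l. (\<lambda>i. fst p i + snd p i) = s}. c (fst p) * d (snd p)"], rule allI)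
      fix x
      have "f x * g x = (\<Sum>p\<in>?E k \<times> ?E l. (c (fst p) * d (snd p)) * ?m x (\<lambda>i. fst p i + snd p i))"
        unfolding c[rule_format] d[rule_format] sum_product sum.cartesian_product
        by (rule sum.cong) (auto simp: power_add prod.distrib mult_ac)
      also have "\<dots> = (\<Sum>s\<in>?E (k + l). \<Sum>p\<in>{p \<in> ?E k \<times> ?E l. (\<lambda>i. fst p i + snd p i) = s}.
          (c (fst p) * d (snd p)) * ?m x (\<lambda>i. fst p i + snd p i))"
        by (rule sum.group[symmetric]) (auto simp: fin intro: add_mono)
      also have "\<dots> = (\<Sum>s\<in>?E (k + l). (\<Sum>p\<in>{p \<in> ?E k \<times> ?E l. (\<lambda>i. fst p i + snd p i) = s}.
          c (fst p) * d (snd p)) * ?m x s)"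
        by (auto simp: sum_distrib_right intro!: sum.cong)
      finally show "f x * g x = \<dots>" .
    qed }
qed

section \<open>Algebraic independence and the Jacobian criterion\<close>

abbreviation vars :: "nat \<Rightarrow> ((nat \<Rightarrow> complex) \<Rightarrow> complex) set"
  where "vars r \<equiv> (\<lambda>i v. v i) ` {..<r}"

lemma ga_sum: "(\<And>i. i \<in> I \<Longrightarrow> f i \<in> generated_algebra X) \<Longrightarrow> (\<lambda>x. \<Sum>i\<in>I. f i x) \<in> generated_algebra X"
  by (induction I rule: infinite_finite_induct) (auto intro: generated_algebra.intros)

lemma ga_prod: "(\<And>i. i \<in> I \<Longrightarrow> f i \<in> generated_algebra X) \<Longrightarrow> (\<lambda>x. \<Prod>i\<in>I. f i x) \<in> generated_algebra X"
  by (induction I rule: infinite_finite_induct) (auto intro: generated_algebra.intros)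

lemma ga_power: "f \<in> generated_algebra X \<Longrightarrow> (\<lambda>x. f x ^ n) \<in> generated_algebra X"
  by (induction n) (auto intro: generated_algebra.intros)

lemma ga_vars_poly:
  assumes "P \<in> generated_algebra (vars r)" "\<And>i. i < r \<Longrightarrow> g i \<in> poly_funs"
  shows "(\<lambda>x. P (\<lambda>i. g i x)) \<in> poly_funs"
  using assms by (intro pf_generated[of P "vars r"]) auto

lemma deg_le_power: "deg_le k f \<Longrightarrow> deg_le (n * k) (\<lambda>x. f x ^ n)"
  by (induction n) (auto intro: deg_const deg_mult)

lemma deg_le_prod:
  "finite I \<Longrightarrow> (\<And>i. i \<in> I \<Longrightarrow> deg_le (k i) (f i)) \<Longrightarrow> deg_le (\<Sum>i\<in>I. k i) (\<lambda>x. \<Prod>i\<in>I. f i x)"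
  by (induction I rule: finite_induct) (auto intro: deg_const deg_mult)

lemma sum_digits: "(\<Sum>i<r. (n div b ^ i mod b) * b ^ i) = n mod b ^ r" for n b r :: nat
proof (induction r)
  case (Suc r)
  have "n mod b ^ Suc r = b ^ r * (n div b ^ r mod b) + n mod b ^ r"
    by (subst power_Suc2, rule mod_mult2_eq)
  then show ?case using Suc by (simp add: mult.commute)
qed simp

text \<open>
  The transcendence degree of a polynomial ring is at most the number of variables, by counting. Products of
  powers of the \<open>g i\<close> with exponents at most \<open>k\<close> are \<open>(k + 1) ^ r\<close> many and lie in a space of dimension \<open>O(k ^ m)\<close>,
  where \<open>m\<close> is the number of variables; if \<open>m < r\<close>, there is a linear relation between them for large \<open>k\<close>.
\<close>

lemma alg_independent_bound:
  fixes g :: "nat \<Rightarrow> complex ^ 'p \<Rightarrow> complex"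
  assumes g: "\<And>i. i < r \<Longrightarrow> g i \<in> poly_funs" and ind: "alg_independent_on UNIV r g"
  shows "r \<le> CARD('p)"
proof (rule ccontr)
  define m where "m = CARD('p)"
  assume "\<not> r \<le> CARD('p)"
  then have mr: "Suc m \<le> r" by (simp add: m_def)
  have "\<forall>i. \<exists>D. i < r \<longrightarrow> deg_le D (g i)" using g poly_deg_le by blast
  then obtain D' where D': "\<And>i. i < r \<Longrightarrow> deg_le (D' i) (g i)" by metis
  define D where "D = Suc (\<Sum>i<r. D' i)"
  have D: "deg_le D (g i)" if "i < r" for i
    using member_le_sum[of i "{..<r}" D'] that by (intro deg_le_mono[OF D'[OF that]]) (auto simp: D_def)
  \<comment> \<open>With \<open>K = k * (r * D)\<close>, this makes \<open>(K + 1) ^ m \<le> (k + 1) ^ m * k < (k + 1) ^ (m + 1)\<close>. The exponent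
    vectors with entries at most \<open>k\<close> are the digits of the numbers below \<open>N\<close> in base \<open>b = k + 1\<close>.\<close>
  define k where "k = (r * D) ^ m"
  define b where "b = Suc k"
  define N where "N = b ^ r"
  define dig where "dig n i = n div b ^ i mod b" for n i :: nat
  define K where "K = r * k * D"
  have dig_le: "dig n i \<le> k" for n i
    using mod_less_divisor[of b "n div b ^ i"] by (simp add: dig_def b_def del: mod_less_divisor)
  let ?E = "{e::'p \<Rightarrow> nat. \<forall>i. e i \<le> K}"
  have E: "?E = PiE UNIV (\<lambda>_. {..K})" by (auto simp: PiE_def Pi_def)
  have finE: "finite ?E" unfolding E by (intro finite_PiE) auto
  have "card ?E = Suc K ^ m" unfolding E by (subst card_PiE) (auto simp: m_def)
  also have "\<dots> \<le> (b * (r * D)) ^ m"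
  proof (rule power_mono)
    have "1 \<le> r * D" using mr by (simp add: D_def)
    moreover have "K = k * (r * D)" by (simp add: K_def)
    moreover have "b * (r * D) = r * D + k * (r * D)" by (simp add: b_def)
    ultimately show "Suc K \<le> b * (r * D)" by linarith
  qed simp
  also have "\<dots> = b ^ m * k" by (simp only: power_mult_distrib[of b "r * D" m] k_def)
  also have "\<dots> < b ^ m * b" by (simp add: b_def)
  also have "\<dots> = b ^ Suc m" by simp
  also have "\<dots> \<le> N" unfolding N_def using mr by (intro power_increasing) (auto simp: b_def)
  finally have card: "card ?E < card {..<N}" by simp
  have "\<exists>M. \<forall>x. (\<Prod>i<r. g i x ^ dig n i) = (\<Sum>e\<in>?E. M e * (\<Prod>i\<in>UNIV. (x $ i) ^ e i))" for n
  proof -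
    have "deg_le (\<Sum>i<r. dig n i * D) (\<lambda>x. \<Prod>i<r. g i x ^ dig n i)"
      by (intro deg_le_prod deg_le_power D) auto
    moreover have "(\<Sum>i<r. dig n i * D) \<le> (\<Sum>i<r. k * D)"
      by (intro sum_mono mult_right_mono dig_le) auto
    then have "(\<Sum>i<r. dig n i * D) \<le> K" by (simp add: K_def mult.assoc)
    ultimately show ?thesis by (rule deg_le_monomials[OF deg_le_mono])
  qed
  then have "\<forall>n. \<exists>M. \<forall>x. (\<Prod>i<r. g i x ^ dig n i) = (\<Sum>e\<in>?E. M e * (\<Prod>i\<in>UNIV. (x $ i) ^ e i))"
    by blast
  from choice[OF this] obtain M where M: "\<And>n x. (\<Prod>i<r. g i x ^ dig n i) = (\<Sum>e\<in>?E. M n e * (\<Prod>i\<in>UNIV. (x $ i) ^ e i))"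
    by blast
  obtain c where c: "\<exists>n\<in>{..<N}. c n \<noteq> 0" "\<forall>e\<in>?E. (\<Sum>n<N. c n * M n e) = 0"
    using underdetermined[OF finE finite_lessThan card, of M] by blast
  define P where "P = (\<lambda>v. \<Sum>n<N. c n * (\<Prod>i<r. v i ^ dig n i))"
  have "P \<in> generated_algebra (vars r)"
    unfolding P_def
  proof (rule ga_sum, rule generated_algebra.mult, rule generated_algebra.const, rule ga_prod, rule ga_power)
    fix i assume "i \<in> {..<r}"
    then show "(\<lambda>v. v i) \<in> generated_algebra (vars r)" by (intro generated_algebra.gen imageI)
  qed
  moreover have "P (\<lambda>i. g i x) = 0" for x
  proof -
    have "P (\<lambda>i. g i x) = (\<Sum>e\<in>?E. (\<Sum>n<N. c n * M n e) * (\<Prod>i\<in>UNIV. (x $ i) ^ e i))"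
      unfolding P_def M sum_distrib_left sum_distrib_right by (subst sum.swap) (simp add: mult.assoc)
    then show ?thesis using c(2) by simp
  qed
  ultimately have P0: "P = (\<lambda>_. 0)" using ind unfolding alg_independent_on_def by auto
  \<comment> \<open>Kronecker substitution turns distinct monomials into distinct powers of one variable.\<close>
  have "(\<Sum>n<N. c n * w ^ n) = 0" for w
  proof -
    have "(\<Prod>i<r. (w ^ (b ^ i)) ^ dig n i) = w ^ n" if "n < N" for n
    proof -
      have "(\<Prod>i<r. (w ^ (b ^ i)) ^ dig n i) = (\<Prod>i<r. w ^ (dig n i * b ^ i))"
        by (simp add: mult.commute flip: power_mult)
      also have "\<dots> = w ^ (\<Sum>i<r. dig n i * b ^ i)" by (simp add: power_sum)
      also have "(\<Sum>i<r. dig n i * b ^ i) = n" using that by (simp add: dig_def sum_digits N_def)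
      finally show ?thesis .
    qed
    then show ?thesis using P0[THEN fun_cong, of "\<lambda>i. w ^ (b ^ i)"] by (simp add: P_def)
  qed
  moreover have "{..<N} = {..N - 1}" using card by (auto simp: lessThan_Suc_atMost[symmetric])
  ultimately have "\<forall>i\<le>N - 1. c i = 0" using polyfun_eq_0[of c "N - 1"] by simp
  then show False using c(1) by auto
qed

text \<open>
  A polynomial in \<open>r + 1\<close> variables as a polynomial in the last one.
\<close>

lemma ga_decompose:
  assumes "P \<in> generated_algebra (vars (Suc r))"
  shows "\<exists>n C. (\<forall>k. C k \<in> generated_algebra (vars r)) \<and> (\<forall>k>n. C k = (\<lambda>_. 0)) \<and>
    (\<forall>v. P v = (\<Sum>k\<le>n. C k v * v r ^ k))"
  using assms
proof (induction rule: generated_algebra.induct)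
  case (const c)
  show ?case
    by (rule exI[of _ 0], rule exI[of _ "\<lambda>k. if k = 0 then (\<lambda>_. c) else (\<lambda>_. 0)"])
       (auto intro: generated_algebra.const)
next
  case (gen g)
  then obtain i where i: "g = (\<lambda>v. v i)" "i < Suc r" by auto
  show ?case
  proof (cases "i = r")
    case True
    show ?thesis
      by (rule exI[of _ 1], rule exI[of _ "\<lambda>k. if k = 1 then (\<lambda>_. 1) else (\<lambda>_. 0)"])
         (auto simp: i True intro: generated_algebra.const)
  next
    case False
    then show ?thesis using i
      by (intro exI[of _ 0] exI[of _ "\<lambda>k. if k = 0 then (\<lambda>v. v i) else (\<lambda>_. 0)"])
         (auto intro: generated_algebra.const generated_algebra.gen)
  qed
next
  case (add g h)
  obtain n C where C: "\<And>k. C k \<in> generated_algebra (vars r)" "\<And>k. k > n \<Longrightarrow> C k = (\<lambda>_. 0)"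
    "\<And>v. g v = (\<Sum>k\<le>n. C k v * v r ^ k)" using add.IH(1) by blast
  obtain m D where D: "\<And>k. D k \<in> generated_algebra (vars r)"
    "\<And>k. k > m \<Longrightarrow> D k = (\<lambda>_. 0)" "\<And>v. h v = (\<Sum>k\<le>m. D k v * v r ^ k)" using add.IH(2) by blast
  have g: "g v = (\<Sum>k\<le>n + m. C k v * v r ^ k)" for v
    unfolding C(3) by (rule sum.mono_neutral_left) (auto simp: C(2))
  have h: "h v = (\<Sum>k\<le>n + m. D k v * v r ^ k)" for v
    unfolding D(3) by (rule sum.mono_neutral_left) (auto simp: D(2))
  show ?case
  proof (intro exI conjI allI impI)
    fix v
    show "g v + h v = (\<Sum>k\<le>n + m. (C k v + D k v) * v r ^ k)"
      unfolding g h by (simp add: sum.distrib distrib_right)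
  next
    fix k
    show "(\<lambda>v. C k v + D k v) \<in> generated_algebra (vars r)" by (rule generated_algebra.add[OF C(1) D(1)])
  next
    fix k assume "n + m < k"
    then show "(\<lambda>v. C k v + D k v) = (\<lambda>_. 0)" using C(2)[of k] D(2)[of k] by simp
  qed
next
  case (mult g h)
  obtain n C where C: "\<And>k. C k \<in> generated_algebra (vars r)" "\<And>k. k > n \<Longrightarrow> C k = (\<lambda>_. 0)"
    "\<And>v. g v = (\<Sum>k\<le>n. C k v * v r ^ k)" using mult.IH(1) by blast
  obtain m D where D: "\<And>k. D k \<in> generated_algebra (vars r)"
    "\<And>k. k > m \<Longrightarrow> D k = (\<lambda>_. 0)" "\<And>v. h v = (\<Sum>k\<le>m. D k v * v r ^ k)" using mult.IH(2) by blast
  show ?case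
  proof (intro exI conjI allI impI)
    fix v
    show "g v * h v = (\<Sum>k\<le>n + m. (\<Sum>i\<le>k. C i v * D (k - i) v) * v r ^ k)"
      unfolding C(3) D(3) by (rule polynomial_product) (use C(2) D(2) in auto)
  next
    fix k
    show "(\<lambda>v. \<Sum>i\<le>k. C i v * D (k - i) v) \<in> generated_algebra (vars r)"
      by (intro ga_sum generated_algebra.mult C D)
  next
    fix k assume nmk: "n + m < k"
    have "C i v * D (k - i) v = 0" if "i \<le> k" for i v
    proof (cases "n < i")
      case False
      then have "m < k - i" using nmk by linarith
      then show ?thesis by (simp add: D(2))
    qed (simp add: C(2))
    then have "(\<Sum>i\<le>k. C i v * D (k - i) v) = 0" for v by (intro sum.neutral) simp
    then show "(\<lambda>v. \<Sum>i\<le>k. C i v * D (k - i) v) = (\<lambda>_. 0)" by (rule ext)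
  qed
qed

lemma ga_gradient:
  assumes "P \<in> generated_algebra (vars r)" and g: "\<And>i. i < r \<Longrightarrow> g i \<in> poly_funs"
    and 0: "\<And>i. i < r \<Longrightarrow> dirderiv v (g i) x = 0"
  shows "dirderiv v (\<lambda>x. P (\<lambda>i. g i x)) x = 0"
  using assms(1)
proof (induction rule: generated_algebra.induct)
  case (add a b)
  have "(\<lambda>x. a (\<lambda>i. g i x)) \<in> poly_funs" "(\<lambda>x. b (\<lambda>i. g i x)) \<in> poly_funs"
    using ga_vars_poly[of a r g] ga_vars_poly[of b r g] add.hyps g by blast+
  then show ?case using add.IH by (simp add: dirderiv_add)
next
  case (mult a b)
  have "(\<lambda>x. a (\<lambda>i. g i x)) \<in> poly_funs" "(\<lambda>x. b (\<lambda>i. g i x)) \<in> poly_funs"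
    using ga_vars_poly[of a r g] ga_vars_poly[of b r g] mult.hyps g by blast+
  then show ?case using mult.IH by (simp add: dirderiv_mult)
qed (use 0 in auto)

text \<open>
  If \<open>y\<close> is algebraic over the field generated by the \<open>g i\<close>, its differential is a combination of theirs wherever
  the derivative \<open>q\<close> of a minimal relation does not vanish: differentiate the relation. Minimality of its degree
  \<open>n\<close> in \<open>y\<close> and characteristic \<open>0\<close> ensure that \<open>q\<close> is not identically \<open>0\<close>.
\<close>

lemma algebraic_gradient:
  fixes g :: "nat \<Rightarrow> complex ^ 'p \<Rightarrow> complex"
  assumes g: "\<And>i. i < r \<Longrightarrow> g i \<in> poly_funs" and y: "y \<in> poly_funs"
    and ind: "alg_independent_on UNIV r g"
    and dep: "\<not> alg_independent_on UNIV (Suc r) (g(r := y))"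
  shows "\<exists>q\<in>poly_funs. (\<exists>x. q x \<noteq> 0) \<and>
    (\<forall>x v. q x \<noteq> 0 \<longrightarrow> (\<forall>i<r. dirderiv v (g i) x = 0) \<longrightarrow> dirderiv v y x = 0)"
proof -
  let ?A = "generated_algebra (vars r)"
  define rel where "rel n C \<longleftrightarrow> (\<forall>k. C k \<in> ?A) \<and> (\<exists>k\<le>n. C k \<noteq> (\<lambda>_. 0)) \<and>
    (\<forall>x. (\<Sum>k\<le>n. C k (\<lambda>i. g i x) * y x ^ k) = 0)" for n C
  have ga_g: "P (\<lambda>i. (g(r := y)) i x) = P (\<lambda>i. g i x)" if "P \<in> ?A" for P x
    using that by (induction rule: generated_algebra.induct) auto
  have "\<exists>n C. rel n C"
  proof -
    obtain P where P: "P \<in> generated_algebra (vars (Suc r))" "P \<noteq> (\<lambda>_. 0)"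
      "\<And>x. P (\<lambda>i. (g(r := y)) i x) = 0"
      using dep unfolding alg_independent_on_def by auto
    obtain n C where C: "\<And>k. C k \<in> ?A" "\<And>v. P v = (\<Sum>k\<le>n. C k v * v r ^ k)"
      using ga_decompose[OF P(1)] by blast
    have "\<exists>k\<le>n. C k \<noteq> (\<lambda>_. 0)" using P(2) C(2) by force
    then show ?thesis using P(3) C(1) unfolding C(2) ga_g[OF C(1)] by (auto simp: rel_def)
  qed
  then have ex: "\<exists>n. \<exists>C. rel n C" .
  define n where "n = (LEAST n. \<exists>C. rel n C)"
  obtain C where C: "rel n C" using LeastI_ex[OF ex] unfolding n_def by blast
  have CA: "C k \<in> ?A" for k using C unfolding rel_def by blast
  have min: "\<not> rel n' C'" if "n' < n" for n' C' using not_less_Least that unfolding n_def by blast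
  have n0: "n \<noteq> 0"
  proof
    assume "n = 0"
    then have "C 0 \<in> ?A" "C 0 \<noteq> (\<lambda>_. 0)" "\<And>x. C 0 (\<lambda>i. g i x) = 0" using C by (auto simp: rel_def)
    then show False using ind by (auto simp: alg_independent_on_def)
  qed
  have Cn: "C n \<noteq> (\<lambda>_. 0)"
  proof
    assume "C n = (\<lambda>_. 0)"
    then have "rel (n - 1) C" using C n0 unfolding rel_def
      by (cases n) (auto simp: le_Suc_eq)
    then show False using min[of "n - 1" C] n0 by simp
  qed
  define q where "q x = (\<Sum>k\<le>n. of_nat k * C k (\<lambda>i. g i x) * y x ^ (k - 1))" for x
  have CP: "(\<lambda>x. C k (\<lambda>i. g i x)) \<in> poly_funs" for k
    using ga_vars_poly[of "C k" r g] CA g by blast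
  have "q \<in> poly_funs" unfolding q_def by (intro pf_sum pf_mult pf_const CP pf_power y)
  moreover have "\<exists>x. q x \<noteq> 0"
  proof (rule ccontr)
    assume "\<nexists>x. q x \<noteq> 0"
    moreover have "q x = (\<Sum>k\<le>n - 1. (of_nat (Suc k) * C (Suc k) (\<lambda>i. g i x)) * y x ^ k)" for x
      unfolding q_def using n0 by (cases n) (simp_all add: sum.atMost_Suc_shift del: sum.atMost_Suc)
    moreover have "(\<lambda>v. of_nat (Suc k) * C (Suc k) v) \<in> ?A" for k
      by (intro generated_algebra.mult generated_algebra.const CA)
    moreover have "(\<lambda>v. of_nat (Suc (n - 1)) * C (Suc (n - 1)) v) \<noteq> (\<lambda>_. 0)"
      using Cn n0 by (auto simp: fun_eq_iff)
    ultimately have "rel (n - 1) (\<lambda>k v. of_nat (Suc k) * C (Suc k) v)"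
      unfolding rel_def by (intro conjI allI exI[of _ "n - 1"]) (simp_all del: of_nat_Suc)
    then show False using min[of "n - 1"] n0 by simp
  qed
  moreover have "dirderiv v y x = 0" if q: "q x \<noteq> 0" and 0: "\<forall>i<r. dirderiv v (g i) x = 0" for x v
  proof -
    have C0: "dirderiv v (\<lambda>x. C k (\<lambda>i. g i x)) x = 0" for k
      using ga_gradient[of "C k" r g v x] CA g 0 by blast
    have "0 = dirderiv v (\<lambda>x. \<Sum>k\<le>n. C k (\<lambda>i. g i x) * y x ^ k) x"
      using C by (simp add: rel_def)
    also have "\<dots> = (\<Sum>k\<le>n. dirderiv v (\<lambda>x. C k (\<lambda>i. g i x) * y x ^ k) x)"
      by (intro dirderiv_sum pf_mult CP pf_power y)
    also have "\<dots> = (\<Sum>k\<le>n. of_nat k * C k (\<lambda>i. g i x) * y x ^ (k - 1) * dirderiv v y x)"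
      by (intro sum.cong refl)
        (subst dirderiv_mult[OF CP pf_power[OF y]], simp add: C0 dirderiv_power[OF y] mult_ac)
    also have "\<dots> = q x * dirderiv v y x" by (simp add: q_def sum_distrib_right)
    finally show ?thesis using q by simp
  qed
  ultimately show ?thesis by blast
qed

text \<open>
  Algebraically independent polynomials have linearly independent differentials at some point, which can be chosen
  off the zero set of any given \<open>h\<close>. The \<open>p i\<close> are extended to a maximal independent family \<open>g\<close>; it has \<open>r\<close> members,
  and \<open>r\<close> is at most the number of coordinates. Every coordinate function is algebraic over \<open>g\<close>, so that at a generic
  point a vector killed by all differentials of \<open>g\<close> is \<open>0\<close>. This forces these differentials to be independent: if
  one of them could be dropped, fewer equations than coordinates would have a nonzero solution.
\<close>

theorem jacobian_criterion:
  fixes p :: "nat \<Rightarrow> complex ^ 'p \<Rightarrow> complex"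
  assumes p: "\<And>i. i < d \<Longrightarrow> p i \<in> poly_funs" and ind: "alg_independent_on UNIV d p"
    and h: "h \<in> poly_funs" "h x0 \<noteq> 0"
  shows "\<exists>x. h x \<noteq> 0 \<and> (\<forall>c. (\<exists>i<d. c i \<noteq> 0) \<longrightarrow> (\<exists>v. (\<Sum>i<d. c i * dirderiv v (p i) x) \<noteq> 0))"
proof -
  define ext where "ext r g \<longleftrightarrow> d \<le> r \<and> (\<forall>i<d. g i = p i) \<and> (\<forall>i<r. g i \<in> poly_funs) \<and>
    alg_independent_on UNIV r g" for r and g :: "nat \<Rightarrow> complex ^ 'p \<Rightarrow> complex"
  have "ext d p" using assms by (simp add: ext_def)
  then have ex: "\<exists>r. \<exists>g. ext r g" by blast
  have bd: "r \<le> CARD('p)" if "\<exists>g. ext r g" for r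
    using that alg_independent_bound by (auto simp: ext_def)
  obtain r g where rg: "ext r g" and max: "\<And>r' g'. ext r' g' \<Longrightarrow> r' \<le> r"
    using GreatestI_ex_nat[OF ex bd] Greatest_le_nat[of "\<lambda>r. \<exists>g. ext r g", OF _ bd] by blast
  have rm: "r \<le> CARD('p)" using bd rg by blast
  have g: "\<And>i. i < r \<Longrightarrow> g i \<in> poly_funs" using rg by (simp add: ext_def)
  have "\<exists>q\<in>poly_funs. (\<exists>x. q x \<noteq> 0) \<and>
    (\<forall>x v. q x \<noteq> 0 \<longrightarrow> (\<forall>i<r. dirderiv v (g i) x = 0) \<longrightarrow> v $ j = 0)" for j :: 'p
  proof -
    have "\<not> ext (Suc r) (g(r := \<lambda>x. x $ j))" using max by force
    then have "\<not> alg_independent_on UNIV (Suc r) (g(r := \<lambda>x. x $ j))"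
      using rg by (auto simp: ext_def less_Suc_eq)
    from algebraic_gradient[OF g _ _ this] rg show ?thesis by (auto simp: ext_def)
  qed
  then obtain q where q: "\<And>j. q j \<in> poly_funs" "\<And>j. \<exists>x. q j x \<noteq> 0"
    "\<And>j x v. q j x \<noteq> 0 \<Longrightarrow> (\<forall>i<r. dirderiv v (g i) x = 0) \<Longrightarrow> v $ j = 0" by metis
  have "\<exists>x. \<forall>f\<in>insert h (range q). f x \<noteq> 0"
    by (rule pf_finite_nonzero) (use q h in auto)
  then obtain x where x: "h x \<noteq> 0" "\<And>j. q j x \<noteq> 0" by auto
  have "\<exists>v. (\<Sum>i<d. c i * dirderiv v (p i) x) \<noteq> 0" if c: "i0 < d" "c i0 \<noteq> 0" for c i0
  proof (rule ccontr)
    assume "\<nexists>v. (\<Sum>i<d. c i * dirderiv v (p i) x) \<noteq> 0"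
    then have 0: "(\<Sum>i<d. c i * dirderiv v (p i) x) = 0" for v by blast
    have i0: "i0 < r" using c rg by (auto simp: ext_def)
    then have "card ({..<r} - {i0}) < card (UNIV :: 'p set)" using rm by simp
    from underdetermined[OF _ _ this, of "\<lambda>j i. dirderiv (axis j 1) (g i) x"]
    obtain w where w: "\<exists>j. w j \<noteq> 0"
      "\<forall>i\<in>{..<r} - {i0}. (\<Sum>j\<in>UNIV. w j * dirderiv (axis j 1) (g i) x) = 0" by auto
    define v where "v = (\<chi> j. w j)"
    have v0: "dirderiv v (g i) x = 0" if "i < r" "i \<noteq> i0" for i
      using w(2) that dirderiv_axis_sum[OF g, of i v x] by (simp add: v_def)
    have gp: "p i = g i \<and> i < r" if "i < d" for i using rg that by (simp add: ext_def)
    have "(\<Sum>i<d. c i * dirderiv v (p i) x) = (\<Sum>i\<in>{i0}. c i * dirderiv v (p i) x)"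
    proof (rule sum.mono_neutral_right)
      show "\<forall>i\<in>{..<d} - {i0}. c i * dirderiv v (p i) x = 0"
        using v0 gp by auto
    qed (use c in auto)
    then have "dirderiv v (p i0) x = 0" using 0[of v] c by simp
    then have "\<forall>i<r. dirderiv v (g i) x = 0" using v0 gp c by metis
    then have "v $ j = 0" for j using q(3) x by blast
    then show False using w(1) by (simp add: v_def)
  qed
  then show ?thesis using x by blast
qed

section \<open>The group action and Zariski closures\<close>

lemma exhaust_6: "x = 1 \<or> x = 2 \<or> x = 3 \<or> x = 4 \<or> x = 5 \<or> x = (6 :: 6)"
proof (induct x)
  case (of_int z)
  then have "0 \<le> z" and "z < 6" by simp_all
  then have "z = 0 \<or> z = 1 \<or> z = 2 \<or> z = 3 \<or> z = 4 \<or> z = 5" by arith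
  then show ?case by auto
qed

lemma UNIV_6: "UNIV = {1, 2, 3, 4, 5, 6 :: 6}"
  using exhaust_6 by auto

lemma forall_6: "(\<forall>i::6. P i) \<longleftrightarrow> P 1 \<and> P 2 \<and> P 3 \<and> P 4 \<and> P 5 \<and> P 6"
  by (metis exhaust_6)

lemma sum_6: "sum f (UNIV :: 6 set) = f 1 + f 2 + f 3 + f 4 + f 5 + f 6"
  unfolding UNIV_6 by (simp add: ac_simps)

lemma sum_triple:
  fixes f :: "'a::finite \<Rightarrow> 'b::finite \<Rightarrow> 'c::finite \<Rightarrow> 'd::comm_monoid_add"
  shows "(\<Sum>q\<in>UNIV. f (fst q) (fst (snd q)) (snd (snd q))) = (\<Sum>k\<in>UNIV. \<Sum>i\<in>UNIV. \<Sum>j\<in>UNIV. f k i j)"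
proof -
  have "(\<Sum>k\<in>UNIV. \<Sum>i\<in>UNIV. \<Sum>j\<in>UNIV. f k i j) = (\<Sum>k\<in>UNIV. \<Sum>(i, j)\<in>UNIV \<times> UNIV. f k i j)"
    by (simp add: sum.cartesian_product)
  also have "\<dots> = (\<Sum>(k, i, j)\<in>UNIV \<times> UNIV \<times> UNIV. f k i j)"
    by (subst sum.cartesian_product) (simp add: case_prod_beta)
  finally show ?thesis by (simp add: case_prod_beta)
qed

lemma sum_product3:
  fixes a :: "'a \<Rightarrow> 'd::comm_semiring_0"
  shows "sum a A * sum b B * sum c C = (\<Sum>k\<in>A. \<Sum>i\<in>B. \<Sum>j\<in>C. a k * b i * c j)"
proof -
  have "sum a A * sum b B * sum c C = (\<Sum>k\<in>A. (\<Sum>i\<in>B. a k * b i) * sum c C)"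
    unfolding sum_product[of a A b B] by (rule sum_distrib_right)
  then show ?thesis by (simp only: sum_product)
qed

lemma act_nth:
  "act (A, B, c) t $ p = c * (\<Sum>q\<in>UNIV. A $ fst p $ fst q * B $ fst (snd p) $ fst (snd q) *
     B $ snd (snd p) $ snd (snd q) * t $ q)"
  using sum_triple[of "\<lambda>k' i' j'. A $ fst p $ k' * B $ fst (snd p) $ i' * B $ snd (snd p) $ j' * t $ (k', i', j')"]
  by (simp add: case_prod_beta)

lemma act_add: "act g (x + y) = act g x + act g y"
proof (cases g)
  case (fields A B c)
  show ?thesis unfolding fields
    by (simp only: vec_eq_iff act_nth vector_add_component) (simp add: distrib_left sum.distrib)
qed

lemma act_scale: "act g (a *s x) = a *s act g x"
proof (cases g)
  case (fields A B c)
  show ?thesis unfolding fields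
    by (simp only: vec_eq_iff act_nth vector_smult_component) (simp add: sum_distrib_left mult_ac)
qed

lemma act_zero: "act g 0 = 0"
  using act_scale[of g 0 0] by simp

text \<open>
  Scaling is absorbed by the matrix that acts on \<open>E\<close>.
\<close>

lemma act_absorb: "act (A, B, c) t = act (\<chi> k. c *s A $ k, B, 1) t"
  by (simp only: vec_eq_iff act_nth) (simp add: sum_distrib_left mult_ac)

lemma act_id: "act (mat 1, mat 1, 1) t = t"
proof -
  have "(\<Sum>q\<in>UNIV. mat 1 $ fst p $ fst q * mat 1 $ fst (snd p) $ fst (snd q) *
     mat 1 $ snd (snd p) $ snd (snd q) * t $ q) = (\<Sum>q\<in>UNIV. if q = p then t $ q else 0)" for p
    by (rule sum.cong) (auto simp: mat_def prod_eq_iff)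
  then show ?thesis by (simp only: vec_eq_iff act_nth) simp
qed

lemma act_act: "act (A, B, 1) (act (A', B', 1) t) = act (A ** A', B ** B', 1) t"
proof -
  let ?M = "\<lambda>A B p q. A $ fst p $ fst q * B $ fst (snd p) $ fst (snd q) * B $ snd (snd p) $ snd (snd q)"
  have M: "(\<Sum>q\<in>UNIV. ?M A B p q * ?M A' B' q r) = ?M (A ** A') (B ** B') p r" for p r
  proof -
    have "(\<Sum>q\<in>UNIV. ?M A B p q * ?M A' B' q r) = (\<Sum>k\<in>UNIV. \<Sum>i\<in>UNIV. \<Sum>j\<in>UNIV.
        (A $ fst p $ k * A' $ k $ fst r) * (B $ fst (snd p) $ i * B' $ i $ fst (snd r)) *
        (B $ snd (snd p) $ j * B' $ j $ snd (snd r)))"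
      by (subst sum_triple[symmetric]) (simp add: mult_ac)
    then show ?thesis
      by (simp only: matrix_matrix_mult_def vec_lambda_beta sum_product3)
  qed
  have "act (A, B, 1) (act (A', B', 1) t) $ p = act (A ** A', B ** B', 1) t $ p" for p
  proof -
    have "act (A, B, 1) (act (A', B', 1) t) $ p = (\<Sum>q\<in>UNIV. \<Sum>r\<in>UNIV. ?M A B p q * ?M A' B' q r * t $ r)"
      by (simp only: act_nth mult_1 sum_distrib_left mult.assoc)
    also have "\<dots> = (\<Sum>r\<in>UNIV. (\<Sum>q\<in>UNIV. ?M A B p q * ?M A' B' q r) * t $ r)"
      by (subst sum.swap) (simp only: sum_distrib_right)
    finally show ?thesis unfolding M by (simp only: act_nth mult_1)
  qed
  then show ?thesis by (simp only: vec_eq_iff) blast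
qed

lemma complex_root_exists:
  assumes "n > 0" shows "\<exists>z::complex. z ^ n = w"
proof (cases "w = 0")
  case False
  have "exp (Ln w / of_nat n) ^ n = exp (of_nat n * (Ln w / of_nat n))" by (rule exp_of_nat_mult[symmetric])
  also have "\<dots> = w" using assms False by simp
  finally show ?thesis ..
qed (use assms in auto)

lemma det_scaled: "det (\<chi> i. c *s A $ i) = c ^ CARD('n) * det A" for A :: "complex ^ 'n ^ 'n"
  using det_rows_mul[of "\<lambda>_. c" "\<lambda>i. A $ i"] by (simp add: vec_lambda_eta)

lemma det_normalize:
  fixes A :: "complex ^ 'n ^ 'n"
  assumes "det A \<noteq> 0"
  shows "\<exists>a A'. a \<noteq> 0 \<and> det A' = 1 \<and> A = (\<chi> i. a *s A' $ i)"
proof -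
  obtain a where a: "a ^ CARD('n) = det A" using complex_root_exists[of "CARD('n)"] by auto
  then have "a \<noteq> 0" using assms by (auto simp: power_0_left)
  define A' where "A' = (\<chi> i. inverse a *s A $ i)"
  have "det A' = 1" using assms a \<open>a \<noteq> 0\<close> by (simp add: A'_def det_scaled power_inverse)
  moreover have "A = (\<chi> i. a *s A' $ i)" using \<open>a \<noteq> 0\<close> by (simp add: A'_def vec_eq_iff)
  ultimately show ?thesis using \<open>a \<noteq> 0\<close> by blast
qed

text \<open>
  The group \<open>SL(E) \<times> SL(F) \<times> \<complex>\<^sup>*\<close> has the orbits of \<open>GL(E) \<times> GL(F)\<close>: roots of the determinants are moved into
  the scalar. From here on arbitrary frames can be used without normalising determinants.
\<close>

lemma orbit_gl: "orbit t = {act (A, B, 1) t | A B. det A \<noteq> 0 \<and> det B \<noteq> 0}"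
proof (intro equalityI subsetI)
  fix y assume "y \<in> orbit t"
  then obtain A B c where g: "det A = 1" "det B = 1" "c \<noteq> 0" "y = act (A, B, c) t"
    by (auto simp: orbit_def G0_def)
  have "det (\<chi> k. c *s A $ k) \<noteq> 0" using g by (simp add: det_scaled)
  moreover have "y = act (\<chi> k. c *s A $ k, B, 1) t" using g(4) act_absorb by metis
  ultimately show "y \<in> {act (A, B, 1) t | A B. det A \<noteq> 0 \<and> det B \<noteq> 0}" using g(2) by force
next
  fix y assume "y \<in> {act (A, B, 1) t | A B. det A \<noteq> 0 \<and> det B \<noteq> 0}"
  then obtain A B where AB: "det A \<noteq> 0" "det B \<noteq> 0" "y = act (A, B, 1) t" by blast
  obtain a A' b B' where A: "a \<noteq> 0" "det A' = 1" "A = (\<chi> i. a *s A' $ i)"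
    and B: "b \<noteq> 0" "det B' = 1" "B = (\<chi> i. b *s B' $ i)" using det_normalize AB by metis
  have "y = act (A', B', a * b * b) t"
    unfolding AB(3) A(3) B(3) by (simp only: vec_eq_iff act_nth) (simp add: sum_distrib_left mult_ac)
  moreover have "(A', B', a * b * b) \<in> G0" using A B by (simp add: G0_def)
  ultimately show "y \<in> orbit t" unfolding orbit_def by blast
qed

lemma act_in_orbit: "det A \<noteq> 0 \<Longrightarrow> det B \<noteq> 0 \<Longrightarrow> act (A, B, 1) t \<in> orbit t"
  unfolding orbit_gl by blast

lemma orbit_refl: "t \<in> orbit t"
  using act_in_orbit[of "mat 1" "mat 1" t] by (simp only: act_id) simp

lemma orbit_trans: "x \<in> orbit y \<Longrightarrow> y \<in> orbit z \<Longrightarrow> x \<in> orbit z"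
proof -
  assume "x \<in> orbit y" "y \<in> orbit z"
  then obtain A B A' B' where "det A \<noteq> 0" "det B \<noteq> 0" "x = act (A, B, 1) y"
    "det A' \<noteq> 0" "det B' \<noteq> 0" "y = act (A', B', 1) z" unfolding orbit_gl by blast
  then have "x = act (A ** A', B ** B', 1) z" "det (A ** A') \<noteq> 0" "det (B ** B') \<noteq> 0"
    by (simp_all only: act_act det_mul) auto
  then show ?thesis using act_in_orbit by blast
qed

lemma orbit_sym:
  assumes "x \<in> orbit y" shows "y \<in> orbit x"
proof -
  obtain A B where g: "det A \<noteq> 0" "det B \<noteq> 0" "x = act (A, B, 1) y" using assms unfolding orbit_gl by blast
  obtain A' B' where A': "A' ** A = mat 1" and B': "B' ** B = mat 1"
    using g(1,2) unfolding invertible_det_nz[symmetric] invertible_def by blast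
  have "act (A', B', 1) x = y" unfolding g(3) act_act A' B' act_id ..
  moreover have "det A' * det A = 1" "det B' * det B = 1" using A' B' by (metis det_mul det_I)+
  ultimately show ?thesis using act_in_orbit[of A' B' x] by force
qed

lemma orbit_eq: "x \<in> orbit y \<Longrightarrow> orbit x = orbit y"
  using orbit_trans orbit_sym by blast

lemma zariski_closure_eq: "zariski_closure S = {x. \<forall>p\<in>poly_funs. (\<forall>y\<in>S. p y = 0) \<longrightarrow> p x = 0}"
proof
  have "zariski_closed {x. \<forall>p\<in>poly_funs. (\<forall>y\<in>S. p y = 0) \<longrightarrow> p x = 0}"
    unfolding zariski_closed_def
    by (rule exI[of _ "{p \<in> poly_funs. \<forall>y\<in>S. p y = 0}"]) auto
  then show "zariski_closure S \<subseteq> {x. \<forall>p\<in>poly_funs. (\<forall>y\<in>S. p y = 0) \<longrightarrow> p x = 0}"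
    unfolding zariski_closure_def by (intro hull_minimal) auto
  show "{x. \<forall>p\<in>poly_funs. (\<forall>y\<in>S. p y = 0) \<longrightarrow> p x = 0} \<subseteq> zariski_closure S"
    unfolding zariski_closure_def hull_def
  proof (intro subsetI InterI)
    fix x T
    assume x: "x \<in> {x. \<forall>p\<in>poly_funs. (\<forall>y\<in>S. p y = 0) \<longrightarrow> p x = 0}"
      and "T \<in> {T. zariski_closed T \<and> S \<subseteq> T}"
    then obtain Q where Q: "Q \<subseteq> poly_funs" "T = {x. \<forall>p\<in>Q. p x = 0}" "S \<subseteq> T"
      by (auto simp: zariski_closed_def)
    have "p x = 0" if "p \<in> Q" for p
    proof -
      have "\<forall>y\<in>S. p y = 0" using Q(2,3) that by blast
      then show ?thesis using x Q(1) that by blast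
    qed
    then show "x \<in> T" using Q(2) by blast
  qed
qed

lemma closure_subset: "S \<subseteq> zariski_closure S"
  by (auto simp: zariski_closure_eq)

lemma closure_mono_closed: "S \<subseteq> zariski_closure T \<Longrightarrow> zariski_closure S \<subseteq> zariski_closure T"
  unfolding zariski_closure_eq subset_iff mem_Collect_eq by blast

lemma pf_act: "(\<lambda>x. act g x $ p) \<in> poly_funs"
proof (cases g)
  case (fields A B c)
  show ?thesis unfolding fields act_nth by (intro pf_mult pf_const pf_sum pf_coord)
qed

lemma orbit_closure_invariant:
  assumes "x \<in> zariski_closure (orbit t)"
  shows "orbit x \<subseteq> zariski_closure (orbit t)"
proof
  fix y assume "y \<in> orbit x"
  then obtain A B where g: "det A \<noteq> 0" "det B \<noteq> 0" "y = act (A, B, 1) x" unfolding orbit_gl by blast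
  have "p y = 0" if p: "p \<in> poly_funs" "\<forall>z\<in>orbit t. p z = 0" for p
  proof -
    have "(\<lambda>z. p (act (A, B, 1) z)) \<in> poly_funs" by (rule pf_compose[OF p(1) pf_act])
    moreover have "p (act (A, B, 1) z) = 0" if "z \<in> orbit t" for z
      using p(2) orbit_trans[OF act_in_orbit[OF g(1,2)] that] by blast
    ultimately have "p (act (A, B, 1) x) = 0"
      using assms unfolding zariski_closure_eq mem_Collect_eq by (elim ballE[of _ _ "\<lambda>z. p (act (A, B, 1) z)"]) simp_all
    then show ?thesis using g(3) by simp
  qed
  then show "y \<in> zariski_closure (orbit t)" unfolding zariski_closure_eq by simp
qed

text \<open>
  The closure of an orbit is invariant, because every group element acts by a polynomial map.
\<close>

lemma closure_orbit_subset_iff: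
  "zariski_closure (orbit x) \<subseteq> zariski_closure (orbit y) \<longleftrightarrow> x \<in> zariski_closure (orbit y)"
proof
  assume "zariski_closure (orbit x) \<subseteq> zariski_closure (orbit y)"
  then show "x \<in> zariski_closure (orbit y)" using closure_subset[of "orbit x"] orbit_refl[of x] by auto
qed (intro closure_mono_closed orbit_closure_invariant)

lemma alg_independent_closure:
  assumes "alg_independent_on S d g" "\<And>i. i < d \<Longrightarrow> g i \<in> poly_funs" "S \<subseteq> zariski_closure T"
  shows "alg_independent_on T d g"
  unfolding alg_independent_on_def
proof (intro ballI impI)
  fix P assume P: "P \<in> generated_algebra (vars d)" "\<forall>x\<in>T. P (\<lambda>i. g i x) = 0"
  have "(\<lambda>x. P (\<lambda>i. g i x)) \<in> poly_funs" by (rule ga_vars_poly[of P d g, OF P(1) assms(2)])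
  moreover have "x \<in> zariski_closure T" if "x \<in> S" for x using assms(3) that by blast
  ultimately have "\<forall>x\<in>S. P (\<lambda>i. g i x) = 0"
    unfolding zariski_closure_eq mem_Collect_eq using P(2) by (auto dest: bspec[of _ _ "\<lambda>x. P (\<lambda>i. g i x)"])
  then show "P = (\<lambda>_. 0)" using assms(1)[unfolded alg_independent_on_def, rule_format, OF P(1)] by simp
qed

text \<open>
  A polynomial relation on \<open>T\<close> holds on the closure of \<open>T\<close>, hence on \<open>S\<close>.
\<close>

lemma alg_dim_mono:
  assumes "zariski_closure S \<subseteq> zariski_closure T" shows "alg_dim S \<le> alg_dim T"
proof -
  have "S \<subseteq> zariski_closure T" using assms closure_subset by blast
  then have "alg_independent_on T d g" if "\<forall>i<d. g i \<in> poly_funs" "alg_independent_on S d g" for d g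
    using alg_independent_closure[of S d g T] that by simp
  then show ?thesis unfolding alg_dim_def by (intro SUP_subset_mono) auto
qed

section \<open>The dimension of an orbit\<close>

type_synonym params = "complex ^ ((2 \<times> 2) + (6 \<times> 6))"

definition matE :: "params \<Rightarrow> complex ^ 2 ^ 2"
  where "matE x = (\<chi> k k'. x $ Inl (k, k'))"

definition matF :: "params \<Rightarrow> complex ^ 6 ^ 6"
  where "matF x = (\<chi> i i'. x $ Inr (i, i'))"

definition params :: "complex ^ 2 ^ 2 \<Rightarrow> complex ^ 6 ^ 6 \<Rightarrow> params"
  where "params A B = (\<chi> p. case p of Inl q \<Rightarrow> A $ fst q $ snd q | Inr q \<Rightarrow> B $ fst q $ snd q)"

lemma matE_params [simp]: "matE (params A B) = A"
  by (simp add: matE_def params_def vec_eq_iff)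

lemma matF_params [simp]: "matF (params A B) = B"
  by (simp add: matF_def params_def vec_eq_iff)

lemma params_mat [simp]: "params (matE x) (matF x) = x"
  by (simp add: matE_def matF_def params_def vec_eq_iff split: sum.split)

text \<open>
  Up to a nonvanishing condition, the orbit is the image of a polynomial map on an affine space of matrix entries.
\<close>

definition orbit_map :: "tensors \<Rightarrow> params \<Rightarrow> tensors"
  where "orbit_map t x = act (matE x, matF x, 1) t"

text \<open>
  The differential of the action at the identity.
\<close>

definition tang :: "complex ^ 2 ^ 2 \<Rightarrow> complex ^ 6 ^ 6 \<Rightarrow> tensors \<Rightarrow> tensors"
  where "tang X Y t = vec_lambda (\<lambda>(k, i, j). (\<Sum>k'\<in>UNIV. X $ k $ k' * t $ (k', i, j)) +
    (\<Sum>i'\<in>UNIV. Y $ i $ i' * t $ (k, i', j)) + (\<Sum>j'\<in>UNIV. Y $ j $ j' * t $ (k, i, j')))"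

definition tangent :: "tensors \<Rightarrow> tensors set"
  where "tangent t = {tang X Y t | X Y. True}"

lemma subspace_tangent: "vec.subspace (tangent t)"
proof (rule vec.subspaceI)
  have "tang 0 0 t = 0" by (simp add: tang_def vec_eq_iff case_prod_beta)
  then show "0 \<in> tangent t" unfolding tangent_def by force
next
  fix x y assume "x \<in> tangent t" "y \<in> tangent t"
  then obtain X Y X' Y' where "x = tang X Y t" "y = tang X' Y' t" unfolding tangent_def by blast
  then have "x + y = tang (X + X') (Y + Y') t"
    by (simp add: tang_def vec_eq_iff case_prod_beta distrib_right sum.distrib)
  then show "x + y \<in> tangent t" unfolding tangent_def by blast
next
  fix c x assume "x \<in> tangent t"
  then obtain X Y where "x = tang X Y t" unfolding tangent_def by blast
  then have "c *s x = tang (\<chi> i. c *s X $ i) (\<chi> i. c *s Y $ i) t"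
    by (simp add: tang_def vec_eq_iff case_prod_beta distrib_left sum_distrib_left mult.assoc)
  then show "c *s x \<in> tangent t" unfolding tangent_def by blast
qed

lemma pf_orbit_map: "(\<lambda>x. orbit_map t x $ p) \<in> poly_funs"
  unfolding orbit_map_def act_nth matE_def matF_def vec_lambda_beta
  by (intro pf_mult pf_const pf_sum pf_coord)

lemma pf_det: "(\<And>i j. (\<lambda>x. M x $ i $ j) \<in> poly_funs) \<Longrightarrow> (\<lambda>x. det (M x)) \<in> poly_funs"
  unfolding det_def by (intro pf_sum pf_mult pf_const pf_prod)

lemma orbit_map_derivative_1:
  "dirderiv v (\<lambda>x. orbit_map t x $ p) (params (mat 1) (mat 1)) = tang (matE v) (matF v) t $ p"
proof -
  obtain k i j where p: "p = (k, i, j)" by (cases p)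
  define one where "one = params (mat 1) (mat 1)"
  let ?a = "\<lambda>q x. x $ Inl (k, fst q)" and ?b = "\<lambda>q x. x $ Inr (i, fst (snd q))"
    and ?c = "\<lambda>q x. x $ Inr (j, snd (snd q)) :: complex"
  have one: "one $ Inl (a, a') = (if a = a' then 1 else 0)" "one $ Inr (b, b') = (if b = b' then 1 else 0)" for a a' b b'
    by (simp_all add: one_def params_def mat_def)
  have pf: "(\<lambda>x. x $ a) \<in> poly_funs" "(\<lambda>x. x $ a * x $ b) \<in> poly_funs" "(\<lambda>x. x $ a * x $ b * x $ c) \<in> poly_funs"
    for a b c :: "(2 \<times> 2) + (6 \<times> 6)" by (intro pf_mult pf_coord)+
  have "orbit_map t x $ p = (\<Sum>q\<in>UNIV. (?a q x * ?b q x * ?c q x) * t $ q)" for x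
    by (simp add: orbit_map_def act_nth matE_def matF_def p del: act.simps)
  then have "dirderiv v (\<lambda>x. orbit_map t x $ p) one
      = dirderiv v (\<lambda>x. \<Sum>q\<in>UNIV. (?a q x * ?b q x * ?c q x) * t $ q) one" by simp
  also have "\<dots> = (\<Sum>q\<in>UNIV. dirderiv v (\<lambda>x. (?a q x * ?b q x * ?c q x) * t $ q) one)"
    by (rule dirderiv_sum) (intro pf_mult pf pf_const)
  also have "\<dots> = (\<Sum>q\<in>UNIV. (v $ Inl (k, fst q) * one $ Inr (i, fst (snd q)) * one $ Inr (j, snd (snd q))
      + one $ Inl (k, fst q) * v $ Inr (i, fst (snd q)) * one $ Inr (j, snd (snd q))
      + one $ Inl (k, fst q) * one $ Inr (i, fst (snd q)) * v $ Inr (j, snd (snd q))) * t $ q)"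
    by (intro sum.cong refl)
      (simp only: dirderiv_mult[OF pf(3) pf_const] dirderiv_mult[OF pf(2) pf(1)]
        dirderiv_mult[OF pf(1) pf(1)] dirderiv_const dirderiv_coord, simp add: algebra_simps)
  also have "\<dots> = (\<Sum>k'\<in>UNIV. \<Sum>i'\<in>UNIV. \<Sum>j'\<in>UNIV. (v $ Inl (k, k') * one $ Inr (i, i') * one $ Inr (j, j')
      + one $ Inl (k, k') * v $ Inr (i, i') * one $ Inr (j, j')
      + one $ Inl (k, k') * one $ Inr (i, i') * v $ Inr (j, j')) * t $ (k', i', j'))"
    by (subst sum_triple[symmetric]) simp
  also have "\<dots> = tang (matE v) (matF v) t $ p"
  proof -
    have d: "(\<Sum>y\<in>UNIV. (if x = y then 1 else 0) * f y) = f x" "(\<Sum>y\<in>UNIV. f y * (if x = y then 1 else 0)) = f x"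
      for f :: "'z::finite \<Rightarrow> complex" and x
      by (simp_all add: if_distrib[of "\<lambda>a. a * _"] if_distrib[of "\<lambda>a. _ * a"] cong: if_cong)
    have "(\<Sum>k'\<in>UNIV. \<Sum>i'\<in>UNIV. \<Sum>j'\<in>UNIV. v $ Inl (k, k') * one $ Inr (i, i') * one $ Inr (j, j') * t $ (k', i', j'))
      = (\<Sum>k'\<in>UNIV. v $ Inl (k, k') * (\<Sum>i'\<in>UNIV. one $ Inr (i, i') * (\<Sum>j'\<in>UNIV. one $ Inr (j, j') * t $ (k', i', j'))))"
      by (simp only: sum_distrib_left mult.assoc)
    also have "\<dots> = (\<Sum>k'\<in>UNIV. v $ Inl (k, k') * t $ (k', i, j))"
      by (simp only: one d)
    finally have 1: "(\<Sum>k'\<in>UNIV. \<Sum>i'\<in>UNIV. \<Sum>j'\<in>UNIV. v $ Inl (k, k') * one $ Inr (i, i') * one $ Inr (j, j') * t $ (k', i', j'))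
      = (\<Sum>k'\<in>UNIV. v $ Inl (k, k') * t $ (k', i, j))" .
    have "(\<Sum>k'\<in>UNIV. \<Sum>i'\<in>UNIV. \<Sum>j'\<in>UNIV. one $ Inl (k, k') * v $ Inr (i, i') * one $ Inr (j, j') * t $ (k', i', j'))
      = (\<Sum>k'\<in>UNIV. one $ Inl (k, k') * (\<Sum>i'\<in>UNIV. v $ Inr (i, i') * (\<Sum>j'\<in>UNIV. one $ Inr (j, j') * t $ (k', i', j'))))"
      by (simp only: sum_distrib_left mult.assoc)
    also have "\<dots> = (\<Sum>i'\<in>UNIV. v $ Inr (i, i') * t $ (k, i', j))"
      by (simp only: one d)
    finally have 2: "(\<Sum>k'\<in>UNIV. \<Sum>i'\<in>UNIV. \<Sum>j'\<in>UNIV. one $ Inl (k, k') * v $ Inr (i, i') * one $ Inr (j, j') * t $ (k', i', j'))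
      = (\<Sum>i'\<in>UNIV. v $ Inr (i, i') * t $ (k, i', j))" .
    have "(\<Sum>k'\<in>UNIV. \<Sum>i'\<in>UNIV. \<Sum>j'\<in>UNIV. one $ Inl (k, k') * one $ Inr (i, i') * v $ Inr (j, j') * t $ (k', i', j'))
      = (\<Sum>k'\<in>UNIV. one $ Inl (k, k') * (\<Sum>i'\<in>UNIV. one $ Inr (i, i') * (\<Sum>j'\<in>UNIV. v $ Inr (j, j') * t $ (k', i', j'))))"
      by (simp only: sum_distrib_left mult.assoc)
    also have "\<dots> = (\<Sum>j'\<in>UNIV. v $ Inr (j, j') * t $ (k, i, j'))"
      by (simp only: one d)
    finally have 3: "(\<Sum>k'\<in>UNIV. \<Sum>i'\<in>UNIV. \<Sum>j'\<in>UNIV. one $ Inl (k, k') * one $ Inr (i, i') * v $ Inr (j, j') * t $ (k', i', j'))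
      = (\<Sum>j'\<in>UNIV. v $ Inr (j, j') * t $ (k, i, j'))" .
    show ?thesis
      by (simp only: distrib_right sum.distrib 1 2 3) (simp add: tang_def p matE_def matF_def)
  qed
  finally show ?thesis unfolding one_def .
qed

text \<open>
  By equivariance, derivatives of the orbit map at any group element are derivatives in the direction of the tangent
  space at \<open>t\<close> itself.
\<close>

lemma orbit_map_derivative:
  assumes "f \<in> poly_funs"
  shows "dirderiv (params (A ** X) (B ** Y)) (\<lambda>x. f (orbit_map t x)) (params A B)
    = dirderiv (tang X Y t) (\<lambda>z. f (act (A, B, 1) z)) t"
proof -
  define F where "F = (\<lambda>z. f (act (A, B, 1) z))"
  have F: "F \<in> poly_funs" unfolding F_def by (rule pf_compose[OF assms pf_act])
  let ?one = "params (mat 1) (mat 1)"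
  have m: "(A ** (\<chi> k k'. M $ k $ k' + s * N $ k $ k')) = (\<chi> k k'. (A ** M) $ k $ k' + s * (A ** N) $ k $ k')"
    for A M N :: "complex ^ 'm ^ 'm" and s
    by (simp add: matrix_matrix_mult_def vec_eq_iff distrib_left sum.distrib sum_distrib_left mult_ac)
  have "orbit_map t (params A B + s *s params (A ** X) (B ** Y))
      = act (A, B, 1) (orbit_map t (?one + s *s params X Y))" for s
  proof -
    have "matE (params M N + s *s params M' N') = (\<chi> k k'. M $ k $ k' + s * M' $ k $ k')"
      "matF (params M N + s *s params M' N') = (\<chi> k k'. N $ k $ k' + s * N' $ k $ k')" for M N M' N'
      by (simp_all add: matE_def matF_def params_def vec_eq_iff)
    then show ?thesis by (simp add: orbit_map_def act_act m del: act.simps)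
  qed
  then have "dirderiv (params (A ** X) (B ** Y)) (\<lambda>x. f (orbit_map t x)) (params A B)
    = dirderiv (params X Y) (\<lambda>x. F (orbit_map t x)) ?one"
    by (simp add: dirderiv_def F_def del: act.simps)
  also have "\<dots> = dirderiv (\<chi> i. dirderiv (params X Y) (\<lambda>x. orbit_map t x $ i) ?one) F (orbit_map t ?one)"
    by (rule dirderiv_compose[OF F pf_orbit_map])
  also have "orbit_map t ?one = t" by (simp add: orbit_map_def act_id del: act.simps)
  also have "(\<chi> i. dirderiv (params X Y) (\<lambda>x. orbit_map t x $ i) ?one) = tang X Y t"
    by (simp add: orbit_map_derivative_1 vec_eq_iff)
  finally show ?thesis unfolding F_def .
qed

lemma dirderiv_linear_comb:
  assumes "f \<in> poly_funs" "finite J"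
  shows "dirderiv (\<Sum>j\<in>J. c j *s w j) f x = (\<Sum>j\<in>J. c j * dirderiv (w j) f x)"
proof -
  have "dirderiv (\<Sum>j\<in>J. c j *s w j) f x = (\<Sum>i\<in>UNIV. \<Sum>j\<in>J. c j * (w j $ i * dirderiv (axis i 1) f x))"
    by (subst dirderiv_axis_sum[OF assms(1)]) (simp add: sum_component sum_distrib_right mult.assoc)
  also have "\<dots> = (\<Sum>j\<in>J. c j * (\<Sum>i\<in>UNIV. w j $ i * dirderiv (axis i 1) f x))"
    by (subst sum.swap) (simp only: sum_distrib_left)
  also have "\<dots> = (\<Sum>j\<in>J. c j * dirderiv (w j) f x)"
    by (intro sum.cong refl arg_cong2[where f = "(*)"]) (rule dirderiv_axis_sum[OF assms(1), symmetric])
  finally show ?thesis .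
qed

lemma orbit_eq_map: "orbit t = {orbit_map t x | x. det (matE x) \<noteq> 0 \<and> det (matF x) \<noteq> 0}"
proof (intro equalityI subsetI)
  fix y assume "y \<in> orbit t"
  then obtain A B where "det A \<noteq> 0" "det B \<noteq> 0" "y = act (A, B, 1) t" unfolding orbit_gl by blast
  then have "y = orbit_map t (params A B) \<and> det (matE (params A B)) \<noteq> 0 \<and> det (matF (params A B)) \<noteq> 0"
    by (simp add: orbit_map_def)
  then show "y \<in> {orbit_map t x | x. det (matE x) \<noteq> 0 \<and> det (matF x) \<noteq> 0}" by blast
next
  fix y assume "y \<in> {orbit_map t x | x. det (matE x) \<noteq> 0 \<and> det (matF x) \<noteq> 0}"
  then show "y \<in> orbit t" unfolding orbit_map_def using act_in_orbit by blast
qed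

text \<open>
  Independent functions on the orbit pull back to independent polynomials on the space of matrices. By the Jacobian
  criterion their differentials are independent at some invertible pair of matrices, and there they factor through the
  tangent space, which is spanned by the vectors \<open>w j\<close>.
\<close>

lemma alg_dim_upper:
  assumes J: "finite J" and tan: "\<And>y. y \<in> tangent t \<Longrightarrow> y = (\<Sum>j\<in>J. y $ j *s w j)"
    and g: "\<And>i. i < d \<Longrightarrow> g i \<in> poly_funs" and ind: "alg_independent_on (orbit t) d g"
  shows "d \<le> card J"
proof (rule ccontr)
  assume "\<not> d \<le> card J"
  then have cd: "card J < card {..<d}" by simp
  define p where "p i x = g i (orbit_map t x)" for i x
  have p: "p i \<in> poly_funs" if "i < d" for i
    unfolding p_def by (rule pf_compose[OF g[OF that] pf_orbit_map])
  have indp: "alg_independent_on UNIV d p"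
    unfolding alg_independent_on_def
  proof (intro ballI impI)
    fix P assume P: "P \<in> generated_algebra (vars d)" "\<forall>x\<in>UNIV. P (\<lambda>i. p i x) = 0"
    have "\<forall>y\<in>orbit t. P (\<lambda>i. g i y) = 0"
      using P(2) unfolding orbit_eq_map p_def by auto
    then show "P = (\<lambda>_. 0)" using ind[unfolded alg_independent_on_def, rule_format, OF P(1)] by simp
  qed
  have h: "(\<lambda>x. det (matE x) * det (matF x)) \<in> poly_funs"
    unfolding matE_def matF_def
    by (intro pf_mult pf_det) (simp_all only: vec_lambda_beta pf_coord)
  have "det (matE (params (mat 1) (mat 1))) * det (matF (params (mat 1) (mat 1))) \<noteq> 0" by simp
  from jacobian_criterion[OF p indp h this] obtain x where x: "det (matE x) * det (matF x) \<noteq> 0"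
    "\<And>c. (\<exists>i<d. c i \<noteq> 0) \<Longrightarrow> \<exists>v. (\<Sum>i<d. c i * dirderiv v (p i) x) \<noteq> 0" by blast
  define A B where "A = matE x" and "B = matF x"
  have xAB: "x = params A B" by (simp add: A_def B_def)
  obtain A' B' where A': "A ** A' = mat 1" and B': "B ** B' = mat 1"
    using x(1) unfolding A_def B_def
    by (metis invertible_det_nz invertible_def mult_eq_0_iff)
  have F: "(\<lambda>z. g i (act (A, B, 1) z)) \<in> poly_funs" if "i < d" for i
    by (rule pf_compose[OF g[OF that] pf_act])
  obtain c where c: "\<exists>i\<in>{..<d}. c i \<noteq> 0"
    "\<forall>j\<in>J. (\<Sum>i<d. c i * dirderiv (w j) (\<lambda>z. g i (act (A, B, 1) z)) t) = 0"
    using underdetermined[OF J finite_lessThan cd, of "\<lambda>i j. dirderiv (w j) (\<lambda>z. g i (act (A, B, 1) z)) t"]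
    by blast
  obtain v where v: "(\<Sum>i<d. c i * dirderiv v (p i) x) \<noteq> 0" using x(2)[of c] c(1) by auto
  define y where "y = tang (A' ** matE v) (B' ** matF v) t"
  have vv: "v = params (A ** (A' ** matE v)) (B ** (B' ** matF v))"
    by (simp add: matrix_mul_assoc A' B')
  have "dirderiv v (p i) x = dirderiv y (\<lambda>z. g i (act (A, B, 1) z)) t" if "i < d" for i
    unfolding y_def xAB p_def
    by (subst vv) (rule orbit_map_derivative[OF g[OF that]])
  moreover have "dirderiv y (\<lambda>z. g i (act (A, B, 1) z)) t
      = (\<Sum>j\<in>J. y $ j * dirderiv (w j) (\<lambda>z. g i (act (A, B, 1) z)) t)" if "i < d" for i
  proof -
    have "y \<in> tangent t" unfolding tangent_def y_def by blast
    from tan[OF this] have "dirderiv y (\<lambda>z. g i (act (A, B, 1) z)) t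
      = dirderiv (\<Sum>j\<in>J. y $ j *s w j) (\<lambda>z. g i (act (A, B, 1) z)) t" by simp
    then show ?thesis using dirderiv_linear_comb[OF F[OF that] J] by simp
  qed
  ultimately have "(\<Sum>i<d. c i * dirderiv v (p i) x)
      = (\<Sum>i<d. c i * (\<Sum>j\<in>J. y $ j * dirderiv (w j) (\<lambda>z. g i (act (A, B, 1) z)) t))"
    by (intro sum.cong refl) simp
  also have "\<dots> = (\<Sum>j\<in>J. y $ j * (\<Sum>i<d. c i * dirderiv (w j) (\<lambda>z. g i (act (A, B, 1) z)) t))"
    unfolding sum_distrib_left by (subst sum.swap) (simp add: mult_ac)
  also have "\<dots> = 0" using c(2) by simp
  finally show False using v by simp
qed

text \<open>
  Estimate an entry of \<open>u\<close> of maximal norm. This replaces the inverse function theorem in the next lemma.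
\<close>

lemma near_identity_injective:
  fixes N :: "'j \<Rightarrow> 'j \<Rightarrow> complex"
  assumes J: "finite J" and N: "\<And>j l. j \<in> J \<Longrightarrow> l \<in> J \<Longrightarrow> norm (N j l - (if j = l then 1 else 0)) < 1 / (card J + 1)"
    and 0: "\<And>j. j \<in> J \<Longrightarrow> (\<Sum>l\<in>J. N j l * u l) = 0" and l: "l \<in> J"
  shows "u l = 0"
proof -
  define m where "m = Max ((\<lambda>j. norm (u j)) ` J)"
  have le: "norm (u j) \<le> m" if "j \<in> J" for j using that J by (simp add: m_def)
  have "m \<in> (\<lambda>j. norm (u j)) ` J" unfolding m_def using J l by (intro Max_in) auto
  then obtain j where j: "j \<in> J" "norm (u j) = m" by auto
  have "(\<Sum>l\<in>J. ((if j = l then 1 else 0) - N j l) * u l) = u j"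
    using J j 0[OF j(1)] by (simp add: left_diff_distrib sum_subtractf if_distrib[of "\<lambda>a. a * _"] cong: if_cong)
  then have "m \<le> (\<Sum>l\<in>J. norm (((if j = l then 1 else 0) - N j l) * u l))"
    using j(2) norm_sum[of "\<lambda>l. ((if j = l then 1 else 0) - N j l) * u l" J] by simp
  also have "\<dots> \<le> (\<Sum>l\<in>J. 1 / (card J + 1) * m)"
  proof (rule sum_mono)
    fix l assume "l \<in> J"
    then show "norm (((if j = l then 1 else 0) - N j l) * u l) \<le> 1 / (card J + 1) * m"
      unfolding norm_mult using N[OF j(1), of l] le[of l]
      by (intro mult_mono) (auto simp: norm_minus_commute)
  qed
  also have "\<dots> = card J / (card J + 1) * m" by simp
  finally have "m * (card J + 1) \<le> card J * m" by (simp add: field_simps)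
  then have "m \<le> 0" by (simp add: algebra_simps)
  then have "norm (u l) \<le> 0" using le[OF l] by linarith
  then show ?thesis by simp
qed

text \<open>
  The coordinates in \<open>J\<close> satisfy no relation on the orbit if the tangent space projects onto them. Near the identity
  the tangent vectors \<open>X j, Y j\<close> project to almost the standard basis, so that all partial derivatives of \<open>f\<close> vanish on
  the image of an open set. Pulled back to the space of matrices they vanish identically, and they have smaller degree
  than \<open>f\<close>; by induction \<open>f\<close> is constant.
\<close>

lemma vanishing_on_orbit:
  fixes t :: tensors and J :: "(2 \<times> 6 \<times> 6) set"
  assumes V: "\<And>j l. j \<in> J \<Longrightarrow> l \<in> J \<Longrightarrow> tang (X j) (Y j) t $ l = (if j = l then 1 else 0)"
    and "deg_le k f" and "\<And>x y. (\<forall>j\<in>J. x $ j = y $ j) \<Longrightarrow> f x = f y"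
    and "\<And>x. f (orbit_map t x) = 0"
  shows "f y = 0"
  using assms(2-)
proof (induction k arbitrary: f y rule: less_induct)
  case (less k)
  note f = deg_le_poly[OF less.prems(1)]
  let ?one = "params (mat 1) (mat 1)"
  define N where "N j l x = dirderiv (params (X j) (Y j)) (\<lambda>x. orbit_map t x $ l) x" for j l x
  have pN: "N j l \<in> poly_funs" for j l
    unfolding N_def by (rule pf_dirderiv[OF pf_orbit_map])
  have outside: "dirderiv (axis l 1) f x = 0" if "l \<notin> J" for l x
  proof (rule dirderivI)
    have "f (x + s *s axis l 1) = f x" for s
      by (rule less.prems(2)) (use that in \<open>auto simp: axis_def\<close>)
    then show "((\<lambda>s. f (x + s *s axis l 1)) has_field_derivative 0) (at 0)" by simp
  qed
  define U where "U = (\<Inter>j\<in>J. \<Inter>l\<in>J. {x. norm (N j l x - (if j = l then 1 else 0)) < 1 / (card J + 1)})"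
  have fin: "finite J" by (rule finite)
  have "open {x. norm (N j l x - (if j = l then 1 else 0)) < 1 / (card J + 1)}" for j l
    by (intro open_Collect_less continuous_intros pf_continuous pN)
  then have "open U" unfolding U_def using fin by (intro open_INT ballI)
  moreover have "?one \<in> U"
    unfolding U_def N_def by (auto simp: orbit_map_derivative_1 V)
  moreover have in_U: "dirderiv (axis l 1) f (orbit_map t x) = 0" if "x \<in> U" "l \<in> J" for x l
  proof (rule near_identity_injective[OF fin, of "\<lambda>j l. N j l x" "\<lambda>l. dirderiv (axis l 1) f (orbit_map t x)"])
    fix j assume "j \<in> J"
    have "0 = dirderiv (params (X j) (Y j)) (\<lambda>x. f (orbit_map t x)) x" using less.prems(3) by simp
    also have "\<dots> = dirderiv (\<chi> i. N j i x) f (orbit_map t x)"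
      unfolding N_def by (rule dirderiv_compose[OF f pf_orbit_map])
    also have "\<dots> = (\<Sum>l\<in>UNIV. N j l x * dirderiv (axis l 1) f (orbit_map t x))"
      by (subst dirderiv_axis_sum[OF f]) simp
    also have "\<dots> = (\<Sum>l\<in>J. N j l x * dirderiv (axis l 1) f (orbit_map t x))"
      by (rule sum.mono_neutral_right) (auto simp: outside)
    finally show "(\<Sum>l\<in>J. N j l x * dirderiv (axis l 1) f (orbit_map t x)) = 0" by simp
  qed (use that in \<open>auto simp: U_def\<close>)
  have inside: "dirderiv (axis l 1) f z = 0" if l: "l \<in> J" for l z
  proof (cases "k = 0")
    case True
    then show ?thesis using deg_le_dirderiv[OF less.prems(1)] by simp
  next
    case False
    show ?thesis
    proof (rule less.IH[of "k - 1" "dirderiv (axis l 1) f"])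
      show "k - 1 < k" using False by simp
      show "deg_le (k - 1) (dirderiv (axis l 1) f)" using deg_le_dirderiv[OF less.prems(1)] by blast
      fix x y :: tensors assume xy: "\<forall>j\<in>J. x $ j = y $ j"
      then have "f (x + s *s axis l 1) = f (y + s *s axis l 1)" for s
        by (intro less.prems(2)) auto
      then show "dirderiv (axis l 1) f x = dirderiv (axis l 1) f y" by (simp add: dirderiv_def)
    next
      fix x
      have "(\<lambda>x. dirderiv (axis l 1) f (orbit_map t x)) \<in> poly_funs"
        by (rule pf_compose[OF pf_dirderiv[OF f] pf_orbit_map])
      then show "dirderiv (axis l 1) f (orbit_map t x) = 0"
        using pf_zero_if_open[OF _ \<open>open U\<close> \<open>?one \<in> U\<close>, of "\<lambda>x. dirderiv (axis l 1) f (orbit_map t x)" x] in_U l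
        by blast
    qed
  qed
  have "f y = f (orbit_map t ?one)"
    by (rule pf_constant[OF f]) (use inside outside in blast)
  then show ?case using less.prems(3) by simp
qed

lemma ga_cong: "P \<in> generated_algebra (vars d) \<Longrightarrow> (\<And>i. i < d \<Longrightarrow> v i = w i) \<Longrightarrow> P v = P w"
  by (induction rule: generated_algebra.induct) auto

lemma alg_dim_lower:
  fixes t :: tensors and J :: "(2 \<times> 6 \<times> 6) set"
  assumes V: "\<And>j l. j \<in> J \<Longrightarrow> l \<in> J \<Longrightarrow> tang (X j) (Y j) t $ l = (if j = l then 1 else 0)"
  shows "\<exists>g. (\<forall>i<card J. g i \<in> poly_funs) \<and> alg_independent_on (orbit t) (card J) g"
proof -
  obtain idx where idx: "bij_betw idx {..<card J} J"
    using ex_bij_betw_nat_finite[of J] by (auto simp: atLeast0LessThan)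
  define g where "g = (\<lambda>i (y :: tensors). y $ idx i)"
  have g: "g i \<in> poly_funs" for i unfolding g_def by (rule pf_coord)
  have "alg_independent_on (orbit t) (card J) g"
    unfolding alg_independent_on_def
  proof (intro ballI impI)
    fix P assume P: "P \<in> generated_algebra (vars (card J))" and 0: "\<forall>x\<in>orbit t. P (\<lambda>i. g i x) = 0"
    define f where "f y = P (\<lambda>i. g i y)" for y
    have f: "f \<in> poly_funs" unfolding f_def by (rule ga_vars_poly[of P "card J" g, OF P g])
    then obtain k where k: "deg_le k f" using poly_deg_le by blast
    have dep: "f x = f y" if "\<forall>j\<in>J. x $ j = y $ j" for x y
      unfolding f_def
    proof (rule ga_cong[OF P])
      fix i assume "i < card J"
      then have "idx i \<in> J" using idx by (auto simp: bij_betw_def)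
      then show "g i x = g i y" using that by (simp add: g_def)
    qed
    have van: "f (orbit_map t x) = 0" for x
    proof (rule ccontr)
      assume "f (orbit_map t x) \<noteq> 0"
      moreover have h: "(\<lambda>x. det (matE x) * det (matF x)) \<in> poly_funs"
        unfolding matE_def matF_def
        by (intro pf_mult pf_det) (simp_all only: vec_lambda_beta pf_coord)
      moreover have "det (matE (params (mat 1) (mat 1))) * det (matF (params (mat 1) (mat 1))) \<noteq> 0" by simp
      moreover have "(\<lambda>x. f (orbit_map t x)) \<in> poly_funs" by (rule pf_compose[OF f pf_orbit_map])
      ultimately obtain z where "f (orbit_map t z) \<noteq> 0" "det (matE z) * det (matF z) \<noteq> 0"
        using pf_mult_nonzero[of "\<lambda>x. f (orbit_map t x)" "\<lambda>x. det (matE x) * det (matF x)" x "params (mat 1) (mat 1)"]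
        by blast
      then have "orbit_map t z \<in> orbit t" unfolding orbit_eq_map by auto
      then show False using 0 \<open>f (orbit_map t z) \<noteq> 0\<close> unfolding f_def by blast
    qed
    have f0: "f y = 0" for y by (rule vanishing_on_orbit[OF V k dep van])
    show "P = (\<lambda>_. 0)"
    proof
      fix v :: "nat \<Rightarrow> complex"
      define y where "y = (\<chi> j. v (inv_into {..<card J} idx j))"
      have "P v = P (\<lambda>i. g i y)"
        by (rule ga_cong[OF P]) (use idx in \<open>simp add: y_def g_def bij_betw_def inv_into_f_f\<close>)
      then show "P v = 0" using f0 by (simp add: f_def)
    qed
  qed
  then show ?thesis using g by blast
qed

text \<open>
  The dimension of an orbit is the dimension of its tangent space, stated through a set \<open>J\<close> of coordinates onto which
  the tangent space projects isomorphically.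
\<close>

theorem alg_dim_orbit:
  fixes t :: tensors and J :: "(2 \<times> 6 \<times> 6) set"
  assumes inj: "\<And>y. y \<in> tangent t \<Longrightarrow> (\<And>j. j \<in> J \<Longrightarrow> y $ j = 0) \<Longrightarrow> y = 0"
    and surj: "\<And>z. \<exists>X Y. \<forall>j\<in>J. tang X Y t $ j = z j"
  shows "alg_dim (orbit t) = enat (card J)"
proof -
  have "\<forall>j. \<exists>X Y. \<forall>l\<in>J. tang X Y t $ l = (if j = l then 1 else 0)"
    by (rule allI) (rule surj)
  then obtain X Y where V: "\<And>j l. l \<in> J \<Longrightarrow> tang (X j) (Y j) t $ l = (if j = l then 1 else 0)" by metis
  define w where "w j = tang (X j) (Y j) t" for j
  have w: "w j \<in> tangent t" for j unfolding w_def tangent_def by blast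
  have fin: "finite J" by (rule finite)
  have "y = (\<Sum>j\<in>J. y $ j *s w j)" if y: "y \<in> tangent t" for y
  proof -
    have "y - (\<Sum>j\<in>J. y $ j *s w j) \<in> tangent t"
      using subspace_tangent y w by (intro vec.subspace_diff vec.subspace_sum vec.subspace_scale)
    moreover have "(y - (\<Sum>j\<in>J. y $ j *s w j)) $ l = 0" if "l \<in> J" for l
      using that fin by (simp add: sum_component w_def V if_distrib cong: if_cong)
    ultimately have "y - (\<Sum>j\<in>J. y $ j *s w j) = 0" using inj by blast
    then show ?thesis by simp
  qed
  then have upper: "d \<le> card J" if "\<forall>i<d. g i \<in> poly_funs" "alg_independent_on (orbit t) d g" for d g
    using alg_dim_upper[OF fin, of t w d g] that by blast
  have "\<exists>g. (\<forall>i<card J. g i \<in> poly_funs) \<and> alg_independent_on (orbit t) (card J) g"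
    using V by (intro alg_dim_lower[of J X Y])
  then show ?thesis unfolding alg_dim_def
    by (intro antisym SUP_least SUP_upper2[of "card J"]) (auto intro: upper)
qed

section \<open>Representatives and their tangent spaces\<close>

abbreviation stdE :: "2 \<Rightarrow> complex ^ 2" where "stdE \<equiv> \<lambda>k. axis k 1"
abbreviation stdF :: "6 \<Rightarrow> complex ^ 6" where "stdF \<equiv> \<lambda>i. axis i 1"

definition generic_rep :: "(2 \<Rightarrow> complex ^ 2) \<Rightarrow> (6 \<Rightarrow> complex ^ 6) \<Rightarrow> tensors"
  where "generic_rep e f = bracket e f 1 1 2 + bracket e f 2 3 4 + bracket e f 1 5 6 + bracket e f 2 5 6"

text \<open>
  In the last position stands the sum of the brackets \<open>[1;12]\<close>, \<open>[2;34]\<close>, \<open>[1;56]\<close>, \<open>[2;56]\<close>, one particular element of the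
  open orbit, in place of a generic element.
\<close>

definition rep :: "(2 \<Rightarrow> complex ^ 2) \<Rightarrow> (6 \<Rightarrow> complex ^ 6) \<Rightarrow> nat \<Rightarrow> tensors"
  where "rep e f i = representatives e f (generic_rep e f) ! i"

abbreviation std_rep :: "nat \<Rightarrow> tensors" where "std_rep \<equiv> rep stdE stdF"

lemma rep_simps:
  "rep e f 0 = 0"
  "rep e f (Suc 0) = bracket e f 1 1 2"
  "rep e f 2 = bracket e f 1 1 2 + bracket e f 1 3 4"
  "rep e f 3 = bracket e f 1 1 2 + bracket e f 2 1 3"
  "rep e f 4 = bracket e f 1 1 2 + bracket e f 1 3 4 + bracket e f 1 5 6"
  "rep e f 5 = bracket e f 1 1 2 + bracket e f 1 3 4 + bracket e f 2 1 3"
  "rep e f 6 = bracket e f 1 1 2 + bracket e f 2 3 4"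
  "rep e f 7 = bracket e f 1 1 2 + bracket e f 2 3 4 + bracket e f 1 3 5"
  "rep e f 8 = bracket e f 1 1 2 + bracket e f 2 3 4 + bracket e f 1 3 5 + bracket e f 2 1 5"
  "rep e f 9 = bracket e f 1 1 2 + bracket e f 2 3 4 + bracket e f 1 3 5 + bracket e f 1 4 6"
  "rep e f 10 = bracket e f 1 1 2 + bracket e f 2 3 4 + bracket e f 1 4 5 + bracket e f 2 1 6"
  "rep e f 11 = bracket e f 1 1 2 + bracket e f 2 3 4 + bracket e f 1 4 5 + bracket e f 2 1 6 + bracket e f 1 3 6"
  "rep e f 12 = bracket e f 1 1 2 + bracket e f 2 3 4 + bracket e f 1 5 6"
  "rep e f 13 = bracket e f 1 1 2 + bracket e f 2 3 4 + bracket e f 1 5 6 + bracket e f 2 1 5"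
  "rep e f 14 = bracket e f 1 1 2 + bracket e f 2 3 4 + bracket e f 1 5 6 + bracket e f 2 5 6"
  by (simp_all add: rep_def representatives_def generic_rep_def Let_def)

lemma eq_6:
  "((1::6) = 2) = False" "((1::6) = 3) = False" "((1::6) = 4) = False" "((1::6) = 5) = False" "((1::6) = 6) = False"
  "((2::6) = 1) = False" "((2::6) = 3) = False" "((2::6) = 4) = False" "((2::6) = 5) = False" "((2::6) = 6) = False"
  "((3::6) = 1) = False" "((3::6) = 2) = False" "((3::6) = 4) = False" "((3::6) = 5) = False" "((3::6) = 6) = False"
  "((4::6) = 1) = False" "((4::6) = 2) = False" "((4::6) = 3) = False" "((4::6) = 5) = False" "((4::6) = 6) = False"
  "((5::6) = 1) = False" "((5::6) = 2) = False" "((5::6) = 3) = False" "((5::6) = 4) = False" "((5::6) = 6) = False"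
  "((6::6) = 1) = False" "((6::6) = 2) = False" "((6::6) = 3) = False" "((6::6) = 4) = False" "((6::6) = 5) = False"
  by simp_all

lemma eq_2: "((1::2) = 2) = False" "((2::2) = 1) = False"
  by simp_all

text \<open>
  One coordinate from each pair of opposite ones; they determine a skew-symmetric tensor.
\<close>

definition coords :: "(2 \<times> 6 \<times> 6) list"
  where "coords = [(1, 1, 2), (1, 1, 3), (1, 1, 4), (1, 1, 5), (1, 1, 6), (1, 2, 3), (1, 2, 4), (1, 2, 5),
    (1, 2, 6), (1, 3, 4), (1, 3, 5), (1, 3, 6), (1, 4, 5), (1, 4, 6), (1, 5, 6),
    (2, 1, 2), (2, 1, 3), (2, 1, 4), (2, 1, 5), (2, 1, 6), (2, 2, 3), (2, 2, 4), (2, 2, 5),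
    (2, 2, 6), (2, 3, 4), (2, 3, 5), (2, 3, 6), (2, 4, 5), (2, 4, 6), (2, 5, 6)]"

lemma skewD: "t \<in> E_Wedge2_F \<Longrightarrow> t $ (k, j, i) = - t $ (k, i, j)"
  unfolding E_Wedge2_F_def mem_Collect_eq by blast

lemma skew_zero: "t \<in> E_Wedge2_F \<Longrightarrow> t $ (k, i, i) = 0"
  using skewD[of t k i i] by (simp add: eq_neg_iff_add_eq_0)

lemma coords_cases: "(k, i, j) \<in> set coords \<or> i = j \<or> (k, j, i) \<in> set coords"
proof -
  have "\<forall>k. \<forall>i. \<forall>j. (k, i, j) \<in> set coords \<or> i = j \<or> (k, j, i) \<in> set coords"
    unfolding forall_2 forall_6 by (simp add: coords_def eq_6 eq_2)
  then show ?thesis by blast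
qed

lemma skew_eqI:
  assumes "s \<in> E_Wedge2_F" "t \<in> E_Wedge2_F" "\<forall>p\<in>set coords. s $ p = t $ p"
  shows "s = t"
proof -
  have "s $ (k, i, j) = t $ (k, i, j)" for k i j
    using coords_cases[of k i j]
  proof (elim disjE)
    assume "(k, j, i) \<in> set coords"
    then have "- s $ (k, j, i) = - t $ (k, j, i)" using assms(3) by simp
    then show ?thesis unfolding skewD[OF assms(1), of k i j] skewD[OF assms(2), of k i j] by simp
  qed (use assms skew_zero in auto)
  then show ?thesis by (simp add: vec_eq_iff)
qed

lemma bracket_nth:
  "bracket e f k i j $ (l, p, q) = e k $ l * (f i $ p * f j $ q - f i $ q * f j $ p)"
  by (simp add: bracket_def tensor_def wedge_def)

lemma skew_bracket: "bracket e f k i j \<in> E_Wedge2_F"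
  unfolding E_Wedge2_F_def mem_Collect_eq by (simp add: bracket_nth algebra_simps)

lemma skew_add: "s \<in> E_Wedge2_F \<Longrightarrow> t \<in> E_Wedge2_F \<Longrightarrow> s + t \<in> E_Wedge2_F"
  unfolding E_Wedge2_F_eq_span by (rule vec.span_add)

lemma skew_scale: "t \<in> E_Wedge2_F \<Longrightarrow> c *s t \<in> E_Wedge2_F"
  unfolding E_Wedge2_F_eq_span by (rule vec.span_scale)

lemma skew_0: "0 \<in> E_Wedge2_F"
  unfolding E_Wedge2_F_eq_span by (rule vec.span_zero)

lemma nat_le_14_cases:
  assumes "i \<le> (14 :: nat)"
  shows "i = 0 \<or> i = 1 \<or> i = 2 \<or> i = 3 \<or> i = 4 \<or> i = 5 \<or> i = 6 \<or> i = 7 \<or> i = 8 \<or> i = 9 \<or> i = 10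
    \<or> i = 11 \<or> i = 12 \<or> i = 13 \<or> i = 14"
  using assms by arith

lemma skew_rep: "i \<le> 14 \<Longrightarrow> rep e f i \<in> E_Wedge2_F"
  by (drule nat_le_14_cases, elim disjE) (simp_all add: rep_simps skew_add skew_bracket skew_0)

lemma skew_tang:
  assumes "t \<in> E_Wedge2_F" shows "tang X Y t \<in> E_Wedge2_F"
  unfolding E_Wedge2_F_def mem_Collect_eq
proof (intro allI)
  fix k i j
  have neg: "(\<Sum>x\<in>UNIV. f x * g x) = - (\<Sum>x\<in>UNIV. f x * h x)" if "\<And>x. g x = - h x"
    for f g h :: "'z::finite \<Rightarrow> complex"
    unfolding that mult_minus_right sum_negf ..
  have 1: "(\<Sum>k'\<in>UNIV. X $ k $ k' * t $ (k', j, i)) = - (\<Sum>k'\<in>UNIV. X $ k $ k' * t $ (k', i, j))"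
    by (rule neg) (rule skewD[OF assms])
  have 2: "(\<Sum>i'\<in>UNIV. Y $ b $ i' * t $ (k, i', a)) = - (\<Sum>j'\<in>UNIV. Y $ b $ j' * t $ (k, a, j'))" for a b
    by (rule neg) (rule skewD[OF assms])
  show "tang X Y t $ (k, j, i) = - tang X Y t $ (k, i, j)"
    unfolding tang_def vec_lambda_beta prod.case using 1 2[of j i] 2[of i j] by simp
qed

lemma tang_add: "tang X Y (s + t) = tang X Y s + tang X Y t"
  by (simp add: tang_def vec_eq_iff case_prod_beta distrib_left sum.distrib)

lemma tang_bracket:
  "tang X Y (bracket stdE stdF k i j) $ (l, p, q) =
    (if p = i \<and> q = j then X $ l $ k else 0) - (if q = i \<and> p = j then X $ l $ k else 0) +
    (if l = k then (if q = j then Y $ p $ i else 0) - (if q = i then Y $ p $ j else 0) +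
      (if p = i then Y $ q $ j else 0) - (if p = j then Y $ q $ i else 0) else 0)"
proof -
  have d: "(\<Sum>y\<in>UNIV. f y * axis x 1 $ y) = f x" for f :: "'z::finite \<Rightarrow> complex" and x
    by (simp add: axis_def if_distrib[of "\<lambda>a. _ * a"] cong: if_cong)
  have "(\<Sum>k'\<in>UNIV. X $ l $ k' * bracket stdE stdF k i j $ (k', p, q)) =
      (\<Sum>k'\<in>UNIV. X $ l $ k' * axis k 1 $ k') * (stdF i $ p * stdF j $ q - stdF i $ q * stdF j $ p)"
    by (simp only: bracket_nth sum_distrib_right mult.assoc)
  moreover have "(\<Sum>i'\<in>UNIV. Y $ p $ i' * bracket stdE stdF k i j $ (l, i', q)) =
      stdE k $ l * ((\<Sum>i'\<in>UNIV. Y $ p $ i' * stdF i $ i') * stdF j $ q - (\<Sum>i'\<in>UNIV. Y $ p $ i' * stdF j $ i') * stdF i $ q)"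
    unfolding bracket_nth sum_distrib_right sum_subtractf[symmetric] sum_distrib_left
    by (intro sum.cong refl) (simp add: algebra_simps)
  moreover have "(\<Sum>j'\<in>UNIV. Y $ q $ j' * bracket stdE stdF k i j $ (l, p, j')) =
      stdE k $ l * ((\<Sum>i'\<in>UNIV. Y $ q $ i' * stdF j $ i') * stdF i $ p - (\<Sum>i'\<in>UNIV. Y $ q $ i' * stdF i $ i') * stdF j $ p)"
    unfolding bracket_nth sum_distrib_right sum_subtractf[symmetric] sum_distrib_left
    by (intro sum.cong refl) (simp add: algebra_simps)
  ultimately have "tang X Y (bracket stdE stdF k i j) $ (l, p, q) =
     X $ l $ k * (stdF i $ p * stdF j $ q - stdF i $ q * stdF j $ p) +
     stdE k $ l * (Y $ p $ i * stdF j $ q - Y $ p $ j * stdF i $ q) +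
     stdE k $ l * (Y $ q $ j * stdF i $ p - Y $ q $ i * stdF j $ p)"
    unfolding d by (simp only: tang_def vec_lambda_beta prod.case)
  moreover have "a * ((if b then 1 else 0) * (if c then 1 else 0) - (if b' then 1 else 0) * (if c' then 1 else 0))
      = (if b \<and> c then a else 0) - (if b' \<and> c' then a else 0)" for a :: complex and b c b' c'
    by simp
  ultimately show ?thesis by (simp add: axis_def)
qed

text \<open>
  Matrices given by their nonzero entries, for explicit calculations.
\<close>

definition entries :: "(('m::finite \<times> 'm) \<times> complex) list \<Rightarrow> complex ^ 'm ^ 'm"
  where "entries xs = (\<chi> i j. case map_of xs (i, j) of None \<Rightarrow> 0 | Some c \<Rightarrow> c)"

lemma entries_nth: "entries [] $ i $ j = 0"
  "entries (((a, b), c) # xs) $ i $ j = (if i = a \<and> j = b then c else entries xs $ i $ j)"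
  by (simp_all add: entries_def)

lemma tang_add_nth: "tang X Y (s + t) $ p = tang X Y s $ p + tang X Y t $ p"
  by (simp add: tang_add)

lemma list_all_zip_Cons: "list_all P (zip (x # xs) (b # bs)) = (P (x, b) \<and> list_all P (zip xs bs))"
  by simp

lemmas eval_simps = eq_6 eq_2 if_True if_False simp_thms HOL.refl diff_0 add_0 add_0_right diff_zero
  diff_self minus_zero mult_zero_left mult_zero_right

lemmas list_all_simps = list_all_zip_Cons list.pred_inject zip_Nil prod.case simp_thms

lemmas tang_simps = tang_add_nth tang_bracket eval_simps

text \<open>
  The mask selects the set \<open>J\<close> of coordinates of the general statement by \<open>False\<close>: on the tangent space, the
  coordinates marked \<open>True\<close> depend linearly on the others.
\<close>

lemma alg_dim_orbit_coords:
  assumes t: "t \<in> E_Wedge2_F" and len: "length dep_mask = 30"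
    and dep: "\<And>X Y. list_all (\<lambda>(p, b). b \<or> tang X Y t $ p = 0) (zip coords dep_mask) \<Longrightarrow>
      list_all (\<lambda>(p, b). b \<longrightarrow> tang X Y t $ p = 0) (zip coords dep_mask)"
    and surj: "\<And>z. \<exists>X Y. list_all (\<lambda>(p, b). b \<or> tang X Y t $ p = z p) (zip coords dep_mask)"
  shows "alg_dim (orbit t) = enat (length (filter Not dep_mask))"
proof -
  define free where "free = map fst (filter (\<lambda>x. \<not> snd x) (zip coords dep_mask))"
  have free: "p \<in> set free \<longleftrightarrow> (p, False) \<in> set (zip coords dep_mask)" for p
    unfolding free_def by force
  have coords: "distinct coords" "length coords = 30" by (simp_all add: coords_def)
  have "distinct free"
    unfolding free_def using coords len by (intro distinct_map_filter) simp
  moreover have "length free = length (filter Not dep_mask)"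
  proof -
    have "length free = length (filter Not (map snd (zip coords dep_mask)))"
      unfolding free_def by (simp add: filter_map comp_def)
    then show ?thesis using coords len by simp
  qed
  ultimately have "card (set free) = length (filter Not dep_mask)" by (simp add: distinct_card)
  moreover have "alg_dim (orbit t) = enat (card (set free))"
  proof (rule alg_dim_orbit)
    fix y assume y: "y \<in> tangent t" and 0: "\<And>j. j \<in> set free \<Longrightarrow> y $ j = 0"
    obtain X Y where XY: "y = tang X Y t" using y unfolding tangent_def by blast
    have free0: "list_all (\<lambda>(p, b). b \<or> y $ p = 0) (zip coords dep_mask)"
      unfolding list_all_iff
    proof (intro ballI, unfold split_paired_all prod.case)
      fix k i j b assume "((k, i, j), b) \<in> set (zip coords dep_mask)"
      then show "b \<or> y $ (k, i, j) = 0" using 0[of "(k, i, j)"] free[of "(k, i, j)"] by (cases b) simp_all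
    qed
    have dep0: "list_all (\<lambda>(p, b). b \<longrightarrow> y $ p = 0) (zip coords dep_mask)"
      using free0 unfolding XY by (rule dep)
    have "y $ p = 0 $ p" if "p \<in> set coords" for p
    proof -
      have "map fst (zip coords dep_mask) = coords" using coords len by simp
      then have "p \<in> fst ` set (zip coords dep_mask)" using that by (metis set_map)
      then obtain b where "(p, b) \<in> set (zip coords dep_mask)" by auto
      then show ?thesis using free0 dep0 unfolding list_all_iff by (cases b) auto
    qed
    then show "y = 0" using skew_eqI[OF skew_tang[OF t] skew_0, of X Y] XY by simp
  next
    fix z
    obtain X Y where "list_all (\<lambda>(p, b). b \<or> tang X Y t $ p = z p) (zip coords dep_mask)" using surj by blast
    then have "\<forall>x\<in>set (zip coords dep_mask). snd x \<or> tang X Y t $ fst x = z (fst x)"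
      unfolding list_all_iff case_prod_beta .
    then have "\<forall>j\<in>set free. tang X Y t $ j = z j"
      unfolding free_def by auto
    then show "\<exists>X Y. \<forall>j\<in>set free. tang X Y t $ j = z j" by blast
  qed
  ultimately show ?thesis by simp
qed

section \<open>Dimensions of the orbits\<close>

lemma rep_1: "rep e f 1 = bracket e f 1 1 2"
  using rep_simps(2) by simp

text \<open>
  In this and the following calculations the matrices list a solution \<open>X, Y\<close> of the linear system
  \<open>tang X Y t $ p = z p\<close> for all unmarked coordinates \<open>p\<close>.
\<close>

lemma dim_orbit_1: "alg_dim (orbit (std_rep 1)) = enat 10"
proof -
  let ?mask = "[False, False, False, False, False, False, False, False, False, True, True, True,
      True, True, True, False, True, True, True, True, True, True, True, True, True, True, True,
      True, True, True]"
  have "alg_dim (orbit (std_rep 1)) = enat (length (filter Not ?mask))"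
  proof (rule alg_dim_orbit_coords[OF skew_rep])
    fix z :: "2 \<times> 6 \<times> 6 \<Rightarrow> complex"
    show "\<exists>X Y. list_all (\<lambda>(p, b). b \<or> tang X Y (std_rep 1) $ p = z p) (zip coords ?mask)"
      by (intro exI[of _ "entries [
      ((2, 1), z (2, 1, 2))]"]
        exI[of _ "entries [
      ((2, 2), z (1, 1, 2)), ((3, 1), - z (1, 2, 3)), ((3, 2), z (1, 1, 3)),
      ((4, 1), - z (1, 2, 4)), ((4, 2), z (1, 1, 4)), ((5, 1), - z (1, 2, 5)),
      ((5, 2), z (1, 1, 5)), ((6, 1), - z (1, 2, 6)), ((6, 2), z (1, 1, 6))]"])
        (simp only: coords_def list_all_simps rep_1 rep_simps tang_simps;
          (simp only: entries_nth eval_simps)?; simp?)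
  next
    fix X Y
    assume "list_all (\<lambda>(p, b). b \<or> tang X Y (std_rep 1) $ p = 0) (zip coords ?mask)"
    then show "list_all (\<lambda>(p, b). b \<longrightarrow> tang X Y (std_rep 1) $ p = 0) (zip coords ?mask)"
      by (simp only: coords_def list_all_simps rep_1 rep_simps tang_simps; algebra?)
  qed simp_all
  then show ?thesis by simp
qed

lemma dim_orbit_2: "alg_dim (orbit (std_rep 2)) = enat 15"
proof -
  let ?mask = "[False, False, False, False, False, False, False, False, False, False, False,
      False, False, False, True, False, True, True, True, True, True, True, True, True, True,
      True, True, True, True, True]"
  have "alg_dim (orbit (std_rep 2)) = enat (length (filter Not ?mask))"
  proof (rule alg_dim_orbit_coords[OF skew_rep])
    fix z :: "2 \<times> 6 \<times> 6 \<Rightarrow> complex"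
    show "\<exists>X Y. list_all (\<lambda>(p, b). b \<or> tang X Y (std_rep 2) $ p = z p) (zip coords ?mask)"
      by (intro exI[of _ "entries [
      ((2, 1), z (2, 1, 2))]"]
        exI[of _ "entries [
      ((2, 2), z (1, 1, 2)), ((2, 3), z (1, 2, 4)), ((2, 4), - z (1, 2, 3)),
      ((3, 2), z (1, 1, 3)), ((3, 3), z (1, 3, 4)), ((4, 2), z (1, 1, 4)),
      ((5, 1), - z (1, 2, 5)), ((5, 2), z (1, 1, 5)), ((5, 3), - z (1, 4, 5)),
      ((5, 4), z (1, 3, 5)), ((6, 1), - z (1, 2, 6)), ((6, 2), z (1, 1, 6)),
      ((6, 3), - z (1, 4, 6)), ((6, 4), z (1, 3, 6))]"])
        (simp only: coords_def list_all_simps rep_1 rep_simps tang_simps;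
          (simp only: entries_nth eval_simps)?; simp?)
  next
    fix X Y
    assume "list_all (\<lambda>(p, b). b \<or> tang X Y (std_rep 2) $ p = 0) (zip coords ?mask)"
    then show "list_all (\<lambda>(p, b). b \<longrightarrow> tang X Y (std_rep 2) $ p = 0) (zip coords ?mask)"
      by (simp only: coords_def list_all_simps rep_1 rep_simps tang_simps; algebra?)
  qed simp_all
  then show ?thesis by simp
qed

lemma dim_orbit_3: "alg_dim (orbit (std_rep 3)) = enat 15"
proof -
  let ?mask = "[False, False, False, False, False, False, False, True, True, True, True, True,
      True, True, True, False, False, False, False, False, False, True, True, True, True, False,
      False, True, True, True]"
  have "alg_dim (orbit (std_rep 3)) = enat (length (filter Not ?mask))"
  proof (rule alg_dim_orbit_coords[OF skew_rep])
    fix z :: "2 \<times> 6 \<times> 6 \<Rightarrow> complex"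
    show "\<exists>X Y. list_all (\<lambda>(p, b). b \<or> tang X Y (std_rep 3) $ p = z p) (zip coords ?mask)"
      by (intro exI[of _ "entries [
      ((1, 1), z (1, 1, 2))]"]
        exI[of _ "entries [
      ((2, 1), z (2, 2, 3)), ((2, 3), z (2, 1, 2)), ((3, 1), - z (1, 2, 3)),
      ((3, 2), z (1, 1, 3)), ((3, 3), z (2, 1, 3)), ((4, 1), - z (1, 2, 4)),
      ((4, 2), z (1, 1, 4)), ((4, 3), z (2, 1, 4)), ((5, 1), - z (2, 3, 5)),
      ((5, 2), z (1, 1, 5)), ((5, 3), z (2, 1, 5)), ((6, 1), - z (2, 3, 6)),
      ((6, 2), z (1, 1, 6)), ((6, 3), z (2, 1, 6))]"])
        (simp only: coords_def list_all_simps rep_1 rep_simps tang_simps;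
          (simp only: entries_nth eval_simps)?; simp?)
  next
    fix X Y
    assume "list_all (\<lambda>(p, b). b \<or> tang X Y (std_rep 3) $ p = 0) (zip coords ?mask)"
    then show "list_all (\<lambda>(p, b). b \<longrightarrow> tang X Y (std_rep 3) $ p = 0) (zip coords ?mask)"
      by (simp only: coords_def list_all_simps rep_1 rep_simps tang_simps; algebra?)
  qed simp_all
  then show ?thesis by simp
qed

lemma dim_orbit_4: "alg_dim (orbit (std_rep 4)) = enat 16"
proof -
  let ?mask = "[False, False, False, False, False, False, False, False, False, False, False,
      False, False, False, False, True, True, True, True, True, True, True, True, True, False,
      True, True, True, True, True]"
  have "alg_dim (orbit (std_rep 4)) = enat (length (filter Not ?mask))"
  proof (rule alg_dim_orbit_coords[OF skew_rep])
    fix z :: "2 \<times> 6 \<times> 6 \<Rightarrow> complex"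
    show "\<exists>X Y. list_all (\<lambda>(p, b). b \<or> tang X Y (std_rep 4) $ p = z p) (zip coords ?mask)"
      by (intro exI[of _ "entries [
      ((2, 1), z (2, 3, 4))]"]
        exI[of _ "entries [
      ((1, 3), z (1, 1, 4)), ((1, 5), z (1, 1, 6)), ((2, 2), z (1, 1, 2)),
      ((2, 4), - z (1, 2, 3)), ((2, 5), z (1, 2, 6)), ((3, 2), z (1, 1, 3)),
      ((3, 5), z (1, 3, 6)), ((4, 1), - z (1, 2, 4)), ((4, 4), z (1, 3, 4)),
      ((4, 5), z (1, 4, 6)), ((5, 1), - z (1, 2, 5)), ((5, 2), z (1, 1, 5)),
      ((5, 3), - z (1, 4, 5)), ((5, 4), z (1, 3, 5)), ((5, 5), z (1, 5, 6))]"])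
        (simp only: coords_def list_all_simps rep_1 rep_simps tang_simps;
          (simp only: entries_nth eval_simps)?; simp?)
  next
    fix X Y
    assume "list_all (\<lambda>(p, b). b \<or> tang X Y (std_rep 4) $ p = 0) (zip coords ?mask)"
    then show "list_all (\<lambda>(p, b). b \<longrightarrow> tang X Y (std_rep 4) $ p = 0) (zip coords ?mask)"
      by (simp only: coords_def list_all_simps rep_1 rep_simps tang_simps; algebra?)
  qed simp_all
  then show ?thesis by simp
qed

lemma dim_orbit_5: "alg_dim (orbit (std_rep 5)) = enat 19"
proof -
  let ?mask = "[False, False, False, False, False, False, False, False, True, False, False,
      False, True, False, True, False, False, False, False, True, False, True, True, True, False,
      True, False, True, True, True]"
  have "alg_dim (orbit (std_rep 5)) = enat (length (filter Not ?mask))"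
  proof (rule alg_dim_orbit_coords[OF skew_rep])
    fix z :: "2 \<times> 6 \<times> 6 \<Rightarrow> complex"
    show "\<exists>X Y. list_all (\<lambda>(p, b). b \<or> tang X Y (std_rep 5) $ p = z p) (zip coords ?mask)"
      by (intro exI[of _ "entries [
      ((1, 2), z (1, 1, 3)),
      ((2, 1), - 1/2 * z (1, 2, 4) + 1/2 * z (2, 1, 2) + 1/2 * z (2, 3, 4)), ((2, 2), z (2, 1, 3))]"]
        exI[of _ "entries [
      ((1, 3), z (1, 1, 4)), ((2, 1), z (2, 2, 3)), ((2, 2), z (1, 1, 2)),
      ((2, 3), 1/2 * z (1, 2, 4) + 1/2 * z (2, 1, 2) - 1/2 * z (2, 3, 4)),
      ((2, 4), - z (1, 2, 3)),
      ((4, 1), - 1/2 * z (1, 2, 4) + 1/2 * z (2, 1, 2) - 1/2 * z (2, 3, 4)),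
      ((4, 3), z (2, 1, 4)), ((4, 4), z (1, 3, 4)), ((5, 1), - z (1, 2, 5)),
      ((5, 2), z (1, 1, 5)), ((5, 3), z (2, 1, 5)), ((5, 4), z (1, 3, 5)),
      ((6, 1), - z (2, 3, 6)), ((6, 2), z (1, 1, 6)), ((6, 3), - z (1, 4, 6)),
      ((6, 4), z (1, 3, 6))]"])
        (simp only: coords_def list_all_simps rep_1 rep_simps tang_simps;
          (simp only: entries_nth eval_simps)?; simp?)
  next
    fix X Y
    assume "list_all (\<lambda>(p, b). b \<or> tang X Y (std_rep 5) $ p = 0) (zip coords ?mask)"
    then show "list_all (\<lambda>(p, b). b \<longrightarrow> tang X Y (std_rep 5) $ p = 0) (zip coords ?mask)"
      by (simp only: coords_def list_all_simps rep_1 rep_simps tang_simps; algebra?)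
  qed simp_all
  then show ?thesis by simp
qed

lemma dim_orbit_6: "alg_dim (orbit (std_rep 6)) = enat 20"
proof -
  let ?mask = "[False, False, False, False, False, False, False, False, False, False, True, True,
      True, True, True, False, False, False, True, True, False, False, True, True, False, False,
      False, False, False, True]"
  have "alg_dim (orbit (std_rep 6)) = enat (length (filter Not ?mask))"
  proof (rule alg_dim_orbit_coords[OF skew_rep])
    fix z :: "2 \<times> 6 \<times> 6 \<Rightarrow> complex"
    show "\<exists>X Y. list_all (\<lambda>(p, b). b \<or> tang X Y (std_rep 6) $ p = z p) (zip coords ?mask)"
      by (intro exI[of _ "entries [
      ((1, 1), z (1, 1, 2)), ((1, 2), z (1, 3, 4)), ((2, 1), z (2, 1, 2)), ((2, 2), z (2, 3, 4))]"]
        exI[of _ "entries [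
      ((1, 3), z (2, 1, 4)), ((1, 4), - z (2, 1, 3)), ((2, 3), z (2, 2, 4)),
      ((2, 4), - z (2, 2, 3)), ((3, 1), - z (1, 2, 3)), ((3, 2), z (1, 1, 3)),
      ((4, 1), - z (1, 2, 4)), ((4, 2), z (1, 1, 4)), ((5, 1), - z (1, 2, 5)),
      ((5, 2), z (1, 1, 5)), ((5, 3), - z (2, 4, 5)), ((5, 4), z (2, 3, 5)),
      ((6, 1), - z (1, 2, 6)), ((6, 2), z (1, 1, 6)), ((6, 3), - z (2, 4, 6)),
      ((6, 4), z (2, 3, 6))]"])
        (simp only: coords_def list_all_simps rep_1 rep_simps tang_simps;
          (simp only: entries_nth eval_simps)?; simp?)
  next
    fix X Y
    assume "list_all (\<lambda>(p, b). b \<or> tang X Y (std_rep 6) $ p = 0) (zip coords ?mask)"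
    then show "list_all (\<lambda>(p, b). b \<longrightarrow> tang X Y (std_rep 6) $ p = 0) (zip coords ?mask)"
      by (simp only: coords_def list_all_simps rep_1 rep_simps tang_simps; algebra?)
  qed simp_all
  then show ?thesis by simp
qed

lemma dim_orbit_7: "alg_dim (orbit (std_rep 7)) = enat 23"
proof -
  let ?mask = "[False, False, False, False, False, False, False, False, False, False, False,
      False, False, True, False, False, False, False, True, True, False, False, True, True,
      False, False, False, False, True, True]"
  have "alg_dim (orbit (std_rep 7)) = enat (length (filter Not ?mask))"
  proof (rule alg_dim_orbit_coords[OF skew_rep])
    fix z :: "2 \<times> 6 \<times> 6 \<Rightarrow> complex"
    show "\<exists>X Y. list_all (\<lambda>(p, b). b \<or> tang X Y (std_rep 7) $ p = z p) (zip coords ?mask)"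
      by (intro exI[of _ "entries [
      ((1, 2), z (1, 3, 4)), ((2, 1), z (2, 1, 2)), ((2, 2), z (2, 3, 4))]"]
        exI[of _ "entries [
      ((1, 3), z (2, 1, 4)), ((1, 4), - z (2, 1, 3)), ((2, 2), z (1, 1, 2)),
      ((2, 3), z (2, 2, 4)), ((2, 4), - z (2, 2, 3)), ((3, 1), - z (1, 2, 3)),
      ((3, 2), z (1, 1, 3)), ((4, 1), - z (1, 2, 4)), ((4, 2), z (1, 1, 4)),
      ((4, 3), z (1, 4, 5)), ((5, 1), - z (1, 2, 5) + z (2, 2, 4)),
      ((5, 2), z (1, 1, 5) - z (2, 1, 4)), ((5, 3), - z (2, 4, 5)),
      ((5, 4), - z (2, 1, 2) + z (2, 3, 5)), ((5, 5), z (1, 3, 5)), ((6, 1), - z (1, 2, 6)),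
      ((6, 2), z (1, 1, 6)), ((6, 3), - z (1, 5, 6)), ((6, 4), z (2, 3, 6)), ((6, 5), z (1, 3, 6))]"])
        (simp only: coords_def list_all_simps rep_1 rep_simps tang_simps;
          (simp only: entries_nth eval_simps)?; simp?)
  next
    fix X Y
    assume "list_all (\<lambda>(p, b). b \<or> tang X Y (std_rep 7) $ p = 0) (zip coords ?mask)"
    then show "list_all (\<lambda>(p, b). b \<longrightarrow> tang X Y (std_rep 7) $ p = 0) (zip coords ?mask)"
      by (simp only: coords_def list_all_simps rep_1 rep_simps tang_simps; algebra?)
  qed simp_all
  then show ?thesis by simp
qed

lemma dim_orbit_8: "alg_dim (orbit (std_rep 8)) = enat 25"
proof -
  let ?mask = "[False, False, False, False, False, False, False, False, False, False, False,
      True, False, True, False, False, False, False, False, False, False, False, False, True,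
      False, False, False, False, True, True]"
  have "alg_dim (orbit (std_rep 8)) = enat (length (filter Not ?mask))"
  proof (rule alg_dim_orbit_coords[OF skew_rep])
    fix z :: "2 \<times> 6 \<times> 6 \<Rightarrow> complex"
    show "\<exists>X Y. list_all (\<lambda>(p, b). b \<or> tang X Y (std_rep 8) $ p = z p) (zip coords ?mask)"
      by (intro exI[of _ "entries [
      ((1, 2), z (1, 3, 4)), ((2, 1), z (2, 1, 2))]"]
        exI[of _ "entries [
      ((1, 1), z (2, 1, 5)), ((1, 3), z (2, 1, 4)), ((1, 4), - z (2, 1, 3)),
      ((2, 1), z (2, 2, 5)), ((2, 2), z (1, 1, 2) - z (2, 1, 5)), ((2, 3), z (2, 2, 4)),
      ((2, 4), - z (2, 2, 3)), ((3, 1), - z (1, 2, 3)), ((3, 2), z (1, 1, 3)),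
      ((3, 3), z (1, 3, 5)), ((4, 1), - z (1, 2, 4)), ((4, 2), z (1, 1, 4)),
      ((4, 3), z (1, 4, 5)), ((4, 4), - z (1, 3, 5) + z (2, 3, 4)),
      ((5, 1), - z (1, 2, 5) + z (2, 2, 4)), ((5, 2), z (1, 1, 5) - z (1, 3, 4) - z (2, 1, 4)),
      ((5, 3), - z (1, 2, 4) - z (2, 4, 5)), ((5, 4), z (1, 2, 3) - z (2, 1, 2) + z (2, 3, 5)),
      ((6, 1), - z (1, 2, 6)), ((6, 2), z (1, 1, 6)), ((6, 3), - z (1, 5, 6)),
      ((6, 4), z (2, 3, 6)), ((6, 5), z (2, 1, 6))]"])
        (simp only: coords_def list_all_simps rep_1 rep_simps tang_simps;
          (simp only: entries_nth eval_simps)?; simp?)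
  next
    fix X Y
    assume "list_all (\<lambda>(p, b). b \<or> tang X Y (std_rep 8) $ p = 0) (zip coords ?mask)"
    then show "list_all (\<lambda>(p, b). b \<longrightarrow> tang X Y (std_rep 8) $ p = 0) (zip coords ?mask)"
      by (simp only: coords_def list_all_simps rep_1 rep_simps tang_simps; algebra?)
  qed simp_all
  then show ?thesis by simp
qed

lemma dim_orbit_9: "alg_dim (orbit (std_rep 9)) = enat 24"
proof -
  let ?mask = "[False, False, False, False, False, False, False, False, False, False, False,
      False, False, False, True, False, False, False, True, True, False, False, True, True,
      False, False, False, False, False, True]"
  have "alg_dim (orbit (std_rep 9)) = enat (length (filter Not ?mask))"
  proof (rule alg_dim_orbit_coords[OF skew_rep])
    fix z :: "2 \<times> 6 \<times> 6 \<Rightarrow> complex"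
    show "\<exists>X Y. list_all (\<lambda>(p, b). b \<or> tang X Y (std_rep 9) $ p = z p) (zip coords ?mask)"
      by (intro exI[of _ "entries [
      ((2, 1), z (2, 1, 2)), ((2, 2), z (2, 3, 4))]"]
        exI[of _ "entries [
      ((1, 3), z (2, 1, 4)), ((1, 4), - z (2, 1, 3)), ((1, 5), - z (1, 1, 3)),
      ((2, 2), z (1, 1, 2)), ((2, 3), z (2, 2, 4)), ((2, 4), - z (2, 2, 3)),
      ((2, 6), - z (1, 2, 4)), ((3, 1), - z (1, 2, 3)), ((3, 4), z (1, 3, 6)),
      ((3, 6), - z (1, 3, 4)), ((4, 2), z (1, 1, 4)), ((4, 3), z (1, 4, 5)),
      ((5, 1), - z (1, 2, 5) + z (2, 2, 4)), ((5, 2), z (1, 1, 5) - z (2, 1, 4)),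
      ((5, 3), - z (2, 4, 5)), ((5, 4), - z (2, 1, 2) + z (2, 3, 5)), ((5, 5), z (1, 3, 5)),
      ((6, 1), - z (1, 2, 6) - z (2, 2, 3)), ((6, 2), z (1, 1, 6) + z (2, 1, 3)),
      ((6, 3), z (2, 1, 2) - z (2, 4, 6)), ((6, 4), z (2, 3, 6)), ((6, 6), z (1, 4, 6))]"])
        (simp only: coords_def list_all_simps rep_1 rep_simps tang_simps;
          (simp only: entries_nth eval_simps)?; simp?)
  next
    fix X Y
    assume "list_all (\<lambda>(p, b). b \<or> tang X Y (std_rep 9) $ p = 0) (zip coords ?mask)"
    then show "list_all (\<lambda>(p, b). b \<longrightarrow> tang X Y (std_rep 9) $ p = 0) (zip coords ?mask)"
      by (simp only: coords_def list_all_simps rep_1 rep_simps tang_simps; algebra?)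
  qed simp_all
  then show ?thesis by simp
qed

lemma dim_orbit_10: "alg_dim (orbit (std_rep 10)) = enat 26"
proof -
  let ?mask = "[False, False, False, False, False, False, False, True, False, False, False, True,
      False, False, False, False, False, False, False, False, False, False, True, False, False,
      False, True, False, False, False]"
  have "alg_dim (orbit (std_rep 10)) = enat (length (filter Not ?mask))"
  proof (rule alg_dim_orbit_coords[OF skew_rep])
    fix z :: "2 \<times> 6 \<times> 6 \<Rightarrow> complex"
    show "\<exists>X Y. list_all (\<lambda>(p, b). b \<or> tang X Y (std_rep 10) $ p = z p) (zip coords ?mask)"
      by (intro exI[of _ "entries []"]
        exI[of _ "entries [
      ((1, 3), z (2, 1, 4)), ((1, 5), - z (1, 1, 4)), ((2, 1), z (2, 2, 6)),
      ((2, 2), z (1, 1, 2)), ((2, 3), z (2, 2, 4)), ((2, 4), - z (2, 2, 3)),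
      ((2, 5), - z (1, 2, 4)), ((2, 6), z (2, 1, 2)), ((3, 1), - z (1, 2, 3)),
      ((3, 2), z (1, 1, 3)), ((3, 3), z (2, 3, 4)), ((3, 4), z (1, 3, 5)),
      ((3, 5), - z (1, 3, 4)), ((3, 6), z (2, 1, 3)), ((5, 1), z (2, 5, 6)),
      ((5, 2), z (1, 1, 5)), ((5, 3), - z (2, 4, 5)), ((5, 4), z (2, 3, 5)),
      ((5, 5), z (1, 4, 5)), ((5, 6), z (2, 1, 5)), ((6, 1), - z (1, 2, 6)),
      ((6, 2), z (1, 1, 6)), ((6, 3), - z (2, 4, 6)), ((6, 4), - z (1, 5, 6)),
      ((6, 5), z (1, 4, 6)), ((6, 6), z (2, 1, 6))]"])
        (simp only: coords_def list_all_simps rep_1 rep_simps tang_simps;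
          (simp only: entries_nth eval_simps)?; simp?)
  next
    fix X Y
    assume "list_all (\<lambda>(p, b). b \<or> tang X Y (std_rep 10) $ p = 0) (zip coords ?mask)"
    then show "list_all (\<lambda>(p, b). b \<longrightarrow> tang X Y (std_rep 10) $ p = 0) (zip coords ?mask)"
      by (simp only: coords_def list_all_simps rep_1 rep_simps tang_simps; algebra?)
  qed simp_all
  then show ?thesis by simp
qed

lemma dim_orbit_11: "alg_dim (orbit (std_rep 11)) = enat 28"
proof -
  let ?mask = "[False, False, False, False, False, False, False, True, False, False, False,
      False, False, False, False, False, False, False, False, False, False, False, True, False,
      False, False, False, False, False, False]"
  have "alg_dim (orbit (std_rep 11)) = enat (length (filter Not ?mask))"
  proof (rule alg_dim_orbit_coords[OF skew_rep])
    fix z :: "2 \<times> 6 \<times> 6 \<Rightarrow> complex"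
    show "\<exists>X Y. list_all (\<lambda>(p, b). b \<or> tang X Y (std_rep 11) $ p = z p) (zip coords ?mask)"
      by (intro exI[of _ "entries [
      ((1, 1), z (1, 3, 6)),
      ((2, 1), 1/3 * z (1, 2, 3) + 1/3 * z (1, 5, 6) + 1/3 * z (2, 1, 2) + 1/3 * z (2, 3, 6) + 1/3 * z (2, 4, 5))]"]
        exI[of _ "entries [
      ((1, 1), z (2, 1, 6)), ((1, 3), z (2, 1, 4)), ((1, 6), - z (1, 1, 3)),
      ((2, 1), z (2, 2, 6)), ((2, 2), z (1, 1, 2) - z (1, 3, 6) - z (2, 1, 6)),
      ((2, 3), z (2, 2, 4)), ((2, 4), - z (2, 2, 3)), ((2, 5), - z (1, 2, 4)),
      ((2, 6), - 1/3 * z (1, 2, 3) - 1/3 * z (1, 5, 6) + 2/3 * z (2, 1, 2) - 1/3 * z (2, 3, 6) - 1/3 * z (2, 4, 5)),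
      ((3, 1), - 2/3 * z (1, 2, 3) + 1/3 * z (1, 5, 6) - 2/3 * z (2, 1, 2) + 1/3 * z (2, 3, 6) + 1/3 * z (2, 4, 5)),
      ((3, 4), z (1, 3, 5) - z (2, 1, 5)), ((3, 5), - z (1, 3, 4)), ((3, 6), z (2, 1, 3)),
      ((4, 2), z (1, 1, 4)), ((4, 3), z (1, 4, 6)), ((4, 4), z (2, 3, 4)), ((5, 1), z (2, 5, 6)),
      ((5, 2), z (1, 1, 5)),
      ((5, 3), 1/3 * z (1, 2, 3) + 1/3 * z (1, 5, 6) + 1/3 * z (2, 1, 2) + 1/3 * z (2, 3, 6) - 2/3 * z (2, 4, 5)),
      ((5, 4), z (2, 3, 5)), ((5, 5), - z (1, 3, 6) + z (1, 4, 5) - z (2, 3, 4)),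
      ((5, 6), z (2, 1, 5)), ((6, 1), - z (1, 2, 6) + z (2, 2, 4)),
      ((6, 2), z (1, 1, 6) - z (2, 1, 4)), ((6, 3), - z (2, 4, 6)),
      ((6, 4), 1/3 * z (1, 2, 3) - 2/3 * z (1, 5, 6) + 1/3 * z (2, 1, 2) + 1/3 * z (2, 3, 6) - 2/3 * z (2, 4, 5))]"])
        (simp only: coords_def list_all_simps rep_1 rep_simps tang_simps;
          (simp only: entries_nth eval_simps)?; simp?)
  next
    fix X Y
    assume "list_all (\<lambda>(p, b). b \<or> tang X Y (std_rep 11) $ p = 0) (zip coords ?mask)"
    then show "list_all (\<lambda>(p, b). b \<longrightarrow> tang X Y (std_rep 11) $ p = 0) (zip coords ?mask)"
      by (simp only: coords_def list_all_simps rep_1 rep_simps tang_simps; algebra?)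
  qed simp_all
  then show ?thesis by simp
qed

lemma dim_orbit_12: "alg_dim (orbit (std_rep 12)) = enat 25"
proof -
  let ?mask = "[False, False, False, False, False, False, False, False, False, False, False,
      False, False, False, False, False, False, False, True, True, False, False, True, True,
      False, False, False, False, False, True]"
  have "alg_dim (orbit (std_rep 12)) = enat (length (filter Not ?mask))"
  proof (rule alg_dim_orbit_coords[OF skew_rep])
    fix z :: "2 \<times> 6 \<times> 6 \<Rightarrow> complex"
    show "\<exists>X Y. list_all (\<lambda>(p, b). b \<or> tang X Y (std_rep 12) $ p = z p) (zip coords ?mask)"
      by (intro exI[of _ "entries [
      ((1, 2), z (1, 3, 4)), ((2, 1), z (2, 1, 2))]"]
        exI[of _ "entries [
      ((1, 3), z (2, 1, 4)), ((1, 4), - z (2, 1, 3)), ((1, 6), - z (1, 1, 5)),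
      ((2, 2), z (1, 1, 2)), ((2, 3), z (2, 2, 4)), ((2, 4), - z (2, 2, 3)),
      ((3, 1), - z (1, 2, 3)), ((3, 2), z (1, 1, 3)), ((3, 3), z (2, 3, 4)),
      ((3, 5), z (1, 3, 6)), ((3, 6), - z (1, 3, 5)), ((4, 1), - z (1, 2, 4)),
      ((4, 2), z (1, 1, 4)), ((4, 5), z (1, 4, 6)), ((4, 6), - z (1, 4, 5)),
      ((5, 1), - z (1, 2, 5)), ((5, 3), - z (2, 4, 5)), ((5, 4), z (2, 3, 5)),
      ((6, 1), - z (1, 2, 6)), ((6, 2), z (1, 1, 6)), ((6, 3), - z (2, 4, 6)),
      ((6, 4), z (2, 3, 6)), ((6, 6), z (1, 5, 6))]"])
        (simp only: coords_def list_all_simps rep_1 rep_simps tang_simps;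
          (simp only: entries_nth eval_simps)?; simp?)
  next
    fix X Y
    assume "list_all (\<lambda>(p, b). b \<or> tang X Y (std_rep 12) $ p = 0) (zip coords ?mask)"
    then show "list_all (\<lambda>(p, b). b \<longrightarrow> tang X Y (std_rep 12) $ p = 0) (zip coords ?mask)"
      by (simp only: coords_def list_all_simps rep_1 rep_simps tang_simps; algebra?)
  qed simp_all
  then show ?thesis by simp
qed

lemma dim_orbit_13: "alg_dim (orbit (std_rep 13)) = enat 29"
proof -
  let ?mask = "[False, False, False, False, False, False, False, False, False, False, False,
      False, False, False, False, False, False, False, False, False, False, False, False, True,
      False, False, False, False, False, False]"
  have "alg_dim (orbit (std_rep 13)) = enat (length (filter Not ?mask))"
  proof (rule alg_dim_orbit_coords[OF skew_rep])
    fix z :: "2 \<times> 6 \<times> 6 \<Rightarrow> complex"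
    show "\<exists>X Y. list_all (\<lambda>(p, b). b \<or> tang X Y (std_rep 13) $ p = z p) (zip coords ?mask)"
      by (intro exI[of _ "entries [
      ((1, 2), z (1, 3, 4)), ((2, 1), - 1/2 * z (1, 2, 6) + 1/2 * z (2, 1, 2) + 1/2 * z (2, 5, 6))]"]
        exI[of _ "entries [
      ((1, 1), z (2, 1, 5)), ((1, 3), - z (1, 4, 6) + z (2, 1, 4)),
      ((1, 4), z (1, 3, 6) - z (2, 1, 3)), ((1, 5), z (1, 1, 6)), ((2, 1), z (2, 2, 5)),
      ((2, 2), z (1, 1, 2) - z (2, 1, 5)), ((2, 3), z (2, 2, 4)), ((2, 4), - z (2, 2, 3)),
      ((2, 5), 1/2 * z (1, 2, 6) + 1/2 * z (2, 1, 2) - 1/2 * z (2, 5, 6)),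
      ((2, 6), - z (1, 2, 5)), ((3, 1), - z (1, 2, 3)), ((3, 2), z (1, 1, 3)),
      ((3, 5), z (1, 3, 6)), ((3, 6), - z (1, 3, 5)), ((4, 1), - z (1, 2, 4)),
      ((4, 2), z (1, 1, 4)), ((4, 4), z (2, 3, 4)), ((4, 5), z (1, 4, 6)),
      ((4, 6), - z (1, 4, 5)), ((5, 2), z (1, 1, 5) - z (1, 3, 4)),
      ((5, 3), - z (1, 2, 4) - z (2, 4, 5)), ((5, 4), z (1, 2, 3) + z (2, 3, 5)),
      ((6, 1), - 1/2 * z (1, 2, 6) + 1/2 * z (2, 1, 2) - 1/2 * z (2, 5, 6)),
      ((6, 3), - z (2, 4, 6)), ((6, 4), z (2, 3, 6)), ((6, 5), z (2, 1, 6)), ((6, 6), z (1, 5, 6))]"])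
        (simp only: coords_def list_all_simps rep_1 rep_simps tang_simps;
          (simp only: entries_nth eval_simps)?; simp?)
  next
    fix X Y
    assume "list_all (\<lambda>(p, b). b \<or> tang X Y (std_rep 13) $ p = 0) (zip coords ?mask)"
    then show "list_all (\<lambda>(p, b). b \<longrightarrow> tang X Y (std_rep 13) $ p = 0) (zip coords ?mask)"
      by (simp only: coords_def list_all_simps rep_1 rep_simps tang_simps; algebra?)
  qed simp_all
  then show ?thesis by simp
qed

lemma dim_orbit_14: "alg_dim (orbit (std_rep 14)) = enat 30"
proof -
  let ?mask = "[False, False, False, False, False, False, False, False, False, False, False,
      False, False, False, False, False, False, False, False, False, False, False, False, False,
      False, False, False, False, False, False]"
  have "alg_dim (orbit (std_rep 14)) = enat (length (filter Not ?mask))"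
  proof (rule alg_dim_orbit_coords[OF skew_rep])
    fix z :: "2 \<times> 6 \<times> 6 \<Rightarrow> complex"
    show "\<exists>X Y. list_all (\<lambda>(p, b). b \<or> tang X Y (std_rep 14) $ p = z p) (zip coords ?mask)"
      by (intro exI[of _ "entries [
      ((1, 1), - z (1, 3, 4) + z (1, 5, 6)), ((1, 2), z (1, 3, 4)), ((2, 1), z (2, 1, 2)),
      ((2, 2), - z (2, 1, 2) + z (2, 5, 6))]"]
        exI[of _ "entries [
      ((1, 1), z (1, 1, 2) + z (1, 3, 4) - z (1, 5, 6)), ((1, 3), z (2, 1, 4)),
      ((1, 4), - z (2, 1, 3)), ((1, 5), z (2, 1, 6)), ((1, 6), - z (2, 1, 5)),
      ((2, 3), z (2, 2, 4)), ((2, 4), - z (2, 2, 3)), ((2, 5), z (2, 2, 6)),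
      ((2, 6), - z (2, 2, 5)), ((3, 1), - z (1, 2, 3)), ((3, 2), z (1, 1, 3)),
      ((3, 3), z (2, 1, 2) + z (2, 3, 4) - z (2, 5, 6)), ((3, 5), z (1, 3, 6)),
      ((3, 6), - z (1, 3, 5)), ((4, 1), - z (1, 2, 4)), ((4, 2), z (1, 1, 4)),
      ((4, 5), z (1, 4, 6)), ((4, 6), - z (1, 4, 5)), ((5, 1), - z (1, 2, 5) + z (2, 2, 5)),
      ((5, 2), z (1, 1, 5) - z (2, 1, 5)), ((5, 3), z (1, 4, 5) - z (2, 4, 5)),
      ((5, 4), - z (1, 3, 5) + z (2, 3, 5)), ((6, 1), - z (1, 2, 6) + z (2, 2, 6)),
      ((6, 2), z (1, 1, 6) - z (2, 1, 6)), ((6, 3), z (1, 4, 6) - z (2, 4, 6)),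
      ((6, 4), - z (1, 3, 6) + z (2, 3, 6))]"])
        (simp only: coords_def list_all_simps rep_1 rep_simps tang_simps;
          (simp only: entries_nth eval_simps)?; simp?)
  next
    fix X Y
    assume "list_all (\<lambda>(p, b). b \<or> tang X Y (std_rep 14) $ p = 0) (zip coords ?mask)"
    then show "list_all (\<lambda>(p, b). b \<longrightarrow> tang X Y (std_rep 14) $ p = 0) (zip coords ?mask)"
      by (simp only: coords_def list_all_simps rep_1 rep_simps tang_simps; algebra?)
  qed simp_all
  then show ?thesis by simp
qed

lemma dim_orbit_0: "alg_dim (orbit (std_rep 0)) = enat 0"
proof -
  have "tang X Y 0 = 0" for X Y by (simp add: tang_def vec_eq_iff case_prod_beta)
  then have "alg_dim (orbit (std_rep 0)) = enat (card ({} :: (2 \<times> 6 \<times> 6) set))"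
    by (intro alg_dim_orbit) (auto simp: rep_simps tangent_def)
  then show ?thesis by simp
qed

lemma dim_orbit: "i \<le> 14 \<Longrightarrow> alg_dim (orbit (std_rep i)) = enat (orbit_dims ! i)"
  by (drule nat_le_14_cases, elim disjE)
    (simp_all add: orbit_dims_def dim_orbit_0 dim_orbit_1[simplified] dim_orbit_2 dim_orbit_3 dim_orbit_4 dim_orbit_5
      dim_orbit_6 dim_orbit_7 dim_orbit_8 dim_orbit_9 dim_orbit_10 dim_orbit_11 dim_orbit_12
      dim_orbit_13 dim_orbit_14)

section \<open>Frames\<close>

text \<open>
  Lists allow single vectors of a frame to be replaced, while the order of the others is kept.
\<close>

definition ind :: "(complex ^ 'n) list \<Rightarrow> bool"
  where "ind vs \<longleftrightarrow> distinct vs \<and> vec.independent (set vs)"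

lemma ind_exchange:
  assumes "ind vs" "length ws = length vs" "set vs \<subseteq> vec.span (set ws)"
  shows "ind ws"
proof -
  let ?V = "vec.span (set ws)"
  have "length vs = card (set vs)" using assms(1) by (simp add: ind_def distinct_card)
  also have "\<dots> = vec.dim (set vs)" using assms(1) by (simp add: ind_def vec.dim_eq_card_independent)
  also have "\<dots> \<le> vec.dim ?V" by (rule vec.dim_subset[OF assms(3)])
  finally have le: "length ws \<le> vec.dim ?V" using assms(2) by simp
  have "vec.dim ?V \<le> card (set ws)" by (simp add: vec.dim_le_card')
  then have card: "card (set ws) = length ws" using le card_length[of ws] by linarith
  then have "distinct ws" by (rule card_distinct)
  moreover have "vec.independent (set ws)"
    by (rule vec.card_le_dim_spanning[of _ ?V]) (use le card in \<open>auto simp: vec.span_superset\<close>)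
  ultimately show ?thesis by (simp add: ind_def)
qed

lemma ind_cong: "ind vs \<Longrightarrow> set ws = set vs \<Longrightarrow> length ws = length vs \<Longrightarrow> ind ws"
  by (rule ind_exchange) (auto intro: vec.span_base)

lemma ind_update:
  assumes "ind (xs @ v # ys)" "c \<noteq> 0" "u \<in> vec.span (set xs \<union> set ys)"
  shows "ind (xs @ (c *s v + u) # ys)"
proof (rule ind_exchange[OF assms(1)])
  let ?S = "set (xs @ (c *s v + u) # ys)"
  have u: "u \<in> vec.span ?S" using assms(3) by (rule subsetD[OF vec.span_mono, rotated]) auto
  have "v = (1 / c) *s ((c *s v + u) - u)" using assms(2) by (simp add: vec_eq_iff)
  also have "\<dots> \<in> vec.span ?S"
    by (intro vec.span_scale vec.span_diff u vec.span_base) simp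
  finally show "set (xs @ v # ys) \<subseteq> vec.span ?S" by (auto intro: vec.span_base)
qed simp

lemma ind_span_UNIV:
  fixes vs :: "(complex ^ 'n) list"
  assumes "ind vs" "length vs = CARD('n)" shows "vec.span (set vs) = UNIV"
proof -
  have "vec.dim (UNIV :: (complex ^ 'n) set) = CARD('n)" by (simp add: vec.dim_UNIV card_cart_basis)
  then have "UNIV \<subseteq> vec.span (set vs)"
    using assms by (intro vec.card_ge_dim_independent) (auto simp: ind_def distinct_card)
  then show ?thesis by auto
qed

lemma mult_axis: "A *v axis i 1 = column i A" for A :: "complex ^ 'n ^ 'm"
  by (simp add: vec_eq_iff matrix_vector_mult_def column_def axis_def if_distrib cong: if_cong)

lemma spans_matrix:
  fixes e :: "'n \<Rightarrow> complex ^ 'n"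
  assumes "vec.span (range e) = UNIV"
  shows "\<exists>A. det A \<noteq> 0 \<and> (\<forall>i. A *v axis i 1 = e i)"
proof -
  define A :: "complex ^ 'n ^ 'n" where "A = (\<chi> i j. e j $ i)"
  have col: "column i A = e i" for i by (simp add: A_def column_def vec_eq_iff)
  then have "columns A = range e" by (auto simp: columns_def)
  then obtain B where "A ** B = mat 1"
    using assms matrix_right_invertible_span_columns[of A] by auto
  then have "det A * det B = 1" by (metis det_mul det_I)
  then have "det A \<noteq> 0" by auto
  moreover have "A *v axis i 1 = e i" for i by (simp add: mult_axis col)
  ultimately show ?thesis by blast
qed

lemma act_bracket:
  assumes "\<And>k. A *v stdE k = e k" "\<And>i. B *v stdF i = f i"
  shows "act (A, B, 1) (bracket stdE stdF k i j) = bracket e f k i j"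
  unfolding bracket_def act_tensor_wedge assms by simp

text \<open>
  Only the spanning property of the two frames matters; by dimension it implies independence.
\<close>

lemma rep_in_orbit:
  assumes "vec.span (range e) = UNIV" "vec.span (range f) = UNIV" "i \<le> 14"
  shows "rep e f i \<in> orbit (std_rep i)"
proof -
  obtain A B where AB: "det A \<noteq> 0" "\<And>k. A *v stdE k = e k" "det B \<noteq> 0" "\<And>i. B *v stdF i = f i"
    using spans_matrix[OF assms(1)] spans_matrix[OF assms(2)] by blast
  have br: "act (A, B, 1) (bracket stdE stdF k i j) = bracket e f k i j" for k i j
    by (rule act_bracket) (rule AB)+
  have "act (A, B, 1) (std_rep i) = rep e f i"
    using nat_le_14_cases[OF assms(3)]
    by (elim disjE) (simp_all add: rep_simps act_add act_zero br del: act.simps)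
  then show ?thesis using act_in_orbit[OF AB(1,3), of "std_rep i"] by simp
qed

lemma rep_orbit:
  "vec.span (range e) = UNIV \<Longrightarrow> vec.span (range f) = UNIV \<Longrightarrow> i \<le> 14 \<Longrightarrow> orbit (rep e f i) = orbit (std_rep i)"
  by (rule orbit_eq[OF rep_in_orbit])

section \<open>Pencils of alternating forms\<close>

definition alt :: "(complex ^ 6 \<Rightarrow> complex ^ 6 \<Rightarrow> complex) \<Rightarrow> bool"
  where "alt a \<longleftrightarrow> (\<forall>x y z. a (x + y) z = a x z + a y z) \<and> (\<forall>c x y. a (c *s x) y = c * a x y) \<and>
    (\<forall>x y. a x y = - a y x)"

lemma alt_rules:
  assumes "alt a"
  shows "a (x + y) z = a x z + a y z" "a (c *s x) z = c * a x z"
    "a z (x + y) = a z x + a z y" "a z (c *s x) = c * a z x" "a x x = 0"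
    "a (x - y) z = a x z - a y z" "a z (x - y) = a z x - a z y" "a (- x) z = - a x z" "a z (- x) = - a z x"
    "a 0 z = 0" "a z 0 = 0"
proof -
  have s: "a x y = - a y x" for x y using assms unfolding alt_def by blast
  show add: "a (x + y) z = a x z + a y z" for x y z using assms unfolding alt_def by blast
  show sc: "a (c *s x) z = c * a x z" for c x z using assms unfolding alt_def by blast
  show add': "a z (x + y) = a z x + a z y" for x y z
    unfolding s[of z "x + y"] s[of z x] s[of z y] add by simp
  show sc': "a z (c *s x) = c * a z x" for c x z
    unfolding s[of z "c *s x"] s[of z x] sc by simp
  have "2 * a x x = 0" using s[of x x] by (metis add.right_inverse mult_2)
  then show "a x x = 0" by simp
  have n: "- x = (- 1) *s x" for x :: "complex ^ 6" by (simp add: vec_eq_iff)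
  show m: "a (- x) z = - a x z" for x z unfolding n sc by simp
  show m': "a z (- x) = - a z x" for x z unfolding n sc' by simp
  show "a (x - y) z = a x z - a y z" unfolding diff_conv_add_uminus add m ..
  show "a z (x - y) = a z x - a z y" unfolding diff_conv_add_uminus add' m' ..
  show "a 0 z = 0" using sc[of 0 0 z] by simp
  show "a z 0 = 0" using sc'[of z 0 0] by simp
qed

lemma alt_skew: "alt a \<Longrightarrow> a x y = - a y x"
  unfolding alt_def by blast

lemma alt_span_left:
  assumes "alt a" "\<And>v. v \<in> S \<Longrightarrow> a v y = 0" "x \<in> vec.span S" shows "a x y = 0"
  using assms(3) by (induction rule: vec.span_induct_alt) (simp_all add: alt_rules[OF assms(1)] assms(2))

lemma alt_span:
  assumes "alt a" "\<And>v w. v \<in> S \<Longrightarrow> w \<in> T \<Longrightarrow> a v w = 0" "x \<in> vec.span S" "y \<in> vec.span T"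
  shows "a x y = 0"
proof (rule alt_span_left[OF assms(1) _ assms(3)])
  fix v assume v: "v \<in> S"
  have "a w v = 0" if "w \<in> T" for w
    using alt_skew[OF assms(1), of w v] assms(2)[OF v that] by simp
  then have "a y v = 0" by (rule alt_span_left[OF assms(1) _ assms(4)])
  then show "a v y = 0" using alt_skew[OF assms(1), of v y] by simp
qed

text \<open>
  A tensor in \<open>E \<otimes> \<And>\<^sup>2 F\<close> is a pencil of alternating forms on the dual of \<open>F\<close>, parametrised by the dual
  of \<open>E\<close>. In these terms, elements of the dual spaces are coordinate vectors as well.
\<close>

definition form :: "tensors \<Rightarrow> complex ^ 2 \<Rightarrow> complex ^ 6 \<Rightarrow> complex ^ 6 \<Rightarrow> complex"
  where "form t s u v = (\<Sum>k\<in>UNIV. \<Sum>i\<in>UNIV. \<Sum>j\<in>UNIV. s $ k * u $ i * v $ j * t $ (k, i, j))"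

lemma form_lin: "form t (x *s s + y *s s') u v = x * form t s u v + y * form t s' u v"
  by (simp add: form_def distrib_left distrib_right sum.distrib sum_distrib_left mult.assoc)

lemma alt_form:
  assumes "t \<in> E_Wedge2_F" shows "alt (form t s)"
  unfolding alt_def
proof (intro conjI allI)
  fix x y z show "form t s (x + y) z = form t s x z + form t s y z"
    by (simp add: form_def distrib_left distrib_right sum.distrib)
next
  fix c x y show "form t s (c *s x) y = c * form t s x y"
    by (simp add: form_def sum_distrib_left mult_ac)
next
  fix x y
  have "form t s x y = (\<Sum>k\<in>UNIV. \<Sum>j\<in>UNIV. \<Sum>i\<in>UNIV. s $ k * x $ i * y $ j * t $ (k, i, j))"
    unfolding form_def by (subst sum.swap) (rule refl)
  also have "\<dots> = (\<Sum>k\<in>UNIV. \<Sum>j\<in>UNIV. \<Sum>i\<in>UNIV. - (s $ k * y $ j * x $ i * t $ (k, j, i)))"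
    by (intro sum.cong refl) (subst skewD[OF assms], simp)
  finally show "form t s x y = - form t s y x" by (simp add: form_def sum_negf)
qed

definition list2 :: "'a \<Rightarrow> 'a \<Rightarrow> 2 \<Rightarrow> 'a"
  where "list2 a b k = (if k = 1 then a else b)"

definition list6 :: "'a \<Rightarrow> 'a \<Rightarrow> 'a \<Rightarrow> 'a \<Rightarrow> 'a \<Rightarrow> 'a \<Rightarrow> 6 \<Rightarrow> 'a"
  where "list6 a b c d e f i =
    (if i = 1 then a else if i = 2 then b else if i = 3 then c else if i = 4 then d else if i = 5 then e else f)"

lemma list_nth: "list2 a b 1 = a" "list2 a b 2 = b"
  "list6 a b c d e f 1 = a" "list6 a b c d e f 2 = b" "list6 a b c d e f 3 = c"
  "list6 a b c d e f 4 = d" "list6 a b c d e f 5 = e" "list6 a b c d e f 6 = f"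
  by (simp_all add: list2_def list6_def)

lemma det_rows_nonzero:
  fixes v :: "'n \<Rightarrow> complex ^ 'n"
  assumes "vec.span (range v) = UNIV" shows "det (\<chi> i. v i) \<noteq> 0"
proof -
  obtain A where A: "det A \<noteq> 0" "\<forall>i. A *v axis i 1 = v i" using spans_matrix[OF assms] by blast
  have "transpose A = (\<chi> i. v i)"
    using A(2) by (simp add: mult_axis vec_eq_iff transpose_def column_def)
  then show ?thesis using A(1) det_transpose[of A] by simp
qed

text \<open>
  This is how every case of the classification ends: frames in which the pencil has the coordinates of a representative
  form invertible matrices that carry \<open>t\<close> to the representative.
\<close>

lemma normal_form:
  assumes t: "t \<in> E_Wedge2_F" and n: "n \<le> 14"
    and s: "ind [s1, s2]" and v: "ind [v1, v2, v3, v4, v5, v6]"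
    and val: "list_all (\<lambda>(k, i, j). form t (list2 s1 s2 k) (list6 v1 v2 v3 v4 v5 v6 i) (list6 v1 v2 v3 v4 v5 v6 j)
      = std_rep n $ (k, i, j)) coords"
  shows "\<exists>n\<le>14. t \<in> orbit (std_rep n)"
proof -
  define S where "S = (\<chi> k. list2 s1 s2 k)"
  define V where "V = (\<chi> i. list6 v1 v2 v3 v4 v5 v6 i)"
  have "range (list2 s1 s2) = set [s1, s2]" by (simp add: UNIV_2 list_nth insert_commute)
  then have "det S \<noteq> 0" unfolding S_def by (intro det_rows_nonzero) (use ind_span_UNIV[OF s] in simp)
  have "range (list6 v1 v2 v3 v4 v5 v6) = set [v1, v2, v3, v4, v5, v6]" by (simp add: UNIV_6 list_nth)
  then have "det V \<noteq> 0" unfolding V_def by (intro det_rows_nonzero) (use ind_span_UNIV[OF v] in simp)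
  have val': "act (S, V, 1) t $ (k, i, j) = form t (S $ k) (V $ i) (V $ j)" for k i j
    by (simp add: form_def)
  have "act (S, V, 1) t \<in> E_Wedge2_F"
    unfolding E_Wedge2_F_def mem_Collect_eq val' using alt_skew[OF alt_form[OF t]] by blast
  moreover have "\<forall>p\<in>set coords. act (S, V, 1) t $ p = std_rep n $ p"
    using val unfolding list_all_iff
  proof (intro ballI, unfold split_paired_all)
    fix k i j assume "(k, i, j) \<in> set coords" "\<forall>x\<in>set coords. case x of (k, i, j) \<Rightarrow>
      form t (list2 s1 s2 k) (list6 v1 v2 v3 v4 v5 v6 i) (list6 v1 v2 v3 v4 v5 v6 j) = std_rep n $ (k, i, j)"
    then show "act (S, V, 1) t $ (k, i, j) = std_rep n $ (k, i, j)"
      unfolding val' unfolding S_def V_def vec_lambda_beta by auto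
  qed
  ultimately have "act (S, V, 1) t = std_rep n" using skew_rep[OF n] skew_eqI by blast
  then have "std_rep n \<in> orbit t" using act_in_orbit[OF \<open>det S \<noteq> 0\<close> \<open>det V \<noteq> 0\<close>] by metis
  then show ?thesis using orbit_sym n by blast
qed

section \<open>Adapted frames\<close>

text \<open>
  One step of the symplectic Gram-Schmidt process. The vectors \<open>us\<close> are left unchanged; in applications they come from
  earlier steps.
\<close>

lemma hyperbolic_pair:
  assumes a: "alt a" and ind: "ind (vs @ us)" and nz: "x \<in> set vs" "y \<in> set vs" "a x y \<noteq> 0"
  shows "\<exists>p q ws. ind (p # q # ws @ us) \<and> length vs = length ws + 2 \<and> set (p # q # ws) \<subseteq> vec.span (set vs) \<and>
    a p q = 1 \<and> (\<forall>w\<in>set ws. a p w = 0 \<and> a q w = 0)"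
proof -
  note alt = alt_rules[OF a]
  have xy: "x \<noteq> y" using nz(3) alt(5) by auto
  have dist: "distinct vs" using ind by (simp add: ind_def)
  define q where "q = (1 / a x y) *s y"
  define ws0 where "ws0 = remove1 y (remove1 x vs)"
  define f where "f w = w - a x w *s q + a q w *s x" for w
  have set0: "set vs = insert x (insert y (set ws0))"
    using nz(1,2) xy dist unfolding ws0_def by auto
  have rem: "length us = Suc (length (remove1 u us))" if "u \<in> set us" for u :: "complex ^ 6" and us
    using length_pos_if_in_set[OF that] that by (simp add: length_remove1)
  have "y \<in> set (remove1 x vs)" using nz(2) xy by (simp add: in_set_remove1)
  then have len: "length vs = length ws0 + 2"
    using rem[OF nz(1)] rem[of y "remove1 x vs"] unfolding ws0_def by simp
  have pq: "a x q = 1" unfolding q_def using nz(3) by (simp add: alt)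
  have qp: "a q x = - 1" using alt_skew[OF a, of q x] pq by simp
  have f: "a x (f w) = 0 \<and> a q (f w) = 0" for w
    unfolding f_def by (simp add: alt pq qp)
  have "ind (x # q # map f ws0 @ us)"
  proof (rule ind_exchange[OF ind])
    show "length (x # q # map f ws0 @ us) = length (vs @ us)" using len by simp
    let ?S = "vec.span (set (x # q # map f ws0 @ us))"
    have base: "x \<in> ?S" "q \<in> ?S" by (auto intro: vec.span_base)
    have "y = a x y *s q" unfolding q_def using nz(3) by (simp add: vec_eq_iff)
    then have "y \<in> ?S" using vec.span_scale[OF base(2)] by metis
    moreover have "w \<in> ?S" if "w \<in> set ws0" for w
    proof -
      have "f w \<in> ?S" using that by (intro vec.span_base) simp
      moreover have "w = f w + a x w *s q - a q w *s x" by (simp add: f_def)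
      ultimately show ?thesis using base by (metis vec.span_add vec.span_diff vec.span_scale)
    qed
    moreover have "u \<in> ?S" if "u \<in> set us" for u using that by (intro vec.span_base) simp
    ultimately show "set (vs @ us) \<subseteq> ?S" using base set0 by auto
  qed
  moreover have "set (x # q # map f ws0) \<subseteq> vec.span (set vs)"
  proof -
    have x: "x \<in> vec.span (set vs)" using nz(1) by (rule vec.span_base)
    have q: "q \<in> vec.span (set vs)" unfolding q_def using nz(2) by (intro vec.span_scale vec.span_base)
    have "f w \<in> vec.span (set vs)" if "w \<in> set ws0" for w
      unfolding f_def using that set0 by (intro vec.span_add vec.span_diff vec.span_scale x q vec.span_base) auto
    then show ?thesis using x q by auto
  qed
  ultimately show ?thesis using len pq f
    by (intro exI[of _ x] exI[of _ q] exI[of _ "map f ws0"]) auto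
qed

text \<open>
  The last conclusion keeps orthogonality relations that were obtained for other forms.
\<close>

lemma clear_vector:
  assumes b: "alt b" and ind: "ind (us @ vs)" and nz: "x \<in> set vs" "b p x \<noteq> 0"
  shows "\<exists>w ws. ind (us @ w # ws) \<and> length vs = Suc (length ws) \<and> set (w # ws) \<subseteq> vec.span (set vs) \<and>
    b p w = 1 \<and> (\<forall>v\<in>set ws. b p v = 0) \<and>
    (\<forall>c r. alt c \<longrightarrow> (\<forall>v\<in>set vs. c r v = 0) \<longrightarrow> (\<forall>v\<in>set (w # ws). c r v = 0))"
proof -
  note alt = alt_rules[OF b]
  have dist: "distinct vs" using ind by (simp add: ind_def)
  define w where "w = (1 / b p x) *s x"
  define ws0 where "ws0 = remove1 x vs"
  define f where "f v = v - b p v *s w" for v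
  have set0: "set vs = insert x (set ws0)" using nz(1) dist unfolding ws0_def by auto
  have len: "length vs = Suc (length ws0)"
    using nz(1) length_pos_if_in_set[OF nz(1)] unfolding ws0_def by (simp add: length_remove1)
  have pw: "b p w = 1" unfolding w_def using nz(2) by (simp add: alt)
  have f: "b p (f v) = 0" for v unfolding f_def by (simp add: alt pw)
  have "ind (us @ w # map f ws0)"
  proof (rule ind_exchange[OF ind])
    show "length (us @ w # map f ws0) = length (us @ vs)" using len by simp
    let ?S = "vec.span (set (us @ w # map f ws0))"
    have base: "w \<in> ?S" by (auto intro: vec.span_base)
    have "x = b p x *s w" unfolding w_def using nz(2) by (simp add: vec_eq_iff)
    then have "x \<in> ?S" using vec.span_scale[OF base] by metis
    moreover have "v \<in> ?S" if "v \<in> set ws0" for v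
    proof -
      have "f v \<in> ?S" using that by (intro vec.span_base) simp
      moreover have "v = f v + b p v *s w" by (simp add: f_def)
      ultimately show ?thesis using base by (metis vec.span_add vec.span_scale)
    qed
    moreover have "u \<in> ?S" if "u \<in> set us" for u using that by (intro vec.span_base) simp
    ultimately show "set (us @ vs) \<subseteq> ?S" using set0 by auto
  qed
  moreover have sub: "set (w # map f ws0) \<subseteq> vec.span (set vs)"
  proof -
    have w: "w \<in> vec.span (set vs)" unfolding w_def using nz(1) by (intro vec.span_scale vec.span_base)
    have "f v \<in> vec.span (set vs)" if "v \<in> set ws0" for v
      unfolding f_def using that set0 by (intro vec.span_diff vec.span_scale w vec.span_base) auto
    then show ?thesis using w by auto
  qed
  moreover have "\<forall>v\<in>set (w # map f ws0). c r v = 0" if c: "alt c" "\<forall>v\<in>set vs. c r v = 0" for c r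
  proof
    fix v assume "v \<in> set (w # map f ws0)"
    then have "v \<in> vec.span (set vs)" using sub by blast
    then show "c r v = 0"
      using alt_span[OF c(1), of "{r}" "set vs" r v] c(2) vec.span_base[of r "{r}"] by blast
  qed
  ultimately show ?thesis using len pw f
    by (intro exI[of _ w] exI[of _ "map f ws0"]) auto
qed

text \<open>
  Normal form of the pairing between a plane and a complement under \<open>b\<close>: it has rank \<open>0\<close>, \<open>1\<close> or \<open>2\<close>. The base
  change of the plane is chosen with determinant \<open>1\<close>, so that the value of any alternating form on the plane
  is preserved.
\<close>

lemma pairing_normal_form:
  assumes b: "alt b" and ind: "ind (p1 # p2 # us @ vs)"
  obtains q1 q2 ws where "ind (q1 # q2 # us @ ws)" "length ws = length vs" "set ws \<subseteq> vec.span (set vs)"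
    "{q1, q2} \<subseteq> vec.span {p1, p2}" "\<And>a. alt a \<Longrightarrow> a q1 q2 = a p1 p2" "\<forall>w\<in>set ws. b q1 w = 0 \<and> b q2 w = 0"
  | q1 q2 w ws where "ind (q1 # q2 # us @ w # ws)" "length vs = Suc (length ws)" "set (w # ws) \<subseteq> vec.span (set vs)"
    "{q1, q2} \<subseteq> vec.span {p1, p2}" "\<And>a. alt a \<Longrightarrow> a q1 q2 = a p1 p2"
    "b q1 w = 1" "b q2 w = 0" "\<forall>w\<in>set ws. b q1 w = 0 \<and> b q2 w = 0"
  | q1 q2 w1 w2 ws where "ind (q1 # q2 # us @ w1 # w2 # ws)" "length vs = length ws + 2"
    "set (w1 # w2 # ws) \<subseteq> vec.span (set vs)"
    "{q1, q2} \<subseteq> vec.span {p1, p2}" "\<And>a. alt a \<Longrightarrow> a q1 q2 = a p1 p2"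
    "b q1 w1 = 1" "b q2 w1 = 0" "b q1 w2 = 0" "b q2 w2 = 1" "\<forall>w\<in>set ws. b q1 w = 0 \<and> b q2 w = 0"
proof (cases "\<forall>w\<in>set vs. b p1 w = 0 \<and> b p2 w = 0")
  case True
  show ?thesis
    by (rule that(1)[OF ind refl _ _ _ True]) (auto intro: vec.span_base)
next
  case False
  note alt = alt_rules[OF b]
  have p: "p1 \<in> vec.span {p1, p2}" "p2 \<in> vec.span {p1, p2}" by (auto intro: vec.span_base)
  have "\<exists>q1 q2 x. ind (q1 # q2 # us @ vs) \<and> {q1, q2} \<subseteq> vec.span {p1, p2} \<and> (\<forall>a. alt a \<longrightarrow> a q1 q2 = a p1 p2) \<and>
    x \<in> set vs \<and> b q1 x \<noteq> 0"
  proof (cases "\<exists>x\<in>set vs. b p1 x \<noteq> 0")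
    case True
    then show ?thesis using ind p by blast
  next
    case nz: False
    then obtain x where x: "x \<in> set vs" "b p2 x \<noteq> 0" using False by blast
    have "ind ([p2] @ p1 # us @ vs)" by (rule ind_cong[OF ind]) auto
    from ind_update[OF this, of "-1" 0] have "ind (p2 # (- p1) # us @ vs)"
      by (simp add: vec.span_zero)
    moreover have "a p2 (- p1) = a p1 p2" if "alt a" for a
      using alt_rules(9)[OF that] alt_skew[OF that, of p1 p2] by simp
    moreover have "- p1 \<in> vec.span {p1, p2}" by (rule vec.span_neg[OF p(1)])
    ultimately show ?thesis using x p by blast
  qed
  then obtain q1 q2 x where q: "ind (q1 # q2 # us @ vs)" "{q1, q2} \<subseteq> vec.span {p1, p2}"
    "\<And>a. alt a \<Longrightarrow> a q1 q2 = a p1 p2" "x \<in> set vs" "b q1 x \<noteq> 0" by blast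
  have "ind ((q1 # q2 # us) @ vs)" using q(1) by simp
  from clear_vector[OF b this q(4,5)] obtain w ws where w: "ind ((q1 # q2 # us) @ w # ws)"
    "length vs = Suc (length ws)" "set (w # ws) \<subseteq> vec.span (set vs)" "b q1 w = 1" "\<forall>v\<in>set ws. b q1 v = 0" by metis
  define r2 where "r2 = q2 - b q2 w *s q1"
  have "ind ([q1] @ q2 # us @ w # ws)" using w(1) by simp
  then have "ind ([q1] @ (1 *s q2 + (- b q2 w) *s q1) # us @ w # ws)"
  proof (rule ind_update)
    show "(- b q2 w) *s q1 \<in> vec.span (set [q1] \<union> set (us @ w # ws))"
      by (intro vec.span_scale vec.span_base) simp
  qed simp
  then have ind2: "ind (q1 # r2 # us @ w # ws)" by (simp add: r2_def)
  have r2: "{q1, r2} \<subseteq> vec.span {p1, p2}"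
    using q(2) by (auto simp: r2_def intro!: vec.span_diff vec.span_scale)
  have det: "a q1 r2 = a p1 p2" if "alt a" for a
    using q(3)[OF that] by (simp add: r2_def alt_rules[OF that])
  have r2w: "b r2 w = 0" by (simp add: r2_def alt w(4))
  show ?thesis
  proof (cases "\<forall>v\<in>set ws. b r2 v = 0")
    case True
    then show ?thesis using that(2)[OF ind2 w(2,3) r2 det w(4) r2w] w(5) by blast
  next
    case False
    then obtain y where y: "y \<in> set ws" "b r2 y \<noteq> 0" by blast
    have "ind ((q1 # r2 # us @ [w]) @ ws)" using ind2 by simp
    from clear_vector[OF b this y] obtain w' ws' where w': "ind ((q1 # r2 # us @ [w]) @ w' # ws')"
      "length ws = Suc (length ws')" "set (w' # ws') \<subseteq> vec.span (set ws)" "b r2 w' = 1" "\<forall>v\<in>set ws'. b r2 v = 0"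
      "\<forall>v\<in>set (w' # ws'). b q1 v = 0" using b w(5) by metis
    have "vec.span (set ws) \<subseteq> vec.span (set vs)"
      using w(3) by (intro vec.span_minimal) auto
    then have sub: "set (w # w' # ws') \<subseteq> vec.span (set vs)" using w(3) w'(3) by auto
    show ?thesis
      by (rule that(3)[OF _ _ sub r2 det w(4) r2w _ w'(4)]) (use w' w(2) in auto)
  qed
qed

lemma pf_matrix_line:
  fixes A B :: "complex ^ 'n ^ 'n"
  shows "\<exists>p. \<forall>z. det (\<chi> i j. A $ i $ j + z * B $ i $ j) = poly p z"
proof -
  have "\<exists>p. \<forall>z. (\<Prod>i\<in>I. A $ i $ \<sigma> i + z * B $ i $ \<sigma> i) = poly p z" if "finite I" for I and \<sigma> :: "'n \<Rightarrow> 'n"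
    by (rule exI[of _ "\<Prod>i\<in>I. [:A $ i $ \<sigma> i, B $ i $ \<sigma> i:]"]) (simp add: poly_prod mult.commute)
  then obtain P where P: "\<And>\<sigma> z. (\<Prod>i\<in>UNIV. A $ i $ \<sigma> i + z * B $ i $ \<sigma> i) = poly (P \<sigma>) z"
    by (metis finite)
  show ?thesis
    by (rule exI[of _ "\<Sum>\<sigma>\<in>{\<sigma>. \<sigma> permutes UNIV}. smult (of_int (sign \<sigma>)) (P \<sigma>)"])
       (simp add: det_def poly_sum P)
qed

lemma singular_combination:
  fixes A B :: "complex ^ 'n ^ 'n"
  shows "\<exists>x y. (x, y) \<noteq> (0, 0) \<and> det (\<chi> i j. x * A $ i $ j + y * B $ i $ j) = 0"
proof (cases "det B = 0")
  case True
  then show ?thesis by - (rule exI[of _ 0], rule exI[of _ 1], simp add: vec_lambda_eta)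
next
  case False
  obtain p where p: "\<And>z. det (\<chi> i j. A $ i $ j + z * B $ i $ j) = poly p z" using pf_matrix_line[of A B] by blast
  obtain q where q: "\<And>z. det (\<chi> i j. B $ i $ j + z * A $ i $ j) = poly q z" using pf_matrix_line[of B A] by blast
  show ?thesis
  proof (cases "constant (poly p)")
    case False
    then obtain z where "poly p z = 0" using fundamental_theorem_of_algebra by blast
    then show ?thesis using p[of z] by - (rule exI[of _ 1], rule exI[of _ z], simp)
  next
    case True
    define c where "c = poly p 0"
    have pc: "poly p z = c" for z using True unfolding constant_def c_def by blast
    have "poly q z = z ^ CARD('n) * c" if "z \<noteq> 0" for z
    proof -
      have eq: "(\<chi> i j. B $ i $ j + z * A $ i $ j) = (\<chi> i. z *s (\<chi> i j. A $ i $ j + (1 / z) * B $ i $ j) $ i)"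
        using that by (simp add: vec_eq_iff distrib_left)
      show ?thesis unfolding q[symmetric] eq det_scaled p pc ..
    qed
    then have "poly (q - monom c CARD('n)) z = 0" if "z \<noteq> 0" for z
      using that by (simp add: poly_monom)
    then have "q - monom c CARD('n) = 0" by (intro poly_eq_0_if_small[of 1]) auto
    then have "poly q 0 = poly (monom c CARD('n)) 0" by simp
    then have "det B = 0" using q[of 0] by (simp add: poly_monom vec_lambda_eta power_0_left)
    then show ?thesis using False by simp
  qed
qed

text \<open>
  The determinant of a linear pencil of matrices has a zero over an algebraically closed field.
\<close>

lemma singular_member:
  assumes t: "t \<in> E_Wedge2_F"
  shows "\<exists>s v. s \<noteq> 0 \<and> v \<noteq> 0 \<and> (\<forall>u. form t s u v = 0)"
proof -
  obtain x y where xy: "(x, y) \<noteq> (0, 0)" "det (\<chi> i j. x * (\<chi> i j. t $ (1, i, j)) $ i $ j + y * (\<chi> i j. t $ (2, i, j)) $ i $ j) = (0 :: complex)"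
    using singular_combination[of "\<chi> i j. t $ (1, i, j)" "\<chi> i j. t $ (2, i, j)"] by blast
  define s :: "complex ^ 2" where "s = (\<chi> k. if k = 1 then x else y)"
  define M where "M = (\<chi> i j. \<Sum>k\<in>UNIV. s $ k * t $ (k, i, j))"
  have "M = (\<chi> i j. x * (\<chi> i j. t $ (1, i, j)) $ i $ j + y * (\<chi> i j. t $ (2, i, j)) $ i $ j)"
    by (simp add: M_def s_def sum_2 eq_2)
  then have "det M = 0" using xy(2) by simp
  then have "\<not> invertible M" by (simp add: invertible_det_nz)
  then obtain v where v: "v \<noteq> 0" "M *v v = 0"
    using matrix_left_invertible_ker[of M] invertible_left_inverse[of M] by blast
  have "s \<noteq> 0" using xy(1) by (auto simp: s_def vec_eq_iff forall_2 eq_2)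
  moreover have "form t s u v = 0" for u
  proof -
    have "form t s u v = (\<Sum>i\<in>UNIV. u $ i * (M *v v) $ i)"
    proof -
      have "form t s u v = (\<Sum>i\<in>UNIV. \<Sum>k\<in>UNIV. \<Sum>j\<in>UNIV. s $ k * u $ i * v $ j * t $ (k, i, j))"
        unfolding form_def by (rule sum.swap)
      also have "\<dots> = (\<Sum>i\<in>UNIV. \<Sum>j\<in>UNIV. \<Sum>k\<in>UNIV. s $ k * u $ i * v $ j * t $ (k, i, j))"
        by (intro sum.cong refl sum.swap)
      also have "\<dots> = (\<Sum>i\<in>UNIV. u $ i * (M *v v) $ i)"
        by (simp add: M_def matrix_vector_mult_def sum_distrib_left sum_distrib_right mult_ac)
      finally show ?thesis .
    qed
    then show ?thesis using v(2) by simp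
  qed
  ultimately show ?thesis using v(1) by blast
qed

lemma ind_shear1:
  assumes "ind (u # vs)" "d \<in> vec.span (set vs)" shows "ind ((u + d) # vs)"
  using ind_update[of "[]" u vs 1 d] assms by simp

lemma ind_shear2:
  assumes "ind (u1 # u2 # vs)" "d1 \<in> vec.span (set vs)" "d2 \<in> vec.span (set vs)"
  shows "ind ((u1 + d1) # (u2 + d2) # vs)"
proof -
  have "d1 \<in> vec.span (set (u2 # vs))" using assms(2) by (rule subsetD[OF vec.span_mono, rotated]) auto
  from ind_shear1[OF assms(1) this] have "ind ([u1 + d1] @ u2 # vs)" by simp
  from ind_update[OF this, of 1 d2] show ?thesis
    using assms(3) subsetD[OF vec.span_mono[of "set vs" "set [u1 + d1] \<union> set vs"]] by simp blast
qed

lemma ind_scale: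
  assumes "ind (u # vs)" "c \<noteq> 0" shows "ind ((c *s u) # vs)"
  using ind_update[of "[]" u vs c 0] assms by (simp add: vec.span_zero)

lemma ind_nonzero: "ind vs \<Longrightarrow> v \<in> set vs \<Longrightarrow> v \<noteq> 0"
  unfolding ind_def using vec.dependent_zero by blast

lemma ind_sub: "ind vs \<Longrightarrow> set ws \<subseteq> set vs \<Longrightarrow> distinct ws \<Longrightarrow> ind ws"
  unfolding ind_def using vec.independent_mono by blast

lemma ind_append_span:
  assumes "ind (us @ vs)" "v \<in> vec.span (set vs)" "v \<noteq> 0" shows "v \<notin> vec.span (set us)"
proof
  assume "v \<in> vec.span (set us)"
  then obtain f where f: "v = (\<Sum>x\<in>set us. f x *s x)" using vec.span_finite[of "set us"] by auto
  obtain g where g: "v = (\<Sum>x\<in>set vs. g x *s x)" using assms(2) vec.span_finite[of "set vs"] by auto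
  define h where "h x = (if x \<in> set us then f x else - g x)" for x
  have disj: "set us \<inter> set vs = {}" and indep: "vec.independent (set us \<union> set vs)"
    using assms(1) by (auto simp: ind_def)
  have "(\<Sum>x\<in>set us \<union> set vs. h x *s x) = (\<Sum>x\<in>set us. h x *s x) + (\<Sum>x\<in>set vs. h x *s x)"
    by (rule sum.union_disjoint) (use disj in auto)
  also have "(\<Sum>x\<in>set us. h x *s x) = v" unfolding f by (rule sum.cong) (auto simp: h_def)
  also have "(\<Sum>x\<in>set vs. h x *s x) = (\<Sum>x\<in>set vs. - (g x *s x))"
    by (rule sum.cong) (use disj in \<open>auto simp: h_def\<close>)
  also have "\<dots> = - v" unfolding g by (simp add: sum_negf)
  finally have "(\<Sum>x\<in>set us \<union> set vs. h x *s x) = 0" by simp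
  then have "h x = 0" if "x \<in> set us" for x
    using vec.independentD[OF indep _ order_refl, of h x] that by simp
  then have "v = 0" unfolding f by (auto simp: h_def intro!: sum.neutral)
  then show False using assms(3) by simp
qed

lemma ind_Cons: "ind vs \<Longrightarrow> v \<notin> vec.span (set vs) \<Longrightarrow> ind (v # vs)"
  unfolding ind_def using vec.independent_insertI[of v "set vs"] vec.span_base[of v "set vs"] by auto

lemma perp_span:
  assumes "alt c" "\<forall>v\<in>set vs. c r v = 0" "set ws \<subseteq> vec.span (set vs)"
  shows "\<forall>v\<in>set ws. c r v = 0"
proof
  fix v assume "v \<in> set ws"
  then show "c r v = 0"
    using alt_span[OF assms(1), of "{r}" "set vs" r v] assms(2,3) vec.span_base[of r "{r}"] by blast
qed

lemma isotropic_span: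
  assumes "alt c" "\<forall>v\<in>set vs. \<forall>w\<in>set vs. c v w = 0" "set ws \<subseteq> vec.span (set vs)"
  shows "\<forall>v\<in>set ws. \<forall>w\<in>set ws. c v w = 0"
  using alt_span[OF assms(1), of "set vs" "set vs"] assms(2,3) by blast

lemma skew_pairs:
  assumes "alt a"
  shows "a v2 v1 = - a v1 v2 \<and> a v3 v1 = - a v1 v3 \<and> a v4 v1 = - a v1 v4 \<and> a v5 v1 = - a v1 v5 \<and> a v6 v1 = - a v1 v6 \<and>
    a v3 v2 = - a v2 v3 \<and> a v4 v2 = - a v2 v4 \<and> a v5 v2 = - a v2 v5 \<and> a v6 v2 = - a v2 v6 \<and> a v4 v3 = - a v3 v4 \<and>
    a v5 v3 = - a v3 v5 \<and> a v6 v3 = - a v3 v6 \<and> a v5 v4 = - a v4 v5 \<and> a v6 v4 = - a v4 v6 \<and> a v6 v5 = - a v5 v6"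
  by (intro conjI) (rule alt_skew[OF assms])+

lemma kernel_right: "alt a \<Longrightarrow> \<forall>y. a k y = 0 \<Longrightarrow> a y k = 0"
  using alt_skew[of a y k] by simp

lemma length_2: "length ws = 2 \<Longrightarrow> \<exists>x y. ws = [x, y]"
  by (auto simp: length_Suc_conv numeral_eq_Suc)

lemma length_3: "length ws = 3 \<Longrightarrow> \<exists>x y z. ws = [x, y, z]"
  by (auto simp: length_Suc_conv numeral_eq_Suc)

lemma length_4: "length ws = 4 \<Longrightarrow> \<exists>x y z w. ws = [x, y, z, w]"
  by (auto simp: length_Suc_conv numeral_eq_Suc)

text \<open>
  Darboux frames of four-dimensional spaces, by rank.
\<close>

lemma darboux_4:
  assumes b: "alt b" and ind: "ind (us @ vs)" and len: "length vs = 4"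
  obtains "\<forall>v\<in>set vs. \<forall>w\<in>set vs. b v w = 0"
  | p q x y where "ind (us @ [p, q, x, y])" "{p, q, x, y} \<subseteq> vec.span (set vs)" "b p q = 1"
    "b p x = 0" "b p y = 0" "b q x = 0" "b q y = 0" "b x y = 0"
  | p q x y where "ind (us @ [p, q, x, y])" "{p, q, x, y} \<subseteq> vec.span (set vs)" "b p q = 1"
    "b p x = 0" "b p y = 0" "b q x = 0" "b q y = 0" "b x y = 1"
proof (cases "\<forall>v\<in>set vs. \<forall>w\<in>set vs. b v w = 0")
  case False
  then obtain v w where vw: "v \<in> set vs" "w \<in> set vs" "b v w \<noteq> 0" by blast
  have "ind (vs @ us)" by (rule ind_cong[OF ind]) auto
  from hyperbolic_pair[OF b this vw] obtain p q ws where
    1: "ind (p # q # ws @ us)" "length vs = length ws + 2" "set (p # q # ws) \<subseteq> vec.span (set vs)"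
      "b p q = 1" "\<forall>w\<in>set ws. b p w = 0 \<and> b q w = 0" by blast
  obtain x y where ws: "ws = [x, y]" using length_2[of ws] 1(2) len by auto
  have ind': "ind (us @ [p, q, x, y])" by (rule ind_cong[OF 1(1)]) (auto simp: ws)
  show ?thesis
  proof (cases "b x y = 0")
    case True
    show ?thesis by (rule that(2)[OF ind' _ 1(4) _ _ _ _ True]) (use 1 ws in auto)
  next
    case False
    let ?y = "(1 / b x y) *s y"
    have "ind (y # us @ [p, q, x])" by (rule ind_cong[OF ind']) auto
    from ind_scale[OF this, of "1 / b x y"] have "ind (?y # us @ [p, q, x])" using False by simp
    then have "ind (us @ [p, q, x, ?y])" by (rule ind_cong) auto
    then show ?thesis
      by (rule that(3)[OF _ _ 1(4)]) (use 1 ws False in \<open>auto simp: alt_rules[OF b] intro: vec.span_scale\<close>)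
  qed
qed (use that in blast)

lemmas leaf_simps = coords_def list_nth rep_simps bracket_nth axis_def eq_6 eq_2

lemma form_shift: "form t (s2 + m *s s1) x y = form t s2 x y + m * form t s1 x y"
  using form_lin[of t 1 s2 m s1 x y] by simp

lemma form_scale: "form t (m *s s) x y = m * form t s x y"
  using form_lin[of t m s 0 s x y] by simp

lemma ind2_swap: "ind [s1, s2] \<Longrightarrow> ind [s2, s1]"
  by (erule ind_cong) auto

lemma ind2_shift: "ind [s1, s2] \<Longrightarrow> ind [s1, s2 + m *s s1]"
proof -
  assume "ind [s1, s2]"
  from ind_shear1[OF ind2_swap[OF this], of "m *s s1"] have "ind [s2 + m *s s1, s1]"
    by (simp add: vec.span_scale vec.span_base)
  then show ?thesis by (rule ind2_swap)
qed

lemma form_zero_frame: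
  assumes t: "t \<in> E_Wedge2_F" and v: "ind vs" "length vs = 6" and 0: "\<forall>w\<in>set vs. form t s x w = 0"
  shows "\<forall>y. form t s x y = 0"
proof
  fix y
  have "y \<in> vec.span (set vs)" using ind_span_UNIV[OF v(1)] v(2) by simp
  then show "form t s x y = 0"
    using alt_span[OF alt_form[OF t], of "{x}" "set vs" s x y] 0 vec.span_base[of x "{x}"] by blast
qed

lemma frame_exists: "\<exists>v1 v2 v3 v4 v5 v6 :: complex ^ 6. ind [v1, v2, v3, v4, v5, v6]"
proof -
  have "distinct [axis 1 1, axis 2 1, axis 3 1, axis 4 1, axis 5 1, axis 6 1 :: complex ^ 6]"
    by (simp add: axis_eq_axis eq_6)
  moreover have "{axis 1 1, axis 2 1, axis 3 1, axis 4 1, axis 5 1, axis 6 1 :: complex ^ 6} = cart_basis"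
    unfolding cart_basis_def using UNIV_6 by (auto simp: axis_eq_axis)
  ultimately have "ind [axis 1 1, axis 2 1, axis 3 1, axis 4 1, axis 5 1, axis 6 1 :: complex ^ 6]"
    unfolding ind_def using vec.independent_Basis by simp
  then show ?thesis by blast
qed

section \<open>Pencils with a member of rank at most two\<close>

lemma classify_one_form:
  assumes t: "t \<in> E_Wedge2_F" and s: "ind [s1, s2]" and a0: "\<And>x y. form t s1 x y = 0"
  shows "\<exists>n\<le>14. t \<in> orbit (std_rep n)"
proof -
  let ?b = "form t s2"
  note b = alt_form[OF t, of s2]
  note s' = ind2_swap[OF s]
  obtain v1 v2 v3 v4 v5 v6 :: "complex ^ 6" where v: "ind [v1, v2, v3, v4, v5, v6]" using frame_exists by blast
  show ?thesis
  proof (cases "\<forall>v\<in>set [v1, v2, v3, v4, v5, v6]. \<forall>w\<in>set [v1, v2, v3, v4, v5, v6]. ?b v w = 0")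
    case True
    show ?thesis
      by (rule normal_form[OF t, of 0, OF _ s' v]) (use True in \<open>simp_all add: leaf_simps a0\<close>)
  next
    case False
    then obtain x y where xy: "x \<in> set [v1, v2, v3, v4, v5, v6]" "y \<in> set [v1, v2, v3, v4, v5, v6]" "?b x y \<noteq> 0"
      by blast
    have "ind ([v1, v2, v3, v4, v5, v6] @ [])" using v by simp
    from hyperbolic_pair[OF b this xy] obtain p q ws where
      1: "ind ([p, q] @ ws)" "length ws = 4" "?b p q = 1" "\<forall>w\<in>set ws. ?b p w = 0 \<and> ?b q w = 0" by auto
    have pq: "\<forall>v\<in>set xs. ?b p v = 0 \<and> ?b q v = 0" if "set xs \<subseteq> vec.span (set ws)" for xs
      using perp_span[OF b, of ws p xs] perp_span[OF b, of ws q xs] 1(4) that by blast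
    show ?thesis
    proof (cases rule: darboux_4[OF b 1(1,2)])
      case 1: 1
      obtain x y z w where ws: "ws = [x, y, z, w]" using length_4 \<open>length ws = 4\<close> by blast
      have i: "ind [p, q, x, y, z, w]" using \<open>ind ([p, q] @ ws)\<close> by (simp add: ws)
      show ?thesis
        by (rule normal_form[OF t, of 1, OF _ s' i])
          (use 1 \<open>?b p q = 1\<close> \<open>\<forall>w\<in>set ws. ?b p w = 0 \<and> ?b q w = 0\<close> in \<open>simp_all add: leaf_simps a0 ws\<close>)
    next
      case (2 p' q' x y)
      have i: "ind [p, q, p', q', x, y]" using 2(1) by simp
      have "set [p', q', x, y] \<subseteq> vec.span (set ws)" using 2(2) by simp
      from pq[OF this] show ?thesis
        by (intro normal_form[OF t, of 2, OF _ s' i]) (use 2 1(3) in \<open>simp_all add: leaf_simps a0\<close>)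
    next
      case (3 p' q' x y)
      have i: "ind [p, q, p', q', x, y]" using 3(1) by simp
      have "set [p', q', x, y] \<subseteq> vec.span (set ws)" using 3(2) by simp
      from pq[OF this] show ?thesis
        by (intro normal_form[OF t, of 4, OF _ s' i]) (use 3 1(3) in \<open>simp_all add: leaf_simps a0\<close>)
    qed
  qed
qed

lemma form_shift_minus: "form t (s2 - m *s s1) x y = form t s2 x y - m * form t s1 x y"
  using form_shift[of t s2 "- m" s1 x y] by simp

lemma skew_pairs_4:
  assumes "alt a"
  shows "a v2 v1 = - a v1 v2 \<and> a v3 v1 = - a v1 v3 \<and> a v4 v1 = - a v1 v4 \<and>
    a v3 v2 = - a v2 v3 \<and> a v4 v2 = - a v2 v4 \<and> a v4 v3 = - a v3 v4"
  by (intro conjI) (rule alt_skew[OF assms])+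

text \<open>
  Unless the form of \<open>s1\<close> is zero, it is the sum of a hyperbolic plane and a four-dimensional kernel. The restriction of the
  other form \<open>b\<close> to the kernel has rank \<open>0\<close>, \<open>2\<close> or \<open>4\<close>. The plane is made orthogonal to the nondegenerate
  part of this restriction, and what remains is the pairing between the plane and the radical. The value of \<open>b\<close> on
  the plane is removed by subtracting a multiple of \<open>s1\<close>. The representatives \<open>1\<close>, \<open>3\<close>, \<open>5\<close> (rank \<open>0\<close>),
  \<open>6\<close>, \<open>7\<close>, \<open>9\<close> (rank \<open>2\<close>) and \<open>12\<close> (rank \<open>4\<close>) arise.
\<close>

lemma classify_rank_2:
  assumes t: "t \<in> E_Wedge2_F" and s: "ind [s1, s2]" and v: "ind [v1, v2, v3, v4, v5, v6]"
    and ker: "\<And>x y. x \<in> {v3, v4, v5, v6} \<Longrightarrow> form t s1 x y = 0"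
  shows "\<exists>n\<le>14. t \<in> orbit (std_rep n)"
proof -
  let ?a = "form t s1"
  have altf: "alt (form t r)" for r by (rule alt_form[OF t])
  note ar = alt_rules[OF altf]
  have sw: "ind [s2 + m *s s1, s1]" "ind [s1, s2 + m *s s1]" for m
    using ind2_shift[OF s, of m] by (auto intro: ind2_swap)
  define K where "K = vec.span (set [v3, v4, v5, v6])"
  have kerK: "?a x y = 0" "?a y x = 0" if "x \<in> K" for x y
  proof -
    show "?a x y = 0" for y using alt_span_left[OF altf, of "set [v3, v4, v5, v6]" s1 y x] that ker K_def by auto
    then show "?a y x = 0" using alt_skew[OF altf, of s1 y x] by simp
  qed
  show ?thesis
  proof (cases "?a v1 v2 = 0")
    case True
    have "\<forall>w\<in>set [v1, v2, v3, v4, v5, v6]. ?a v w = 0" if "v \<in> set [v1, v2, v3, v4, v5, v6]" for v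
      using that True ker kerK alt_skew[OF altf, of s1 v2 v1] ar(5)
      by (auto simp: K_def vec.span_base)
    then have "?a x y = 0" for x y
      using alt_span[OF altf, of "set [v1, v2, v3, v4, v5, v6]" "set [v1, v2, v3, v4, v5, v6]" s1 x y]
        ind_span_UNIV[OF v] by auto
    then show ?thesis by (rule classify_one_form[OF t s])
  next
    case False
    define w2 where "w2 = (1 / ?a v1 v2) *s v2"
    have a12: "?a v1 w2 = 1" unfolding w2_def using False by (simp add: ar)
    have "ind (v2 # [v1, v3, v4, v5, v6])" by (rule ind_cong[OF v]) auto
    from ind_scale[OF this, of "1 / ?a v1 v2"] have "ind (w2 # [v1, v3, v4, v5, v6])" using False by (simp add: w2_def)
    then have ind: "ind ([v1, w2] @ [v3, v4, v5, v6])" by (rule ind_cong) auto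
    let ?b = "form t s2"
    have len: "length [v3, v4, v5, v6] = 4" by simp
    show ?thesis
    proof (cases rule: darboux_4[OF altf[of s2] ind len, case_names zero two four])
      case zero
      have ind': "ind (v1 # w2 # [] @ [v3, v4, v5, v6])" using ind by simp
      show ?thesis
      proof (cases rule: pairing_normal_form[OF altf[of s2] ind'])
        case (1 q1 q2 ws)
        obtain x y z w where ws: "ws = [x, y, z, w]" using length_4[of ws] 1(2) by auto
        have i: "ind [q1, q2, x, y, z, w]" using 1(1) by (simp add: ws)
        have K: "x \<in> K" "y \<in> K" "z \<in> K" "w \<in> K" using 1(3) by (auto simp: ws K_def)
        have b0: "\<forall>v\<in>set ws. \<forall>w\<in>set ws. ?b v w = 0" by (rule isotropic_span[OF altf zero 1(3)])
        show ?thesis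
          by (rule normal_form[OF t, of 1, OF _ sw(2)[of "- ?b q1 q2"] i])
            (use 1 b0 in \<open>simp_all add: leaf_simps form_shift form_shift_minus kerK K ws a12 1(5)[OF altf]\<close>)
      next
        case (2 q1 q2 w ws)
        obtain x y z where ws: "ws = [x, y, z]" using length_3[of ws] 2(2) by auto
        have i: "ind [q1, q2, w, x, y, z]" using 2(1) by (simp add: ws)
        have K: "x \<in> K" "y \<in> K" "z \<in> K" "w \<in> K" using 2(3) by (auto simp: ws K_def)
        have b0: "\<forall>v\<in>set (w # ws). \<forall>w\<in>set (w # ws). ?b v w = 0"
          by (rule isotropic_span[OF altf zero 2(3)])
        show ?thesis
          by (rule normal_form[OF t, of 3, OF _ sw(2)[of "- ?b q1 q2"] i])
            (use 2 b0 in \<open>simp_all add: leaf_simps form_shift form_shift_minus kerK K ws a12 2(5)[OF altf]\<close>)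
      next
        case (3 q1 q2 w1 w2' ws)
        obtain x y where ws: "ws = [x, y]" using length_2[of ws] 3(2) by auto
        have i: "ind [q1, w1, q2, w2', x, y]" by (rule ind_cong[OF 3(1)]) (auto simp: ws)
        have K: "x \<in> K" "y \<in> K" "w1 \<in> K" "w2' \<in> K" using 3(3) by (auto simp: ws K_def)
        have b0: "\<forall>v\<in>set (w1 # w2' # ws). \<forall>w\<in>set (w1 # w2' # ws). ?b v w = 0"
          by (rule isotropic_span[OF altf zero 3(3)])
        show ?thesis
          by (rule normal_form[OF t, of 5, OF _ sw(1)[of "- ?b q1 q2"] i])
            (use 3 b0 in \<open>simp_all add: leaf_simps form_shift form_shift_minus kerK K ws a12 3(5)[OF altf]
              skew_pairs[OF altf[of s2], of q2 q1 w1 w2' x y]\<close>)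
      qed
    next
      case (two p q x y)
      have K: "p \<in> K" "q \<in> K" "x \<in> K" "y \<in> K" using two(2) by (auto simp: K_def)
      define d where "d v = ?b q v *s p - ?b p v *s q" for v
      have dK: "d v \<in> vec.span (set [p, q, x, y])" for v
        unfolding d_def by (intro vec.span_diff vec.span_scale vec.span_base) simp_all
      have dKK: "d v \<in> K" for v unfolding d_def K_def using K[unfolded K_def] by (intro vec.span_diff vec.span_scale)
      have "ind (v1 # w2 # [p, q, x, y])" using two(1) by simp
      from ind_shear2[OF this dK[of v1] dK[of w2]]
      have i: "ind ((v1 + d v1) # (w2 + d w2) # [p, q] @ [x, y])" by simp
      have pv: "?b p (v + d v) = 0" "?b q (v + d v) = 0" for v
        unfolding d_def using two(3) alt_skew[OF altf, of s2 q p] by (simp_all add: ar)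
      have pqv: "?b p r = 0 \<and> ?b q r = 0" if "r \<in> vec.span {v1 + d v1, w2 + d w2}" for r
        using perp_span[OF altf, of "[v1 + d v1, w2 + d w2]" s2 p "[r]"]
          perp_span[OF altf, of "[v1 + d v1, w2 + d w2]" s2 q "[r]"] pv that by simp
      have pqx: "?b p r = 0 \<and> ?b q r = 0" if "r \<in> vec.span (set [x, y])" for r
        using perp_span[OF altf, of "[x, y]" s2 p "[r]"] perp_span[OF altf, of "[x, y]" s2 q "[r]"] two that by simp
      have xy0: "\<forall>v\<in>set [x, y]. \<forall>w\<in>set [x, y]. ?b v w = 0"
        using two alt_skew[OF altf, of s2 y x] by (simp add: ar)
      have a12': "?a (v1 + d v1) (w2 + d w2) = 1" by (simp add: ar kerK dKK a12)
      have subK: "r \<in> K" if "r \<in> vec.span (set [x, y])" for r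
        using that K vec.span_minimal[of "set [x, y]" K] by (auto simp: K_def)
      show ?thesis
      proof (cases rule: pairing_normal_form[OF altf[of s2] i])
        case (1 q1 q2 ws)
        obtain z w where ws: "ws = [z, w]" using length_2[of ws] 1(2) by auto
        have j: "ind [q1, q2, p, q, z, w]" using 1(1) by (simp add: ws)
        have sub: "z \<in> vec.span (set [x, y])" "w \<in> vec.span (set [x, y])" using 1(3) by (auto simp: ws)
        have sub': "q1 \<in> vec.span {v1 + d v1, w2 + d w2}" "q2 \<in> vec.span {v1 + d v1, w2 + d w2}" using 1(4) by auto
        have z0: "?b z w = 0" using isotropic_span[OF altf xy0 1(3)] by (simp add: ws)
        show ?thesis
          by (rule normal_form[OF t, of 6, OF _ sw(2)[of "- ?b q1 q2"] j])
            (use 1 in \<open>simp_all add: leaf_simps form_shift form_shift_minus kerK K subK[OF sub(1)] subK[OF sub(2)] ws a12' 1(5)[OF altf] two(3) z0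
              pqx[OF sub(1)] pqx[OF sub(2)] pqv[OF sub'(1)] pqv[OF sub'(2)] skew_pairs[OF altf[of s2], of q p q1 q2 z w]\<close>)
      next
        case (2 q1 q2 w ws)
        obtain z where ws: "ws = [z]" using 2(2) by (cases ws) auto
        have j: "ind [p, q, q1, q2, w, z]" by (rule ind_cong[OF 2(1)]) (auto simp: ws)
        have sub: "z \<in> vec.span (set [x, y])" "w \<in> vec.span (set [x, y])" using 2(3) by (auto simp: ws)
        have sub': "q1 \<in> vec.span {v1 + d v1, w2 + d w2}" "q2 \<in> vec.span {v1 + d v1, w2 + d w2}" using 2(4) by auto
        have z0: "?b w z = 0" using isotropic_span[OF altf xy0 2(3)] by (simp add: ws)
        show ?thesis
          by (rule normal_form[OF t, of 7, OF _ sw(1)[of "- ?b q1 q2"] j])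
            (use 2 in \<open>simp_all add: leaf_simps form_shift form_shift_minus kerK K subK[OF sub(1)] subK[OF sub(2)] ws a12' 2(5)[OF altf] two(3) z0
              pqx[OF sub(1)] pqx[OF sub(2)] pqv[OF sub'(1)] pqv[OF sub'(2)]\<close>)
      next
        case (3 q1 q2 w z ws)
        have ws: "ws = []" using 3(2) by simp
        have j: "ind [p, q, q1, q2, w, z]" by (rule ind_cong[OF 3(1)]) (auto simp: ws)
        have sub: "z \<in> vec.span (set [x, y])" "w \<in> vec.span (set [x, y])" using 3(3) by (auto simp: ws)
        have sub': "q1 \<in> vec.span {v1 + d v1, w2 + d w2}" "q2 \<in> vec.span {v1 + d v1, w2 + d w2}" using 3(4) by auto
        have z0: "?b w z = 0" using isotropic_span[OF altf xy0 3(3)] by (simp add: ws)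
        show ?thesis
          by (rule normal_form[OF t, of 9, OF _ sw(1)[of "- ?b q1 q2"] j])
            (use 3 in \<open>simp_all add: leaf_simps form_shift form_shift_minus kerK K subK[OF sub(1)] subK[OF sub(2)] ws a12' 3(5)[OF altf] two(3) z0
              pqx[OF sub(1)] pqx[OF sub(2)] pqv[OF sub'(1)] pqv[OF sub'(2)]\<close>)
      qed
    next
      case (four p q x y)
      have K: "p \<in> K" "q \<in> K" "x \<in> K" "y \<in> K" using four(2) by (auto simp: K_def)
      define d where "d v = ?b q v *s p - ?b p v *s q + ?b y v *s x - ?b x v *s y" for v
      have dK: "d v \<in> vec.span (set [p, q, x, y])" for v
        unfolding d_def by (intro vec.span_diff vec.span_add vec.span_scale vec.span_base) simp_all
      have dKK: "d v \<in> K" for v unfolding d_def K_def using K[unfolded K_def] by (intro vec.span_diff vec.span_add vec.span_scale)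
      have "ind (v1 # w2 # [p, q, x, y])" using four(1) by simp
      from ind_shear2[OF this dK[of v1] dK[of w2]]
      have "ind ((v1 + d v1) # (w2 + d w2) # [p, q, x, y])" .
      then have j: "ind [p, q, v1 + d v1, w2 + d w2, x, y]" by (rule ind_cong) auto
      have pv: "?b p (v + d v) = 0" "?b q (v + d v) = 0" "?b x (v + d v) = 0" "?b y (v + d v) = 0" for v
        unfolding d_def by (simp_all add: ar four(3-8) skew_pairs_4[OF altf[of s2], of q p x y])
      have a12': "?a (v1 + d v1) (w2 + d w2) = 1" by (simp add: ar kerK dKK a12)
      define u1 u2 where "u1 = v1 + d v1" and "u2 = w2 + d w2"
      show ?thesis
        by (rule normal_form[OF t, of 12, OF _ sw(1)[of "- ?b u1 u2"] j[folded u1_def u2_def]])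
          (use four pv[of v1, folded u1_def] pv[of w2, folded u2_def] a12'[folded u1_def u2_def] in
            \<open>simp_all add: leaf_simps form_shift form_shift_minus kerK K skew_pairs[OF altf[of s2], of q p x y u1 u2]\<close>)
    qed
  qed
qed

section \<open>Pencils of larger rank\<close>

text \<open>
  Rank at most two, expressed by four independent vectors in the kernel.
\<close>

definition low_rank :: "tensors \<Rightarrow> complex ^ 2 \<Rightarrow> bool"
  where "low_rank t s \<longleftrightarrow> (\<exists>v1 v2 v3 v4 v5 v6. ind [v1, v2, v3, v4, v5, v6] \<and>
    (\<forall>x\<in>{v3, v4, v5, v6}. \<forall>y. form t s x y = 0))"

lemma singular_pair:
  assumes a: "alt a" and b: "alt b" and ind: "ind [u1, u2, u3, u4]"
    and nd: "\<And>v. v \<in> vec.span (set [u1, u2, u3, u4]) \<Longrightarrow> v \<noteq> 0 \<Longrightarrow> \<forall>w\<in>set [u1, u2, u3, u4]. a v w = 0 \<Longrightarrow> False"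
  shows "\<exists>m v. v \<in> vec.span (set [u1, u2, u3, u4]) \<and> v \<noteq> 0 \<and> (\<forall>w\<in>set [u1, u2, u3, u4]. b v w + m * a v w = 0)"
proof -
  define u :: "4 \<Rightarrow> complex ^ 6" where "u i = (if i = 1 then u1 else if i = 2 then u2 else if i = 3 then u3 else u4)" for i
  have u: "u 1 = u1" "u 2 = u2" "u 3 = u3" "u 4 = u4" by (simp_all add: u_def)
  obtain x y where xy: "(x, y) \<noteq> (0, 0)"
    "det (\<chi> i j. x * (\<chi> i j. b (u i) (u j)) $ i $ j + y * (\<chi> i j. a (u i) (u j)) $ i $ j) = 0"
    using singular_combination[of "\<chi> i j. b (u i) (u j)" "\<chi> i j. a (u i) (u j)"] by blast
  define M where "M = (\<chi> i j. x * b (u i) (u j) + y * a (u i) (u j))"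
  have "det M = 0" using xy(2) by (simp add: M_def)
  then have "\<not> invertible M" by (simp add: invertible_det_nz)
  then obtain c where c: "c \<noteq> 0" "M *v c = 0"
    using matrix_left_invertible_ker[of M] invertible_left_inverse[of M] by blast
  define v where "v = c $ 1 *s u1 + c $ 2 *s u2 + c $ 3 *s u3 + c $ 4 *s u4"
  have vs: "v \<in> vec.span (set [u1, u2, u3, u4])"
    unfolding v_def by (intro vec.span_add vec.span_scale vec.span_base) simp_all
  have v0: "v \<noteq> 0"
  proof
    assume "v = 0"
    have dist: "distinct [u1, u2, u3, u4]" and indep: "vec.independent {u1, u2, u3, u4}"
      using ind by (simp_all add: ind_def)
    define h where "h w = (if w = u1 then c $ 1 else if w = u2 then c $ 2 else if w = u3 then c $ 3 else c $ 4)" for w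
    have h: "h u1 = c $ 1" "h u2 = c $ 2" "h u3 = c $ 3" "h u4 = c $ 4" using dist by (auto simp: h_def)
    have "(\<Sum>w\<in>{u1, u2, u3, u4}. h w *s w) = v" using dist by (simp add: h v_def add.assoc)
    then have "h w = 0" if "w \<in> {u1, u2, u3, u4}" for w
      using vec.independentD[OF indep _ order_refl, of h w] that \<open>v = 0\<close> by simp
    then have "c $ 1 = 0" "c $ 2 = 0" "c $ 3 = 0" "c $ 4 = 0" using h by (metis insertI1 insertI2)+
    then have "c = 0" by (simp add: vec_eq_iff forall_4)
    then show False using c(1) by simp
  qed
  have "x * b (u i) v + y * a (u i) v = (M *v c) $ i" for i
    by (simp add: M_def matrix_vector_mult_def sum_4 v_def u alt_rules[OF a] alt_rules[OF b] algebra_simps)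
  then have ker: "x * b (u i) v + y * a (u i) v = 0" for i using c(2) by simp
  then have ker': "x * b v (u i) + y * a v (u i) = 0" for i
    using alt_skew[OF a, of v "u i"] alt_skew[OF b, of v "u i"] by (metis add.inverse_distrib_swap add.commute add.inverse_neutral mult_minus_right)
  have "x \<noteq> 0"
  proof
    assume "x = 0"
    then have "a v (u i) = 0" for i using ker'[of i] xy(1) by simp
    then have "\<forall>w\<in>set [u1, u2, u3, u4]. a v w = 0" using u by (metis empty_iff empty_set set_ConsD)
    then show False using nd vs v0 by blast
  qed
  then have "b v (u i) + (y / x) * a v (u i) = 0" for i
    using ker'[of i] by (simp add: field_simps)
  then have "\<forall>w\<in>set [u1, u2, u3, u4]. b v w + (y / x) * a v w = 0" using u by (metis empty_iff empty_set set_ConsD)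
  then show ?thesis using vs v0 by blast
qed

lemma span_4_coeffs:
  assumes "x \<in> vec.span {u1, u2, u3, u4 :: complex ^ 'n}"
  shows "\<exists>c1 c2 c3 c4. x = c1 *s u1 + c2 *s u2 + c3 *s u3 + c4 *s u4"
proof -
  obtain c1 where "x - c1 *s u1 \<in> vec.span {u2, u3, u4}" using assms vec.span_insert[of u1] by auto
  then obtain c2 where "x - c1 *s u1 - c2 *s u2 \<in> vec.span {u3, u4}" using vec.span_insert[of u2] by auto
  then obtain c3 where "x - c1 *s u1 - c2 *s u2 - c3 *s u3 \<in> vec.span {u4}" using vec.span_insert[of u3] by auto
  then obtain c4 where "x - c1 *s u1 - c2 *s u2 - c3 *s u3 - c4 *s u4 \<in> vec.span {}" using vec.span_insert[of u4] by auto
  then have "x = c1 *s u1 + c2 *s u2 + c3 *s u3 + c4 *s u4"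
    by (simp add: algebra_simps)
  then show ?thesis by blast
qed

text \<open>
  A pencil whose nonzero members all have rank at least four, together with a member \<open>s1\<close> whose kernel has dimension
  at most two. Both conditions are used to exclude degenerate subcases below.
\<close>

locale rank_4_member =
  fixes t s1 s2
  assumes t: "t \<in> E_Wedge2_F" and s: "ind [s1, s2]"
    and not_low: "\<And>r. r \<noteq> 0 \<Longrightarrow> \<not> low_rank t r"
    and small_kernel: "\<And>x y z. ind [x, y, z] \<Longrightarrow> \<forall>w. form t s1 x w = 0 \<Longrightarrow> \<forall>w. form t s1 y w = 0 \<Longrightarrow>
      \<forall>w. form t s1 z w = 0 \<Longrightarrow> False"
begin

lemma altf: "alt (form t r)"
  by (rule alt_form[OF t])

lemmas ar = alt_rules[OF altf]

lemma frames: "ind [s2 + m *s s1, s1]" "ind [s1, s2 + m *s s1]"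
  using ind2_shift[OF s, of m] by (auto intro: ind2_swap)

lemma nondegenerate:
  assumes "ind ([k1, k2] @ vs)" "length vs = 4" "\<forall>y. form t s1 k1 y = 0" "\<forall>y. form t s1 k2 y = 0"
    and "v \<in> vec.span (set vs)" "v \<noteq> 0" "\<forall>w\<in>set vs. form t s1 v w = 0"
  shows False
proof -
  have "form t s1 v k1 = 0" "form t s1 v k2 = 0" using kernel_right[OF altf] assms(3,4) by blast+
  then have frame: "\<forall>w\<in>set ([k1, k2] @ vs). form t s1 v w = 0" using assms(7) by auto
  have v: "\<forall>w. form t s1 v w = 0"
    by (rule form_zero_frame[OF t assms(1) _ frame]) (use assms(2) in simp)
  have "ind [k1, k2]" by (rule ind_sub[OF assms(1)]) (use assms(1) in \<open>auto simp: ind_def\<close>)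
  moreover have "v \<notin> vec.span (set [k1, k2])" by (rule ind_append_span[OF assms(1,5,6)])
  ultimately have "ind [v, k1, k2]" by (rule ind_Cons)
  then show False using small_kernel v assms(3,4) by blast
qed

lemma nondegenerate_frame:
  assumes "ind [k1, k2, u1, u2, u3, u4]" "\<forall>y. form t s1 k1 y = 0" "\<forall>y. form t s1 k2 y = 0"
    and "u \<in> {u1, u2, u3, u4}" "\<forall>w\<in>{u1, u2, u3, u4}. form t s1 u w = 0"
  shows False
proof (rule nondegenerate[of k1 k2 "[u1, u2, u3, u4]" u])
  show "ind ([k1, k2] @ [u1, u2, u3, u4])" using assms(1) by simp
  show "u \<noteq> 0" using ind_nonzero[OF assms(1), of u] assms(4) by auto
qed (use assms in \<open>auto intro: vec.span_base\<close>)

lemma not_lowI: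
  assumes "r \<noteq> 0" "ind [v1, v2, v3, v4, v5, v6]" "\<And>x y. x \<in> {v3, v4, v5, v6} \<Longrightarrow> y \<in> {v1, v2, v3, v4, v5, v6} \<Longrightarrow> form t r x y = 0"
  shows False
proof -
  have "\<forall>y. form t r x y = 0" if "x \<in> {v3, v4, v5, v6}" for x
    by (rule form_zero_frame[OF t assms(2)]) (use assms(3) that in auto)
  then have "low_rank t r" using assms(2) unfolding low_rank_def by blast
  then show False using not_low assms(1) by blast
qed

lemma second_nonzero: "s2 + m *s s1 \<noteq> 0"
  using ind_nonzero[OF frames(1)[of m], of "s2 + m *s s1"] by simp

text \<open>
  On a complement \<open>vs\<close> of the kernel the form of \<open>s1\<close> is nondegenerate. Therefore some \<open>s2 + m *s s1\<close> is degenerate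
  there, so it has rank \<open>0\<close> or \<open>2\<close> on the complement.
\<close>

lemma split_quadruple:
  assumes ind: "ind ([k1, k2] @ vs)" and len: "length vs = 4"
    and ker: "\<forall>y. form t s1 k1 y = 0" "\<forall>y. form t s1 k2 y = 0"
  obtains m where "\<forall>v\<in>set vs. \<forall>w\<in>set vs. form t (s2 + m *s s1) v w = 0"
  | m p q x y where "ind ([k1, k2] @ [p, q, x, y])" "{p, q, x, y} \<subseteq> vec.span (set vs)"
    "form t (s2 + m *s s1) p q = 1" "form t (s2 + m *s s1) p x = 0" "form t (s2 + m *s s1) p y = 0"
    "form t (s2 + m *s s1) q x = 0" "form t (s2 + m *s s1) q y = 0" "form t (s2 + m *s s1) x y = 0"
proof -
  obtain u1 u2 u3 u4 where vs: "vs = [u1, u2, u3, u4]" using length_4[OF len] by blast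
  have "ind [u1, u2, u3, u4]" by (rule ind_sub[OF ind]) (use ind in \<open>auto simp: vs ind_def\<close>)
  from singular_pair[OF altf altf this, of s1 s2] nondegenerate[OF ind len ker]
  obtain m v where v: "v \<in> vec.span (set vs)" "v \<noteq> 0" "\<forall>w\<in>set vs. form t s2 v w + m * form t s1 v w = 0"
    unfolding vs by blast
  let ?b = "form t (s2 + m *s s1)"
  have bv: "\<forall>w\<in>set vs. ?b v w = 0" using v(3) by (simp add: form_shift)
  show ?thesis
  proof (cases rule: darboux_4[OF altf[of "s2 + m *s s1"] ind len, case_names zero two four])
    case zero
    then show ?thesis by (rule that(1))
  next
    case (two p q x y)
    then show ?thesis by (rule that(2))
  next
    case (four p q x y)
    have "set [p, q, x, y] \<subseteq> vec.span (set vs)" using four(2) by simp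
    then have 0: "\<forall>w\<in>set [p, q, x, y]. ?b v w = 0" by (rule perp_span[OF altf bv])
    have "set vs \<subseteq> vec.span {p, q, x, y}"
    proof -
      have "ind [p, q, x, y]" by (rule ind_sub[OF four(1)]) (use four(1) in \<open>auto simp: ind_def\<close>)
      then have "vec.independent {p, q, x, y}" "card {p, q, x, y} = 4" by (simp_all add: ind_def)
      moreover have "vec.dim (vec.span (set vs)) \<le> 4"
        using vec.dim_le_card'[of "set vs"] card_length[of vs] len by simp
      ultimately have "vec.span (set vs) \<subseteq> vec.span {p, q, x, y}"
        using four(2) by (intro vec.card_ge_dim_independent[of "{p, q, x, y}" "vec.span (set vs)"]) simp_all
      then show ?thesis using vec.span_superset[of "set vs"] by blast
    qed
    then have "v \<in> vec.span {p, q, x, y}" using v(1) vec.span_minimal[of "set vs" "vec.span {p, q, x, y}"] by auto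
    then obtain c1 c2 c3 c4 where c: "v = c1 *s p + c2 *s q + c3 *s x + c4 *s y" using span_4_coeffs by blast
    have "?b v q = c1" "?b v p = - c2" "?b v y = c3" "?b v x = - c4"
      unfolding c by (simp_all add: ar four(3-8) skew_pairs_4[OF altf[of "s2 + m *s s1"], of q p x y])
    then have "v = 0" using 0 c by simp
    then show ?thesis using v(2) by simp
  qed
qed

end

context rank_4_member
begin

lemma frame_scale: "ind [r1, r2] \<Longrightarrow> c \<noteq> 0 \<Longrightarrow> ind [c *s r1, r2]"
  by (rule ind_scale)

text \<open>
  The four remaining vectors are made orthogonal to the kernel plane for both forms. After a shift of \<open>s2\<close> by a multiple of \<open>s1\<close> the
  second form has rank \<open>2\<close> on them, with radical \<open>x, y\<close>. If \<open>x, y\<close> is not isotropic for the first form, both forms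
  are diagonal in a common hyperbolic frame, which is the generic case \<open>14\<close>; otherwise the pencil is in the orbit of the representative \<open>13\<close>.
\<close>

lemma classify_kernel_nondegenerate:
  assumes ind: "ind [k1, k2, u1, u2, u3, u4]"
    and ker: "\<forall>y. form t s1 k1 y = 0" "\<forall>y. form t s1 k2 y = 0"
    and nz: "form t s2 k1 k2 \<noteq> 0"
  shows "\<exists>n\<le>14. t \<in> orbit (std_rep n)"
proof -
  let ?a = "form t s1"
  define \<kappa> where "\<kappa> = form t s2 k1 k2"
  define k where "k = (1 / \<kappa>) *s k2"
  have kk: "form t s2 k1 k = 1" using nz by (simp add: k_def \<kappa>_def ar)
  have kerk: "\<forall>y. ?a k y = 0" using ker(2) by (simp add: k_def ar)
  define d where "d v = form t s2 k v *s k1 - form t s2 k1 v *s k" for v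
  have kd: "form t s2 k1 (v + d v) = 0" "form t s2 k (v + d v) = 0" for v
    using kk alt_skew[OF altf, of s2 k k1] by (simp_all add: d_def ar)
  have "ind (k2 # [k1, u1, u2, u3, u4])" by (rule ind_cong[OF ind]) auto
  from ind_scale[OF this, of "1 / \<kappa>"] have i0: "ind ([k, k1] @ [u1, u2, u3, u4])" using nz by (simp add: k_def \<kappa>_def)
  have i: "ind ([k1, k] @ map (\<lambda>v. v + d v) [u1, u2, u3, u4])"
  proof (rule ind_exchange[OF i0])
    let ?S = "vec.span (set ([k1, k] @ map (\<lambda>v. v + d v) [u1, u2, u3, u4]))"
    have S: "k1 \<in> ?S" "k \<in> ?S" by (auto intro: vec.span_base)
    have "v \<in> ?S" if "v \<in> {u1, u2, u3, u4}" for v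
    proof -
      have "v + d v \<in> ?S" using that by (auto intro: vec.span_base)
      moreover have "d v \<in> ?S"
        by (subst d_def) (intro vec.span_diff vec.span_scale S)
      ultimately have "(v + d v) - d v \<in> ?S" by (rule vec.span_diff)
      then show ?thesis by simp
    qed
    then show "set ([k, k1] @ [u1, u2, u3, u4]) \<subseteq> ?S" using S by auto
  qed simp
  let ?vs = "map (\<lambda>v. v + d v) [u1, u2, u3, u4]"
  have kv: "\<forall>v\<in>set ?vs. form t s2 k1 v = 0 \<and> form t s2 k v = 0" using kd by auto
  have len: "length ?vs = 4" by simp
  show ?thesis
  proof (cases rule: split_quadruple[OF i len ker(1) kerk, case_names zero two])
    case (zero m)
    have False
    proof (rule not_lowI[OF second_nonzero[of m], of k1 k "u1 + d u1" "u2 + d u2" "u3 + d u3" "u4 + d u4"])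
      show "ind [k1, k, u1 + d u1, u2 + d u2, u3 + d u3, u4 + d u4]" using i by simp
      fix x y
      assume x: "x \<in> {u1 + d u1, u2 + d u2, u3 + d u3, u4 + d u4}"
        and y: "y \<in> {k1, k, u1 + d u1, u2 + d u2, u3 + d u3, u4 + d u4}"
      have "form t (s2 + m *s s1) k1 x = 0" "form t (s2 + m *s s1) k x = 0"
        using x kv ker(1) kerk by (auto simp: form_shift)
      then have "form t (s2 + m *s s1) x k1 = 0" "form t (s2 + m *s s1) x k = 0"
        using alt_skew[OF altf, of "s2 + m *s s1" x] by simp_all
      then show "form t (s2 + m *s s1) x y = 0" using y x zero by auto
    qed
    then show ?thesis ..
  next
    case (two m p q x y)
    let ?b = "form t (s2 + m *s s1)"
    have kb: "?b k1 v = 0 \<and> ?b k v = 0" if "v \<in> {p, q, x, y}" for v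
    proof -
      have "set [v] \<subseteq> vec.span (set ?vs)" using two(2) that by auto
      then have "form t s2 k1 v = 0" "form t s2 k v = 0"
        using perp_span[OF altf, of ?vs s2 k1 "[v]"] perp_span[OF altf, of ?vs s2 k "[v]"] kv by auto
      then show ?thesis using ker(1) kerk by (simp add: form_shift)
    qed
    have kbs: "?b k1 p = 0" "?b k1 q = 0" "?b k1 x = 0" "?b k1 y = 0" "?b k p = 0" "?b k q = 0" "?b k x = 0" "?b k y = 0"
      using kb by auto
    have bkk: "?b k1 k = 1" using kk ker(1) by (simp add: form_shift)
    have ak: "?a k1 v = 0" "?a k v = 0" "?a v k1 = 0" "?a v k = 0" for v
      using ker(1) kerk kernel_right[OF altf] by blast+
    note bsk = skew_pairs[OF altf[of "s2 + m *s s1"]]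
    show ?thesis
    proof (cases "?a x y = 0")
      case False
      define y' where "y' = (1 / ?a x y) *s y"
      have axy: "?a x y' = 1" using False by (simp add: y'_def ar)
      define e where "e v = ?a y' v *s x - ?a x v *s y'" for v
      have ae: "?a x (v + e v) = 0" "?a y' (v + e v) = 0" for v
        using axy alt_skew[OF altf, of s1 y' x] by (simp_all add: e_def ar)
      define p' q' where "p' = p + e p" and "q' = q + e q"
      have "ind (y # [k1, k, p, q, x])" by (rule ind_cong[OF two(1)]) auto
      from ind_scale[OF this, of "1 / ?a x y"] have "ind (y' # [k1, k, p, q, x])" using False by (simp add: y'_def)
      then have "ind (p # q # [x, y', k1, k])" by (rule ind_cong) auto
      from ind_shear2[OF this, of "e p" "e q"] have i1: "ind [p', q', x, y', k1, k]"
        unfolding p'_def q'_def e_def by (simp add: vec.span_diff vec.span_scale vec.span_base)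
      have bxy: "?b p x = 0" "?b p y' = 0" "?b q x = 0" "?b q y' = 0" "?b x y' = 0" "?b k1 y' = 0" "?b k y' = 0"
        using two kbs by (simp_all add: y'_def ar)
      have bxy': "?b x p = 0" "?b y' p = 0" "?b x q = 0" "?b y' q = 0" "?b y' x = 0"
        using alt_skew[OF altf, of "s2 + m *s s1" x p] alt_skew[OF altf, of "s2 + m *s s1" y' p]
          alt_skew[OF altf, of "s2 + m *s s1" x q] alt_skew[OF altf, of "s2 + m *s s1" y' q]
          alt_skew[OF altf, of "s2 + m *s s1" y' x] bxy by simp_all
      have bp: "?b p' q' = 1" "?b p' x = 0" "?b p' y' = 0" "?b q' x = 0" "?b q' y' = 0" "?b k1 p' = 0" "?b k p' = 0"
         "?b k1 q' = 0" "?b k q' = 0"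
        unfolding p'_def q'_def e_def using two(3) bxy bxy' kbs by (simp_all add: ar)
      define \<nu> where "\<nu> = ?a p' q'"
      have nu: "\<nu> \<noteq> 0"
      proof
        assume "\<nu> = 0"
        have "ind [k1, k, p', q', x, y']" by (rule ind_cong[OF i1]) auto
        then show False
          by (rule nondegenerate_frame[OF _ ker(1) kerk, of p' q' x y' p'])
            (use ae[of p] \<open>\<nu> = 0\<close> \<nu>_def alt_skew[OF altf, of s1 p' x] alt_skew[OF altf, of s1 p' y'] in
              \<open>auto simp: ar simp flip: p'_def\<close>)
      qed
      have "ind (x # [y', k1, k, p', q'])" by (rule ind_cong[OF i1]) auto
      from ind_scale[OF this nu] have i2: "ind [\<nu> *s x, y', k1, k, p', q']" .
      show ?thesis
        by (rule normal_form[OF t, of 14, OF _ frame_scale[OF frames(2)[of m], of "1 / \<nu>"] i2])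
          (use nu in \<open>simp_all add: leaf_simps form_scale ar ak axy ae[of p, folded p'_def] ae[of q, folded q'_def]
             bp bxy bkk \<nu>_def[symmetric] alt_skew[OF altf, of "s2 + m *s s1" x k1]
            alt_skew[OF altf, of "s2 + m *s s1" x k] alt_skew[OF altf, of "s2 + m *s s1" y' k1]
            alt_skew[OF altf, of "s2 + m *s s1" y' k] alt_skew[OF altf, of "s2 + m *s s1" x p']
            alt_skew[OF altf, of "s2 + m *s s1" y' p'] alt_skew[OF altf, of "s2 + m *s s1" x q']
            alt_skew[OF altf, of "s2 + m *s s1" y' q'] kbs\<close>)
    next
      case True
      have xy0: "\<forall>v\<in>set [x, y]. \<forall>w\<in>set [x, y]. ?a v w = 0"
        using True alt_skew[OF altf, of s1 y x] by (simp add: ar)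
      have bxy0: "?b r v = 0" if "r \<in> {k1, k, p, q, x, y}" "v \<in> vec.span (set [x, y])" for r v
      proof -
        have bxx: "?b x x = 0" "?b y y = 0" by (rule ar(5))+
        have byx: "?b y x = 0" using alt_skew[OF altf, of "s2 + m *s s1" y x] two(8) by simp
        have "\<forall>w\<in>set [x, y]. ?b r w = 0"
          using that(1) kbs two(4-8) byx bxx by auto
        from perp_span[OF altf this, of "[v]"] show ?thesis using that(2) by simp
      qed
      have i1: "ind (p # q # [k1, k] @ [x, y])" by (rule ind_cong[OF two(1)]) auto
      show ?thesis
      proof (cases rule: pairing_normal_form[OF altf[of s1] i1, case_names none one both])
        case (none q1 q2 ws)
        obtain w w' where ws: "ws = [w, w']" using length_2[of ws] none(2) by auto
        have "ind [k1, k, w, w', q1, q2]" by (rule ind_cong[OF none(1)]) (auto simp: ws)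
        then have False
          by (rule nondegenerate_frame[OF _ ker(1) kerk, of w w' q1 q2 w])
            (use none(6) isotropic_span[OF altf xy0 none(3)] alt_skew[OF altf, of s1 w q1] alt_skew[OF altf, of s1 w q2] in
              \<open>auto simp: ws\<close>)
        then show ?thesis ..
      next
        case (one q1 q2 w' ws)
        obtain w where ws: "ws = [w]" using one(2) by (cases ws) auto
        have "ind [k1, k, w, w', q1, q2]" by (rule ind_cong[OF one(1)]) (auto simp: ws)
        then have False
          by (rule nondegenerate_frame[OF _ ker(1) kerk, of w w' q1 q2 w])
            (use one(8) isotropic_span[OF altf xy0 one(3)] alt_skew[OF altf, of s1 w q1] alt_skew[OF altf, of s1 w q2] in
              \<open>auto simp: ws\<close>)
        then show ?thesis ..
      next
        case (both q1 q2 w1 w2 ws)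
        have ws: "ws = []" using both(2) by simp
        have w: "w1 \<in> vec.span (set [x, y])" "w2 \<in> vec.span (set [x, y])" using both(3) by auto
        have aw: "?a w1 w2 = 0" using isotropic_span[OF altf xy0 both(3)] by simp
        have bq: "?b q1 q2 = 1" using both(5)[OF altf] two(3) by simp
        have brow: "?b r v = 0" if "r \<in> {q1, q2}" "v \<in> vec.span (set [x, y])" for r v
        proof -
          have "r \<in> vec.span {p, q}" using both(4) that(1) by auto
          moreover have "?b u v = 0" if "u \<in> {p, q}" for u using bxy0[of u v] that \<open>v \<in> vec.span (set [x, y])\<close> by auto
          ultimately show ?thesis by (rule alt_span_left[OF altf, rotated])
        qed
        have bk: "?b k1 r = 0 \<and> ?b k r = 0" if "r \<in> {q1, q2}" for r
        proof -
          have r: "set [r] \<subseteq> vec.span (set [p, q])" using both(4) that by auto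
          have "\<forall>v\<in>set [p, q]. ?b k1 v = 0" "\<forall>v\<in>set [p, q]. ?b k v = 0" using kbs by simp_all
          from this[THEN perp_span[OF altf _ r]] show ?thesis by simp
        qed
        have bww: "?b w1 w2 = 0"
        proof (rule alt_span_left[OF altf _ w(1)])
          show "?b v w2 = 0" if "v \<in> set [x, y]" for v using bxy0[of v w2] w(2) that by auto
        qed
        define c where "c = ?a q1 q2 *s w2"
        have "ind (q1 # [w1, k1, k, q2, w2])" by (rule ind_cong[OF both(1)]) (auto simp: ws)
        then have i2: "ind [q1 + c, w1, k1, k, q2, w2]"
          by (rule ind_shear1) (simp add: c_def vec.span_scale vec.span_base)
        have bc: "?b c v = 0" if "v \<in> {q2, w1, w2, k1, k}" for v
          using that brow[of q2 w2] w bww bxy0[of k1 w2] bxy0[of k w2] ar(5)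
            alt_skew[OF altf, of "s2 + m *s s1" w2 q2] alt_skew[OF altf, of "s2 + m *s s1" w2 w1]
            alt_skew[OF altf, of "s2 + m *s s1" w2 k1] alt_skew[OF altf, of "s2 + m *s s1" w2 k]
          by (auto simp: c_def ar)
        have a1: "?a (q1 + c) w1 = 1" "?a (q1 + c) w2 = 0" "?a (q1 + c) q2 = 0" "?a w1 q2 = 0" "?a q2 w2 = 1"
          using both alt_skew[OF altf, of s1 w2 q2] alt_skew[OF altf, of s1 w2 w1] alt_skew[OF altf, of s1 w1 q2] aw
          by (simp_all add: c_def ar)
        have b1: "?b (q1 + c) w1 = 0" "?b (q1 + c) w2 = 0" "?b (q1 + c) q2 = 1" "?b (q1 + c) k1 = 0" "?b (q1 + c) k = 0"
          using bc brow[of q1] w bq bk[of q1] alt_skew[OF altf, of "s2 + m *s s1" q1 k1] alt_skew[OF altf, of "s2 + m *s s1" q1 k]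
          by (simp_all add: ar)
        have b2: "?b w1 q2 = 0" "?b q2 w2 = 0" "?b w1 k1 = 0" "?b w1 k = 0" "?b k1 q2 = 0" "?b k q2 = 0" "?b k1 w2 = 0" "?b k w2 = 0"
          using brow[of q2] w bk[of q2] bxy0[of k1] bxy0[of k] alt_skew[OF altf, of "s2 + m *s s1" w1]
          by simp_all
        show ?thesis
          by (rule normal_form[OF t, of 13, OF _ frames(2)[of m] i2])
            (simp_all add: leaf_simps a1 b1 b2 aw bww bkk ak)
      qed
    qed
  qed
qed

end

context rank_4_member
begin

text \<open>
  Here the kernel plane of \<open>s1\<close> is isotropic for \<open>s2\<close> and pairs perfectly with \<open>p1, p2\<close>. Terms \<open>form t s2 v pi\<close> can thus
  be removed by adding multiples of \<open>k1, k2\<close> to \<open>v\<close>, without changing the first form. If \<open>l1, l2\<close> is a hyperbolic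
  plane for \<open>s1\<close>, representative \<open>13\<close> arises; if it is isotropic, it pairs perfectly with \<open>p1, p2\<close>, and
  representative \<open>10\<close> or \<open>11\<close> arises, depending on the value of \<open>s2\<close> on it.
\<close>

lemma classify_kernel_both:
  assumes ind: "ind [k1, k2, p1, p2, l1, l2]"
    and ker: "\<forall>y. form t s1 k1 y = 0" "\<forall>y. form t s1 k2 y = 0"
    and b: "form t s2 k1 k2 = 0" "form t s2 k1 p1 = 1" "form t s2 k1 p2 = 0" "form t s2 k2 p1 = 0" "form t s2 k2 p2 = 1"
      "form t s2 k1 l1 = 0" "form t s2 k1 l2 = 0" "form t s2 k2 l1 = 0" "form t s2 k2 l2 = 0"
  shows "\<exists>n\<le>14. t \<in> orbit (std_rep n)"
proof -
  let ?a = "form t s1"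
  have ak: "?a k1 v = 0" "?a k2 v = 0" "?a v k1 = 0" "?a v k2 = 0" for v
    using ker kernel_right[OF altf] by blast+
  note sk = alt_skew[OF altf]
  show ?thesis
  proof (cases "?a l1 l2 = 0")
    case False
    define m2 where "m2 = (1 / ?a l1 l2) *s l2"
    have al: "?a l1 m2 = 1" "?a m2 l1 = - 1" using False sk[of s1 l2 l1] by (simp_all add: m2_def ar)
    define d where "d v = ?a m2 v *s l1 - ?a l1 v *s m2" for v
    define P1 P2 where "P1 = p1 + d p1" and "P2 = p2 + d p2"
    have aP: "?a l1 P1 = 0" "?a m2 P1 = 0" "?a l1 P2 = 0" "?a m2 P2 = 0"
      unfolding P1_def P2_def d_def by (simp_all add: ar al)
    have bk: "form t s2 k1 P1 = 1" "form t s2 k1 P2 = 0" "form t s2 k2 P1 = 0" "form t s2 k2 P2 = 1"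
      "form t s2 k1 m2 = 0" "form t s2 k2 m2 = 0"
      unfolding P1_def P2_def d_def m2_def by (simp_all add: ar b)
    have "ind (l2 # [k1, k2, p1, p2, l1])" by (rule ind_cong[OF ind]) auto
    from ind_scale[OF this, of "1 / ?a l1 l2"] have "ind (m2 # [k1, k2, p1, p2, l1])" using False by (simp add: m2_def)
    then have "ind (p1 # p2 # [k1, k2, l1, m2])" by (rule ind_cong) auto
    from ind_shear2[OF this, of "d p1" "d p2"] have i1: "ind [P1, P2, k1, k2, l1, m2]"
      unfolding P1_def P2_def d_def by (simp add: vec.span_diff vec.span_scale vec.span_base)
    define \<mu> where "\<mu> = - form t s2 l1 m2"
    let ?b = "form t (s2 + \<mu> *s s1)"
    have bl: "?b l1 m2 = 0" by (simp add: form_shift_minus \<mu>_def al)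
    have bk': "?b k1 P1 = 1" "?b k1 P2 = 0" "?b k2 P1 = 0" "?b k2 P2 = 1" "?b k1 m2 = 0" "?b k2 m2 = 0"
      "?b k1 l1 = 0" "?b k2 l1 = 0" "?b k1 k2 = 0" "?b k2 k1 = 0"
      using sk[of s2 k2 k1] by (simp_all add: form_shift bk b ak)
    have bkr: "?b m2 k1 = 0" "?b m2 k2 = 0" "?b l1 k1 = 0" "?b l1 k2 = 0" "?b P1 k1 = - 1" "?b P2 k2 = - 1" "?b P1 k2 = 0" "?b P2 k1 = 0"
      using sk[of "s2 + \<mu> *s s1" _ k1] sk[of "s2 + \<mu> *s s1" _ k2] bk' by (metis minus_zero)+
    define e where "e v = (- ?b v P1) *s k1 + (- ?b v P2) *s k2" for v
    define L1 L2 where "L1 = l1 + e l1" and "L2 = m2 + e m2"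
    have "ind (l1 # m2 # [P1, P2, k1, k2])" by (rule ind_cong[OF i1]) auto
    from ind_shear2[OF this, of "e l1" "e m2"] have i2: "ind [L1, L2, P1, P2, k1, k2]"
      unfolding L1_def L2_def e_def by (simp add: vec.span_diff vec.span_neg vec.span_scale vec.span_base)
    have bL: "?b L1 P1 = 0" "?b L1 P2 = 0" "?b L2 P1 = 0" "?b L2 P2 = 0" "?b L1 L2 = 0" "?b k1 L1 = 0" "?b k1 L2 = 0"
      "?b k2 L1 = 0" "?b k2 L2 = 0"
      unfolding L1_def L2_def e_def by (simp_all add: ar bk' bkr bl)
    have aL: "?a L1 L2 = 1" "?a L1 P1 = 0" "?a L2 P1 = 0" "?a L1 P2 = 0" "?a L2 P2 = 0"
      unfolding L1_def L2_def e_def by (simp_all add: ar ak al aP)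
    define Q1 where "Q1 = P1 + (- ?b P1 P2) *s k2"
    have "ind (P1 # [L1, L2, P2, k1, k2])" by (rule ind_cong[OF i2]) auto
    then have i3: "ind [Q1, L1, L2, P2, k1, k2]" unfolding Q1_def
      by (rule ind_shear1) (simp add: vec.span_neg vec.span_scale vec.span_base)
    have bQ: "?b Q1 P2 = 0" "?b k1 Q1 = 1" "?b k2 Q1 = 0" "?b L1 Q1 = 0" "?b L2 Q1 = 0"
      unfolding Q1_def using sk[of "s2 + \<mu> *s s1" L1 k2] sk[of "s2 + \<mu> *s s1" L2 k2] by (simp_all add: ar bk' bL)
    have aQ: "?a L1 Q1 = 0" "?a L2 Q1 = 0" unfolding Q1_def by (simp_all add: ar ak aL)
    define \<rho> where "\<rho> = ?a Q1 P2"
    have rho: "\<rho> \<noteq> 0"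
    proof
      assume "\<rho> = 0"
      have "ind [k1, k2, Q1, L1, L2, P2]" by (rule ind_cong[OF i3]) auto
      then show False
        by (rule nondegenerate_frame[OF _ ker, of Q1 L1 L2 P2 Q1])
          (use aQ \<open>\<rho> = 0\<close> \<rho>_def sk[of s1 Q1 L1] sk[of s1 Q1 L2] in \<open>auto simp: ar\<close>)
    qed
    have "ind (k1 # [Q1, L1, L2, P2, k2])" by (rule ind_cong[OF i3]) auto
    from ind_scale[OF this, of "- \<rho>"] have "ind ((- \<rho> *s k1) # [Q1, L1, L2, P2, k2])" using rho by simp
    then have "ind (Q1 # [- \<rho> *s k1, L1, L2, P2, k2])" by (rule ind_cong) auto
    from ind_scale[OF this, of "1 / \<rho>"] have "ind ((1 / \<rho>) *s Q1 # [- \<rho> *s k1, L1, L2, P2, k2])" using rho by simp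
    then have "ind (k2 # [(1 / \<rho>) *s Q1, - \<rho> *s k1, L1, L2, P2])" by (rule ind_cong) auto
    from ind_scale[OF this, of "- 1"] have "ind ((- 1) *s k2 # [(1 / \<rho>) *s Q1, - \<rho> *s k1, L1, L2, P2])" by simp
    then have i4: "ind [(1 / \<rho>) *s Q1, - \<rho> *s k1, L1, L2, P2, (- 1) *s k2]" by (rule ind_cong) auto
    have rev: "?b Q1 k1 = - 1" "?b Q1 k2 = 0" "?b P2 k1 = 0" "?b P2 k2 = - 1" "?b L1 k1 = 0" "?b L1 k2 = 0" "?b L2 k1 = 0"
      "?b L2 k2 = 0" "?b Q1 L1 = 0" "?b Q1 L2 = 0" "?a Q1 L1 = 0" "?a Q1 L2 = 0"
      using sk[of "s2 + \<mu> *s s1" Q1] sk[of "s2 + \<mu> *s s1" P2] sk[of "s2 + \<mu> *s s1" L1] sk[of "s2 + \<mu> *s s1" L2]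
        sk[of s1 Q1] bQ bk' bL aQ by (metis minus_zero)+
    show ?thesis
      by (rule normal_form[OF t, of 13, OF _ frames(1)[of \<mu>] i4])
        (use rho in \<open>simp_all add: leaf_simps ar ak aL aQ bL bQ bk' rev \<rho>_def[symmetric]\<close>)
  next
    case True
    define n11 n12 n21 n22 where n: "n11 = ?a l1 p1" "n12 = ?a l1 p2" "n21 = ?a l2 p1" "n22 = ?a l2 p2"
    define \<delta> where "\<delta> = n11 * n22 - n12 * n21"
    have ll: "?a l1 l2 = 0" "?a l2 l1 = 0" using True sk[of s1 l2 l1] by simp_all
    have kill: False if xy: "x \<noteq> 0 \<or> y \<noteq> 0" and v: "x * n11 + y * n21 = 0" "x * n12 + y * n22 = 0" for x y
    proof (rule nondegenerate[of k1 k2 "[p1, p2, l1, l2]" "x *s l1 + y *s l2"])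
      show "ind ([k1, k2] @ [p1, p2, l1, l2])" using ind by simp
      show "x *s l1 + y *s l2 \<in> vec.span (set [p1, p2, l1, l2])"
        by (intro vec.span_add vec.span_scale vec.span_base) simp_all
      show "x *s l1 + y *s l2 \<noteq> 0"
      proof (cases "x = 0")
        case True
        then show ?thesis using xy ind_nonzero[OF ind, of l2] by (simp add: vec.scale_eq_0_iff)
      next
        case False
        have "ind [l1, l2]" by (rule ind_sub[OF ind]) (use ind in \<open>auto simp: ind_def\<close>)
        from ind_update[of "[]", OF _ False, of l1 "[l2]" "y *s l2"] this have "ind [x *s l1 + y *s l2, l2]"
          by (simp add: vec.span_scale vec.span_base)
        then show ?thesis using ind_nonzero by force
      qed
      show "\<forall>w\<in>set [p1, p2, l1, l2]. ?a (x *s l1 + y *s l2) w = 0"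
        using v by (simp add: ar ll n)
    qed (use ker in simp_all)
    have del: "\<delta> \<noteq> 0"
    proof
      assume 0: "\<delta> = 0"
      have "n11 = 0 \<and> n21 = 0" using kill[of n21 "- n11"] 0 by (auto simp: \<delta>_def algebra_simps)
      moreover have "n12 = 0 \<and> n22 = 0" using kill[of n22 "- n12"] 0 by (auto simp: \<delta>_def algebra_simps)
      ultimately show False using kill[of 1 0] by simp
    qed
    define L1 L2 where L: "L1 = (n22 / \<delta>) *s l1 + (- n12 / \<delta>) *s l2" "L2 = (- n21 / \<delta>) *s l1 + (n11 / \<delta>) *s l2"
    have comb: "x *s (a *s l1 + b *s l2) + y *s (c *s l1 + d *s l2) = (x * a + y * c) *s l1 + (x * b + y * d) *s l2"
      for x y a b c d by (simp add: vec_eq_iff algebra_simps)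
    have inv: "n11 * (n22 / \<delta>) + n12 * (- n21 / \<delta>) = 1" "n21 * (- n12 / \<delta>) + n22 * (n11 / \<delta>) = 1"
      using del by (simp_all add: \<delta>_def divide_simps mult.commute)
    have l: "l1 = n11 *s L1 + n12 *s L2" "l2 = n21 *s L1 + n22 *s L2"
      unfolding L comb inv by (simp_all add: mult.commute)
    have i1: "ind [L1, L2, p1, p2, k1, k2]"
    proof (rule ind_exchange[OF ind])
      let ?S = "vec.span (set [L1, L2, p1, p2, k1, k2])"
      have "L1 \<in> ?S" "L2 \<in> ?S" by (auto intro: vec.span_base)
      then have "l1 \<in> ?S" "l2 \<in> ?S" using l vec.span_add vec.span_scale by metis+
      then show "set [k1, k2, p1, p2, l1, l2] \<subseteq> ?S" by (auto intro: vec.span_base)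
    qed simp
    have inv': "(n22 / \<delta>) * n11 + (- n12 / \<delta>) * n21 = 1" "(n22 / \<delta>) * n12 + (- n12 / \<delta>) * n22 = 0"
      "(- n21 / \<delta>) * n11 + (n11 / \<delta>) * n21 = 0" "(- n21 / \<delta>) * n12 + (n11 / \<delta>) * n22 = 1"
      using inv by (simp_all add: mult.commute)
    have aL: "?a L1 p1 = 1" "?a L1 p2 = 0" "?a L2 p1 = 0" "?a L2 p2 = 1" "?a L1 L2 = 0" "?a L2 L1 = 0"
      unfolding L by (simp_all only: ar n[symmetric] inv' ll mult_zero_right add_0)
    have bL: "form t s2 k1 L1 = 0" "form t s2 k1 L2 = 0" "form t s2 k2 L1 = 0" "form t s2 k2 L2 = 0"
      unfolding L by (simp_all add: ar b)
    define P1 where "P1 = p1 + (- ?a p1 p2) *s L2"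
    have "ind (p1 # [L1, L2, p2, k1, k2])" by (rule ind_cong[OF i1]) auto
    then have i2: "ind [P1, L1, L2, p2, k1, k2]" unfolding P1_def
      by (rule ind_shear1) (simp add: vec.span_neg vec.span_scale vec.span_base)
    have aP: "?a P1 p2 = 0" "?a L1 P1 = 1" "?a L2 P1 = 0" unfolding P1_def by (simp_all add: ar aL)
    let ?b = "form t s2"
    have bP: "?b k1 P1 = 1" "?b k2 P1 = 0" unfolding P1_def by (simp_all add: ar b bL)
    have bkr: "?b L1 k1 = 0" "?b L1 k2 = 0" "?b L2 k1 = 0" "?b L2 k2 = 0" "?b k2 k1 = 0" "?b P1 k2 = 0" "?b P1 k1 = - 1"
      "?b p2 k1 = 0" "?b p2 k2 = - 1"
      using sk[of s2 _ k1] sk[of s2 _ k2] b bL bP by (metis minus_zero)+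
    define e where "e v = (- ?b v P1) *s k1 + (- ?b v p2) *s k2" for v
    define N1 N2 where "N1 = L1 + e L1" and "N2 = L2 + e L2"
    have "ind (L1 # L2 # [P1, p2, k1, k2])" by (rule ind_cong[OF i2]) auto
    from ind_shear2[OF this, of "e L1" "e L2"] have i3: "ind [N1, N2, P1, p2, k1, k2]"
      unfolding N1_def N2_def e_def by (simp add: vec.span_diff vec.span_neg vec.span_scale vec.span_base)
    have bN: "?b N1 P1 = 0" "?b N1 p2 = 0" "?b N2 P1 = 0" "?b N2 p2 = 0" "?b k1 N1 = 0" "?b k1 N2 = 0" "?b k2 N1 = 0" "?b k2 N2 = 0"
      unfolding N1_def N2_def e_def by (simp_all add: ar b bP bkr bL)
    have aN: "?a N1 P1 = 1" "?a N1 p2 = 0" "?a N2 P1 = 0" "?a N2 p2 = 1" "?a N1 N2 = 0"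
      unfolding N1_def N2_def e_def by (simp_all add: ar ak aL aP)
    define Q1 where "Q1 = P1 + (- ?b P1 p2) *s k2"
    have "ind (P1 # [N1, N2, p2, k1, k2])" by (rule ind_cong[OF i3]) auto
    then have i4: "ind [Q1, N1, N2, p2, k1, k2]" unfolding Q1_def
      by (rule ind_shear1) (simp add: vec.span_neg vec.span_scale vec.span_base)
    have bNr: "?b N1 k1 = 0" "?b N1 k2 = 0" "?b N2 k1 = 0" "?b N2 k2 = 0"
      using sk[of s2 N1] sk[of s2 N2] bN by (metis minus_zero)+
    have aQ: "?a Q1 p2 = 0" "?a N1 Q1 = 1" "?a N2 Q1 = 0" unfolding Q1_def by (simp_all add: ar ak aP aN)
    have bQ: "?b Q1 p2 = 0" "?b k1 Q1 = 1" "?b k2 Q1 = 0" "?b N1 Q1 = 0" "?b N2 Q1 = 0"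
      unfolding Q1_def by (simp_all add: ar b bP bN bNr)
    have rev: "?b Q1 k1 = - 1" "?b Q1 k2 = 0" "?b Q1 N1 = 0" "?b Q1 N2 = 0" "?a Q1 N1 = - 1" "?a Q1 N2 = 0"
      "?b p2 N1 = 0" "?b p2 N2 = 0" "?a p2 N1 = 0" "?a p2 N2 = - 1" "?a N2 N1 = 0"
      using sk[of s2 Q1] sk[of s2 p2] sk[of s1 Q1] sk[of s1 p2] sk[of s1 N2 N1] bQ bN aQ aN by (metis minus_zero)+
    define \<mu> where "\<mu> = ?b N1 N2"
    have mu': "?b N2 N1 = - \<mu>" using sk[of s2 N2 N1] by (simp add: \<mu>_def)
    show ?thesis
    proof (cases "\<mu> = 0")
      case mu0: True
      have "ind (N1 # k1 # N2 # [Q1, k2, p2])" by (rule ind_cong[OF i4]) auto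
      from ind_scale[OF this, of "- 1"] have "ind ((- 1) *s N1 # k1 # N2 # [Q1, k2, p2])" by simp
      then have "ind (k1 # (- 1) *s N1 # N2 # [Q1, k2, p2])" by (rule ind_cong) auto
      from ind_scale[OF this, of "- 1"] have "ind ((- 1) *s k1 # (- 1) *s N1 # N2 # [Q1, k2, p2])" by simp
      then have "ind (N2 # (- 1) *s k1 # (- 1) *s N1 # [Q1, k2, p2])" by (rule ind_cong) auto
      from ind_scale[OF this, of "- 1"] have "ind ((- 1) *s N2 # (- 1) *s k1 # (- 1) *s N1 # [Q1, k2, p2])" by simp
      then have i5: "ind [Q1, (- 1) *s N1, k2, p2, (- 1) *s N2, (- 1) *s k1]" by (rule ind_cong) auto
      show ?thesis
        by (rule normal_form[OF t, of 10, OF _ s i5])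
          (simp_all add: leaf_simps ar ak aN aQ bN bQ bkr bNr b rev mu0 mu' \<mu>_def[symmetric])
    next
      case mu: False
      have "ind (N1 # k1 # k2 # [N2, Q1, p2])" by (rule ind_cong[OF i4]) auto
      from ind_scale[OF this, of "- 1"] have "ind ((- 1) *s N1 # k1 # k2 # [N2, Q1, p2])" by simp
      then have "ind (k1 # (- 1) *s N1 # k2 # [N2, Q1, p2])" by (rule ind_cong) auto
      from ind_scale[OF this, of "- \<mu>"] have "ind ((- \<mu>) *s k1 # (- 1) *s N1 # k2 # [N2, Q1, p2])" using mu by simp
      then have "ind (k2 # (- \<mu>) *s k1 # (- 1) *s N1 # [N2, Q1, p2])" by (rule ind_cong) auto
      from ind_scale[OF this, of "- \<mu>"] have "ind ((- \<mu>) *s k2 # (- \<mu>) *s k1 # (- 1) *s N1 # [N2, Q1, p2])" using mu by simp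
      then have i5: "ind [Q1, (- \<mu>) *s k1, N2, p2, (- \<mu>) *s k2, (- 1) *s N1]" by (rule ind_cong) auto
      have j: "ind [(1 / \<mu>) *s s2, s1]" by (rule ind_scale[OF ind2_swap[OF s]]) (use mu in simp)
      show ?thesis
        by (rule normal_form[OF t, of 11, OF _ j i5])
          (use mu in \<open>simp_all add: leaf_simps form_scale ar ak aN aQ bN bQ bkr bNr b rev mu' \<mu>_def[symmetric]\<close>)
    qed
  qed
qed

end

context rank_4_member
begin

text \<open>
  The pairing of the kernel plane with a complement under \<open>s2\<close> has rank one. The vectors \<open>l1, l2, l3\<close> cannot be isotropic for
  \<open>s1\<close>, since the form is nondegenerate on the complement. The numbers \<open>\<beta>1, \<beta>2\<close> do not both vanish, because
  otherwise some member would have rank at most two.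
\<close>

lemma classify_kernel_one:
  assumes ind: "ind [k1, k2, p, l1, l2, l3]"
    and ker: "\<forall>y. form t s1 k1 y = 0" "\<forall>y. form t s1 k2 y = 0"
    and b: "form t s2 k1 k2 = 0" "form t s2 k1 p = 1" "form t s2 k2 p = 0"
      "\<forall>l\<in>set [l1, l2, l3]. form t s2 k1 l = 0 \<and> form t s2 k2 l = 0"
  shows "\<exists>n\<le>14. t \<in> orbit (std_rep n)"
proof -
  let ?a = "form t s1"
  have ak: "?a k1 v = 0" "?a k2 v = 0" "?a v k1 = 0" "?a v k2 = 0" for v
    using ker kernel_right[OF altf] by blast+
  note sk = alt_skew[OF altf]
  obtain m1 m2 l where m: "ind [k1, k2, p, m1, m2, l]" "set [m1, m2, l] \<subseteq> vec.span (set [l1, l2, l3])"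
    "?a m1 m2 = 1" "?a m1 l = 0" "?a m2 l = 0"
  proof (cases "\<forall>v\<in>set [l1, l2, l3]. \<forall>w\<in>set [l1, l2, l3]. ?a v w = 0")
    case False
    then obtain v w where vw: "v \<in> set [l1, l2, l3]" "w \<in> set [l1, l2, l3]" "?a v w \<noteq> 0" by blast
    have "ind ([l1, l2, l3] @ [k1, k2, p])" by (rule ind_cong[OF ind]) auto
    from hyperbolic_pair[OF altf this vw] obtain m1 m2 ws where
      1: "ind (m1 # m2 # ws @ [k1, k2, p])" "length [l1, l2, l3] = length ws + 2"
      "set (m1 # m2 # ws) \<subseteq> vec.span (set [l1, l2, l3])" "?a m1 m2 = 1"
      "\<forall>w\<in>set ws. ?a m1 w = 0 \<and> ?a m2 w = 0" by blast
    obtain l where ws: "ws = [l]" using 1(2) by (cases ws) auto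
    have "ind [k1, k2, p, m1, m2, l]" by (rule ind_cong[OF 1(1)]) (auto simp: ws)
    then show ?thesis by (rule that) (use 1 ws in auto)
  next
    case zero: True
    have False
    proof (cases "\<exists>l\<in>set [l1, l2, l3]. ?a p l \<noteq> 0")
      case True
      then obtain x where x: "x \<in> set [l1, l2, l3]" "?a p x \<noteq> 0" by blast
      have "ind ([k1, k2, p] @ [l1, l2, l3])" using ind by simp
      from clear_vector[OF altf this x] obtain w ws where
        1: "ind ([k1, k2, p] @ w # ws)" "length [l1, l2, l3] = Suc (length ws)"
        "set (w # ws) \<subseteq> vec.span (set [l1, l2, l3])" "\<forall>v\<in>set ws. ?a p v = 0" by metis
      obtain y z where ws: "ws = [y, z]" using length_2[of ws] 1(2) by auto
      have "ind [k1, k2, p, w, y, z]" using 1(1) by (simp add: ws)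
      then show False
        by (rule nondegenerate_frame[OF _ ker, of p w y z y])
          (use 1(4) isotropic_span[OF altf zero 1(3)] sk[of s1 y p] in \<open>auto simp: ws\<close>)
    next
      case False
      show False
        by (rule nondegenerate_frame[OF ind ker, of l1]) (use False zero sk[of s1 l1 p] in auto)
    qed
    then show ?thesis ..
  qed
  have bm: "form t s2 k1 v = 0 \<and> form t s2 k2 v = 0" if "v \<in> {m1, m2, l}" for v
  proof -
    have v: "set [v] \<subseteq> vec.span (set [l1, l2, l3])" using m(2) that by auto
    have "\<forall>v\<in>set [l1, l2, l3]. form t s2 k1 v = 0" "\<forall>v\<in>set [l1, l2, l3]. form t s2 k2 v = 0" using b(4) by simp_all
    from this[THEN perp_span[OF altf _ v]] show ?thesis by simp
  qed
  define \<alpha> where "\<alpha> = ?a l p"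
  have alpha: "\<alpha> \<noteq> 0"
  proof
    assume "\<alpha> = 0"
    then show False
      by (intro nondegenerate_frame[OF m(1) ker, of l])
        (use m \<alpha>_def sk[of s1 l m1] sk[of s1 l m2] in \<open>auto simp: ar\<close>)
  qed
  define l' where "l' = (1 / \<alpha>) *s l"
  have al: "?a l' p = 1" "?a m1 l' = 0" "?a m2 l' = 0" "?a l' m1 = 0" "?a l' m2 = 0" "?a m2 m1 = - 1"
    using alpha m sk[of s1 l m1] sk[of s1 l m2] sk[of s1 m2 m1] by (simp_all add: l'_def \<alpha>_def ar)
  have bl: "form t s2 k1 l' = 0" "form t s2 k2 l' = 0" "form t s2 k1 m1 = 0" "form t s2 k2 m1 = 0"
      "form t s2 k1 m2 = 0" "form t s2 k2 m2 = 0"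
    using bm by (simp_all add: l'_def ar)
  have "ind (l # [k1, k2, p, m1, m2])" by (rule ind_cong[OF m(1)]) auto
  from ind_scale[OF this, of "1 / \<alpha>"] have "ind (l' # [k1, k2, p, m1, m2])" using alpha by (simp add: l'_def)
  then have i1: "ind (p # [k1, k2, m1, m2, l'])" by (rule ind_cong) auto
  define P where "P = p + ((- ?a p m2) *s m1 + ?a p m1 *s m2)"
  have i2: "ind (P # [k1, k2, m1, m2, l'])" unfolding P_def
    by (rule ind_shear1[OF i1]) (simp add: vec.span_neg vec.span_diff vec.span_add vec.span_scale vec.span_base)
  have aP: "?a P m1 = 0" "?a P m2 = 0" "?a l' P = 1" "?a m1 P = 0" "?a m2 P = 0" "?a P l' = - 1"
    unfolding P_def using sk[of s1 m1 p] sk[of s1 m2 p] sk[of s1 p l'] by (simp_all add: ar al m(3))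
  have bP: "form t s2 k1 P = 1" "form t s2 k2 P = 0" unfolding P_def by (simp_all add: ar bl b)
  define \<mu> where "\<mu> = - form t s2 m1 m2"
  let ?b = "form t (s2 + \<mu> *s s1)"
  have bk: "?b k1 P = 1" "?b k2 P = 0" "?b k1 l' = 0" "?b k2 l' = 0" "?b k1 m1 = 0" "?b k2 m1 = 0"
      "?b k1 m2 = 0" "?b k2 m2 = 0" "?b k1 k2 = 0" "?b k2 k1 = 0" "?b m1 m2 = 0"
    using sk[of s2 k2 k1] by (simp_all add: form_shift bP bl b ak) (simp add: \<mu>_def form_shift_minus m(3))
  have bkr: "?b m1 k1 = 0" "?b m2 k1 = 0" "?b l' k1 = 0" "?b m2 m1 = 0"
    using sk[of "s2 + \<mu> *s s1" _ k1] sk[of "s2 + \<mu> *s s1" m2 m1] bk by (metis minus_zero)+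
  define e where "e v = (- ?b v P) *s k1" for v
  define L M1 M2 where "L = l' + e l'" and "M1 = m1 + e m1" and "M2 = m2 + e m2"
  have "ind (m1 # m2 # [l', P, k1, k2])" by (rule ind_cong[OF i2]) auto
  from ind_shear2[OF this, of "e m1" "e m2"] have "ind [M1, M2, l', P, k1, k2]"
    unfolding M1_def M2_def e_def by (simp add: vec.span_neg vec.span_scale vec.span_base)
  then have "ind (l' # [M1, M2, P, k1, k2])" by (rule ind_cong) auto
  then have i3: "ind [L, M1, M2, P, k1, k2]" unfolding L_def e_def
    by (rule ind_shear1) (simp add: vec.span_neg vec.span_scale vec.span_base)
  have aL: "?a L P = 1" "?a L M1 = 0" "?a L M2 = 0" "?a M1 M2 = 1" "?a P M1 = 0" "?a P M2 = 0" "?a P L = - 1"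
     "?a M1 L = 0" "?a M2 L = 0" "?a M1 P = 0" "?a M2 P = 0" "?a M2 M1 = - 1"
    unfolding L_def M1_def M2_def e_def by (simp_all add: ar ak al aP m(3))
  have bL: "?b L P = 0" "?b M1 P = 0" "?b M2 P = 0" "?b M1 M2 = 0" "?b M2 M1 = 0" "?b k1 L = 0" "?b k2 L = 0" "?b k1 M1 = 0"
    "?b k2 M1 = 0" "?b k1 M2 = 0" "?b k2 M2 = 0"
    unfolding L_def M1_def M2_def e_def by (simp_all add: ar bk bkr)
  define \<beta>1 \<beta>2 where "\<beta>1 = ?b L M1" and "\<beta>2 = ?b L M2"
  have rev: "?b P L = 0" "?b P M1 = 0" "?b P M2 = 0" "?b L k1 = 0" "?b L k2 = 0" "?b M1 k1 = 0" "?b M1 k2 = 0"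
    "?b M2 k1 = 0" "?b M2 k2 = 0" "?b P k1 = - 1" "?b P k2 = 0"
    using sk[of "s2 + \<mu> *s s1" P] sk[of "s2 + \<mu> *s s1" L] sk[of "s2 + \<mu> *s s1" M1] sk[of "s2 + \<mu> *s s1" M2] bL bk
    by (metis minus_zero)+
  have rev2: "?b M1 L = - \<beta>1" "?b M2 L = - \<beta>2"
    using sk[of "s2 + \<mu> *s s1" M1 L] sk[of "s2 + \<mu> *s s1" M2 L] by (simp_all add: \<beta>1_def \<beta>2_def)
  have nonzero: "\<beta>1 \<noteq> 0 \<or> \<beta>2 \<noteq> 0"
  proof (rule ccontr)
    assume "\<not> (\<beta>1 \<noteq> 0 \<or> \<beta>2 \<noteq> 0)"
    then have 0: "?b L M1 = 0" "?b L M2 = 0" "?b M1 L = 0" "?b M2 L = 0" using rev2 by (simp_all add: \<beta>1_def \<beta>2_def)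
    have i: "ind [k1, P, L, M1, M2, k2]" by (rule ind_cong[OF i3]) auto
    show False
    proof (rule not_lowI[OF second_nonzero[of \<mu>] i])
      fix x y assume "x \<in> {L, M1, M2, k2}" "y \<in> {k1, P, L, M1, M2, k2}"
      then show "?b x y = 0"
        by (elim insertE emptyE) (simp_all only: 0 bL bk rev ar)
    qed
  qed
  obtain N1 N2 where N: "ind [N1, N2, L, P, k1, k2]" "?a N1 N2 = 1" "?b N1 N2 = 0" "?b N1 L = - 1" "?b N2 L = 0"
    "\<And>v. ?a v M1 = 0 \<Longrightarrow> ?a v M2 = 0 \<Longrightarrow> ?a v N1 = 0 \<and> ?a v N2 = 0"
    "\<And>v. ?b v M1 = 0 \<Longrightarrow> ?b v M2 = 0 \<Longrightarrow> ?b v N1 = 0 \<and> ?b v N2 = 0"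
  proof (cases "\<beta>1 = 0")
    case False
    have "ind ([M1] @ M2 # [L, P, k1, k2])" by (rule ind_cong[OF i3]) auto
    from ind_update[OF this False, of "(- \<beta>2) *s M1"]
    have "ind (M1 # [\<beta>1 *s M2 + (- \<beta>2) *s M1, L, P, k1, k2])"
      by (simp add: vec.span_neg vec.span_scale vec.span_base)
    from ind_scale[OF this, of "1 / \<beta>1"]
    have i: "ind [(1 / \<beta>1) *s M1, \<beta>1 *s M2 + (- \<beta>2) *s M1, L, P, k1, k2]" using False by simp
    show ?thesis
      by (rule that[OF i]) (use False in \<open>simp_all add: ar aL bL rev2\<close>)
  next
    case True
    then have b2: "\<beta>2 \<noteq> 0" using nonzero by simp
    have "ind (M2 # [M1, L, P, k1, k2])" by (rule ind_cong[OF i3]) auto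
    from ind_scale[OF this, of "1 / \<beta>2"] have "ind (M1 # [(1 / \<beta>2) *s M2, L, P, k1, k2])"
      using b2 by (intro ind_cong[of "(1 / \<beta>2) *s M2 # [M1, L, P, k1, k2]" "M1 # [(1 / \<beta>2) *s M2, L, P, k1, k2]"]) auto
    from ind_scale[OF this, of "- \<beta>2"] have "ind ((- \<beta>2) *s M1 # [(1 / \<beta>2) *s M2, L, P, k1, k2])" using b2 by simp
    then have i: "ind [(1 / \<beta>2) *s M2, (- \<beta>2) *s M1, L, P, k1, k2]" by (rule ind_cong) auto
    show ?thesis
      by (rule that[OF i]) (use b2 True in \<open>simp_all add: ar aL bL rev2\<close>)
  qed
  have "ind (k1 # [N1, N2, L, P, k2])" by (rule ind_cong[OF N(1)]) auto
  from ind_scale[OF this, of "- 1"] have "ind ((- 1) *s k1 # [N1, N2, L, P, k2])" by simp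
  then have "ind (L # [N1, N2, P, (- 1) *s k1, k2])" by (rule ind_cong) auto
  from ind_scale[OF this, of "- 1"] have "ind ((- 1) *s L # [N1, N2, P, (- 1) *s k1, k2])" by simp
  then have i4: "ind [N1, N2, P, (- 1) *s k1, (- 1) *s L, k2]" by (rule ind_cong) auto
  have aN: "?a P N1 = 0" "?a P N2 = 0" "?a L N1 = 0" "?a L N2 = 0" using N(6)[of P] N(6)[of L] aL by simp_all
  have bN: "?b P N1 = 0" "?b P N2 = 0" "?b k1 N1 = 0" "?b k1 N2 = 0" "?b k2 N1 = 0" "?b k2 N2 = 0"
    using N(7)[of P] N(7)[of k1] N(7)[of k2] bL rev by simp_all
  have rev3: "?a N1 P = 0" "?a N2 P = 0" "?a N1 L = 0" "?a N2 L = 0" "?b N1 P = 0" "?b N2 P = 0" "?b N1 k1 = 0" "?b N2 k1 = 0"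
     "?b N1 k2 = 0" "?b N2 k2 = 0"
    using sk[of s1 N1] sk[of s1 N2] sk[of "s2 + \<mu> *s s1" N1] sk[of "s2 + \<mu> *s s1" N2] aN bN by (metis minus_zero)+
  show ?thesis
    by (rule normal_form[OF t, of 8, OF _ frames(2)[of \<mu>] i4])
      (simp_all add: leaf_simps ar ak N(2-5) aL bL rev rev3 bk)
qed

lemma classify_kernel_isotropic:
  assumes ind: "ind [k1, k2, u1, u2, u3, u4]"
    and ker: "\<forall>y. form t s1 k1 y = 0" "\<forall>y. form t s1 k2 y = 0"
    and b0: "form t s2 k1 k2 = 0"
  shows "\<exists>n\<le>14. t \<in> orbit (std_rep n)"
proof -
  have i: "ind (k1 # k2 # [] @ [u1, u2, u3, u4])" using ind by simp
  have kerspan: "\<forall>y. form t s1 r y = 0" if "r \<in> vec.span {k1, k2}" for r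
  proof
    fix y show "form t s1 r y = 0"
      by (rule alt_span_left[OF altf _ that]) (use ker in auto)
  qed
  show ?thesis
  proof (cases rule: pairing_normal_form[OF altf[of s2] i, case_names none one both])
    case (none q1 q2 ws)
    have k: "\<forall>y. form t s1 q1 y = 0" "\<forall>y. form t s1 q2 y = 0" using kerspan none(4) by auto
    have bq: "form t s2 q1 q2 = 0" using none(5)[OF altf] b0 by simp
    have ws: "ind ([q1, q2] @ ws)" "length ws = 4" using none(1,2) by simp_all
    have bz: "form t (s2 + m *s s1) q v = 0" "form t (s2 + m *s s1) v q = 0"
      if "q \<in> {q1, q2}" "v \<in> vec.span (set ws) \<union> {q1, q2}" for q v m
    proof -
      have "form t s2 q v = 0"
      proof (cases "v \<in> {q1, q2}")
        case True
        then show ?thesis using that(1) bq alt_skew[OF altf, of s2 q2 q1] by (auto simp: ar)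
      next
        case False
        then have "set [v] \<subseteq> vec.span (set ws)" using that(2) by auto
        from perp_span[OF altf _ this, of s2 q] show ?thesis using none(6) that(1) by auto
      qed
      then show "form t (s2 + m *s s1) q v = 0" using k that(1) by (auto simp: form_shift)
      then show "form t (s2 + m *s s1) v q = 0" using alt_skew[OF altf, of "s2 + m *s s1" v q] by simp
    qed
    have False
    proof (cases rule: split_quadruple[OF ws k, case_names zero two])
      case (zero m)
      obtain x y z w where e: "ws = [x, y, z, w]" using length_4[OF ws(2)] by blast
      have j: "ind [q1, q2, x, y, z, w]" using ws(1) by (simp add: e)
      show ?thesis
      proof (rule not_lowI[OF second_nonzero[of m] j])
        fix v u assume v: "v \<in> {x, y, z, w}" and u: "u \<in> {q1, q2, x, y, z, w}"
        have "v \<in> vec.span (set ws)" using v by (auto simp: e intro: vec.span_base)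
        then show "form t (s2 + m *s s1) v u = 0" using bz(2)[of u v m] zero u v by (auto simp: e)
      qed
    next
      case (two m p q x y)
      have j: "ind [p, q, x, y, q1, q2]" by (rule ind_cong[OF two(1)]) auto
      have xy: "form t (s2 + m *s s1) x p = 0" "form t (s2 + m *s s1) y p = 0" "form t (s2 + m *s s1) x q = 0"
        "form t (s2 + m *s s1) y q = 0" "form t (s2 + m *s s1) y x = 0"
        using alt_skew[OF altf, of "s2 + m *s s1" x p] alt_skew[OF altf, of "s2 + m *s s1" y p]
          alt_skew[OF altf, of "s2 + m *s s1" x q] alt_skew[OF altf, of "s2 + m *s s1" y q]
          alt_skew[OF altf, of "s2 + m *s s1" y x] two by simp_all
      show ?thesis
      proof (rule not_lowI[OF second_nonzero[of m] j])
        fix v u assume v: "v \<in> {x, y, q1, q2}" and u: "u \<in> {p, q, x, y, q1, q2}"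
        have "w \<in> vec.span (set ws) \<union> {q1, q2}" if "w \<in> {p, q, x, y, q1, q2}" for w using two(2) that by auto
        then have q: "form t (s2 + m *s s1) v u = 0" if "v \<in> {q1, q2} \<or> u \<in> {q1, q2}"
          using bz[of v u m] bz[of u v m] that u v by auto
        have "form t (s2 + m *s s1) v u = 0" if "v \<in> {x, y}" "u \<in> {p, q, x, y}"
          using that two(8) xy by (auto simp: ar)
        then show "form t (s2 + m *s s1) v u = 0" using q u v by blast
      qed
    qed
    then show ?thesis ..
  next
    case (one q1 q2 w ws)
    have k: "\<forall>y. form t s1 q1 y = 0" "\<forall>y. form t s1 q2 y = 0" using kerspan one(4) by auto
    have bq: "form t s2 q1 q2 = 0" using one(5)[OF altf] b0 by simp
    obtain x y z where ws: "ws = [x, y, z]" using length_3[of ws] one(2) by auto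
    have j: "ind [q1, q2, w, x, y, z]" using one(1) by (simp add: ws)
    show ?thesis by (rule classify_kernel_one[OF j k bq one(6,7)]) (use one(8) ws in simp)
  next
    case (both q1 q2 w1 w2 ws)
    have k: "\<forall>y. form t s1 q1 y = 0" "\<forall>y. form t s1 q2 y = 0" using kerspan both(4) by auto
    have bq: "form t s2 q1 q2 = 0" using both(5)[OF altf] b0 by simp
    obtain x y where ws: "ws = [x, y]" using length_2[of ws] both(2) by auto
    have j: "ind [q1, q2, w1, w2, x, y]" using both(1) by (simp add: ws)
    show ?thesis by (rule classify_kernel_both[OF j k bq both(6,8,7,9)]) (use both(10) ws in simp_all)
  qed
qed

end

section \<open>The classification\<close>

lemma span_6_coeffs:
  assumes "x \<in> vec.span {u1, u2, u3, u4, u5, u6 :: complex ^ 'n}"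
  shows "\<exists>c1 c2 c3 c4 c5 c6. x = c1 *s u1 + c2 *s u2 + c3 *s u3 + c4 *s u4 + c5 *s u5 + c6 *s u6"
proof -
  obtain c1 where "x - c1 *s u1 \<in> vec.span {u2, u3, u4, u5, u6}" using assms vec.span_insert[of u1] by auto
  then obtain c2 where "x - c1 *s u1 - c2 *s u2 \<in> vec.span {u3, u4, u5, u6}" using vec.span_insert[of u2] by auto
  from span_4_coeffs[OF this] obtain c3 c4 c5 c6 where
    "x - c1 *s u1 - c2 *s u2 = c3 *s u3 + c4 *s u4 + c5 *s u5 + c6 *s u6" by blast
  then have "x = c1 *s u1 + c2 *s u2 + c3 *s u3 + c4 *s u4 + c5 *s u5 + c6 *s u6"
    by (simp add: algebra_simps)
  then show ?thesis by blast
qed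

lemma low_rankI:
  assumes "ind [v1, v2, v3, v4, v5, v6]" "\<And>x. x \<in> {v3, v4, v5, v6} \<Longrightarrow> \<forall>y. form t s x y = 0"
  shows "low_rank t s"
  unfolding low_rank_def by (intro exI conjI ballI, rule assms(1), rule assms(2))

lemma extend_to_pair:
  fixes r :: "complex ^ 2"
  assumes "r \<noteq> 0" shows "\<exists>s. ind [r, s]"
proof -
  have "{axis 1 1, axis 2 1 :: complex ^ 2} = cart_basis"
    unfolding cart_basis_def using UNIV_2 by (auto simp: axis_eq_axis)
  then have i: "ind [axis 1 1, axis 2 1 :: complex ^ 2]"
    unfolding ind_def using vec.independent_Basis by (simp add: axis_eq_axis eq_2)
  have r: "r = r $ 1 *s axis 1 1 + r $ 2 *s axis 2 1" "r = r $ 2 *s axis 2 1 + r $ 1 *s axis 1 1"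
    by (simp_all add: vec_eq_iff forall_2 axis_def eq_2)
  show ?thesis
  proof (cases "r $ 1 = 0")
    case False
    have "ind ([] @ (r $ 1 *s axis 1 1 + r $ 2 *s axis 2 1) # [axis 2 1 :: complex ^ 2])"
      by (rule ind_update[OF _ False]) (use i in \<open>simp_all add: vec.span_scale vec.span_base\<close>)
    then show ?thesis using r(1) by auto
  next
    case True
    then have "r $ 2 \<noteq> 0" using assms by (auto simp: vec_eq_iff forall_2)
    then have "ind ([] @ (r $ 2 *s axis 2 1 + r $ 1 *s axis 1 1) # [axis 1 1 :: complex ^ 2])"
      by (rule ind_update[rotated]) (use ind2_swap[OF i] in \<open>simp_all add: vec.span_scale vec.span_base\<close>)
    then show ?thesis using r(2) by auto
  qed
qed

text \<open>
  If a nonzero member of the pencil has rank at most two, the analysis starts from its kernel. Otherwise a degenerate member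
  exists and has rank exactly four; two hyperbolic planes \<open>p, q\<close> and \<open>p', q'\<close> are split off, and the kernel
  \<open>k1, k2\<close> remains.
\<close>

theorem classification:
  assumes t: "t \<in> E_Wedge2_F"
  shows "\<exists>n\<le>14. t \<in> orbit (std_rep n)"
proof (cases "\<exists>r. r \<noteq> 0 \<and> low_rank t r")
  case True
  then obtain r where r: "r \<noteq> 0" "low_rank t r" by blast
  obtain s where s: "ind [r, s]" using extend_to_pair[OF r(1)] by blast
  obtain v1 v2 v3 v4 v5 v6 where v: "ind [v1, v2, v3, v4, v5, v6]" "\<forall>x\<in>{v3, v4, v5, v6}. \<forall>y. form t r x y = 0"
    using r(2) unfolding low_rank_def by blast
  show ?thesis by (rule classify_rank_2[OF t s v(1)]) (use v(2) in blast)
next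
  case False
  obtain s1 v where sv: "s1 \<noteq> 0" "v \<noteq> 0" "\<And>u. form t s1 u v = 0" using singular_member[OF t] by blast
  obtain s2 where s: "ind [s1, s2]" using extend_to_pair[OF sv(1)] by blast
  let ?a = "form t s1"
  have altf: "alt ?a" by (rule alt_form[OF t])
  note ar = alt_rules[OF altf]
  have not_low: "\<not> low_rank t s1" using False sv(1) by blast
  obtain v1 v2 v3 v4 v5 v6 :: "complex ^ 6" where f: "ind [v1, v2, v3, v4, v5, v6]" using frame_exists by blast
  have "\<not> (\<forall>x\<in>set [v1, v2, v3, v4, v5, v6]. \<forall>y\<in>set [v1, v2, v3, v4, v5, v6]. ?a x y = 0)"
  proof
    assume 0: "\<forall>x\<in>set [v1, v2, v3, v4, v5, v6]. \<forall>y\<in>set [v1, v2, v3, v4, v5, v6]. ?a x y = 0"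
    have "\<forall>y. ?a x y = 0" if "x \<in> {v3, v4, v5, v6}" for x
    proof (rule form_zero_frame[OF t f])
      have "x \<in> set [v1, v2, v3, v4, v5, v6]" using that by auto
      then show "\<forall>y\<in>set [v1, v2, v3, v4, v5, v6]. ?a x y = 0" by (rule bspec[OF 0])
    qed simp
    then have "low_rank t s1" by (rule low_rankI[OF f])
    then show False using not_low by contradiction
  qed
  then obtain x y where xy: "x \<in> set [v1, v2, v3, v4, v5, v6]" "y \<in> set [v1, v2, v3, v4, v5, v6]" "?a x y \<noteq> 0"
    by blast
  have "ind ([v1, v2, v3, v4, v5, v6] @ [])" using f by simp
  from hyperbolic_pair[OF altf this xy] obtain p q ws where
    1: "ind (p # q # ws @ [])" "length [v1, v2, v3, v4, v5, v6] = length ws + 2" "?a p q = 1" "\<forall>w\<in>set ws. ?a p w = 0 \<and> ?a q w = 0"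
    by blast
  obtain w1 w2 w3 w4 where ws: "ws = [w1, w2, w3, w4]" using length_4[of ws] 1(2) by auto
  have pw: "?a w p = 0" "?a w q = 0" if "w \<in> set ws" for w
    using 1(4) that alt_skew[OF altf, of w p] alt_skew[OF altf, of w q] by simp_all
  have "\<not> (\<forall>x\<in>set ws. \<forall>y\<in>set ws. ?a x y = 0)"
  proof
    assume 0: "\<forall>x\<in>set ws. \<forall>y\<in>set ws. ?a x y = 0"
    have g: "ind [p, q, w1, w2, w3, w4]" using 1(1) by (simp add: ws)
    have "\<forall>y. ?a x y = 0" if "x \<in> {w1, w2, w3, w4}" for x
    proof (rule form_zero_frame[OF t g])
      have x: "x \<in> set ws" using that by (auto simp: ws)
      then have "\<forall>y\<in>set ws. ?a x y = 0" by (rule bspec[OF 0])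
      then show "\<forall>y\<in>set [p, q, w1, w2, w3, w4]. ?a x y = 0" using pw[OF x] by (simp add: ws)
    qed simp
    then have "low_rank t s1" by (rule low_rankI[OF g])
    then show False using not_low by contradiction
  qed
  then obtain x y where xy: "x \<in> set ws" "y \<in> set ws" "?a x y \<noteq> 0" by blast
  have "ind (ws @ [p, q])" by (rule ind_cong[OF 1(1)]) auto
  from hyperbolic_pair[OF altf this xy] obtain p' q' ks where
    2: "ind (p' # q' # ks @ [p, q])" "length ws = length ks + 2" "set (p' # q' # ks) \<subseteq> vec.span (set ws)"
      "?a p' q' = 1" "\<forall>w\<in>set ks. ?a p' w = 0 \<and> ?a q' w = 0"
    by blast
  obtain k1 k2 where ks: "ks = [k1, k2]" using length_2[of ks] 2(2) by (auto simp: ws)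
  have "\<forall>w\<in>set ws. ?a p w = 0" "\<forall>w\<in>set ws. ?a q w = 0" using 1(4) by auto
  note pq = this[THEN perp_span[OF altf _ 2(3)]]
  have a: "?a p q = 1" "?a p p' = 0" "?a p q' = 0" "?a p k1 = 0" "?a p k2 = 0" "?a q p' = 0" "?a q q' = 0" "?a q k1 = 0"
    "?a q k2 = 0" "?a p' q' = 1" "?a p' k1 = 0" "?a p' k2 = 0" "?a q' k1 = 0" "?a q' k2 = 0"
    using 1(3) pq 2(4,5) by (simp_all add: ks)
  note sk = skew_pairs[OF altf, of q p p' q' k1 k2]
  have i: "ind [k1, k2, p, q, p', q']" by (rule ind_cong[OF 2(1)]) (auto simp: ks)
  have UN: "x \<in> vec.span {k1, k2, p, q, p', q'}" for x using ind_span_UNIV[OF i] by auto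
  have kernel_form: "\<exists>c1 c2. x = c1 *s k1 + c2 *s k2" if "\<forall>u. ?a x u = 0" for x
  proof -
    obtain c1 c2 c3 c4 c5 c6 where c: "x = c1 *s k1 + c2 *s k2 + c3 *s p + c4 *s q + c5 *s p' + c6 *s q'"
      using span_6_coeffs[OF UN] by blast
    have "?a x q = c3" "?a x p = - c4" "?a x q' = c5" "?a x p' = - c6"
      unfolding c by (simp_all add: ar a sk)
    then show ?thesis using that c by auto
  qed
  have vker: "\<forall>u. ?a v u = 0" using sv(3) alt_skew[OF altf, of v] by simp
  obtain c1 c2 where c: "v = c1 *s k1 + c2 *s k2" using kernel_form[OF vker] by blast
  have kk: "?a k1 k2 = 0"
  proof (rule ccontr)
    assume "?a k1 k2 \<noteq> 0"
    moreover have "?a v k2 = c1 * ?a k1 k2" "?a v k1 = - c2 * ?a k1 k2" unfolding c by (simp_all add: ar sk)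
    ultimately have "c1 = 0" "c2 = 0" using vker by auto
    then show False using c sv(2) by simp
  qed
  have ker: "\<forall>y. ?a k1 y = 0" "\<forall>y. ?a k2 y = 0"
    by (rule form_zero_frame[OF t i]; simp add: ar a sk kk)+
  interpret rank_4_member t s1 s2
  proof
    fix x y z assume xyz: "ind [x, y, z]" "\<forall>w. ?a x w = 0" "\<forall>w. ?a y w = 0" "\<forall>w. ?a z w = 0"
    have "u \<in> vec.span {k1, k2}" if "\<forall>w. ?a u w = 0" for u
      using kernel_form[OF that] by (auto intro: vec.span_add vec.span_scale vec.span_base)
    then have "{x, y, z} \<subseteq> vec.span {k1, k2}" using xyz by blast
    moreover have "vec.independent {x, y, z}" "card {x, y, z} = 3" using xyz(1) by (simp_all add: ind_def)
    ultimately have "3 \<le> card {k1, k2}" using vec.independent_span_bound[of "{k1, k2}" "{x, y, z}"] by simp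
    moreover have "card {k1, k2} \<le> 2" by (simp add: card_insert_if)
    ultimately show False by simp
  qed (use t s False in blast)+
  show ?thesis
    using classify_kernel_isotropic[OF i ker] classify_kernel_nondegenerate[OF i ker] by blast
qed

section \<open>Degenerations\<close>

text \<open>
  A polynomial that vanishes on the punctured line vanishes at its centre as well.
\<close>

lemma degeneration:
  assumes "\<And>\<epsilon>. \<epsilon> \<noteq> 0 \<Longrightarrow> x + \<epsilon> *s r \<in> S"
  shows "x \<in> zariski_closure S"
  unfolding zariski_closure_eq mem_Collect_eq
proof (intro ballI impI)
  fix p assume p: "p \<in> poly_funs" "\<forall>y\<in>S. p y = 0"
  obtain q where q: "\<forall>s. p (x + s *s r) = poly q s" using pf_along_line[OF p(1)] by blast
  have "poly q s = 0" if "s \<noteq> 0" for s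
    using p(2) assms[OF that] q[rule_format, of s] by simp
  then have "q = 0" by (intro poly_eq_0_if_small[of 1]) simp_all
  then show "p x = 0" using q[rule_format, of 0] by simp
qed

lemma det_nonzero_span:
  fixes M :: "complex ^ 'n ^ 'n"
  assumes "det M \<noteq> 0" shows "vec.span (range (($) M)) = UNIV"
proof -
  obtain N where "N ** M = mat 1" using assms unfolding invertible_det_nz[symmetric] invertible_def by blast
  then have "vec.span (rows M) = UNIV" using matrix_left_invertible_span_rows_gen[of M] by blast
  moreover have "rows M = range (($) M)" by (auto simp: rows_def row_def vec_lambda_eta)
  ultimately show ?thesis by simp
qed

lemma left_inverse_det: "N ** M = mat 1 \<Longrightarrow> det M \<noteq> 0" for M N :: "complex ^ 'n ^ 'n"
  using det_mul[of N M] by auto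

text \<open>
  Left inverses \<open>A', B'\<close> are a certificate of invertibility that is checked by matrix multiplication.
\<close>

lemma in_orbit_by_matrices:
  assumes n: "n \<le> 14" and A: "list_all (\<lambda>(i, j). (A' ** A) $ i $ j = mat 1 $ i $ j) (List.product [1, 2] [1, 2])"
    and B: "list_all (\<lambda>(i, j). (B' ** B) $ i $ j = mat 1 $ i $ j) (List.product [1, 2, 3, 4, 5, 6] [1, 2, 3, 4, 5, 6])"
    and t: "t \<in> E_Wedge2_F"
    and eq: "list_all (\<lambda>p. t $ p = rep (($) A) (($) B) n $ p) coords"
  shows "t \<in> orbit (std_rep n)"
proof -
  have "A' ** A = mat 1" using A unfolding vec_eq_iff forall_2 by simp
  moreover have "B' ** B = mat 1" using B unfolding vec_eq_iff forall_6 by simp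
  moreover have "t = rep (($) A) (($) B) n"
    by (rule skew_eqI[OF t skew_rep[OF n]]) (use eq in \<open>simp add: list_all_iff\<close>)
  ultimately show ?thesis
    using rep_in_orbit[OF det_nonzero_span det_nonzero_span n] left_inverse_det by metis
qed

lemma skew_perturbation: "n \<le> 14 \<Longrightarrow> rep e f n + c *s bracket e f k i j \<in> E_Wedge2_F"
  by (intro skew_add skew_rep skew_scale skew_bracket)

lemma axis_nth_6: "axis (a :: 6) (1 :: complex) $ b = (if b = a then 1 else 0)"
  by (simp add: axis_def)

lemma axis_nth_2: "axis (a :: 2) (1 :: complex) $ b = (if b = a then 1 else 0)"
  by (simp add: axis_def)

lemmas degeneration_simps = coords_def list.pred_inject prod.case simp_thms rep_simps vector_add_component
  vector_smult_component bracket_nth axis_nth_2 axis_nth_6 entries_nth eval_simps zero_index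
  List.product.simps list.map append.simps matrix_matrix_mult_def vec_lambda_beta sum_2 sum_6 mat_def
  mult_1_left mult_1_right mult_1

text \<open>
  In each of these degenerations the representative plus any nonzero multiple \<open>\<epsilon>\<close> of one bracket lies in the larger orbit;
  the rows of the matrices are frames in which this sum has the form of the larger representative.
\<close>

lemma degeneration_0_1: "std_rep 0 \<in> zariski_closure (orbit (std_rep (Suc 0)))"
proof (rule degeneration[where r = "bracket stdE stdF 1 1 2"])
  fix \<epsilon> :: complex assume eps: "\<epsilon> \<noteq> 0"
  show "std_rep 0 + \<epsilon> *s bracket stdE stdF 1 1 2 \<in> orbit (std_rep (Suc 0))"
    by (rule in_orbit_by_matrices[where A = "entries [
      ((1, 1), \<epsilon>), ((2, 2), 1)]" and A' = "entries [
      ((1, 1), 1 / \<epsilon>), ((2, 2), 1)]"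
      and B = "entries [
      ((1, 1), 1), ((2, 2), 1), ((3, 3), 1), ((4, 4), 1), ((5, 5), 1), ((6, 6), 1)]" and B' = "entries [
      ((1, 1), 1), ((2, 2), 1), ((3, 3), 1), ((4, 4), 1), ((5, 5), 1), ((6, 6), 1)]"],
      simp, (simp only: degeneration_simps; simp add: eps), (simp only: degeneration_simps; simp add: eps power2_eq_square),
      rule skew_perturbation, simp, (simp only: degeneration_simps; simp add: eps field_simps power2_eq_square))
qed

lemma degeneration_1_2: "std_rep (Suc 0) \<in> zariski_closure (orbit (std_rep 2))"
proof (rule degeneration[where r = "bracket stdE stdF 1 3 4"])
  fix \<epsilon> :: complex assume eps: "\<epsilon> \<noteq> 0"
  show "std_rep (Suc 0) + \<epsilon> *s bracket stdE stdF 1 3 4 \<in> orbit (std_rep 2)"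
    by (rule in_orbit_by_matrices[where A = "entries [
      ((1, 1), 1), ((2, 2), 1)]" and A' = "entries [
      ((1, 1), 1), ((2, 2), 1)]"
      and B = "entries [
      ((1, 1), 1), ((2, 2), 1), ((3, 3), \<epsilon>), ((4, 4), 1), ((5, 5), 1), ((6, 6), 1)]" and B' = "entries [
      ((1, 1), 1), ((2, 2), 1), ((3, 3), 1 / \<epsilon>), ((4, 4), 1), ((5, 5), 1), ((6, 6), 1)]"],
      simp, (simp only: degeneration_simps; simp add: eps), (simp only: degeneration_simps; simp add: eps power2_eq_square),
      rule skew_perturbation, simp, (simp only: degeneration_simps; simp add: eps field_simps power2_eq_square))
qed

lemma degeneration_1_3: "std_rep (Suc 0) \<in> zariski_closure (orbit (std_rep 3))"
proof (rule degeneration[where r = "bracket stdE stdF 2 1 3"])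
  fix \<epsilon> :: complex assume eps: "\<epsilon> \<noteq> 0"
  show "std_rep (Suc 0) + \<epsilon> *s bracket stdE stdF 2 1 3 \<in> orbit (std_rep 3)"
    by (rule in_orbit_by_matrices[where A = "entries [
      ((1, 1), 1), ((2, 2), 1)]" and A' = "entries [
      ((1, 1), 1), ((2, 2), 1)]"
      and B = "entries [
      ((1, 1), 1), ((2, 2), 1), ((3, 3), \<epsilon>), ((4, 4), 1), ((5, 5), 1), ((6, 6), 1)]" and B' = "entries [
      ((1, 1), 1), ((2, 2), 1), ((3, 3), 1 / \<epsilon>), ((4, 4), 1), ((5, 5), 1), ((6, 6), 1)]"],
      simp, (simp only: degeneration_simps; simp add: eps), (simp only: degeneration_simps; simp add: eps power2_eq_square),
      rule skew_perturbation, simp, (simp only: degeneration_simps; simp add: eps field_simps power2_eq_square))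
qed

lemma degeneration_2_4: "std_rep 2 \<in> zariski_closure (orbit (std_rep 4))"
proof (rule degeneration[where r = "bracket stdE stdF 1 5 6"])
  fix \<epsilon> :: complex assume eps: "\<epsilon> \<noteq> 0"
  show "std_rep 2 + \<epsilon> *s bracket stdE stdF 1 5 6 \<in> orbit (std_rep 4)"
    by (rule in_orbit_by_matrices[where A = "entries [
      ((1, 1), 1), ((2, 2), 1)]" and A' = "entries [
      ((1, 1), 1), ((2, 2), 1)]"
      and B = "entries [
      ((1, 1), 1), ((2, 2), 1), ((3, 3), 1), ((4, 4), 1), ((5, 5), \<epsilon>), ((6, 6), 1)]" and B' = "entries [
      ((1, 1), 1), ((2, 2), 1), ((3, 3), 1), ((4, 4), 1), ((5, 5), 1 / \<epsilon>), ((6, 6), 1)]"],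
      simp, (simp only: degeneration_simps; simp add: eps), (simp only: degeneration_simps; simp add: eps power2_eq_square),
      rule skew_perturbation, simp, (simp only: degeneration_simps; simp add: eps field_simps power2_eq_square))
qed

lemma degeneration_2_5: "std_rep 2 \<in> zariski_closure (orbit (std_rep 5))"
proof (rule degeneration[where r = "bracket stdE stdF 2 1 3"])
  fix \<epsilon> :: complex assume eps: "\<epsilon> \<noteq> 0"
  show "std_rep 2 + \<epsilon> *s bracket stdE stdF 2 1 3 \<in> orbit (std_rep 5)"
    by (rule in_orbit_by_matrices[where A = "entries [
      ((1, 1), 1), ((2, 2), \<epsilon>)]" and A' = "entries [
      ((1, 1), 1), ((2, 2), 1 / \<epsilon>)]"
      and B = "entries [
      ((1, 1), 1), ((2, 2), 1), ((3, 3), 1), ((4, 4), 1), ((5, 5), 1), ((6, 6), 1)]" and B' = "entries [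
      ((1, 1), 1), ((2, 2), 1), ((3, 3), 1), ((4, 4), 1), ((5, 5), 1), ((6, 6), 1)]"],
      simp, (simp only: degeneration_simps; simp add: eps), (simp only: degeneration_simps; simp add: eps power2_eq_square),
      rule skew_perturbation, simp, (simp only: degeneration_simps; simp add: eps field_simps power2_eq_square))
qed

lemma degeneration_3_5: "std_rep 3 \<in> zariski_closure (orbit (std_rep 5))"
proof (rule degeneration[where r = "bracket stdE stdF 1 3 4"])
  fix \<epsilon> :: complex assume eps: "\<epsilon> \<noteq> 0"
  show "std_rep 3 + \<epsilon> *s bracket stdE stdF 1 3 4 \<in> orbit (std_rep 5)"
    by (rule in_orbit_by_matrices[where A = "entries [
      ((1, 1), 1), ((2, 2), 1)]" and A' = "entries [
      ((1, 1), 1), ((2, 2), 1)]"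
      and B = "entries [
      ((1, 1), 1), ((2, 2), 1), ((3, 3), 1), ((4, 4), \<epsilon>), ((5, 5), 1), ((6, 6), 1)]" and B' = "entries [
      ((1, 1), 1), ((2, 2), 1), ((3, 3), 1), ((4, 4), 1 / \<epsilon>), ((5, 5), 1), ((6, 6), 1)]"],
      simp, (simp only: degeneration_simps; simp add: eps), (simp only: degeneration_simps; simp add: eps power2_eq_square),
      rule skew_perturbation, simp, (simp only: degeneration_simps; simp add: eps field_simps power2_eq_square))
qed

lemma degeneration_4_9: "std_rep 4 \<in> zariski_closure (orbit (std_rep 9))"
proof (rule degeneration[where r = "bracket stdE stdF 2 1 3"])
  fix \<epsilon> :: complex assume eps: "\<epsilon> \<noteq> 0"
  show "std_rep 4 + \<epsilon> *s bracket stdE stdF 2 1 3 \<in> orbit (std_rep 9)"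
    by (rule in_orbit_by_matrices[where A = "entries [
      ((1, 1), 1), ((2, 2), \<epsilon>)]" and A' = "entries [
      ((1, 1), 1), ((2, 2), 1 / \<epsilon>)]"
      and B = "entries [
      ((1, 5), 1), ((2, 6), 1), ((3, 1), 1), ((4, 3), 1), ((5, 2), 1), ((6, 4), 1)]" and B' = "entries [
      ((1, 3), 1), ((2, 5), 1), ((3, 4), 1), ((4, 6), 1), ((5, 1), 1), ((6, 2), 1)]"],
      simp, (simp only: degeneration_simps; simp add: eps), (simp only: degeneration_simps; simp add: eps power2_eq_square),
      rule skew_perturbation, simp, (simp only: degeneration_simps; simp add: eps field_simps power2_eq_square))
qed

lemma degeneration_5_6: "std_rep 5 \<in> zariski_closure (orbit (std_rep 6))"
proof (rule degeneration[where r = "bracket stdE stdF 2 1 2"])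
  fix \<epsilon> :: complex assume eps: "\<epsilon> \<noteq> 0"
  show "std_rep 5 + \<epsilon> *s bracket stdE stdF 2 1 2 \<in> orbit (std_rep 6)"
    by (rule in_orbit_by_matrices[where A = "entries [
      ((1, 1), 1), ((1, 2), \<epsilon>), ((2, 1), 1)]" and A' = "entries [
      ((1, 2), 1), ((2, 1), 1 / \<epsilon>), ((2, 2), - 1 / \<epsilon>)]"
      and B = "entries [
      ((1, 1), 1), ((2, 2), 1), ((2, 3), 1 / \<epsilon>), ((3, 3), 1),
      ((4, 1), 1 / \<epsilon>), ((4, 4), 1), ((5, 5), 1), ((6, 6), 1)]" and B' = "entries [
      ((1, 1), 1), ((2, 2), 1), ((2, 3), - 1 / \<epsilon>), ((3, 3), 1),
      ((4, 1), - 1 / \<epsilon>), ((4, 4), 1), ((5, 5), 1), ((6, 6), 1)]"],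
      simp, (simp only: degeneration_simps; simp add: eps), (simp only: degeneration_simps; simp add: eps power2_eq_square),
      rule skew_perturbation, simp, (simp only: degeneration_simps; simp add: eps field_simps power2_eq_square))
qed

lemma degeneration_6_7: "std_rep 6 \<in> zariski_closure (orbit (std_rep 7))"
proof (rule degeneration[where r = "bracket stdE stdF 1 3 5"])
  fix \<epsilon> :: complex assume eps: "\<epsilon> \<noteq> 0"
  show "std_rep 6 + \<epsilon> *s bracket stdE stdF 1 3 5 \<in> orbit (std_rep 7)"
    by (rule in_orbit_by_matrices[where A = "entries [
      ((1, 1), 1), ((2, 2), 1)]" and A' = "entries [
      ((1, 1), 1), ((2, 2), 1)]"
      and B = "entries [
      ((1, 1), 1), ((2, 2), 1), ((3, 3), 1), ((4, 4), 1), ((5, 5), \<epsilon>), ((6, 6), 1)]" and B' = "entries [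
      ((1, 1), 1), ((2, 2), 1), ((3, 3), 1), ((4, 4), 1), ((5, 5), 1 / \<epsilon>), ((6, 6), 1)]"],
      simp, (simp only: degeneration_simps; simp add: eps), (simp only: degeneration_simps; simp add: eps power2_eq_square),
      rule skew_perturbation, simp, (simp only: degeneration_simps; simp add: eps field_simps power2_eq_square))
qed

lemma degeneration_7_8: "std_rep 7 \<in> zariski_closure (orbit (std_rep 8))"
proof (rule degeneration[where r = "bracket stdE stdF 2 1 5"])
  fix \<epsilon> :: complex assume eps: "\<epsilon> \<noteq> 0"
  show "std_rep 7 + \<epsilon> *s bracket stdE stdF 2 1 5 \<in> orbit (std_rep 8)"
    by (rule in_orbit_by_matrices[where A = "entries [
      ((1, 1), 1), ((2, 2), 1)]" and A' = "entries [
      ((1, 1), 1), ((2, 2), 1)]"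
      and B = "entries [
      ((1, 1), \<epsilon>), ((2, 2), 1 / \<epsilon>), ((3, 3), 1), ((4, 4), 1), ((5, 5), 1),
      ((6, 6), 1)]" and B' = "entries [
      ((1, 1), 1 / \<epsilon>), ((2, 2), \<epsilon>), ((3, 3), 1), ((4, 4), 1), ((5, 5), 1),
      ((6, 6), 1)]"],
      simp, (simp only: degeneration_simps; simp add: eps), (simp only: degeneration_simps; simp add: eps power2_eq_square),
      rule skew_perturbation, simp, (simp only: degeneration_simps; simp add: eps field_simps power2_eq_square))
qed

lemma degeneration_7_9: "std_rep 7 \<in> zariski_closure (orbit (std_rep 9))"
proof (rule degeneration[where r = "bracket stdE stdF 1 4 6"])
  fix \<epsilon> :: complex assume eps: "\<epsilon> \<noteq> 0"
  show "std_rep 7 + \<epsilon> *s bracket stdE stdF 1 4 6 \<in> orbit (std_rep 9)"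
    by (rule in_orbit_by_matrices[where A = "entries [
      ((1, 1), 1), ((2, 2), 1)]" and A' = "entries [
      ((1, 1), 1), ((2, 2), 1)]"
      and B = "entries [
      ((1, 1), 1), ((2, 2), 1), ((3, 3), 1), ((4, 4), 1), ((5, 5), 1), ((6, 6), \<epsilon>)]" and B' = "entries [
      ((1, 1), 1), ((2, 2), 1), ((3, 3), 1), ((4, 4), 1), ((5, 5), 1), ((6, 6), 1 / \<epsilon>)]"],
      simp, (simp only: degeneration_simps; simp add: eps), (simp only: degeneration_simps; simp add: eps power2_eq_square),
      rule skew_perturbation, simp, (simp only: degeneration_simps; simp add: eps field_simps power2_eq_square))
qed

lemma degeneration_8_10: "std_rep 8 \<in> zariski_closure (orbit (std_rep 10))"
proof (rule degeneration[where r = "bracket stdE stdF 2 1 6"])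
  fix \<epsilon> :: complex assume eps: "\<epsilon> \<noteq> 0"
  show "std_rep 8 + \<epsilon> *s bracket stdE stdF 2 1 6 \<in> orbit (std_rep 10)"
    by (rule in_orbit_by_matrices[where A = "entries [
      ((1, 1), 1), ((2, 2), 1)]" and A' = "entries [
      ((1, 1), 1), ((2, 2), 1)]"
      and B = "entries [
      ((1, 1), 1), ((2, 2), 1), ((3, 4), - 1), ((4, 3), 1), ((5, 5), 1), ((6, 5), 1),
      ((6, 6), \<epsilon>)]" and B' = "entries [
      ((1, 1), 1), ((2, 2), 1), ((3, 4), 1), ((4, 3), - 1), ((5, 5), 1),
      ((6, 5), - 1 / \<epsilon>), ((6, 6), 1 / \<epsilon>)]"],
      simp, (simp only: degeneration_simps; simp add: eps), (simp only: degeneration_simps; simp add: eps power2_eq_square),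
      rule skew_perturbation, simp, (simp only: degeneration_simps; simp add: eps field_simps power2_eq_square))
qed

lemma degeneration_9_12: "std_rep 9 \<in> zariski_closure (orbit (std_rep 12))"
proof (rule degeneration[where r = "bracket stdE stdF 2 3 5"])
  fix \<epsilon> :: complex assume eps: "\<epsilon> \<noteq> 0"
  show "std_rep 9 + \<epsilon> *s bracket stdE stdF 2 3 5 \<in> orbit (std_rep 12)"
    by (rule in_orbit_by_matrices[where A = "entries [
      ((1, 1), 1), ((2, 1), 1 / \<epsilon>), ((2, 2), 1)]" and A' = "entries [
      ((1, 1), 1), ((2, 1), - 1 / \<epsilon>), ((2, 2), 1)]"
      and B = "entries [
      ((1, 1), 1), ((2, 2), 1), ((3, 3), 1), ((4, 4), 1), ((4, 5), \<epsilon>),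
      ((5, 4), - 1 / \<epsilon>), ((6, 3), - 1), ((6, 6), - \<epsilon>)]" and B' = "entries [
      ((1, 1), 1), ((2, 2), 1), ((3, 3), 1), ((4, 5), - \<epsilon>), ((5, 4), 1 / \<epsilon>),
      ((5, 5), 1), ((6, 3), - 1 / \<epsilon>), ((6, 6), - 1 / \<epsilon>)]"],
      simp, (simp only: degeneration_simps; simp add: eps), (simp only: degeneration_simps; simp add: eps power2_eq_square),
      rule skew_perturbation, simp, (simp only: degeneration_simps; simp add: eps field_simps power2_eq_square))
qed

lemma degeneration_9_11: "std_rep 9 \<in> zariski_closure (orbit (std_rep 11))"
proof (rule degeneration[where r = "bracket stdE stdF 2 1 5"])
  fix \<epsilon> :: complex assume eps: "\<epsilon> \<noteq> 0"
  show "std_rep 9 + \<epsilon> *s bracket stdE stdF 2 1 5 \<in> orbit (std_rep 11)"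
    by (rule in_orbit_by_matrices[where A = "entries [
      ((1, 1), 1), ((2, 2), 1)]" and A' = "entries [
      ((1, 1), 1), ((2, 2), 1)]"
      and B = "entries [
      ((1, 1), \<epsilon>), ((2, 2), 1 / \<epsilon>), ((3, 3), 1), ((4, 4), 1), ((5, 6), 1),
      ((6, 5), 1)]" and B' = "entries [
      ((1, 1), 1 / \<epsilon>), ((2, 2), \<epsilon>), ((3, 3), 1), ((4, 4), 1), ((5, 6), 1),
      ((6, 5), 1)]"],
      simp, (simp only: degeneration_simps; simp add: eps), (simp only: degeneration_simps; simp add: eps power2_eq_square),
      rule skew_perturbation, simp, (simp only: degeneration_simps; simp add: eps field_simps power2_eq_square))
qed

lemma degeneration_10_11: "std_rep 10 \<in> zariski_closure (orbit (std_rep 11))"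
proof (rule degeneration[where r = "bracket stdE stdF 1 3 6"])
  fix \<epsilon> :: complex assume eps: "\<epsilon> \<noteq> 0"
  show "std_rep 10 + \<epsilon> *s bracket stdE stdF 1 3 6 \<in> orbit (std_rep 11)"
    by (rule in_orbit_by_matrices[where A = "entries [
      ((1, 1), 1), ((2, 2), 1)]" and A' = "entries [
      ((1, 1), 1), ((2, 2), 1)]"
      and B = "entries [
      ((1, 1), 1), ((2, 2), 1), ((3, 3), \<epsilon>), ((4, 4), 1 / \<epsilon>),
      ((5, 5), \<epsilon>), ((6, 6), 1)]" and B' = "entries [
      ((1, 1), 1), ((2, 2), 1), ((3, 3), 1 / \<epsilon>), ((4, 4), \<epsilon>),
      ((5, 5), 1 / \<epsilon>), ((6, 6), 1)]"],
      simp, (simp only: degeneration_simps; simp add: eps), (simp only: degeneration_simps; simp add: eps power2_eq_square),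
      rule skew_perturbation, simp, (simp only: degeneration_simps; simp add: eps field_simps power2_eq_square))
qed

lemma degeneration_11_13: "std_rep 11 \<in> zariski_closure (orbit (std_rep 13))"
proof (rule degeneration[where r = "bracket stdE stdF 2 3 6"])
  fix \<epsilon> :: complex assume eps: "\<epsilon> \<noteq> 0"
  show "std_rep 11 + \<epsilon> *s bracket stdE stdF 2 3 6 \<in> orbit (std_rep 13)"
    by (rule in_orbit_by_matrices[where A = "entries [
      ((1, 1), 1), ((2, 1), 1 / \<epsilon>), ((2, 2), 1)]" and A' = "entries [
      ((1, 1), 1), ((2, 1), - 1 / \<epsilon>), ((2, 2), 1)]"
      and B = "entries [
      ((1, 1), 1), ((2, 2), 1), ((2, 4), 1 / \<epsilon> ^ 2), ((2, 6), - 1 / \<epsilon>),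
      ((3, 1), 1), ((3, 3), \<epsilon>), ((4, 4), 1 / \<epsilon>), ((4, 6), 1),
      ((5, 4), - 1 / \<epsilon>), ((6, 1), - 1 / \<epsilon>), ((6, 3), - 1),
      ((6, 5), - \<epsilon>)]" and B' = "entries [
      ((1, 1), 1), ((2, 2), 1), ((2, 4), 1 / \<epsilon>), ((2, 5), 2 / \<epsilon>),
      ((3, 1), - 1 / \<epsilon>), ((3, 3), 1 / \<epsilon>), ((4, 5), - \<epsilon>),
      ((5, 3), - 1 / \<epsilon> ^ 2), ((5, 6), - 1 / \<epsilon>), ((6, 4), 1), ((6, 5), 1)]"],
      simp, (simp only: degeneration_simps; simp add: eps), (simp only: degeneration_simps; simp add: eps power2_eq_square),
      rule skew_perturbation, simp, (simp only: degeneration_simps; simp add: eps field_simps power2_eq_square))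
qed

lemma degeneration_12_13: "std_rep 12 \<in> zariski_closure (orbit (std_rep 13))"
proof (rule degeneration[where r = "bracket stdE stdF 2 1 5"])
  fix \<epsilon> :: complex assume eps: "\<epsilon> \<noteq> 0"
  show "std_rep 12 + \<epsilon> *s bracket stdE stdF 2 1 5 \<in> orbit (std_rep 13)"
    by (rule in_orbit_by_matrices[where A = "entries [
      ((1, 1), 1), ((2, 2), 1)]" and A' = "entries [
      ((1, 1), 1), ((2, 2), 1)]"
      and B = "entries [
      ((1, 1), \<epsilon>), ((2, 2), 1 / \<epsilon>), ((3, 3), 1), ((4, 4), 1), ((5, 5), 1),
      ((6, 6), 1)]" and B' = "entries [
      ((1, 1), 1 / \<epsilon>), ((2, 2), \<epsilon>), ((3, 3), 1), ((4, 4), 1), ((5, 5), 1),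
      ((6, 6), 1)]"],
      simp, (simp only: degeneration_simps; simp add: eps), (simp only: degeneration_simps; simp add: eps power2_eq_square),
      rule skew_perturbation, simp, (simp only: degeneration_simps; simp add: eps field_simps power2_eq_square))
qed

lemma degeneration_13_14: "std_rep 13 \<in> zariski_closure (orbit (std_rep 14))"
proof (rule degeneration[where r = "bracket stdE stdF 2 5 6"])
  fix \<epsilon> :: complex assume eps: "\<epsilon> \<noteq> 0"
  show "std_rep 13 + \<epsilon> *s bracket stdE stdF 2 5 6 \<in> orbit (std_rep 14)"
    by (rule in_orbit_by_matrices[where A = "entries [
      ((1, 1), 1), ((2, 2), \<epsilon>)]" and A' = "entries [
      ((1, 1), 1), ((2, 2), 1 / \<epsilon>)]"
      and B = "entries [
      ((1, 1), 1), ((2, 2), 1), ((2, 5), - 1 / \<epsilon>), ((3, 3), 1 / \<epsilon>),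
      ((4, 4), 1), ((5, 5), 1), ((6, 1), - 1 / \<epsilon>), ((6, 6), 1)]" and B' = "entries [
      ((1, 1), 1), ((2, 2), 1), ((2, 5), 1 / \<epsilon>), ((3, 3), \<epsilon>), ((4, 4), 1),
      ((5, 5), 1), ((6, 1), 1 / \<epsilon>), ((6, 6), 1)]"],
      simp, (simp only: degeneration_simps; simp add: eps), (simp only: degeneration_simps; simp add: eps power2_eq_square),
      rule skew_perturbation, simp, (simp only: degeneration_simps; simp add: eps field_simps power2_eq_square))
qed

section \<open>Separating functions\<close>

lemma in_orbit_rep:
  assumes "n \<le> 14" "y \<in> orbit (std_rep n)"
  shows "\<exists>e f. y = rep e f n"
proof -
  obtain A B where y: "y = act (A, B, 1) (std_rep n)" using assms(2) unfolding orbit_gl by blast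
  define e f where "e k = A *v stdE k" and "f i = B *v stdF i" for k i
  have br: "act (A, B, 1) (bracket stdE stdF k i j) = bracket e f k i j" for k i j
    by (rule act_bracket) (simp_all add: e_def f_def)
  have "act (A, B, 1) (std_rep n) = rep e f n"
    using nat_le_14_cases[OF assms(1)]
    by (elim disjE) (simp_all add: rep_simps act_add act_zero br del: act.simps)
  then show ?thesis using y by blast
qed

text \<open>
  Only values at the representatives in arbitrary, possibly degenerate, frames have to be computed.
\<close>

lemma not_in_closureI:
  assumes "p \<in> poly_funs" "n \<le> 14" "\<And>e f. p (rep e f n) = 0" "p x \<noteq> 0"
  shows "x \<notin> zariski_closure (orbit (std_rep n))"
proof -
  have "\<forall>y\<in>orbit (std_rep n). p y = 0" using in_orbit_rep[OF assms(2)] assms(3) by metis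
  then show ?thesis using assms(1,4) unfolding zariski_closure_eq by blast
qed

text \<open>
  All members of the pencil of the third representative are divisible by \<open>f 1\<close>, hence decomposable, and their
  Pfaffians vanish.
\<close>

lemma not_2_le_3: "std_rep 2 \<notin> zariski_closure (orbit (std_rep 3))"
proof (rule not_in_closureI)
  let ?p = "\<lambda>x :: tensors. x $ (1, 1, 2) * x $ (1, 3, 4) - x $ (1, 1, 3) * x $ (1, 2, 4) + x $ (1, 1, 4) * x $ (1, 2, 3)"
  show "?p \<in> poly_funs" by (intro pf_add pf_diff pf_mult pf_coord)
  show "?p (rep e f 3) = 0" for e f by (simp add: rep_simps bracket_nth algebra_simps)
  show "?p (std_rep 2) \<noteq> 0" by (simp add: leaf_simps)
qed simp

text \<open>
  The elements of the larger of the two orbits have the form \<open>e 1 \<otimes> \<omega>\<close>; as tensors of rank one they have vanishing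
  two-by-two minors.
\<close>

lemma not_3_le_4: "std_rep 3 \<notin> zariski_closure (orbit (std_rep 4))"
proof (rule not_in_closureI)
  let ?p = "\<lambda>x :: tensors. x $ (1, 1, 2) * x $ (2, 1, 3) - x $ (2, 1, 2) * x $ (1, 1, 3)"
  show "?p \<in> poly_funs" by (intro pf_diff pf_mult pf_coord)
  show "?p (rep e f 4) = 0" for e f by (simp add: rep_simps bracket_nth algebra_simps)
  show "?p (std_rep 3) \<noteq> 0" by (simp add: leaf_simps)
qed simp

definition pfaffian4 :: "tensors \<Rightarrow> 2 \<Rightarrow> 2 \<Rightarrow> 6 \<Rightarrow> 6 \<Rightarrow> 6 \<Rightarrow> 6 \<Rightarrow> complex"
  where "pfaffian4 x k l a b c d = x $ (k, a, b) * x $ (l, c, d) - x $ (k, a, c) * x $ (l, b, d) + x $ (k, a, d) * x $ (l, b, c)"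

text \<open>
  The coefficients of \<open>x \<and> x\<close> in \<open>S\<^sup>2 E \<otimes> \<And>\<^sup>4 F\<close>: the index \<open>i\<close> stands for the basis of \<open>S\<^sup>2 E\<close>.
\<close>

definition pencil_quadric :: "tensors \<Rightarrow> 6 \<Rightarrow> 6 \<Rightarrow> 6 \<Rightarrow> 6 \<Rightarrow> 3 \<Rightarrow> complex"
  where "pencil_quadric x a b c d i =
    (if i = 1 then pfaffian4 x 1 1 a b c d
     else if i = 2 then pfaffian4 x 1 2 a b c d + pfaffian4 x 2 1 a b c d
     else pfaffian4 x 2 2 a b c d)"

text \<open>
  The element is \<open>e 1 \<otimes> w + e 2 \<otimes> z\<close> with \<open>z\<close> decomposable. As \<open>z \<and> z = 0\<close>, its square involves only two
  elements of \<open>S\<^sup>2 E\<close>.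
\<close>

lemma pencil_quadric_rep_12:
  "\<exists>\<alpha> \<beta> P Q. \<forall>a b c d i. pencil_quadric (rep e f 12) a b c d i = \<alpha> i * P a b c d + \<beta> i * Q a b c d"
proof -
  define w where "w p q = (f 1 $ p * f 2 $ q - f 1 $ q * f 2 $ p) + (f 5 $ p * f 6 $ q - f 5 $ q * f 6 $ p)" for p q
  define z where "z p q = f 3 $ p * f 4 $ q - f 3 $ q * f 4 $ p" for p q
  define P where "P a b c d = w a b * w c d - w a c * w b d + w a d * w b c" for a b c d
  define Q where "Q a b c d = w a b * z c d + z a b * w c d - w a c * z b d - z a c * w b d + w a d * z b c + z a d * w b c"
    for a b c d
  have x: "rep e f 12 $ (k, p, q) = e 1 $ k * w p q + e 2 $ k * z p q" for k p q
    by (simp add: rep_simps bracket_nth w_def z_def distrib_left)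
  have pl: "z a b * z c d - z a c * z b d + z a d * z b c = 0" for a b c d by (simp add: z_def algebra_simps)
  have pf: "pfaffian4 (rep e f 12) k l a b c d = e 1 $ k * e 1 $ l * P a b c d
    + (e 1 $ k * e 2 $ l * (w a b * z c d - w a c * z b d + w a d * z b c)
    + e 2 $ k * e 1 $ l * (z a b * w c d - z a c * w b d + z a d * w b c))
    + e 2 $ k * e 2 $ l * (z a b * z c d - z a c * z b d + z a d * z b c)" for k l a b c d
    unfolding pfaffian4_def x P_def by (simp add: algebra_simps)
  have "pencil_quadric (rep e f 12) a b c d i =
    (if i = 1 then e 1 $ 1 * e 1 $ 1 else if i = 2 then 2 * e 1 $ 1 * e 1 $ 2 else e 1 $ 2 * e 1 $ 2) * P a b c d +
    (if i = 1 then e 1 $ 1 * e 2 $ 1 else if i = 2 then e 1 $ 1 * e 2 $ 2 + e 1 $ 2 * e 2 $ 1 else e 1 $ 2 * e 2 $ 2) *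
      Q a b c d" for a b c d i
    unfolding pencil_quadric_def pf pl Q_def by (simp add: algebra_simps)
  then show ?thesis by (intro exI allI) assumption
qed

definition det3 :: "(3 \<Rightarrow> complex) \<Rightarrow> (3 \<Rightarrow> complex) \<Rightarrow> (3 \<Rightarrow> complex) \<Rightarrow> complex"
  where "det3 u v w = u 1 * v 2 * w 3 + u 2 * v 3 * w 1 + u 3 * v 1 * w 2
    - u 1 * v 3 * w 2 - u 2 * v 1 * w 3 - u 3 * v 2 * w 1"

lemma det3_rank_2:
  "det3 (\<lambda>i. \<alpha> i * p1 + \<beta> i * q1) (\<lambda>i. \<alpha> i * p2 + \<beta> i * q2) (\<lambda>i. \<alpha> i * p3 + \<beta> i * q3) = 0"
  unfolding det3_def by algebra

lemma eq_3: "(1 :: 3) \<noteq> 2" "(1 :: 3) \<noteq> 3" "(2 :: 3) \<noteq> 1" "(2 :: 3) \<noteq> 3" "(3 :: 3) \<noteq> 1" "(3 :: 3) \<noteq> 2"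
  by auto

text \<open>
  The square of the element has rank at most two as a map to \<open>S\<^sup>2 E\<close> on one orbit but rank three at the
  eighth representative.
\<close>

lemma not_8_le_12: "std_rep 8 \<notin> zariski_closure (orbit (std_rep 12))"
proof (rule not_in_closureI)
  let ?p = "\<lambda>x. det3 (pencil_quadric x 1 2 3 5) (pencil_quadric x 1 2 3 4) (pencil_quadric x 1 3 4 5)"
  have pf: "(\<lambda>x. pfaffian4 x k l a b c d) \<in> poly_funs" for k l a b c d
    unfolding pfaffian4_def by (intro pf_add pf_diff pf_mult pf_coord)
  have pq: "(\<lambda>x. pencil_quadric x a b c d i) \<in> poly_funs" for a b c d i
    by (cases "i = 1"; cases "i = 2") (simp_all add: pencil_quadric_def pf pf_add)
  show "?p \<in> poly_funs" unfolding det3_def by (intro pf_add pf_diff pf_mult pq)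
  show "?p (rep e f 12) = 0" for e f
  proof -
    obtain \<alpha> \<beta> P Q where pq: "\<And>a b c d i. pencil_quadric (rep e f 12) a b c d i = \<alpha> i * P a b c d + \<beta> i * Q a b c d"
      using pencil_quadric_rep_12 by blast
    have "pencil_quadric (rep e f 12) a b c d = (\<lambda>i. \<alpha> i * P a b c d + \<beta> i * Q a b c d)" for a b c d
      by (rule ext) (rule pq)
    then show ?thesis by (simp only: det3_rank_2)
  qed
  have "pencil_quadric (std_rep 8) 1 2 3 5 i = (if i = 1 then 1 else 0)"
    "pencil_quadric (std_rep 8) 1 2 3 4 i = (if i = 1 then 0 else if i = 2 then 1 else 0)"
    "pencil_quadric (std_rep 8) 1 3 4 5 i = (if i = 1 \<or> i = 2 then 0 else 1)" for i
    unfolding pencil_quadric_def pfaffian4_def by (simp_all add: leaf_simps)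
  then show "?p (std_rep 8) \<noteq> 0" by (simp add: det3_def eq_3)
qed simp

section \<open>The top exterior product\<close>

text \<open>
  The coefficient of \<open>x \<and> y \<and> z\<close> in the one-dimensional space \<open>\<And>\<^sup>6 F\<close>, up to a constant factor.
\<close>

definition top_form :: "(6 \<Rightarrow> 6 \<Rightarrow> complex) \<Rightarrow> (6 \<Rightarrow> 6 \<Rightarrow> complex) \<Rightarrow> (6 \<Rightarrow> 6 \<Rightarrow> complex) \<Rightarrow> complex"
  where "top_form x y z = (\<Sum>\<sigma> | \<sigma> permutes UNIV. of_int (sign \<sigma>) * (x (\<sigma> 1) (\<sigma> 2) * y (\<sigma> 3) (\<sigma> 4) * z (\<sigma> 5) (\<sigma> 6)))"

abbreviation wdg :: "complex ^ 6 \<Rightarrow> complex ^ 6 \<Rightarrow> 6 \<Rightarrow> 6 \<Rightarrow> complex"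
  where "wdg u v \<equiv> \<lambda>p q. u $ p * v $ q - u $ q * v $ p"

abbreviation det6 :: "complex ^ 6 \<Rightarrow> complex ^ 6 \<Rightarrow> complex ^ 6 \<Rightarrow> complex ^ 6 \<Rightarrow> complex ^ 6 \<Rightarrow> complex ^ 6 \<Rightarrow> complex"
  where "det6 a b c d e f \<equiv> det (\<chi> i. list6 a b c d e f i)"

lemma top_form_linear:
  "top_form (\<lambda>p q. c * x p q + d * x' p q) y z = c * top_form x y z + d * top_form x' y z"
  "top_form x (\<lambda>p q. c * y p q + d * y' p q) z = c * top_form x y z + d * top_form x y' z"
  "top_form x y (\<lambda>p q. c * z p q + d * z' p q) = c * top_form x y z + d * top_form x y z'"
  unfolding top_form_def sum_distrib_left sum.distrib[symmetric]
  by (intro sum.cong refl; simp add: algebra_simps)+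

lemma prod_6: "(\<Prod>i\<in>UNIV. g i) = g 1 * g 2 * g 3 * g 4 * g 5 * g (6 :: 6)" for g :: "6 \<Rightarrow> complex"
  unfolding UNIV_6 by (simp add: eq_6 mult.assoc)

lemma det6_expand:
  "det6 a b c d e f = (\<Sum>\<sigma> | \<sigma> permutes UNIV. of_int (sign \<sigma>) *
    (a $ \<sigma> 1 * b $ \<sigma> 2 * c $ \<sigma> 3 * d $ \<sigma> 4 * e $ \<sigma> 5 * f $ \<sigma> 6))"
  unfolding det_def prod_6 vec_lambda_beta list_nth ..

lemma det_swap:
  fixes v :: "'n \<Rightarrow> complex ^ 'n"
  assumes "a \<noteq> b" shows "det (\<chi> i. v (Transposition.transpose a b i)) = - det (\<chi> i. v i)"
proof -
  have "det (\<chi> i. (\<chi> i. v i) $ Transposition.transpose a b i) = of_int (sign (Transposition.transpose a b)) * det (\<chi> i. v i)"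
    by (rule det_permute_rows) (simp add: permutes_swap_id)
  then show ?thesis by (simp add: sign_swap_id assms)
qed

lemma det6_swaps:
  "det6 b a c d e f = - det6 a b c d e f" "det6 a b d c e f = - det6 a b c d e f" "det6 a b c d f e = - det6 a b c d e f"
  "det6 a c b d e f = - det6 a b c d e f" "det6 a b c e d f = - det6 a b c d e f"
proof -
  have tr: "(\<chi> i. list6 a b c d e f (Transposition.transpose j k i)) = (\<chi> i. list6 a' b' c' d' e' f' i)"
    if "list6 a b c d e f \<circ> Transposition.transpose j k = list6 a' b' c' d' e' f'" for j k a' b' c' d' e' f'
    using that by (simp add: fun_eq_iff)
  have l: "(g = h) = (\<forall>i::6. g i = h i)" for g h :: "6 \<Rightarrow> complex ^ 6" by auto
  show "det6 b a c d e f = - det6 a b c d e f"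
    by (subst det_swap[of 1 2 "list6 a b c d e f", symmetric], simp, subst tr)
      (simp_all add: l forall_6 list_nth Transposition.transpose_def eq_6)
  show "det6 a b d c e f = - det6 a b c d e f"
    by (subst det_swap[of 3 4 "list6 a b c d e f", symmetric], simp, subst tr)
      (simp_all add: l forall_6 list_nth Transposition.transpose_def eq_6)
  show "det6 a b c d f e = - det6 a b c d e f"
    by (subst det_swap[of 5 6 "list6 a b c d e f", symmetric], simp, subst tr)
      (simp_all add: l forall_6 list_nth Transposition.transpose_def eq_6)
  show "det6 a c b d e f = - det6 a b c d e f"
    by (subst det_swap[of 2 3 "list6 a b c d e f", symmetric], simp, subst tr)
      (simp_all add: l forall_6 list_nth Transposition.transpose_def eq_6)
  show "det6 a b c e d f = - det6 a b c d e f"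
    by (subst det_swap[of 4 5 "list6 a b c d e f", symmetric], simp, subst tr)
      (simp_all add: l forall_6 list_nth Transposition.transpose_def eq_6)
qed

lemma det6_pair_swaps:
  "det6 c d a b e f = det6 a b c d e f" "det6 a b e f c d = det6 a b c d e f"
proof -
  have "det6 c d a b e f = - det6 c a d b e f" by (rule det6_swaps(4))
  also have "\<dots> = det6 a c d b e f" using det6_swaps(1)[of c a d b e f] by simp
  also have "\<dots> = - det6 a c b d e f" by (rule det6_swaps(2))
  also have "\<dots> = det6 a b c d e f" using det6_swaps(4)[of a c b d e f] by simp
  finally show "det6 c d a b e f = det6 a b c d e f" .
  have "det6 a b e f c d = - det6 a b e c f d" by (rule det6_swaps(5))
  also have "\<dots> = det6 a b c e f d" using det6_swaps(2)[of a b e c f d] by simp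
  also have "\<dots> = - det6 a b c e d f" by (rule det6_swaps(3))
  also have "\<dots> = det6 a b c d e f" using det6_swaps(5)[of a b c e d f] by simp
  finally show "det6 a b e f c d = det6 a b c d e f" .
qed

lemma top_form_wedge: "top_form (wdg a b) (wdg c d) (wdg e f) = 8 * det6 a b c d e f"
proof -
  have "top_form (wdg a b) (wdg c d) (wdg e f) =
      det6 a b c d e f - det6 b a c d e f - det6 a b d c e f + det6 b a d c e f
      - det6 a b c d f e + det6 b a c d f e + det6 a b d c f e - det6 b a d c f e"
    unfolding top_form_def det6_expand sum_subtractf[symmetric] sum.distrib[symmetric]
    by (intro sum.cong refl) (simp add: algebra_simps)
  also have "\<dots> = 8 * det6 a b c d e f"
    using det6_swaps(1)[of b a] det6_swaps(2)[of _ _ d c] det6_swaps(3)[of _ _ _ _ f e] by simp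
  finally show ?thesis .
qed

lemma det6_repeated: "det6 a b a d e f = 0" "det6 a b c a e f = 0" "det6 a b c d a f = 0" "det6 a b c d e a = 0"
  "det6 a b b d e f = 0" "det6 a b c b e f = 0" "det6 a b c d b f = 0" "det6 a b c d e b = 0"
  "det6 a b c d c f = 0" "det6 a b c d e c = 0" "det6 a b c d d f = 0" "det6 a b c d e d = 0"
  by (rule det_identical_rows[of 1 3], simp add: eq_6, simp add: row_def list_nth,
    rule det_identical_rows[of 1 4], simp add: eq_6, simp add: row_def list_nth,
    rule det_identical_rows[of 1 5], simp add: eq_6, simp add: row_def list_nth,
    rule det_identical_rows[of 1 6], simp add: eq_6, simp add: row_def list_nth,
    rule det_identical_rows[of 2 3], simp add: eq_6, simp add: row_def list_nth,
    rule det_identical_rows[of 2 4], simp add: eq_6, simp add: row_def list_nth,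
    rule det_identical_rows[of 2 5], simp add: eq_6, simp add: row_def list_nth,
    rule det_identical_rows[of 2 6], simp add: eq_6, simp add: row_def list_nth,
    rule det_identical_rows[of 3 5], simp add: eq_6, simp add: row_def list_nth,
    rule det_identical_rows[of 3 6], simp add: eq_6, simp add: row_def list_nth,
    rule det_identical_rows[of 4 5], simp add: eq_6, simp add: row_def list_nth,
    rule det_identical_rows[of 4 6], simp add: eq_6, simp add: row_def list_nth)

lemma top_form_sum_list:
  "top_form (\<lambda>p q. \<Sum>(c, u, v)\<leftarrow>xs. c * wdg u v p q) y z = (\<Sum>(c, u, v)\<leftarrow>xs. c * top_form (wdg u v) y z)" (is ?A)
  "top_form x (\<lambda>p q. \<Sum>(c, u, v)\<leftarrow>xs. c * wdg u v p q) z = (\<Sum>(c, u, v)\<leftarrow>xs. c * top_form x (wdg u v) z)" (is ?B)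
  "top_form x y (\<lambda>p q. \<Sum>(c, u, v)\<leftarrow>xs. c * wdg u v p q) = (\<Sum>(c, u, v)\<leftarrow>xs. c * top_form x y (wdg u v))" (is ?C)
proof -
  show ?A
  proof (induction xs)
    case Nil show ?case by (simp add: top_form_def)
  next
    case (Cons s xs)
    obtain c u v where s: "s = (c, u, v)" by (cases s) auto
    show ?case
      using top_form_linear(1)[of c "wdg u v" 1 "\<lambda>p q. \<Sum>(c, u, v)\<leftarrow>xs. c * wdg u v p q" y z]
      unfolding s list.map sum_list.Cons prod.case Cons mult_1_left .
  qed
  show ?B
  proof (induction xs)
    case Nil show ?case by (simp add: top_form_def)
  next
    case (Cons s xs)
    obtain c u v where s: "s = (c, u, v)" by (cases s) auto
    show ?case
      using top_form_linear(2)[of x c "wdg u v" 1 "\<lambda>p q. \<Sum>(c, u, v)\<leftarrow>xs. c * wdg u v p q" z]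
      unfolding s list.map sum_list.Cons prod.case Cons mult_1_left .
  qed
  show ?C
  proof (induction xs)
    case Nil show ?case by (simp add: top_form_def)
  next
    case (Cons s xs)
    obtain c u v where s: "s = (c, u, v)" by (cases s) auto
    show ?case
      using top_form_linear(3)[of x y c "wdg u v" 1 "\<lambda>p q. \<Sum>(c, u, v)\<leftarrow>xs. c * wdg u v p q"]
      unfolding s list.map sum_list.Cons prod.case Cons mult_1_left .
  qed
qed

text \<open>
  The coefficients of the cubic form on the pencil whose value is the Pfaffian of a member.
\<close>

definition cubic :: "2 \<Rightarrow> 2 \<Rightarrow> 2 \<Rightarrow> tensors \<Rightarrow> complex"
  where "cubic k l m x = top_form (\<lambda>p q. x $ (k, p, q)) (\<lambda>p q. x $ (l, p, q)) (\<lambda>p q. x $ (m, p, q))"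

lemma pf_cubic: "cubic k l m \<in> poly_funs"
proof -
  have "cubic k l m = (\<lambda>x. \<Sum>\<sigma> | \<sigma> permutes UNIV. of_int (sign \<sigma>) *
      (x $ (k, \<sigma> 1, \<sigma> 2) * x $ (l, \<sigma> 3, \<sigma> 4) * x $ (m, \<sigma> 5, \<sigma> 6)))"
    by (auto simp: cubic_def top_form_def)
  also have "\<dots> \<in> poly_funs" by (intro pf_sum pf_mult pf_coord pf_const)
  finally show ?thesis .
qed

lemma cubic_wedges:
  assumes "\<And>k p q. x $ (k, p, q) = (\<Sum>(c, u, v)\<leftarrow>xs k. c * wdg u v p q)"
  shows "cubic k l m x = (\<Sum>(c, u, v)\<leftarrow>xs k. c * (\<Sum>(c', u', v')\<leftarrow>xs l. c' * (\<Sum>(c'', u'', v'')\<leftarrow>xs m.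
    c'' * (8 * det6 u v u' v' u'' v''))))"
  unfolding cubic_def assms top_form_sum_list top_form_wedge ..

lemma det6_permute_pairs:
  "det6 a b e f c d = det6 a b c d e f" "det6 c d a b e f = det6 a b c d e f"
  "det6 c d e f a b = det6 a b c d e f" "det6 e f a b c d = det6 a b c d e f" "det6 e f c d a b = det6 a b c d e f"
  using det6_pair_swaps by metis+

lemma det6_std: "det6 (stdF 1) (stdF 2) (stdF 3) (stdF 4) (stdF 5) (stdF 6) = 1"
proof -
  have "(\<chi> i. list6 (stdF 1) (stdF 2) (stdF 3) (stdF 4) (stdF 5) (stdF 6) i) = (mat 1 :: complex ^ 6 ^ 6)"
    by (simp add: vec_eq_iff forall_6 list_nth axis_def mat_def eq_6)
  then show ?thesis by simp
qed

lemmas det6_std_pairs = det6_std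
  det6_permute_pairs[where a = "stdF 1" and b = "stdF 2" and c = "stdF 3" and d = "stdF 4" and e = "stdF 5" and f = "stdF 6", unfolded det6_std]

lemma stdE_nth: "stdE 1 $ 1 = 1" "stdE 1 $ 2 = 0" "stdE 2 $ 1 = 0" "stdE 2 $ 2 = 1"
  by (simp_all add: axis_def)

text \<open>
  No three of the four brackets of the tenth representative cover all six indices, so that the cubic form vanishes.
\<close>

lemma not_4_le_10: "std_rep 4 \<notin> zariski_closure (orbit (std_rep 10))"
proof (rule not_in_closureI)
  show "cubic 1 1 1 \<in> poly_funs" by (rule pf_cubic)
  show "cubic 1 1 1 (rep e f 10) = 0" for e f
  proof -
    have x: "rep e f 10 $ (k, p, q) = (\<Sum>(c, u, v)\<leftarrow>[(e 1 $ k, f 1, f 2), (e 2 $ k, f 3, f 4), (e 1 $ k, f 4, f 5),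
        (e 2 $ k, f 1, f 6)]. c * wdg u v p q)" for k p q
      by (simp add: rep_simps bracket_nth)
    show ?thesis unfolding cubic_wedges[OF x] by (simp add: det6_repeated)
  qed
  have x: "std_rep 4 $ (k, p, q) = (\<Sum>(c, u, v)\<leftarrow>[(stdE 1 $ k, stdF 1, stdF 2), (stdE 1 $ k, stdF 3, stdF 4),
      (stdE 1 $ k, stdF 5, stdF 6)]. c * wdg u v p q)" for k p q
    by (simp add: rep_simps bracket_nth)
  have "cubic 1 1 1 (std_rep 4) = 48"
    unfolding cubic_wedges[OF x] by (simp add: det6_repeated det6_std_pairs stdE_nth)
  then show "cubic 1 1 1 (std_rep 4) \<noteq> 0" by simp
qed simp

text \<open>
  The only three brackets of the eleventh representative that cover all six indices are \<open>[1;12]\<close>, \<open>[1;45]\<close> and \<open>[1;36]\<close>. The cubic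
  form is therefore a cube of a linear form and its Hessian vanishes, in contrast to the form at the twelfth
  representative, which has exactly two distinct zeros.
\<close>

lemma not_12_le_11: "std_rep 12 \<notin> zariski_closure (orbit (std_rep 11))"
proof (rule not_in_closureI)
  let ?p = "\<lambda>x. cubic 1 1 2 x * cubic 1 1 2 x - cubic 1 1 1 x * cubic 1 2 2 x"
  show "?p \<in> poly_funs" by (intro pf_diff pf_mult pf_cubic)
  show "?p (rep e f 11) = 0" for e f
  proof -
    have x: "rep e f 11 $ (k, p, q) = (\<Sum>(c, u, v)\<leftarrow>[(e 1 $ k, f 1, f 2), (e 2 $ k, f 3, f 4), (e 1 $ k, f 4, f 5),
        (e 2 $ k, f 1, f 6), (e 1 $ k, f 3, f 6)]. c * wdg u v p q)" for k p q
      by (simp add: rep_simps bracket_nth)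
    define D where "D = det6 (f 1) (f 2) (f 4) (f 5) (f 3) (f 6)"
    note D = det6_permute_pairs[where a = "f 1" and b = "f 2" and c = "f 4" and d = "f 5" and e = "f 3" and f = "f 6", folded D_def] D_def[symmetric]
    have c: "cubic k l m (rep e f 11) = 48 * D * (e 1 $ k * e 1 $ l * e 1 $ m)" for k l m
      unfolding cubic_wedges[OF x] by (simp add: det6_repeated D algebra_simps)
    show ?thesis unfolding c by simp
  qed
  have x: "std_rep 12 $ (k, p, q) = (\<Sum>(c, u, v)\<leftarrow>[(stdE 1 $ k, stdF 1, stdF 2), (stdE 2 $ k, stdF 3, stdF 4),
      (stdE 1 $ k, stdF 5, stdF 6)]. c * wdg u v p q)" for k p q
    by (simp add: rep_simps bracket_nth)
  have 1: "cubic 1 1 1 (std_rep 12) = 0"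
    unfolding cubic_wedges[OF x] by (simp add: det6_repeated stdE_nth)
  have 2: "cubic 1 1 2 (std_rep 12) = 16"
    unfolding cubic_wedges[OF x]
    by (simp add: det6_repeated det6_std_pairs stdE_nth)
  show "?p (std_rep 12) \<noteq> 0" unfolding 1 2 by simp
qed simp

section \<open>The closure order\<close>

lemma coverings_from:
  "(0, k) \<in> coverings \<longleftrightarrow> k = 1"
  "(Suc 0, k) \<in> coverings \<longleftrightarrow> k = 2 \<or> k = 3"
  "(2, k) \<in> coverings \<longleftrightarrow> k = 4 \<or> k = 5"
  "(3, k) \<in> coverings \<longleftrightarrow> k = 5"
  "(4, k) \<in> coverings \<longleftrightarrow> k = 9"
  "(5, k) \<in> coverings \<longleftrightarrow> k = 6"
  "(6, k) \<in> coverings \<longleftrightarrow> k = 7"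
  "(7, k) \<in> coverings \<longleftrightarrow> k = 8 \<or> k = 9"
  "(8, k) \<in> coverings \<longleftrightarrow> k = 10"
  "(9, k) \<in> coverings \<longleftrightarrow> k = 12 \<or> k = 11"
  "(10, k) \<in> coverings \<longleftrightarrow> k = 11"
  "(11, k) \<in> coverings \<longleftrightarrow> k = 13"
  "(12, k) \<in> coverings \<longleftrightarrow> k = 13"
  "(13, k) \<in> coverings \<longleftrightarrow> k = 14"
  "(14, k) \<in> coverings \<longleftrightarrow> False"
  by (auto simp: coverings_def)

text \<open>
  Read from the largest index downwards, this recursion computes all elements above a given one.
\<close>

lemma coverings_rtrancl_step:
  "(i, j) \<in> coverings\<^sup>* \<longleftrightarrow> j = i \<or> (\<exists>k. (i, k) \<in> coverings \<and> (k, j) \<in> coverings\<^sup>*)"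
  by (metis converse_rtranclE converse_rtrancl_into_rtrancl rtrancl.rtrancl_refl)

lemma above_14: "(14, j) \<in> coverings\<^sup>* \<longleftrightarrow> j \<in> {14}"
  using coverings_rtrancl_step[of 14 j] unfolding coverings_from by auto

lemma above_13: "(13, j) \<in> coverings\<^sup>* \<longleftrightarrow> j \<in> {13, 14}"
  using coverings_rtrancl_step[of 13 j] unfolding coverings_from by (auto simp: above_14)

lemma above_12: "(12, j) \<in> coverings\<^sup>* \<longleftrightarrow> j \<in> {12, 13, 14}"
  using coverings_rtrancl_step[of 12 j] unfolding coverings_from by (auto simp: above_13)

lemma above_11: "(11, j) \<in> coverings\<^sup>* \<longleftrightarrow> j \<in> {11, 13, 14}"
  using coverings_rtrancl_step[of 11 j] unfolding coverings_from by (auto simp: above_13)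

lemma above_10: "(10, j) \<in> coverings\<^sup>* \<longleftrightarrow> j \<in> {10, 11, 13, 14}"
  using coverings_rtrancl_step[of 10 j] unfolding coverings_from by (auto simp: above_11)

lemma above_9: "(9, j) \<in> coverings\<^sup>* \<longleftrightarrow> j \<in> {9, 11, 12, 13, 14}"
  using coverings_rtrancl_step[of 9 j] unfolding coverings_from by (auto simp: above_12 above_11)

lemma above_8: "(8, j) \<in> coverings\<^sup>* \<longleftrightarrow> j \<in> {8, 10, 11, 13, 14}"
  using coverings_rtrancl_step[of 8 j] unfolding coverings_from by (auto simp: above_10)

lemma above_7: "(7, j) \<in> coverings\<^sup>* \<longleftrightarrow> j \<in> {7, 8, 9, 10, 11, 12, 13, 14}"
  using coverings_rtrancl_step[of 7 j] unfolding coverings_from by (auto simp: above_8 above_9)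

lemma above_6: "(6, j) \<in> coverings\<^sup>* \<longleftrightarrow> j \<in> {6, 7, 8, 9, 10, 11, 12, 13, 14}"
  using coverings_rtrancl_step[of 6 j] unfolding coverings_from by (auto simp: above_7)

lemma above_5: "(5, j) \<in> coverings\<^sup>* \<longleftrightarrow> j \<in> {5, 6, 7, 8, 9, 10, 11, 12, 13, 14}"
  using coverings_rtrancl_step[of 5 j] unfolding coverings_from by (auto simp: above_6)

lemma above_4: "(4, j) \<in> coverings\<^sup>* \<longleftrightarrow> j \<in> {4, 9, 11, 12, 13, 14}"
  using coverings_rtrancl_step[of 4 j] unfolding coverings_from by (auto simp: above_9)

lemma above_3: "(3, j) \<in> coverings\<^sup>* \<longleftrightarrow> j \<in> {3, 5, 6, 7, 8, 9, 10, 11, 12, 13, 14}"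
  using coverings_rtrancl_step[of 3 j] unfolding coverings_from by (auto simp: above_5)

lemma above_2: "(2, j) \<in> coverings\<^sup>* \<longleftrightarrow> j \<in> {2, 4, 5, 6, 7, 8, 9, 10, 11, 12, 13, 14}"
  using coverings_rtrancl_step[of 2 j] unfolding coverings_from by (auto simp: above_4 above_5)

lemma above_1: "(Suc 0, j) \<in> coverings\<^sup>* \<longleftrightarrow> j \<in> {Suc 0, 2, 3, 4, 5, 6, 7, 8, 9, 10, 11, 12, 13, 14}"
  using coverings_rtrancl_step[of "Suc 0" j] unfolding coverings_from by (auto simp: above_2 above_3)

lemma above_0: "(0, j) \<in> coverings\<^sup>* \<longleftrightarrow> j \<in> {0, Suc 0, 2, 3, 4, 5, 6, 7, 8, 9, 10, 11, 12, 13, 14}"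
  using coverings_rtrancl_step[of 0 j] unfolding coverings_from by (auto simp: above_1)

lemmas above = above_0 above_1 above_2 above_3 above_4 above_5 above_6 above_7 above_8 above_9 above_10 above_11 above_12 above_13 above_14

lemma coverings_less: "(i, j) \<in> coverings \<Longrightarrow> i < j \<and> j \<le> 14"
  by (auto simp: coverings_def)

lemma coverings_rtrancl_le: "(i, j) \<in> coverings\<^sup>* \<Longrightarrow> i \<le> j"
  by (induction rule: rtrancl_induct) (use coverings_less in fastforce)+

abbreviation std_closure :: "nat \<Rightarrow> tensors set" where "std_closure i \<equiv> zariski_closure (orbit (std_rep i))"

lemma cl_coverings: "(i, j) \<in> coverings \<Longrightarrow> std_closure i \<subseteq> std_closure j"
  unfolding closure_orbit_subset_iff coverings_def
  using degeneration_0_1 degeneration_1_2 degeneration_1_3 degeneration_2_4 degeneration_2_5 degeneration_3_5 degeneration_4_9 degeneration_5_6 degeneration_6_7 degeneration_7_8 degeneration_7_9 degeneration_8_10 degeneration_9_12 degeneration_9_11 degeneration_10_11 degeneration_11_13 degeneration_12_13 degeneration_13_14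
  by auto

lemma cl_coverings_rtrancl: "(i, j) \<in> coverings\<^sup>* \<Longrightarrow> std_closure i \<subseteq> std_closure j"
  by (induction rule: rtrancl_induct) (use cl_coverings in blast)+

text \<open>
  The listed pairs are those unrelated pairs \<open>(a, b)\<close> in which \<open>a\<close> cannot be made smaller and \<open>b\<close> cannot be made larger
  without becoming related. It suffices to exclude these inclusions.
\<close>

definition obstructed :: "nat \<Rightarrow> nat \<Rightarrow> bool"
  where "obstructed i j \<longleftrightarrow> (\<exists>(a, b) \<in> {(1, 0), (2, 3), (3, 4), (4, 10), (6, 5), (7, 6), (8, 12), (10, 8), (12, 11), (14, 13)}.
    (a, i) \<in> coverings\<^sup>* \<and> (j, b) \<in> coverings\<^sup>*)"

text \<open>
  Five of the ten pairs are excluded by the dimension, the other five by a separating function.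
\<close>

lemma obstructed_not_cl:
  assumes "obstructed i j" shows "\<not> std_closure i \<subseteq> std_closure j"
proof
  assume sub: "std_closure i \<subseteq> std_closure j"
  have dim: "orbit_dims ! a \<le> orbit_dims ! b" if "std_closure a \<subseteq> std_closure b" "a \<le> 14" "b \<le> 14" for a b
    using alg_dim_mono[OF that(1)] dim_orbit[OF that(2)] dim_orbit[OF that(3)] by simp
  obtain a b where ab: "(a, b) \<in> {(1 :: nat, 0 :: nat), (2, 3), (3, 4), (4, 10), (6, 5), (7, 6), (8, 12), (10, 8), (12, 11), (14, 13)}"
    "(a, i) \<in> coverings\<^sup>*" "(j, b) \<in> coverings\<^sup>*"
    using assms unfolding obstructed_def by blast
  have "std_closure a \<subseteq> std_closure b" using cl_coverings_rtrancl[OF ab(2)] sub cl_coverings_rtrancl[OF ab(3)] by blast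
  moreover from this have "orbit_dims ! a \<le> orbit_dims ! b" using ab(1) by (intro dim) auto
  ultimately show False
    using ab(1) not_2_le_3 not_3_le_4 not_4_le_10 not_8_le_12 not_12_le_11
    by (auto simp: closure_orbit_subset_iff orbit_dims_def)
qed

lemma obstructed_simp:
  "obstructed i j \<longleftrightarrow>
    (Suc 0, i) \<in> coverings\<^sup>* \<and> (j, 0) \<in> coverings\<^sup>* \<or> (2, i) \<in> coverings\<^sup>* \<and> (j, 3) \<in> coverings\<^sup>* \<or>
    (3, i) \<in> coverings\<^sup>* \<and> (j, 4) \<in> coverings\<^sup>* \<or> (4, i) \<in> coverings\<^sup>* \<and> (j, 10) \<in> coverings\<^sup>* \<or>
    (6, i) \<in> coverings\<^sup>* \<and> (j, 5) \<in> coverings\<^sup>* \<or> (7, i) \<in> coverings\<^sup>* \<and> (j, 6) \<in> coverings\<^sup>* \<or>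
    (8, i) \<in> coverings\<^sup>* \<and> (j, 12) \<in> coverings\<^sup>* \<or> (10, i) \<in> coverings\<^sup>* \<and> (j, 8) \<in> coverings\<^sup>* \<or>
    (12, i) \<in> coverings\<^sup>* \<and> (j, 11) \<in> coverings\<^sup>* \<or> (14, i) \<in> coverings\<^sup>* \<and> (j, 13) \<in> coverings\<^sup>*"
  by (simp add: obstructed_def)

lemma related_or_obstructed:
  assumes "i \<le> 14" "j \<le> 14" shows "(i, j) \<in> coverings\<^sup>* \<or> obstructed i j"
proof -
  have "\<forall>i\<in>set [0, Suc 0, 2, 3, 4, 5, 6, 7, 8, 9, 10, 11, 12, 13, 14]. \<forall>j\<in>set [0, Suc 0, 2, 3, 4, 5, 6, 7, 8, 9, 10, 11, 12, 13, 14].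
    (i, j) \<in> coverings\<^sup>* \<or> obstructed i j"
    unfolding list.set ball_simps obstructed_simp
    by (simp add: above)
  moreover have "i \<in> set [0, Suc 0, 2, 3, 4, 5, 6, 7, 8, 9, 10, 11, 12, 13, 14]"
    "j \<in> set [0, Suc 0, 2, 3, 4, 5, 6, 7, 8, 9, 10, 11, 12, 13, 14]"
    using nat_le_14_cases[OF assms(1)] nat_le_14_cases[OF assms(2)] by simp_all
  ultimately show ?thesis by blast
qed

theorem closure_order:
  assumes "i \<le> 14" "j \<le> 14" shows "std_closure i \<subseteq> std_closure j \<longleftrightarrow> (i, j) \<in> coverings\<^sup>*"
  using related_or_obstructed[OF assms] obstructed_not_cl cl_coverings_rtrancl by blast

text \<open>
  The fifteen orbits are distinct because their closures are ordered by a partial order.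
\<close>

lemma closure_order_antisym:
  assumes "i \<le> 14" "j \<le> 14" "std_closure i = std_closure j" shows "i = j"
  using closure_order[OF assms(1,2)] closure_order[OF assms(2,1)] assms(3) coverings_rtrancl_le
  by (metis order_antisym order_refl)

lemma closure_order_strict:
  assumes "i \<le> 14" "j \<le> 14" shows "std_closure i \<subset> std_closure j \<longleftrightarrow> (i, j) \<in> coverings\<^sup>* \<and> i \<noteq> j"
  using closure_order[OF assms] closure_order_antisym[OF assms] by (auto simp: psubset_eq)

lemma coverings_siblings:
  assumes "(i, k) \<in> coverings" "(i, j) \<in> coverings" "(k, j) \<in> coverings\<^sup>*" shows "k = j"
proof -
  have "i \<le> 14" using coverings_less[OF assms(1)] by simp
  from nat_le_14_cases[OF this] assms show ?thesis
    by (elim disjE) (auto simp: coverings_from above)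
qed

text \<open>
  Two covers of the same element are incomparable, hence no covering relation is implied by the others.
\<close>

lemma coverings_no_between:
  assumes "(i, j) \<in> coverings" "(i, k) \<in> coverings\<^sup>*" "(k, j) \<in> coverings\<^sup>*" shows "k = i \<or> k = j"
proof (rule disjCI)
  assume "k \<noteq> j"
  show "k = i"
  proof (rule ccontr)
    assume "k \<noteq> i"
    then obtain l where l: "(i, l) \<in> coverings" "(l, k) \<in> coverings\<^sup>*" using assms(2) by (metis converse_rtranclE)
    have "l = j" using coverings_siblings[OF l(1) assms(1)] l(2) assms(3) by (meson rtrancl_trans)
    then show False using coverings_rtrancl_le[OF l(2)] coverings_rtrancl_le[OF assms(3)] \<open>k \<noteq> j\<close> by simp
  qed
qed

theorem closure_hasse:
  assumes i: "i \<le> 14" and j: "j \<le> 14"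
  shows "std_closure i \<subset> std_closure j \<and> \<not> (\<exists>k\<le>14. std_closure i \<subset> std_closure k \<and> std_closure k \<subset> std_closure j) \<longleftrightarrow> (i, j) \<in> coverings"
proof
  assume a: "std_closure i \<subset> std_closure j \<and> \<not> (\<exists>k\<le>14. std_closure i \<subset> std_closure k \<and> std_closure k \<subset> std_closure j)"
  then have "(i, j) \<in> coverings\<^sup>*" "i \<noteq> j" using closure_order_strict[OF i j] by simp_all
  then obtain k where k: "(i, k) \<in> coverings" "(k, j) \<in> coverings\<^sup>*" by (metis converse_rtranclE)
  have k14: "k \<le> 14" "i \<noteq> k" using coverings_less[OF k(1)] by simp_all
  have "std_closure i \<subset> std_closure k" using closure_order_strict[OF i k14(1)] k(1) k14(2) by blast
  then have "\<not> std_closure k \<subset> std_closure j" using a k14(1) by blast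
  then have "k = j" using closure_order_strict[OF k14(1) j] k(2) by blast
  then show "(i, j) \<in> coverings" using k(1) by simp
next
  assume c: "(i, j) \<in> coverings"
  have "std_closure i \<subset> std_closure j" using closure_order_strict[OF i j] c coverings_less[OF c] by blast
  moreover have "\<not> (std_closure i \<subset> std_closure k \<and> std_closure k \<subset> std_closure j)" if "k \<le> 14" for k
    using closure_order_strict[OF i that] closure_order_strict[OF that j] coverings_no_between[OF c] by blast
  ultimately show "std_closure i \<subset> std_closure j \<and> \<not> (\<exists>k\<le>14. std_closure i \<subset> std_closure k \<and> std_closure k \<subset> std_closure j)" by blast
qed

theorem orbits_bij: "bij_betw (\<lambda>i. orbit (std_rep i)) {..14} orbits"
  unfolding bij_betw_def
proof
  show "inj_on (\<lambda>i. orbit (std_rep i)) {..14}"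
    by (rule inj_onI) (use closure_order_antisym in auto)
  show "(\<lambda>i. orbit (std_rep i)) ` {..14} = orbits"
  proof (intro equalityI subsetI)
    fix X assume "X \<in> (\<lambda>i. orbit (std_rep i)) ` {..14}"
    then show "X \<in> orbits" unfolding orbits_def using skew_rep by blast
  next
    fix X assume "X \<in> orbits"
    then obtain t where t: "t \<in> E_Wedge2_F" "X = orbit t" unfolding orbits_def by blast
    then obtain n where "n \<le> 14" "t \<in> orbit (std_rep n)" using classification by blast
    then show "X \<in> (\<lambda>i. orbit (std_rep i)) ` {..14}" using orbit_eq t(2) by blast
  qed
qed

section \<open>Generic elements\<close>

definition six_brackets :: "(2 \<Rightarrow> complex ^ 2) \<Rightarrow> (6 \<Rightarrow> complex ^ 6) \<Rightarrow> complex \<Rightarrow> complex \<Rightarrow> complex \<Rightarrow> complex \<Rightarrow> complex \<Rightarrow> complex \<Rightarrow> tensors"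
  where "six_brackets e f c1 c2 c3 c4 c5 c6 =
    c1 *s bracket e f 1 1 2 + c2 *s bracket e f 2 1 2 + c3 *s bracket e f 1 3 4 +
    c4 *s bracket e f 2 3 4 + c5 *s bracket e f 1 5 6 + c6 *s bracket e f 2 5 6"

lemma generic_space_eq: "generic_space e f = {six_brackets e f c1 c2 c3 c4 c5 c6 | c1 c2 c3 c4 c5 c6. True}"
proof (intro equalityI subsetI)
  fix x assume "x \<in> generic_space e f"
  then show "x \<in> {six_brackets e f c1 c2 c3 c4 c5 c6 | c1 c2 c3 c4 c5 c6. True}"
    unfolding generic_space_def Let_def six_brackets_def using span_6_coeffs by blast
next
  fix x assume "x \<in> {six_brackets e f c1 c2 c3 c4 c5 c6 | c1 c2 c3 c4 c5 c6. True}"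
  then obtain c1 c2 c3 c4 c5 c6 where x: "x = six_brackets e f c1 c2 c3 c4 c5 c6" by blast
  show "x \<in> generic_space e f"
    unfolding x generic_space_def Let_def six_brackets_def
    by (intro vec.span_add vec.span_scale vec.span_base) simp_all
qed

text \<open>
  The element is \<open>\<epsilon>1 \<otimes> f1 \<and> f2 + \<epsilon>2 \<otimes> f3 \<and> f4 + \<epsilon>3 \<otimes> f5 \<and> f6\<close> for three pairwise independent vectors of a plane.
  Writing \<open>\<epsilon>3 = l *s \<epsilon>1 + m *s \<epsilon>2\<close> and rescaling gives the normal form.
\<close>

lemma generic_std_orbit:
  assumes D: "c1 * c4 - c2 * c3 \<noteq> 0" "c5 * c4 - c6 * c3 \<noteq> 0" "c1 * c6 - c2 * c5 \<noteq> 0"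
  shows "six_brackets stdE stdF c1 c2 c3 c4 c5 c6 \<in> orbit (std_rep 14)"
proof -
  define l m where "l = (c5 * c4 - c6 * c3) / (c1 * c4 - c2 * c3)" and "m = (c1 * c6 - c2 * c5) / (c1 * c4 - c2 * c3)"
  have nz: "l \<noteq> 0" "m \<noteq> 0" using D by (simp_all add: l_def m_def)
  have c56: "c5 = l * c1 + m * c3" "c6 = l * c2 + m * c4"
  proof -
    have "l * c1 + m * c3 = c5 * (c1 * c4 - c2 * c3) / (c1 * c4 - c2 * c3)"
      "l * c2 + m * c4 = c6 * (c1 * c4 - c2 * c3) / (c1 * c4 - c2 * c3)"
      unfolding l_def m_def times_divide_eq_left add_divide_distrib[symmetric] by (simp_all add: algebra_simps)
    then show "c5 = l * c1 + m * c3" "c6 = l * c2 + m * c4" using D(1) by simp_all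
  qed
  define A :: "complex ^ 2 ^ 2" where
    "A = (\<chi> i. if i = 1 then l *s (c1 *s stdE 1 + c2 *s stdE 2) else m *s (c3 *s stdE 1 + c4 *s stdE 2))"
  define d where "d i = (if i = 1 then 1 / l else if i = 3 then 1 / m else 1)" for i :: 6
  define B :: "complex ^ 6 ^ 6" where "B = (\<chi> i. d i *s stdF i)"
  have "det A = l * m * (c1 * c4 - c2 * c3)"
    by (simp add: det_2 A_def axis_def eq_2 algebra_simps)
  then have A: "vec.span (range (($) A)) = UNIV" using D(1) nz by (intro det_nonzero_span) simp
  have "det B = (\<Prod>i\<in>UNIV. d i)"
    by (subst det_diagonal) (simp_all add: B_def axis_def)
  also have "\<dots> \<noteq> 0" using nz by (simp add: d_def)
  finally have B: "vec.span (range (($) B)) = UNIV" by (rule det_nonzero_span)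
  have Ai: "A $ 1 = l *s (c1 *s stdE 1 + c2 *s stdE 2)" "A $ 2 = m *s (c3 *s stdE 1 + c4 *s stdE 2)"
    by (simp_all add: A_def eq_2)
  have Bi: "B $ i = d i *s stdF i" for i by (simp add: B_def)
  have d: "d 1 = 1 / l" "d 2 = 1" "d 3 = 1 / m" "d 4 = 1" "d 5 = 1" "d 6 = 1" by (simp_all add: d_def eq_6)
  have "six_brackets stdE stdF c1 c2 c3 c4 c5 c6 $ (k, p, q) = rep (($) A) (($) B) 14 $ (k, p, q)" for k p q
    unfolding c56 six_brackets_def rep_simps vector_add_component vector_smult_component bracket_nth Ai Bi d
    using nz by (simp add: field_simps)
  then have "six_brackets stdE stdF c1 c2 c3 c4 c5 c6 = rep (($) A) (($) B) 14"
    unfolding vec_eq_iff split_paired_All by blast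
  then show ?thesis using rep_in_orbit[OF A B, of 14] by simp
qed

text \<open>
  The product of the three determinants of pairs among the vectors \<open>\<epsilon>1\<close>, \<open>\<epsilon>2\<close>, \<open>\<epsilon>3\<close> of the previous lemma.
\<close>

definition generic_minors :: "tensors \<Rightarrow> complex"
  where "generic_minors y =
    (y $ (1, 1, 2) * y $ (2, 3, 4) - y $ (2, 1, 2) * y $ (1, 3, 4)) *
    (y $ (1, 5, 6) * y $ (2, 3, 4) - y $ (2, 5, 6) * y $ (1, 3, 4)) *
    (y $ (1, 1, 2) * y $ (2, 5, 6) - y $ (2, 1, 2) * y $ (1, 5, 6))"

lemma generic_minors_six_brackets:
  "generic_minors (six_brackets stdE stdF c1 c2 c3 c4 c5 c6) =
    (c1 * c4 - c2 * c3) * (c5 * c4 - c6 * c3) * (c1 * c6 - c2 * c5)"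
  by (simp add: generic_minors_def six_brackets_def bracket_nth axis_def eq_6 eq_2)

lemma generic_orbit:
  assumes e: "vec.span (range e) = UNIV" and f: "vec.span (range f) = UNIV"
  shows "\<exists>U. zariski_open_in (generic_space e f) U \<and> U \<noteq> {} \<and> (\<forall>x\<in>U. orbit x = orbit (std_rep 14))"
proof -
  obtain A B where AB: "det A \<noteq> 0" "\<And>k. A *v stdE k = e k" "det B \<noteq> 0" "\<And>i. B *v stdF i = f i"
    using spans_matrix[OF e] spans_matrix[OF f] by blast
  obtain A' B' where inv: "A' ** A = mat 1" "B' ** B = mat 1"
    using AB(1,3) unfolding invertible_det_nz[symmetric] invertible_def by blast
  have br: "act (A, B, 1) (bracket stdE stdF k i j) = bracket e f k i j" for k i j
    by (rule act_bracket) (rule AB)+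
  have six: "act (A, B, 1) (six_brackets stdE stdF c1 c2 c3 c4 c5 c6) = six_brackets e f c1 c2 c3 c4 c5 c6" for c1 c2 c3 c4 c5 c6
    unfolding six_brackets_def act_add act_scale br ..
  have six': "act (A', B', 1) (six_brackets e f c1 c2 c3 c4 c5 c6) = six_brackets stdE stdF c1 c2 c3 c4 c5 c6" for c1 c2 c3 c4 c5 c6
    unfolding six[symmetric] act_act inv act_id ..
  let ?P = "\<lambda>x. generic_minors (act (A', B', 1) x)"
  have P: "?P \<in> poly_funs" unfolding generic_minors_def by (intro pf_mult pf_diff pf_act)
  define U where "U = generic_space e f - {x. ?P x = 0}"
  have "zariski_closed {x. ?P x = 0}" unfolding zariski_closed_def using P by (intro exI[of _ "{?P}"]) simp
  then have open_U: "zariski_open_in (generic_space e f) U" unfolding zariski_open_in_def U_def by blast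
  have "six_brackets e f 1 0 0 1 1 1 \<in> generic_space e f" unfolding generic_space_eq by blast
  moreover have "?P (six_brackets e f 1 0 0 1 1 1) \<noteq> 0" unfolding six' generic_minors_six_brackets by simp
  ultimately have "six_brackets e f 1 0 0 1 1 1 \<in> U" unfolding U_def by blast
  then have ne: "U \<noteq> {}" by blast
  have "orbit x = orbit (std_rep 14)" if xU: "x \<in> U" for x
  proof -
    obtain c1 c2 c3 c4 c5 c6 where x: "x = six_brackets e f c1 c2 c3 c4 c5 c6"
      using xU unfolding U_def generic_space_eq by blast
    have "?P x \<noteq> 0" using xU unfolding U_def by blast
    then have "six_brackets stdE stdF c1 c2 c3 c4 c5 c6 \<in> orbit (std_rep 14)"
      unfolding x six' generic_minors_six_brackets by (intro generic_std_orbit) auto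
    moreover have "x \<in> orbit (six_brackets stdE stdF c1 c2 c3 c4 c5 c6)"
      unfolding x six[symmetric] by (rule act_in_orbit[OF AB(1,3)])
    ultimately show ?thesis using orbit_trans orbit_eq by blast
  qed
  with open_U ne show ?thesis by blast
qed

lemma representatives_rep:
  assumes "i < 14" shows "representatives e f x ! i = rep e f i"
proof -
  have "i \<le> 14" "i \<noteq> 14" using assms by simp_all
  from nat_le_14_cases[OF this(1)] this(2) show ?thesis
    by (elim disjE) (simp_all add: rep_def representatives_def Let_def)
qed

lemma representatives_14: "representatives e f x ! 14 = x"
  by (simp add: representatives_def Let_def)

section \<open>Orbits and their closures\<close>

theorem mainTheorem6:
  fixes e :: "2 \<Rightarrow> complex ^ 2" and f :: "6 \<Rightarrow> complex ^ 6"
  assumes "is_basis e" and "is_basis f"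
  shows "\<exists>U. zariski_open_in (generic_space e f) U \<and> U \<noteq> {} \<and>
    (\<forall>x\<in>U.
      let O_orb = (\<lambda>i. orbit (representatives e f x ! i));
          cl = (\<lambda>i. zariski_closure (O_orb i))
      in bij_betw O_orb {..14} orbits \<and>
         (\<forall>i\<le>14. alg_dim (O_orb i) = enat (orbit_dims ! i)) \<and>
         (\<forall>i\<le>14. \<forall>j\<le>14. cl i \<subseteq> cl j \<longleftrightarrow> (i, j) \<in> coverings\<^sup>*) \<and>
         (\<forall>i\<le>14. \<forall>j\<le>14.
            (cl i \<subset> cl j \<and> \<not> (\<exists>k\<le>14. cl i \<subset> cl k \<and> cl k \<subset> cl j)) \<longleftrightarrow> (i, j) \<in> coverings))"
proof -
  have e: "vec.span (range e) = UNIV" and f: "vec.span (range f) = UNIV"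
    using assms unfolding is_basis_def by simp_all
  obtain U where U: "zariski_open_in (generic_space e f) U" "U \<noteq> {}" "\<forall>x\<in>U. orbit x = orbit (std_rep 14)"
    using generic_orbit[OF e f] by blast
  have orb: "orbit (representatives e f x ! i) = orbit (std_rep i)" if x: "x \<in> U" and i: "i \<le> 14" for x i
  proof (cases "i = 14")
    case True
    then show ?thesis using U(3) x by (simp add: representatives_14)
  next
    case False
    then have "representatives e f x ! i = rep e f i" using i by (intro representatives_rep) simp
    then show ?thesis using rep_orbit[OF e f i] by simp
  qed
  have bij: "bij_betw (\<lambda>i. orbit (representatives e f x ! i)) {..14} orbits" if "x \<in> U" for x
    using orbits_bij orb[OF that] by (subst bij_betw_cong[where g = "\<lambda>i. orbit (std_rep i)"]) auto
  show ?thesis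
    unfolding Let_def
  proof (intro exI[of _ U] conjI ballI allI impI U(1,2))
    fix x assume x: "x \<in> U"
    show "bij_betw (\<lambda>i. orbit (representatives e f x ! i)) {..14} orbits" by (rule bij[OF x])
    fix i :: nat assume i: "i \<le> 14"
    show "alg_dim (orbit (representatives e f x ! i)) = enat (orbit_dims ! i)"
      unfolding orb[OF x i] by (rule dim_orbit[OF i])
    fix j :: nat assume j: "j \<le> 14"
    show "zariski_closure (orbit (representatives e f x ! i)) \<subseteq> zariski_closure (orbit (representatives e f x ! j))
      \<longleftrightarrow> (i, j) \<in> coverings\<^sup>*"
      unfolding orb[OF x i] orb[OF x j] by (rule closure_order[OF i j])
    have k: "(\<exists>k\<le>14. std_closure i \<subset> zariski_closure (orbit (representatives e f x ! k)) \<and>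
        zariski_closure (orbit (representatives e f x ! k)) \<subset> std_closure j) \<longleftrightarrow> (\<exists>k\<le>14. std_closure i \<subset> std_closure k \<and> std_closure k \<subset> std_closure j)"
      by (rule ex_cong1, rule conj_cong[OF refl], simp only: orb[OF x])
    show "(zariski_closure (orbit (representatives e f x ! i)) \<subset> zariski_closure (orbit (representatives e f x ! j)) \<and>
        \<not> (\<exists>k\<le>14. zariski_closure (orbit (representatives e f x ! i)) \<subset> zariski_closure (orbit (representatives e f x ! k)) \<and>
          zariski_closure (orbit (representatives e f x ! k)) \<subset> zariski_closure (orbit (representatives e f x ! j))))
      \<longleftrightarrow> (i, j) \<in> coverings"
      unfolding orb[OF x i] orb[OF x j] k by (rule closure_hasse[OF i j])
  qed
qed

end
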